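(* Let $k\ge 1$ be fixed, let $\epsilon_1,\ldots,\epsilon_k\in\{+1,-1\}$ be fixed, and let $p=\#\{i:\epsilon_i=1\}$. For each $n\ge 1$ let $A_1,A_2,\ldots,A_k$ be independent $n\times n$ random matrices with i.i.d. standard complex Gaussian entries. Then, as $n\to\infty$, the limiting expected empirical distribution of the square radial part of the eigenvalues of $$\left(\frac{A_1}{\sqrt n}\right)^{\epsilon_1}\left(\frac{A_2}{\sqrt n}\right)^{\epsilon_2}\cdots\left(\frac{A_k}{\sqrt n}\right)^{\epsilon_k}$$ is the distribution of $$U^p\left(\frac{1}{1-U}\right)^{k-p},$$ where $U$ is a random variable uniformly distributed on $[0,1]$.
   Context: A standard complex Gaussian variable has density $\pi^{-1}e^{-|z|^2}$ with respect to Lebesgue measure on $\mathbb{C}$. For a random $n\times n$ matrix with eigenvalues $\lambda_1,\ldots,\lambda_n$ (with multiplicity), the expected empirical distribution of the square radial part of the eigenvalues is the probability measure on $[0,\infty)$ given by $B\mapsto \mathbf{E}\big[\frac1n\#\{i:|\lambda_i|^2\in B\}\big]$. The "limiting" distribution is the limit of these measures as $n\to\infty$ in the sense of weak convergence (convergence in distribution). *)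

theory Defs
  imports
    "HOL-Probability.Probability"
    "Jordan_Normal_Form.Char_Poly"
    "Jordan_Normal_Form.Gauss_Jordan_Elimination"
begin

definition std_complex_gaussian_density :: "complex \<Rightarrow> ennreal" where
  "std_complex_gaussian_density z = ennreal (exp (- (cmod z)\<^sup>2) / pi)"

definition mat_entries :: "nat \<Rightarrow> complex mat \<Rightarrow> nat \<times> nat \<Rightarrow> complex" where
  "mat_entries n A = (\<lambda>ij\<in>{..<n} \<times> {..<n}. A $$ ij)"

definition gaussian_matrix :: "'a measure \<Rightarrow> nat \<Rightarrow> ('a \<Rightarrow> complex mat) \<Rightarrow> bool" where
  "gaussian_matrix M n X \<longleftrightarrow>
     (\<forall>\<omega>\<in>space M. X \<omega> \<in> carrier_mat n n) \<and>
     (\<forall>ij\<in>{..<n} \<times> {..<n}. distributed M lborel (\<lambda>\<omega>. X \<omega> $$ ij) std_complex_gaussian_density) \<and>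
     prob_space.indep_vars M (\<lambda>_. borel) (\<lambda>ij \<omega>. X \<omega> $$ ij) ({..<n} \<times> {..<n})"

text \<open>Independence of a family of \<open>n \<times> n\<close> random matrices, a matrix being regarded as a
  random element of the product space \<open>complex\<close> to the power \<open>{..<n} \<times> {..<n}\<close>.\<close>

definition indep_matrices ::
    "'a measure \<Rightarrow> nat \<Rightarrow> (nat \<Rightarrow> 'a \<Rightarrow> complex mat) \<Rightarrow> nat set \<Rightarrow> bool" where
  "indep_matrices M n X I \<longleftrightarrow>
     prob_space.indep_vars M (\<lambda>_. \<Pi>\<^sub>M ij\<in>{..<n} \<times> {..<n}. borel)
       (\<lambda>i \<omega>. mat_entries n (X i \<omega>)) I"

text \<open>The library's inverse is partial. A singular matrix gets the inverse \<open>0\<close>, so that the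
  products below remain \<open>n \<times> n\<close> on the null event that some factor is singular.\<close>

definition mat_inv :: "complex mat \<Rightarrow> complex mat" where
  "mat_inv A = (case mat_inverse A of Some B \<Rightarrow> B | None \<Rightarrow> 0\<^sub>m (dim_row A) (dim_row A))"

definition mat_powi :: "complex mat \<Rightarrow> int \<Rightarrow> complex mat" where
  "mat_powi A e = (if e \<ge> 0 then A ^\<^sub>m nat e else mat_inv A ^\<^sub>m nat (- e))"

text \<open>The product \<open>(A 1 / \<surd>n)\<^sup>\<epsilon>\<^sup>1 \<cdots> (A k / \<surd>n)\<^sup>\<epsilon>\<^sup>k\<close>, in this order.\<close>

definition signed_product ::
    "nat \<Rightarrow> nat \<Rightarrow> (nat \<Rightarrow> int) \<Rightarrow> (nat \<Rightarrow> complex mat) \<Rightarrow> complex mat" where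
  "signed_product n k \<epsilon> A =
     foldr (\<lambda>i B. mat_powi (complex_of_real (1 / sqrt (real n)) \<cdot>\<^sub>m A i) (\<epsilon> i) * B)
       [1..<Suc k] (1\<^sub>m n)"

text \<open>Eigenvalues with algebraic multiplicity.\<close>

definition eigenvalue_mset :: "complex mat \<Rightarrow> complex multiset" where
  "eigenvalue_mset A = proots (char_poly A)"

text \<open>The measure assigning to a Borel set \<open>B\<close> the expected fraction of the eigenvalues
  \<open>\<lambda>\<close> (with multiplicity) of the \<open>n \<times> n\<close> random matrix \<open>X\<close> such that \<open>\<bar>\<lambda>\<bar>\<^sup>2 \<in> B\<close>.
  It is taken on the whole real line, as required by the library's notion of weak convergence.\<close>

definition expected_sq_radial_distribution ::
    "'a measure \<Rightarrow> nat \<Rightarrow> ('a \<Rightarrow> complex mat) \<Rightarrow> real measure" where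
  "expected_sq_radial_distribution M n X =
     measure_of UNIV (sets borel)
       (\<lambda>B. \<integral>\<^sup>+\<omega>. ennreal
          (real (size {#z \<in># eigenvalue_mset (X \<omega>). (cmod z)\<^sup>2 \<in> B#}) / real n) \<partial>M)"

end

theory Submission
  imports Defs "HOL-Complex_Analysis.Complex_Analysis" "HOL-Real_Asymp.Real_Asymp"
begin

text \<open>Fix \<open>n\<close>, let \<open>P\<close> be the product and let \<open>\<rho>\<^sub>l = ((n - l) / n)\<^sup>p (n / (l + 1))\<^sup>q\<close> with \<open>q = k - p\<close>.
  By Jensen's formula, \<open>\<Sum> ln (max x \<bar>\<lambda>\<^sub>i\<bar>\<^sup>2)\<close> is the mean of \<open>ln \<bar>det (z - P)\<bar>\<^sup>2\<close> over the circle
  \<open>\<bar>z\<bar>\<^sup>2 = x\<close>, and difference quotients in \<open>ln x\<close> of this potential bound the number of eigenvalues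
  with \<open>\<bar>\<lambda>\<^sub>i\<bar>\<^sup>2 \<le> x\<close> from both sides. So it suffices to know the potential up to an error \<open>o(n)\<close> in mean,
  for every \<open>x > 0\<close>.

  As a function of a single Gaussian factor, \<open>\<bar>det (z - P)\<bar>\<^sup>2\<close> is a sum of squared moduli of
  polynomials that are affine and alternating in the rows. Averaging the rows out one at a time, there
  is, with \<open>d\<close> rows left, always one whose averaging moves the logarithm by at most \<open>O(ln n / \<surd>d)\<close> in
  mean, because alternation forbids the coefficients to concentrate in one direction. Hence a whole
  factor can be replaced by its expectation at the cost \<open>O(\<surd>n ln n)\<close>. The expectation is a
  combination of the sums of squared minors of the remaining product, of the same form again. (For an
  inverse factor one first multiplies by the determinant, which is treated in the same way.) After \<open>k\<close> steps
  what is left is \<open>\<Sum>m\<le>n. x\<^sup>n\<^sup>-\<^sup>m \<rho>\<^sub>0 \<cdots> \<rho>\<^sub>m\<^sub>-\<^sub>1\<close>, whose largest summand is the product of all \<open>max x \<rho>\<^sub>l\<close>.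
  So the squared moduli of the eigenvalues are distributed like the \<open>\<rho>\<^sub>l\<close>, that is, like the
  values of \<open>u\<^sup>p / (1 - u)\<^sup>q\<close> on an equidistant grid.\<close>

section \<open>Complex Gaussian variables\<close>

no_notation scalar_prod (infix "\<bullet>" 70)

text \<open>The obstacle with non-normal matrices is that ln |det (z - P)| may be very negative,
  which usually calls for lower bounds on the least singular value of z - P. Here one elementary
  fact replaces them: the logarithm of a shifted complex Gaussian has a negative part with a second
  moment bounded uniformly in the shift. It is needed for one coordinate of one row at a time.
  Errors are measured by the mean of |ln a - ln b|, set to infinity in degenerate cases, so that
  triangle inequalities hold without exception and the costs of rows and of factors simply add. A
  row costs about sqrt (B / m), where m is the mean of the sum of squares and B bounds the quadratic
  form in that row. Alternation provides a row with B \<le> m / d, and the sum of 1 / sqrt d is at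
  most 2 sqrt n. The inverse of a Gaussian matrix has no second moments, but Cramer's rule writes
  the quantities of interest as quotients of polynomials. Since numerator and denominator each
  concentrate logarithmically, the quotient of their means is the right substitute for a mean. All
  bounds depend on z through |z| only, so Fubini exchanges expectation and circle mean.\<close>

abbreviation cgauss :: "complex measure" where
  "cgauss \<equiv> density lborel std_complex_gaussian_density"

text \<open>The law of the real and of the imaginary part. The variance 1/2 of each gives mean 1 to
  the squared modulus.\<close>

abbreviation half_gauss :: "real measure" where
  "half_gauss \<equiv> density lborel (\<lambda>x. ennreal (normal_density 0 (1 / sqrt 2) x))"

text \<open>Both measures give a box the product of its two side lengths, and boxes determine
  Lebesgue measure. This splits the complex Gaussian density into two real normal ones.\<close>

lemma lborel_complex_eq:
  "(lborel :: complex measure) = distr (lborel \<Otimes>\<^sub>M lborel) borel (\<lambda>(x, y). Complex x y)"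
proof (rule lborel_eqI)
  have meas: "(\<lambda>(x, y). Complex x y) \<in> (lborel \<Otimes>\<^sub>M lborel :: (real \<times> real) measure) \<rightarrow>\<^sub>M borel"
    unfolding Complex_eq by (simp add: case_prod_beta)
  fix l u :: complex
  assume lu: "\<And>b. b \<in> Basis \<Longrightarrow> l \<bullet> b \<le> u \<bullet> b"
  from lu[of 1] lu[of \<i>] have le: "Re l \<le> Re u" "Im l \<le> Im u"
    by (auto simp: Basis_complex_def)
  have pre: "(\<lambda>(x, y). Complex x y) -` box l u \<inter> space (lborel \<Otimes>\<^sub>M lborel)
      = box (Re l) (Re u) \<times> box (Im l) (Im u)"
    by (auto simp: box_def Basis_complex_def space_pair_measure)
  have "emeasure (distr (lborel \<Otimes>\<^sub>M lborel) borel (\<lambda>(x, y). Complex x y)) (box l u)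
      = emeasure (lborel \<Otimes>\<^sub>M lborel) (box (Re l) (Re u) \<times> box (Im l) (Im u))"
    using emeasure_distr[OF meas, of "box l u"] pre by simp
  also have "\<dots> = emeasure lborel (box (Re l) (Re u)) * emeasure lborel (box (Im l) (Im u))"
    by (rule lborel.emeasure_pair_measure_Times) auto
  also have "\<dots> = ennreal ((Re u - Re l) * (Im u - Im l))"
    using le by (simp add: ennreal_mult)
  finally show "emeasure (distr (lborel \<Otimes>\<^sub>M lborel) borel (\<lambda>(x, y). Complex x y)) (box l u)
      = ennreal (prod ((\<bullet>) (u - l)) Basis)"
    by (simp add: Basis_complex_def)
qed simp

lemma prob_space_half_gauss: "prob_space half_gauss"
  by (intro prob_space_normal_density) simp

lemma cgauss_eq_distr:
  "cgauss = distr (half_gauss \<Otimes>\<^sub>M half_gauss) borel (\<lambda>(x, y). Complex x y)"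
proof -
  have meas: "(\<lambda>(x, y). Complex x y) \<in> (lborel \<Otimes>\<^sub>M lborel :: (real \<times> real) measure) \<rightarrow>\<^sub>M borel"
    unfolding Complex_eq by (simp add: case_prod_beta)
  have [measurable]: "std_complex_gaussian_density \<in> borel_measurable borel"
    unfolding std_complex_gaussian_density_def by measurable
  have sf: "sigma_finite_measure half_gauss"
    using prob_space_half_gauss by (simp add: prob_space_imp_sigma_finite)
  have dens: "std_complex_gaussian_density (Complex x y)
      = ennreal (normal_density 0 (1 / sqrt 2) x) * ennreal (normal_density 0 (1 / sqrt 2) y)" for x y
  proof -
    have "exp (- (cmod (Complex x y))\<^sup>2) / pi
        = (exp (- x\<^sup>2) / sqrt pi) * (exp (- y\<^sup>2) / sqrt pi)"
      by (simp add: cmod_def exp_add[symmetric] real_sqrt_mult[symmetric])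
    also have "\<dots> = normal_density 0 (1 / sqrt 2) x * normal_density 0 (1 / sqrt 2) y"
      by (simp add: normal_density_def power_divide)
    finally show ?thesis
      by (simp add: std_complex_gaussian_density_def ennreal_mult'')
  qed
  have "cgauss = density (distr (lborel \<Otimes>\<^sub>M lborel) borel (\<lambda>(x, y). Complex x y)) std_complex_gaussian_density"
    by (subst lborel_complex_eq) simp
  also have "\<dots> = distr (density (lborel \<Otimes>\<^sub>M lborel)
      (\<lambda>p. std_complex_gaussian_density ((\<lambda>(x, y). Complex x y) p))) borel (\<lambda>(x, y). Complex x y)"
    by (rule density_distr) (use meas in auto)
  also have "density (lborel \<Otimes>\<^sub>M lborel) (\<lambda>p. std_complex_gaussian_density ((\<lambda>(x, y). Complex x y) p))
      = half_gauss \<Otimes>\<^sub>M half_gauss"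
    using sf by (subst pair_measure_density) (auto simp: lborel.sigma_finite_measure_axioms dens split_beta')
  finally show ?thesis .
qed

lemma measurable_Complex_pair[measurable]:
  "(\<lambda>(x, y). Complex x y) \<in> (half_gauss \<Otimes>\<^sub>M half_gauss) \<rightarrow>\<^sub>M borel"
proof -
  have "sets (half_gauss \<Otimes>\<^sub>M half_gauss) = sets (borel \<Otimes>\<^sub>M borel)"
    by (intro sets_pair_measure_cong) auto
  moreover have "(\<lambda>(x, y). Complex x y) \<in> (borel \<Otimes>\<^sub>M borel) \<rightarrow>\<^sub>M borel"
    unfolding Complex_eq by (simp add: case_prod_beta)
  ultimately show ?thesis
    using measurable_cong_sets by blast
qed

lemma prob_space_cgauss: "prob_space cgauss"
proof -
  interpret h: prob_space half_gauss by (rule prob_space_half_gauss)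
  interpret p: pair_prob_space half_gauss half_gauss ..
  show ?thesis
    unfolding cgauss_eq_distr by (rule p.prob_space_distr) simp
qed

lemma nn_integral_cgauss_Re:
  assumes [measurable]: "f \<in> borel_measurable borel"
  shows "(\<integral>\<^sup>+z. f (Re z) \<partial>cgauss) = (\<integral>\<^sup>+x. f x \<partial>half_gauss)"
proof -
  interpret h: prob_space half_gauss by (rule prob_space_half_gauss)
  have "(\<integral>\<^sup>+z. f (Re z) \<partial>cgauss) = (\<integral>\<^sup>+p. f (Re ((\<lambda>(x, y). Complex x y) p)) \<partial>(half_gauss \<Otimes>\<^sub>M half_gauss))"
    unfolding cgauss_eq_distr by (rule nn_integral_distr) auto
  also have "\<dots> = (\<integral>\<^sup>+p. f (fst p) \<partial>(half_gauss \<Otimes>\<^sub>M half_gauss))"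
    by (simp add: case_prod_beta)
  also have "\<dots> = (\<integral>\<^sup>+x. \<integral>\<^sup>+y. f x \<partial>half_gauss \<partial>half_gauss)"
    by (subst h.nn_integral_fst[symmetric]) auto
  also have "\<dots> = (\<integral>\<^sup>+x. f x \<partial>half_gauss)"
    by (simp add: h.emeasure_space_1[simplified])
  finally show ?thesis .
qed

lemma half_gauss_moments:
  "has_bochner_integral half_gauss (\<lambda>x. x ^ 0) 1"
  "has_bochner_integral half_gauss (\<lambda>x. x ^ 1) 0"
  "has_bochner_integral half_gauss (\<lambda>x. x ^ 2) (1/2)"
  "has_bochner_integral half_gauss (\<lambda>x. x ^ 3) 0"
  "has_bochner_integral half_gauss (\<lambda>x. x ^ 4) (3/4)"
proof -
  let ?\<sigma> = "1 / sqrt 2 :: real"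
  have s: "?\<sigma> > 0" by simp
  have *: "has_bochner_integral half_gauss (\<lambda>x. x ^ k) v"
    if "has_bochner_integral lborel (\<lambda>x. normal_density 0 ?\<sigma> x * (x - 0) ^ k) v" for k v
    using that by (intro has_bochner_integral_density) (auto simp: has_bochner_integral_density)
  show "has_bochner_integral half_gauss (\<lambda>x. x ^ 0) 1"
    using normal_moment_even[OF s, of 0 0] by (intro *) simp
  show "has_bochner_integral half_gauss (\<lambda>x. x ^ 1) 0"
    using normal_moment_odd[OF s, of 0 0] by (intro *) simp
  show "has_bochner_integral half_gauss (\<lambda>x. x ^ 2) (1/2)"
    using normal_moment_even[OF s, of 0 1] by (intro *) (simp add: power_divide fact_numeral)
  show "has_bochner_integral half_gauss (\<lambda>x. x ^ 3) 0"
    using normal_moment_odd[OF s, of 0 1] by (intro *) (simp add: eval_nat_numeral)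
  show "has_bochner_integral half_gauss (\<lambda>x. x ^ 4) (3/4)"
    using normal_moment_even[OF s, of 0 2] by (intro *) (simp add: power_divide fact_numeral)
qed

lemma has_bochner_integral_pair_mult:
  fixes f :: "'a \<Rightarrow> real" and g :: "'b \<Rightarrow> real"
  assumes "prob_space M" "prob_space N"
    and f: "has_bochner_integral M f a" and g: "has_bochner_integral N g b"
  shows "has_bochner_integral (M \<Otimes>\<^sub>M N) (\<lambda>p. f (fst p) * g (snd p)) (a * b)"
proof -
  interpret M: prob_space M by fact
  interpret N: prob_space N by fact
  interpret P: pair_prob_space M N ..
  have i: "integrable M f" "integrable N g" and v: "integral\<^sup>L M f = a" "integral\<^sup>L N g = b"
    using f g by (auto simp: has_bochner_integral_iff)
  note [measurable] = borel_measurable_integrable[OF i(1)] borel_measurable_integrable[OF i(2)]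
  have int: "integrable (M \<Otimes>\<^sub>M N) (\<lambda>p. f (fst p) * g (snd p))"
  proof (rule P.Fubini_integrable)
    show "integrable M (\<lambda>x. \<integral>y. norm (f (fst (x, y)) * g (snd (x, y))) \<partial>N)"
      using i by (simp add: abs_mult)
    show "AE x in M. integrable N (\<lambda>y. f (fst (x, y)) * g (snd (x, y)))"
      using i by simp
  qed simp
  have "integral\<^sup>L (M \<Otimes>\<^sub>M N) (\<lambda>p. f (fst p) * g (snd p)) = a * b"
    using P.integral_fst'[OF int] i v by simp
  with int show ?thesis by (simp add: has_bochner_integral_iff)
qed

lemma measurable_cnj[measurable]: "cnj \<in> borel \<rightarrow>\<^sub>M borel"
  by (intro borel_measurable_continuous_onI continuous_intros)

text \<open>Rotation invariance is behind the zeros for \<open>a \<noteq> b\<close>. The few cases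
  are computed directly from real moments of order at most four, which is all that the variance of a
  quadratic form requires.\<close>

lemma cgauss_moments:
  assumes "a \<le> 2" "b \<le> 2"
  shows "has_bochner_integral cgauss (\<lambda>z. z ^ a * cnj z ^ b) (if a = b then fact a else 0)"
proof -
  let ?P = "half_gauss \<Otimes>\<^sub>M half_gauss"
  have T: "has_bochner_integral cgauss F v"
    if "F \<in> borel_measurable borel" "has_bochner_integral ?P (\<lambda>p. F (Complex (fst p) (snd p))) v"
    for F :: "complex \<Rightarrow> complex" and v
  proof -
    have "has_bochner_integral (distr ?P borel (\<lambda>(x, y). Complex x y)) F v"
      using that by (intro has_bochner_integral_distr) (auto simp: case_prod_beta)
    then show ?thesis by (subst cgauss_eq_distr)
  qed
  note m = half_gauss_moments
  note pm = has_bochner_integral_pair_mult[OF prob_space_half_gauss prob_space_half_gauss]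
  have m': "has_bochner_integral ?P (\<lambda>p. complex_of_real (fst p ^ i * snd p ^ j)) (complex_of_real (v * w))"
    if "has_bochner_integral half_gauss (\<lambda>x. x ^ i) v" "has_bochner_integral half_gauss (\<lambda>x. x ^ j) w" for i j v w
    using pm[OF that] by (rule has_bochner_integral_of_real)
  have mr: "has_bochner_integral ?P (\<lambda>p. c * complex_of_real (f p)) (c * complex_of_real v)"
    if "has_bochner_integral ?P (\<lambda>p. complex_of_real (f p)) (complex_of_real v)" for c f v
    using that by (intro has_bochner_integral_mult_right)
  have e0: "has_bochner_integral cgauss (\<lambda>z. z ^ 0 * cnj z ^ 0) 1"
    using prob_space.prob_space[OF prob_space_cgauss]
    by (simp add: has_bochner_integral_iff prob_space.finite_measure[OF prob_space_cgauss] finite_measure.integrable_const del: cgauss_eq_distr)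
  have e1: "has_bochner_integral cgauss (\<lambda>z. z ^ 1 * cnj z ^ 0) 0"
  proof (rule T)
    have "has_bochner_integral ?P (\<lambda>p. complex_of_real (fst p ^ 1 * snd p ^ 0)
        + \<i> * complex_of_real (fst p ^ 0 * snd p ^ 1)) (complex_of_real (0 * 1) + \<i> * complex_of_real (1 * 0))"
      by (intro has_bochner_integral_add mr m' m)
    then show "has_bochner_integral ?P (\<lambda>p. Complex (fst p) (snd p) ^ 1 * cnj (Complex (fst p) (snd p)) ^ 0) 0"
      by (simp add: Complex_eq)
  qed measurable
  have e11: "has_bochner_integral cgauss (\<lambda>z. z ^ 1 * cnj z ^ 1) 1"
  proof (rule T)
    have "has_bochner_integral ?P (\<lambda>p. complex_of_real (fst p ^ 2 * snd p ^ 0)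
        + complex_of_real (fst p ^ 0 * snd p ^ 2)) (complex_of_real (1/2 * 1) + complex_of_real (1 * (1/2)))"
      by (intro has_bochner_integral_add mr m' m)
    moreover have "Complex x y ^ 1 * cnj (Complex x y) ^ 1 = complex_of_real (x ^ 2 * y ^ 0)
        + complex_of_real (x ^ 0 * y ^ 2)" for x y
      by (simp add: complex_eq_iff power2_eq_square)
    ultimately show "has_bochner_integral ?P (\<lambda>p. Complex (fst p) (snd p) ^ 1 * cnj (Complex (fst p) (snd p)) ^ 1) 1"
      by simp
  qed measurable
  have e2: "has_bochner_integral cgauss (\<lambda>z. z ^ 2 * cnj z ^ 0) 0"
  proof (rule T)
    have "has_bochner_integral ?P (\<lambda>p. complex_of_real (fst p ^ 2 * snd p ^ 0)
        + (- 1) * complex_of_real (fst p ^ 0 * snd p ^ 2) + (2 * \<i>) * complex_of_real (fst p ^ 1 * snd p ^ 1))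
         (complex_of_real (1/2 * 1) + (-1) * complex_of_real (1 * (1/2)) + (2 * \<i>) * complex_of_real (0 * 0))"
      by (intro has_bochner_integral_add mr m' m)
    moreover have "Complex x y ^ 2 * cnj (Complex x y) ^ 0 = complex_of_real (x ^ 2 * y ^ 0)
        + (- 1) * complex_of_real (x ^ 0 * y ^ 2) + (2 * \<i>) * complex_of_real (x ^ 1 * y ^ 1)" for x y
      by (simp add: complex_eq_iff power2_eq_square)
    ultimately show "has_bochner_integral ?P (\<lambda>p. Complex (fst p) (snd p) ^ 2 * cnj (Complex (fst p) (snd p)) ^ 0) 0"
      by simp
  qed measurable
  have e21: "has_bochner_integral cgauss (\<lambda>z. z ^ 2 * cnj z ^ 1) 0"
  proof (rule T)
    have "has_bochner_integral ?P (\<lambda>p. complex_of_real (fst p ^ 3 * snd p ^ 0)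
        + complex_of_real (fst p ^ 1 * snd p ^ 2) + \<i> * complex_of_real (fst p ^ 2 * snd p ^ 1)
        + \<i> * complex_of_real (fst p ^ 0 * snd p ^ 3))
         (complex_of_real (0 * 1) + complex_of_real (0 * (1/2)) + \<i> * complex_of_real ((1/2) * 0) + \<i> * complex_of_real (1 * 0))"
      by (intro has_bochner_integral_add mr m' m)
    moreover have "Complex x y ^ 2 * cnj (Complex x y) ^ 1 = complex_of_real (x ^ 3 * y ^ 0)
        + complex_of_real (x ^ 1 * y ^ 2) + \<i> * complex_of_real (x ^ 2 * y ^ 1)
        + \<i> * complex_of_real (x ^ 0 * y ^ 3)" for x y
      by (simp add: complex_eq_iff power2_eq_square power3_eq_cube algebra_simps)
    ultimately show "has_bochner_integral ?P (\<lambda>p. Complex (fst p) (snd p) ^ 2 * cnj (Complex (fst p) (snd p)) ^ 1) 0"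
      by simp
  qed measurable
  have e22: "has_bochner_integral cgauss (\<lambda>z. z ^ 2 * cnj z ^ 2) 2"
  proof (rule T)
    have "has_bochner_integral ?P (\<lambda>p. complex_of_real (fst p ^ 4 * snd p ^ 0)
        + 2 * complex_of_real (fst p ^ 2 * snd p ^ 2) + complex_of_real (fst p ^ 0 * snd p ^ 4))
         (complex_of_real (3/4 * 1) + 2 * complex_of_real ((1/2) * (1/2)) + complex_of_real (1 * (3/4)))"
      by (intro has_bochner_integral_add mr m' m)
    moreover have "Complex x y ^ 2 * cnj (Complex x y) ^ 2 = complex_of_real (x ^ 4 * y ^ 0)
        + 2 * complex_of_real (x ^ 2 * y ^ 2) + complex_of_real (x ^ 0 * y ^ 4)" for x y
      by (simp add: complex_eq_iff power2_eq_square power4_eq_xxxx algebra_simps)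
    moreover have "complex_of_real (3/4 * 1) + 2 * complex_of_real ((1/2) * (1/2)) + complex_of_real (1 * (3/4)) = 2"
      by (simp add: complex_eq_iff)
    ultimately show "has_bochner_integral ?P (\<lambda>p. Complex (fst p) (snd p) ^ 2 * cnj (Complex (fst p) (snd p)) ^ 2) 2"
      by simp
  qed measurable
  \<comment> \<open>The cases with more conjugated than plain factors are complex conjugates of
    those already done.\<close>
  have cj: "has_bochner_integral cgauss (\<lambda>z. z ^ j * cnj z ^ i) (cnj v)"
    if "has_bochner_integral cgauss (\<lambda>z. z ^ i * cnj z ^ j) v" for i j v
    using has_bochner_integral_cnj[OF that] by (simp add: mult.commute)
  from assms have "a \<in> {0, 1, 2}" "b \<in> {0, 1, 2}" by auto
  then show ?thesis
    using e0 e1 e11 e2 e21 e22 cj[OF e1] cj[OF e2] cj[OF e21]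
    by (auto simp: fact_numeral)
qed


section \<open>A small-ball estimate in logarithmic form\<close>

lemma nn_integral_ln_sq_unit:
  "(\<integral>\<^sup>+t. ennreal ((2 * ln t)\<^sup>2) * indicator {0<..<1} t \<partial>lborel) = 8"
proof -
  \<comment> \<open>An antiderivative of \<open>(2 * ln x)\<^sup>2\<close> on the positive axis,
    with limit 0 at 0 and value 8 at 1.\<close>
  define F :: "real \<Rightarrow> real" where "F t = 4 * (t * (ln t)\<^sup>2 - 2 * t * ln t + 2 * t)" for t
  have d: "DERIV F x :> (2 * ln x)\<^sup>2" if "0 < x" for x
    unfolding F_def using that
    by (auto intro!: derivative_eq_intros simp: field_simps power2_eq_square)
  have l0: "((F \<circ> real_of_ereal) \<longlongrightarrow> 0) (at_right (ereal 0))"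
  proof -
    have "(F \<longlongrightarrow> 0) (at_right 0)" unfolding F_def by real_asymp
    then show ?thesis by (simp add: ereal_tendsto_simps)
  qed
  have l1: "((F \<circ> real_of_ereal) \<longlongrightarrow> 8) (at_left (ereal 1))"
  proof -
    have "(F \<longlongrightarrow> 8) (at_left 1)" unfolding F_def by real_asymp
    then show ?thesis by (simp add: ereal_tendsto_simps)
  qed
  have "set_integrable lborel (einterval (ereal 0) (ereal 1)) (\<lambda>x. (2 * ln x)\<^sup>2)"
    and "(LBINT x=ereal 0..ereal 1. (2 * ln x)\<^sup>2) = 8 - 0"
    by (rule interval_integral_FTC_nonneg[where F = F];
        use l0 l1 d in \<open>auto intro!: continuous_intros\<close>)+
  then have "set_integrable lborel {0<..<1} (\<lambda>x::real. (2 * ln x)\<^sup>2)" "(LBINT x:{0<..<1}. (2 * ln x)\<^sup>2) = (8::real)"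
    by (auto simp: interval_lebesgue_integral_def)
  then have "(\<integral>\<^sup>+x. ennreal (indicator {0<..<1} x * (2 * ln x)\<^sup>2) \<partial>lborel) = ennreal 8"
    by (subst nn_integral_eq_integral)
      (simp_all only: set_integrable_def set_lebesgue_integral_def real_scaleR_def, auto)
  moreover have "ennreal (indicator {0<..<1} x * (2 * ln x)\<^sup>2) = ennreal ((2 * ln x)\<^sup>2) * indicator {0<..<1} x" for x :: real
    by (auto simp: indicator_def)
  ultimately show ?thesis by simp
qed

text \<open>The squared negative part of the logarithm. Its value at 0 is set to infinity because
  \<open>ln 0\<close> is only a default value and would break antitonicity.\<close>

definition neg_ln_sq :: "real \<Rightarrow> ennreal" where
  "neg_ln_sq t = (if t = 0 then \<infinity> else ennreal ((max 0 (- ln t))\<^sup>2))"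

lemma measurable_neg_ln_sq[measurable]: "neg_ln_sq \<in> borel \<rightarrow>\<^sub>M borel"
  unfolding neg_ln_sq_def by measurable

lemma neg_ln_sq_antimono: "0 \<le> s \<Longrightarrow> s \<le> t \<Longrightarrow> neg_ln_sq t \<le> neg_ln_sq s"
  by (auto simp: neg_ln_sq_def intro!: ennreal_leI power_mono max.mono) (auto simp: max_def)

lemma nn_integral_neg_ln_sq_le: "(\<integral>\<^sup>+t. neg_ln_sq (t\<^sup>2) \<partial>lborel) \<le> 16"
proof -
  let ?g = "\<lambda>t. ennreal ((2 * ln t)\<^sup>2) * indicator {0<..<1} t :: ennreal"
  have "AE t in lborel. t \<noteq> (0::real)" by (rule AE_lborel_singleton)
  then have "AE t in lborel. neg_ln_sq (t\<^sup>2) \<le> ?g t + ?g (- t)"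
  proof eventually_elim
    case (elim t)
    consider "t > 0" "t < 1" | "t < 0" "t > -1" | "\<bar>t\<bar> \<ge> 1" using elim by linarith
    then show ?case
    proof cases
      case 1
      then have "ln (t\<^sup>2) = 2 * ln t" by (simp add: ln_realpow)
      with 1 show ?thesis by (auto simp: neg_ln_sq_def max_def power2_eq_square)
    next
      case 2
      then have "ln (t\<^sup>2) = 2 * ln (- t)"
        using ln_realpow[of "- t" 2] by simp
      with 2 show ?thesis by (auto simp: neg_ln_sq_def max_def power2_eq_square)
    next
      case 3
      then have "1 \<le> t\<^sup>2" using abs_le_square_iff[of 1 t] by simp
      then have "ln (t\<^sup>2) \<ge> 0" by simp
      with elim show ?thesis by (auto simp: neg_ln_sq_def max_def)
    qed
  qed
  then have "(\<integral>\<^sup>+t. neg_ln_sq (t\<^sup>2) \<partial>lborel) \<le> (\<integral>\<^sup>+t. ?g t + ?g (- t) \<partial>lborel)"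
    by (rule nn_integral_mono_AE)
  also have "\<dots> = (\<integral>\<^sup>+t. ?g t \<partial>lborel) + (\<integral>\<^sup>+t. ?g (- t) \<partial>lborel)"
    by (rule nn_integral_add) auto
  also have "(\<integral>\<^sup>+t. ?g (- t) \<partial>lborel) = (\<integral>\<^sup>+t. ?g t \<partial>lborel)"
    using nn_integral_real_affine[of ?g "-1" 0] by simp
  finally show ?thesis unfolding nn_integral_ln_sq_unit by simp
qed

text \<open>Dropping the imaginary part only decreases the modulus. The density of the real part is
  at most 1, so Lebesgue measure may replace it, and translation invariance then makes the bound
  uniform in the shift \<open>b\<close>.\<close>

lemma cgauss_small_ball:
  "(\<integral>\<^sup>+z. neg_ln_sq ((cmod (z + b))\<^sup>2) \<partial>cgauss) \<le> 16"
proof -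
  have "(\<integral>\<^sup>+z. neg_ln_sq ((cmod (z + b))\<^sup>2) \<partial>cgauss) \<le> (\<integral>\<^sup>+z. neg_ln_sq ((Re z + Re b)\<^sup>2) \<partial>cgauss)"
    by (intro nn_integral_mono neg_ln_sq_antimono) (auto simp: cmod_power2)
  also have "\<dots> = (\<integral>\<^sup>+x. neg_ln_sq ((x + Re b)\<^sup>2) \<partial>half_gauss)"
    by (rule nn_integral_cgauss_Re[where f = "\<lambda>x. neg_ln_sq ((x + Re b)\<^sup>2)"]) measurable
  also have "\<dots> = (\<integral>\<^sup>+x. ennreal (normal_density 0 (1 / sqrt 2) x) * neg_ln_sq ((x + Re b)\<^sup>2) \<partial>lborel)"
    by (rule nn_integral_density) auto
  also have "\<dots> \<le> (\<integral>\<^sup>+x. 1 * neg_ln_sq ((x + Re b)\<^sup>2) \<partial>lborel)"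
  proof (intro nn_integral_mono mult_right_mono)
    fix x :: real
    have "normal_density 0 (1 / sqrt 2) x = exp (- x\<^sup>2) / sqrt pi"
      by (simp add: normal_density_def power_divide)
    also have "\<dots> \<le> 1 / 1"
      using pi_ge_two by (intro frac_le) auto
    finally show "ennreal (normal_density 0 (1 / sqrt 2) x) \<le> 1"
      by (simp add: ennreal_le_1)
  qed simp
  also have "\<dots> = (\<integral>\<^sup>+x. neg_ln_sq (x\<^sup>2) \<partial>lborel)"
    using nn_integral_real_affine[of "\<lambda>x. neg_ln_sq (x\<^sup>2)" 1 "Re b"] by (simp add: add.commute)
  also have "\<dots> \<le> 16" by (rule nn_integral_neg_ln_sq_le)
  finally show ?thesis .
qed

section \<open>Orthogonality of monomials in independent Gaussians\<close>

lemma product_prob_space_cgauss: "product_prob_space (\<lambda>_ :: 'i. cgauss)"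
  by (rule product_prob_spaceI) (rule prob_space_cgauss)

lemma cgauss_prod_moment:
  assumes I: "finite I" and "\<And>e. e \<in> I \<Longrightarrow> a e \<le> 2" "\<And>e. e \<in> I \<Longrightarrow> b e \<le> 2"
  shows "has_bochner_integral (\<Pi>\<^sub>M e\<in>I. cgauss) (\<lambda>A. \<Prod>e\<in>I. A e ^ a e * cnj (A e) ^ b e)
    (\<Prod>e\<in>I. if a e = b e then fact (a e) else 0)"
proof -
  interpret product_prob_space "\<lambda>_ :: 'a. cgauss" by (rule product_prob_space_cgauss)
  have *: "integrable cgauss (\<lambda>z. z ^ a e * cnj z ^ b e)"
      "integral\<^sup>L cgauss (\<lambda>z. z ^ a e * cnj z ^ b e) = (if a e = b e then fact (a e) else 0)" if "e \<in> I" for e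
    using cgauss_moments[of "a e" "b e"] assms that by (auto simp: has_bochner_integral_iff)
  show ?thesis
    unfolding has_bochner_integral_iff
    using product_integrable_prod[OF I, of "\<lambda>e z. z ^ a e * cnj z ^ b e"]
      product_integral_prod[OF I, of "\<lambda>e z. z ^ a e * cnj z ^ b e"] * by auto
qed

text \<open>This makes second moments exact: for a polynomial of degree at most one in each entry,
  the mean of the squared modulus is the sum of the squared moduli of its coefficients.\<close>

lemma cgauss_monomials_orthonormal:
  assumes I: "finite I" and "S \<subseteq> I" "T \<subseteq> I"
  shows "has_bochner_integral (\<Pi>\<^sub>M e\<in>I. cgauss) (\<lambda>A. (\<Prod>e\<in>S. A e) * cnj (\<Prod>e\<in>T. A e))
    (if S = T then 1 else 0)"
proof -
  \<comment> \<open>Membership in \<open>S\<close> and \<open>T\<close> becomes an exponent 0 or 1,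
    so that the integral factorises over all of \<open>I\<close>.\<close>
  have "has_bochner_integral (\<Pi>\<^sub>M e\<in>I. cgauss) (\<lambda>A. \<Prod>e\<in>I. A e ^ of_bool (e \<in> S) * cnj (A e) ^ of_bool (e \<in> T))
      (\<Prod>e\<in>I. if (of_bool (e \<in> S) :: nat) = of_bool (e \<in> T) then fact (of_bool (e \<in> S)) else 0)"
    using I by (intro cgauss_prod_moment) auto
  moreover have "(\<Prod>e\<in>I. A e ^ of_bool (e \<in> S) * cnj (A e) ^ of_bool (e \<in> T)) = (\<Prod>e\<in>S. A e) * cnj (\<Prod>e\<in>T. A e)"
    for A :: "'a \<Rightarrow> complex"
  proof -
    have pw: "(\<Prod>e\<in>I. f e ^ of_bool (e \<in> X)) = (\<Prod>e\<in>X. f e)" if "X \<subseteq> I" for f :: "'a \<Rightarrow> complex" and X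
    proof -
      have "(\<Prod>e\<in>I. f e ^ of_bool (e \<in> X)) = (\<Prod>e\<in>I. if e \<in> X then f e else 1)"
        by (intro prod.cong) auto
      also have "\<dots> = (\<Prod>e\<in>X. f e)"
        using that I by (simp add: prod.If_cases Int_absorb1)
      finally show ?thesis .
    qed
    show ?thesis using assms by (simp add: prod.distrib pw)
  qed
  moreover have "(\<Prod>e\<in>I. if (of_bool (e \<in> S) :: nat) = of_bool (e \<in> T) then fact (of_bool (e \<in> S)) else 0)
      = (if S = T then 1 else (0::complex))"
  proof (cases "S = T")
    case False
    then obtain e where "e \<in> I" "(e \<in> S) \<noteq> (e \<in> T)" using assms by blast
    then show ?thesis using False I by (auto intro!: prod_zero bexI[of _ e])
  qed (auto intro!: prod.neutral simp: of_bool_def)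
  ultimately show ?thesis by simp
qed

text \<open>Wick's formula: one contribution from each pairing of plain with conjugated factors. If
  all four indices agree, both pairings count, in accordance with the moment 2! = 2.\<close>

lemma cgauss_fourth_moment:
  assumes I: "finite I" and "j \<in> I" "m \<in> I" "k \<in> I" "l \<in> I"
  shows "has_bochner_integral (\<Pi>\<^sub>M e\<in>I. cgauss) (\<lambda>A. A j * A m * cnj (A k * A l))
    (of_bool (j = k \<and> m = l) + of_bool (j = l \<and> m = k))"
proof -
  define a b :: "'a \<Rightarrow> nat" where "a e = of_bool (e = j) + of_bool (e = m)"
    and "b e = of_bool (e = k) + of_bool (e = l)" for e
  have "has_bochner_integral (\<Pi>\<^sub>M e\<in>I. cgauss) (\<lambda>A. \<Prod>e\<in>I. A e ^ a e * cnj (A e) ^ b e)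
    (\<Prod>e\<in>I. if a e = b e then fact (a e) else 0)"
    using I by (intro cgauss_prod_moment) (auto simp: a_def b_def)
  moreover have "(\<Prod>e\<in>I. A e ^ a e * cnj (A e) ^ b e) = A j * A m * cnj (A k * A l)" for A :: "'a \<Rightarrow> complex"
  proof -
    have pw: "(\<Prod>e\<in>I. f e ^ of_bool (e = i)) = f i" if "i \<in> I" for f :: "'a \<Rightarrow> complex" and i
    proof -
      have "(\<Prod>e\<in>I. f e ^ of_bool (e = i)) = (\<Prod>e\<in>I. if e = i then f e else 1)"
        by (intro prod.cong) auto
      then show ?thesis using that I by (simp add: prod.delta)
    qed
    show ?thesis using assms by (simp add: prod.distrib power_add a_def b_def pw)
  qed
  moreover have "(\<Prod>e\<in>I. if a e = b e then fact (a e) else 0)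
      = (of_bool (j = k \<and> m = l) + of_bool (j = l \<and> m = k) :: complex)"
  proof (cases "\<forall>e\<in>I. a e = b e")
    case True
    \<comment> \<open>Equality of the multiplicity functions says that the multisets {j, m} and {k,
      l} agree; evaluating it at \<open>j\<close> and at \<open>m\<close> already decides which
      pairing holds.\<close>
    then have eq: "(j = k \<and> m = l) \<or> (j = l \<and> m = k)"
    proof -
      have ab: "a j = b j" "a m = b m" using True assms(2,3) by auto
      have bools: "p \<and> u \<or> q \<and> v"
        if "of_bool True + of_bool c = (of_bool p + of_bool q :: nat)" "of_bool c + of_bool True = (of_bool v + of_bool u :: nat)"
          "p \<and> v \<longrightarrow> c" "q \<and> u \<longrightarrow> c" for c p q u v
        using that by (cases c; cases p; cases q; cases u; cases v) simp_all
      show ?thesis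
        by (rule bools[where c = "j = m"]) (use ab in \<open>unfold a_def b_def, simp_all add: eq_commute\<close>)
    qed
    have "(\<Prod>e\<in>I. if a e = b e then fact (a e) else 0) = (\<Prod>e\<in>I. if e = j then (if j = m then 2 else 1) else (1::complex))"
    proof (intro prod.cong refl)
      fix e assume "e \<in> I"
      then have "(if a e = b e then fact (a e) else 0) = (fact (a e) :: complex)" using True by simp
      also have "\<dots> = (if e = j then (if j = m then 2 else 1) else 1)" by (auto simp: a_def)
      finally show "(if a e = b e then fact (a e) else 0) = (if e = j then (if j = m then 2 else 1) else (1::complex))" .
    qed
    also have "\<dots> = (if j = m then 2 else 1)" using assms by (simp add: prod.delta)
    finally show ?thesis using eq by auto
  next
    case False
    then have "(\<Prod>e\<in>I. if a e = b e then fact (a e) else 0) = (0::complex)"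
      using I by (auto intro!: prod_zero)
    moreover have "\<not> (j = k \<and> m = l)" "\<not> (j = l \<and> m = k)" using False by (auto simp: a_def b_def)
    ultimately show ?thesis by (simp only: of_bool_def if_False add_0_left)
  qed
  ultimately show ?thesis by simp
qed

lemma nn_integral_orthonormal:
  assumes T: "finite T"
    and orth: "\<And>s t. s \<in> T \<Longrightarrow> t \<in> T \<Longrightarrow>
      has_bochner_integral M (\<lambda>\<omega>. X s \<omega> * cnj (X t \<omega>)) (if s = t then 1 else 0)"
  shows "(\<integral>\<^sup>+\<omega>. ennreal ((cmod (\<Sum>t\<in>T. a t * X t \<omega>))\<^sup>2) \<partial>M) = ennreal (\<Sum>t\<in>T. (cmod (a t))\<^sup>2)"
proof -
  have "has_bochner_integral M (\<lambda>\<omega>. \<Sum>s\<in>T. \<Sum>t\<in>T. (a s * cnj (a t)) * (X s \<omega> * cnj (X t \<omega>)))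
      (\<Sum>s\<in>T. \<Sum>t\<in>T. (a s * cnj (a t)) * (if s = t then 1 else 0))"
    by (intro has_bochner_integral_sum has_bochner_integral_mult_right orth)
  moreover have "(\<Sum>s\<in>T. \<Sum>t\<in>T. (a s * cnj (a t)) * (X s \<omega> * cnj (X t \<omega>)))
      = complex_of_real ((cmod (\<Sum>t\<in>T. a t * X t \<omega>))\<^sup>2)" for \<omega>
    by (simp only: complex_norm_square cnj_sum sum_product complex_cnj_mult mult_ac)
  moreover have "(\<Sum>s\<in>T. \<Sum>t\<in>T. (a s * cnj (a t)) * (if s = t then 1 else 0)) = complex_of_real (\<Sum>t\<in>T. (cmod (a t))\<^sup>2)"
    using T by (simp add: complex_norm_square if_distrib[where f = "\<lambda>x. _ * x"] sum.delta sum.delta'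
      del: of_real_power cong: if_cong)
  ultimately have "has_bochner_integral M (\<lambda>\<omega>. complex_of_real ((cmod (\<Sum>t\<in>T. a t * X t \<omega>))\<^sup>2))
      (complex_of_real (\<Sum>t\<in>T. (cmod (a t))\<^sup>2))" by simp
  from has_bochner_integral_Re[OF this]
  have "has_bochner_integral M (\<lambda>\<omega>. (cmod (\<Sum>t\<in>T. a t * X t \<omega>))\<^sup>2) (\<Sum>t\<in>T. (cmod (a t))\<^sup>2)" by simp
  then show ?thesis
    by (intro nn_integral_eq_integral[THEN trans]) (auto simp: has_bochner_integral_iff)
qed

section \<open>Fluctuations from a single Gaussian row\<close>

text \<open>Arguments that are not positive are at infinite distance from everything, themselves
  included. Hence the triangle inequality is unconditional, and a finite mean shows that degenerate
  arguments form a null event.\<close>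

definition dist_ln :: "real \<Rightarrow> real \<Rightarrow> ennreal" where
  "dist_ln a b = (if a \<le> 0 \<or> b \<le> 0 then \<infinity> else ennreal \<bar>ln a - ln b\<bar>)"

lemma dist_ln_triangle: "dist_ln a c \<le> dist_ln a b + dist_ln b c"
proof (cases "a \<le> 0 \<or> b \<le> 0 \<or> c \<le> 0")
  case False
  have "ennreal \<bar>ln a - ln c\<bar> \<le> ennreal (\<bar>ln a - ln b\<bar> + \<bar>ln b - ln c\<bar>)"
    by (rule ennreal_leI) linarith
  with False show ?thesis by (simp add: dist_ln_def)
qed (auto simp: dist_ln_def)

lemma dist_ln_self: "0 < a \<Longrightarrow> dist_ln a a = 0"
  by (simp add: dist_ln_def)

lemma measurable_dist_ln[measurable (raw)]:
  assumes [measurable]: "f \<in> borel_measurable M" "g \<in> borel_measurable M"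
  shows "(\<lambda>x. dist_ln (f x) (g x)) \<in> borel_measurable M"
  unfolding dist_ln_def by measurable

lemma complex_Cauchy_Schwarz_sum:
  fixes u v :: "'b \<Rightarrow> complex"
  shows "(cmod (\<Sum>i\<in>I. u i * v i))\<^sup>2 \<le> (\<Sum>i\<in>I. (cmod (u i))\<^sup>2) * (\<Sum>i\<in>I. (cmod (v i))\<^sup>2)"
proof -
  have "cmod (\<Sum>i\<in>I. u i * v i) \<le> (\<Sum>i\<in>I. cmod (u i) * cmod (v i))"
    by (rule order_trans[OF norm_sum]) (simp add: norm_mult)
  then have "(cmod (\<Sum>i\<in>I. u i * v i))\<^sup>2 \<le> (\<Sum>i\<in>I. cmod (u i) * cmod (v i))\<^sup>2"
    by (intro power_mono) auto
  also have "\<dots> \<le> (\<Sum>i\<in>I. (cmod (u i))\<^sup>2) * (\<Sum>i\<in>I. (cmod (v i))\<^sup>2)"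
    by (rule Cauchy_Schwarz_ineq_sum)
  finally show ?thesis .
qed

lemma form_bound_dual:
  fixes q :: "'b \<Rightarrow> 'i \<Rightarrow> complex"
  assumes B: "\<And>x. (\<Sum>\<beta>\<in>\<B>. (cmod (\<Sum>j\<in>J. x j * q \<beta> j))\<^sup>2) \<le> B * (\<Sum>j\<in>J. (cmod (x j))\<^sup>2)"
    and B0: "0 \<le> B"
  shows "(\<Sum>j\<in>J. (cmod (\<Sum>\<beta>\<in>\<B>. q \<beta> j * cnj (w \<beta>)))\<^sup>2) \<le> B * (\<Sum>\<beta>\<in>\<B>. (cmod (w \<beta>))\<^sup>2)"
proof -
  define c where "c j = (\<Sum>\<beta>\<in>\<B>. q \<beta> j * cnj (w \<beta>))" for j
  define S where "S = (\<Sum>j\<in>J. (cmod (c j))\<^sup>2)"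
  have S0: "S \<ge> 0" unfolding S_def by (intro sum_nonneg) auto
  have "complex_of_real S = (\<Sum>j\<in>J. cnj (c j) * c j)"
    by (simp add: S_def complex_norm_square mult.commute del: of_real_power)
  also have "\<dots> = (\<Sum>j\<in>J. \<Sum>\<beta>\<in>\<B>. cnj (w \<beta>) * (cnj (c j) * q \<beta> j))"
    by (subst (2) c_def) (simp add: sum_distrib_left mult_ac)
  also have "\<dots> = (\<Sum>\<beta>\<in>\<B>. cnj (w \<beta>) * (\<Sum>j\<in>J. cnj (c j) * q \<beta> j))"
    by (subst sum.swap) (simp add: sum_distrib_left)
  finally have "S\<^sup>2 = (cmod (\<Sum>\<beta>\<in>\<B>. cnj (w \<beta>) * (\<Sum>j\<in>J. cnj (c j) * q \<beta> j)))\<^sup>2"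
    by (metis norm_of_real power2_abs)
  also have "\<dots> \<le> (\<Sum>\<beta>\<in>\<B>. (cmod (cnj (w \<beta>)))\<^sup>2) * (\<Sum>\<beta>\<in>\<B>. (cmod (\<Sum>j\<in>J. cnj (c j) * q \<beta> j))\<^sup>2)"
    by (rule complex_Cauchy_Schwarz_sum)
  also have "\<dots> \<le> (\<Sum>\<beta>\<in>\<B>. (cmod (w \<beta>))\<^sup>2) * (B * S)"
    using B[of "\<lambda>j. cnj (c j)"] by (intro mult_mono) (auto simp: S_def intro!: sum_nonneg)
  finally have "S * S \<le> (B * (\<Sum>\<beta>\<in>\<B>. (cmod (w \<beta>))\<^sup>2)) * S"
    by (simp add: power2_eq_square mult_ac)
  then have "S \<le> B * (\<Sum>\<beta>\<in>\<B>. (cmod (w \<beta>))\<^sup>2)"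
  proof (cases "S = 0")
    case True then show ?thesis using B0 by (auto intro!: mult_nonneg_nonneg sum_nonneg)
  next
    case False
    with S0 \<open>S * S \<le> _\<close> show ?thesis by (simp add: mult_le_cancel_right)
  qed
  then show ?thesis by (simp add: S_def c_def)
qed


lemma abs_ln_ratio_le:
  fixes Q m s t w h L :: real and N :: nat
  assumes m: "0 < m" and s: "0 < s" and tpos: "0 < t" and w: "0 < w" and lower: "h * w \<le> Q" and Qpos: "0 < Q"
    and j: "t \<le> N * h" and N1: "1 \<le> N" and L_def: "L = ln (N * m / t)" and L0: "0 \<le> L"
  shows "\<bar>ln (Q / m)\<bar> \<le> (3 / s + 4 * L) * (Q / m - 1)\<^sup>2 + s + (s / 2) * (max 0 (- ln w))\<^sup>2"
proof -
  define y where "y = Q / m"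
  have y: "y > 0" using Qpos m by (simp add: y_def)
  define Z where "Z = max 0 (- ln w)"
  have am: "u \<le> u\<^sup>2 / (2 * s) + s / 2" for u :: real
  proof -
    have "0 \<le> (u - s)\<^sup>2" by simp
    then have "2 * s * u \<le> u\<^sup>2 + s\<^sup>2" by (simp add: power2_eq_square algebra_simps)
    then show ?thesis using s by (simp add: field_simps power2_eq_square)
  qed
  have main: "\<bar>ln y\<bar> \<le> (3 / s + 4 * L) * (y - 1)\<^sup>2 + s + (s / 2) * Z\<^sup>2"
  proof (cases "y \<ge> 1 / 2")
    case True
    have "\<bar>ln y\<bar> \<le> 2 * \<bar>y - 1\<bar>"
    proof (cases "y \<ge> 1")
      case True
      then show ?thesis using ln_le_minus_one[of y] by auto
    next
      case False
      have "- ln y = ln (1 / y)" using y by (simp add: ln_divide_pos)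
      also have "\<dots> \<le> 1 / y - 1" using y by (intro ln_le_minus_one) auto
      also have "\<dots> = (1 - y) / y" using y by (simp add: field_simps)
      also have "\<dots> \<le> (1 - y) / (1 / 2)" using True False y by (intro divide_left_mono) auto
      finally show ?thesis using False y by simp
    qed
    also have "\<dots> \<le> 2 * (\<bar>y - 1\<bar>\<^sup>2 / (2 * s) + s / 2)" using am[of "\<bar>y - 1\<bar>"] by simp
    also have "\<dots> = (1 / s) * (y - 1)\<^sup>2 + s" by simp
    also have "\<dots> \<le> (3 / s + 4 * L) * (y - 1)\<^sup>2 + s + (s / 2) * Z\<^sup>2"
    proof -
      have "1 / s \<le> 3 / s + 4 * L" using s L0 by (simp add: divide_right_mono add_increasing2)
      then have "(1 / s) * (y - 1)\<^sup>2 \<le> (3 / s + 4 * L) * (y - 1)\<^sup>2" by (rule mult_right_mono) simp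
      moreover have "0 \<le> (s / 2) * Z\<^sup>2" using s by simp
      ultimately show ?thesis by linarith
    qed
    finally show ?thesis .
  next
    case False
    have c: "1 \<le> 4 * (y - 1)\<^sup>2"
    proof -
      have "(1 / 2)\<^sup>2 \<le> (1 - y)\<^sup>2" using False by (intro power_mono) auto
      then show ?thesis by (simp add: power2_eq_square algebra_simps)
    qed
    have "\<bar>ln y\<bar> = ln (m / Q)" using False y m Qpos by (simp add: y_def ln_divide_pos)
    also have "\<dots> \<le> ln ((N * m / t) / w)"
    proof -
      have "t * w \<le> N * h * w" using j w by simp
      also have "\<dots> \<le> N * Q" using lower by (simp add: mult.assoc mult_left_mono)
      finally have "m / Q \<le> (N * m / t) / w"
        using Qpos tpos w m by (simp add: field_simps)
      moreover have "0 < m / Q" using m Qpos by simp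
      ultimately show ?thesis by (rule ln_mono)
    qed
    also have "\<dots> = L - ln w"
    proof -
      have "N * m / t > 0" using N1 m tpos by simp
      then show ?thesis using w unfolding L_def by (intro ln_divide_pos)
    qed
    also have "\<dots> \<le> L + Z" unfolding Z_def by linarith
    also have "\<dots> \<le> 4 * L * (y - 1)\<^sup>2 + (1 / (2 * s) * (4 * (y - 1)\<^sup>2) + (s / 2) * Z\<^sup>2)"
    proof (rule add_mono)
      show "L \<le> 4 * L * (y - 1)\<^sup>2" using mult_left_mono[OF c L0] by (simp add: mult_ac)
      have "Z \<le> 1 / (2 * s) + (s / 2) * Z\<^sup>2"
      proof -
        have "0 \<le> (s * Z - 1)\<^sup>2" by simp
        then have "2 * s * Z \<le> s\<^sup>2 * Z\<^sup>2 + 1" by (simp add: power2_eq_square algebra_simps)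
        then have "2 * s * Z / (2 * s) \<le> (s\<^sup>2 * Z\<^sup>2 + 1) / (2 * s)" using s by (intro divide_right_mono) auto
        also have "\<dots> = 1 / (2 * s) + (s / 2) * Z\<^sup>2"
          using s by (simp add: add_divide_distrib power2_eq_square)
        finally show ?thesis using s by simp
      qed
      moreover have "1 / (2 * s) \<le> 1 / (2 * s) * (4 * (y - 1)\<^sup>2)"
        using mult_left_mono[OF c, of "1 / (2 * s)"] s by simp
      ultimately show "Z \<le> 1 / (2 * s) * (4 * (y - 1)\<^sup>2) + (s / 2) * Z\<^sup>2" by linarith
    qed
    also have "\<dots> = (2 / s + 4 * L) * (y - 1)\<^sup>2 + (s / 2) * Z\<^sup>2"
      by (simp add: distrib_right)
    also have "\<dots> \<le> (3 / s + 4 * L) * (y - 1)\<^sup>2 + s + (s / 2) * Z\<^sup>2"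
    proof -
      have "2 / s + 4 * L \<le> 3 / s + 4 * L" using s by (simp add: divide_right_mono)
      then have "(2 / s + 4 * L) * (y - 1)\<^sup>2 \<le> (3 / s + 4 * L) * (y - 1)\<^sup>2" by (rule mult_right_mono) simp
      then show ?thesis using s by linarith
    qed
    finally show ?thesis .
  qed
  show ?thesis using main by (simp add: y_def Z_def)
qed

text \<open>The deviation of the quadratic expression from its mean \<open>m\<close> is separated
  into a linear part and a centred quadratic part, each a combination of orthonormal random
  variables.\<close>

lemma gauss_row_form_diff:
  fixes q :: "'b \<Rightarrow> 'i \<Rightarrow> complex" and q0 :: "'b \<Rightarrow> complex"
  assumes J: "finite J"
    and t: "t = (\<Sum>j\<in>J. \<Sum>\<beta>\<in>\<B>. (cmod (q \<beta> j))\<^sup>2)"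
    and m_eq: "m = (\<Sum>\<beta>\<in>\<B>. (cmod (q0 \<beta>))\<^sup>2) + t"
  shows "(\<Sum>\<beta>\<in>\<B>. (cmod (q0 \<beta> + (\<Sum>j\<in>J. r j * q \<beta> j)))\<^sup>2) - m
    = 2 * Re (\<Sum>i\<in>J. (\<Sum>\<beta>\<in>\<B>. q \<beta> i * cnj (q0 \<beta>)) * r i)
      + Re (\<Sum>ik\<in>J \<times> J. (\<Sum>\<beta>\<in>\<B>. q \<beta> (fst ik) * cnj (q \<beta> (snd ik)))
          * (r (fst ik) * cnj (r (snd ik)) - of_bool (fst ik = snd ik)))"
proof -
  define \<kappa> where "\<kappa> i = (\<Sum>\<beta>\<in>\<B>. q \<beta> i * cnj (q0 \<beta>))" for i
  define H where "H i k = (\<Sum>\<beta>\<in>\<B>. q \<beta> i * cnj (q \<beta> k))" for i k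
  define l where "l \<beta> = (\<Sum>i\<in>J. r i * q \<beta> i)" for \<beta>
  have "(\<Sum>\<beta>\<in>\<B>. (cmod (q0 \<beta> + (\<Sum>j\<in>J. r j * q \<beta> j)))\<^sup>2) = (\<Sum>\<beta>\<in>\<B>. (cmod (q0 \<beta>))\<^sup>2) + 2 * Re (\<Sum>\<beta>\<in>\<B>. l \<beta> * cnj (q0 \<beta>)) + Re (\<Sum>\<beta>\<in>\<B>. l \<beta> * cnj (l \<beta>))"
  proof -
    have sq: "(cmod (x + y))\<^sup>2 = (cmod x)\<^sup>2 + 2 * Re (y * cnj x) + Re (y * cnj y)" for x y
      unfolding cmod_power2 by (simp add: power2_eq_square algebra_simps)
    show ?thesis
      unfolding l_def[symmetric] by (simp only: sq sum.distrib Re_sum sum_distrib_left)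
  qed
  also have "(\<Sum>\<beta>\<in>\<B>. l \<beta> * cnj (q0 \<beta>)) = (\<Sum>i\<in>J. \<kappa> i * r i)"
    unfolding l_def \<kappa>_def sum_distrib_right by (subst sum.swap) (simp add: mult_ac)
  also have "(\<Sum>\<beta>\<in>\<B>. l \<beta> * cnj (l \<beta>)) = (\<Sum>i\<in>J. \<Sum>k\<in>J. H i k * (r i * cnj (r k)))"
  proof -
    have "(\<Sum>\<beta>\<in>\<B>. l \<beta> * cnj (l \<beta>)) = (\<Sum>\<beta>\<in>\<B>. \<Sum>i\<in>J. \<Sum>k\<in>J. (q \<beta> i * cnj (q \<beta> k)) * (r i * cnj (r k)))"
      unfolding l_def cnj_sum sum_product by (intro sum.cong refl) (simp add: mult_ac)
    also have "\<dots> = (\<Sum>i\<in>J. \<Sum>k\<in>J. \<Sum>\<beta>\<in>\<B>. (q \<beta> i * cnj (q \<beta> k)) * (r i * cnj (r k)))"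
      by (subst sum.swap, subst (2) sum.swap) (rule refl)
    finally show ?thesis by (simp add: H_def sum_distrib_right)
  qed
  also have "(\<Sum>i\<in>J. \<Sum>k\<in>J. H i k * (r i * cnj (r k)))
    = (\<Sum>ik\<in>J \<times> J. H (fst ik) (snd ik) * (r (fst ik) * cnj (r (snd ik)) - of_bool (fst ik = snd ik)))
      + (\<Sum>i\<in>J. \<Sum>k\<in>J. H i k * of_bool (i = k))"
    by (simp add: sum.cartesian_product split_beta' algebra_simps sum_subtractf)
  also have "(\<Sum>i\<in>J. \<Sum>k\<in>J. H i k * of_bool (i = k)) = complex_of_real t"
  proof -
    have "(\<Sum>i\<in>J. \<Sum>k\<in>J. H i k * of_bool (i = k)) = (\<Sum>i\<in>J. H i i)"
      using J by (intro sum.cong refl) (simp add: of_bool_def if_distrib[where f = "\<lambda>x. _ * x"] sum.delta cong: if_cong)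
    also have "\<dots> = complex_of_real t"
      by (simp add: t H_def complex_norm_square del: of_real_power)
    finally show ?thesis .
  qed
  finally show ?thesis using m_eq unfolding \<kappa>_def H_def by simp
qed
lemma gauss_row_variance:
  fixes q :: "'b \<Rightarrow> 'i \<Rightarrow> complex" and q0 :: "'b \<Rightarrow> complex"
  assumes J: "finite J"
    and B: "\<And>x. (\<Sum>\<beta>\<in>\<B>. (cmod (\<Sum>j\<in>J. x j * q \<beta> j))\<^sup>2) \<le> B * (\<Sum>j\<in>J. (cmod (x j))\<^sup>2)"
    and B0: "0 \<le> B"
    and t: "t = (\<Sum>j\<in>J. \<Sum>\<beta>\<in>\<B>. (cmod (q \<beta> j))\<^sup>2)"
    and m_eq: "m = (\<Sum>\<beta>\<in>\<B>. (cmod (q0 \<beta>))\<^sup>2) + t"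
  shows "(\<integral>\<^sup>+r. ennreal (((\<Sum>\<beta>\<in>\<B>. (cmod (q0 \<beta> + (\<Sum>j\<in>J. r j * q \<beta> j)))\<^sup>2) - m)\<^sup>2) \<partial>(\<Pi>\<^sub>M j\<in>J. cgauss))
    \<le> ennreal (8 * B * m)"
proof -
  define \<kappa> where "\<kappa> i = (\<Sum>\<beta>\<in>\<B>. q \<beta> i * cnj (q0 \<beta>))" for i
  define H where "H i k = (\<Sum>\<beta>\<in>\<B>. q \<beta> i * cnj (q \<beta> k))" for i k
  define Q where "Q r = (\<Sum>\<beta>\<in>\<B>. (cmod (q0 \<beta> + (\<Sum>j\<in>J. r j * q \<beta> j)))\<^sup>2)" for r
  note Qm = gauss_row_form_diff[OF J t m_eq, folded \<kappa>_def H_def Q_def]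
  have t0: "t \<ge> 0" unfolding t by (intro sum_nonneg) auto
  let ?P = "\<Pi>\<^sub>M j\<in>J. cgauss"
  let ?X1 = "\<lambda>i (r :: 'i \<Rightarrow> complex). r i"
  \<comment> \<open>Centring makes diagonal and off-diagonal products orthonormal at once: a
    diagonal one has variance 2 - 1 = 1.\<close>
  let ?X2 = "\<lambda>ik (r :: 'i \<Rightarrow> complex). r (fst ik) * cnj (r (snd ik)) - of_bool (fst ik = snd ik)"
  have i1: "(\<integral>\<^sup>+r. ennreal ((cmod (\<Sum>i\<in>J. \<kappa> i * ?X1 i r))\<^sup>2) \<partial>?P) = ennreal (\<Sum>i\<in>J. (cmod (\<kappa> i))\<^sup>2)"
  proof (rule nn_integral_orthonormal[OF J])
    fix a b assume "a \<in> J" "b \<in> J"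
    then show "has_bochner_integral ?P (\<lambda>r. r a * cnj (r b)) (if a = b then 1 else 0)"
      using cgauss_monomials_orthonormal[OF J, of "{a}" "{b}"] by auto
  qed
  have i2: "(\<integral>\<^sup>+r. ennreal ((cmod (\<Sum>ik\<in>J \<times> J. H (fst ik) (snd ik) * ?X2 ik r))\<^sup>2) \<partial>?P)
    = ennreal (\<Sum>ik\<in>J \<times> J. (cmod (H (fst ik) (snd ik)))\<^sup>2)"
  proof (rule nn_integral_orthonormal)
    fix a b assume ab: "a \<in> J \<times> J" "b \<in> J \<times> J"
    obtain i k u v where [simp]: "a = (i, k)" "b = (u, v)" by (metis surj_pair)
    from ab have ik: "i \<in> J" "k \<in> J" "u \<in> J" "v \<in> J" by auto
    have two: "has_bochner_integral ?P (\<lambda>r. r x * cnj (r y)) (of_bool (x = y))" if "x \<in> J" "y \<in> J" for x y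
      using cgauss_monomials_orthonormal[OF J, of "{x}" "{y}"] that by (auto simp: of_bool_def)
    have one: "has_bochner_integral ?P (\<lambda>r. 1) (1::complex)"
      using cgauss_monomials_orthonormal[OF J, of "{}" "{}"] by simp
    have "has_bochner_integral ?P (\<lambda>r. r i * r v * cnj (r k * r u)
        - of_bool (u = v) * (r i * cnj (r k)) - of_bool (i = k) * (r v * cnj (r u)) + (of_bool (i = k) * of_bool (u = v)) * 1)
       (of_bool (i = k \<and> v = u) + of_bool (i = u \<and> v = k)
        - of_bool (u = v) * of_bool (i = k) - of_bool (i = k) * of_bool (v = u) + (of_bool (i = k) * of_bool (u = v)) * 1)"
      by (intro has_bochner_integral_add has_bochner_integral_diff has_bochner_integral_mult_right
          cgauss_fourth_moment two one J ik)
    moreover have "?X2 a r * cnj (?X2 b r) = r i * r v * cnj (r k * r u)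
        - of_bool (u = v) * (r i * cnj (r k)) - of_bool (i = k) * (r v * cnj (r u)) + (of_bool (i = k) * of_bool (u = v)) * 1" for r
      by (simp add: algebra_simps)
    moreover have "(of_bool (i = k \<and> v = u) + of_bool (i = u \<and> v = k)
        - of_bool (u = v) * of_bool (i = k) - of_bool (i = k) * of_bool (v = u) + (of_bool (i = k) * of_bool (u = v)) * 1)
        = (if a = b then 1 else (0::complex))"
      by (simp only: eq_commute[of v u] eq_commute[of v k] of_bool_conj) simp
    ultimately show "has_bochner_integral ?P (\<lambda>r. ?X2 a r * cnj (?X2 b r)) (if a = b then 1 else 0)"
      by simp
  qed (use J in auto)
  have c1: "(\<Sum>i\<in>J. (cmod (\<kappa> i))\<^sup>2) \<le> B * (\<Sum>\<beta>\<in>\<B>. (cmod (q0 \<beta>))\<^sup>2)"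
    unfolding \<kappa>_def by (rule form_bound_dual[OF B B0])
  \<comment> \<open>The squared Hilbert-Schmidt norm of the Gram matrix is at most its operator norm
    times its trace \<open>t\<close>; column by column this is the dual form bound.\<close>
  have c2: "(\<Sum>ik\<in>J \<times> J. (cmod (H (fst ik) (snd ik)))\<^sup>2) \<le> B * t"
  proof -
    have "(\<Sum>ik\<in>J \<times> J. (cmod (H (fst ik) (snd ik)))\<^sup>2) = (\<Sum>k\<in>J. \<Sum>i\<in>J. (cmod (H i k))\<^sup>2)"
      by (subst sum.swap) (simp add: sum.cartesian_product split_beta')
    also have "\<dots> \<le> (\<Sum>k\<in>J. B * (\<Sum>\<beta>\<in>\<B>. (cmod (q \<beta> k))\<^sup>2))"
      unfolding H_def by (intro sum_mono form_bound_dual[OF B B0])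
    finally show ?thesis by (simp add: t sum_distrib_left)
  qed
  have "(\<integral>\<^sup>+r. ennreal ((Q r - m)\<^sup>2) \<partial>?P) \<le> (\<integral>\<^sup>+r. 8 * ennreal ((cmod (\<Sum>i\<in>J. \<kappa> i * ?X1 i r))\<^sup>2)
      + 2 * ennreal ((cmod (\<Sum>ik\<in>J \<times> J. H (fst ik) (snd ik) * ?X2 ik r))\<^sup>2) \<partial>?P)"
  proof (rule nn_integral_mono)
    fix r :: "'i \<Rightarrow> complex"
    have gen: "(2 * Re x + Re y)\<^sup>2 \<le> 8 * (cmod x)\<^sup>2 + 2 * (cmod y)\<^sup>2" for x y
    proof -
      have "(2 * Re x + Re y)\<^sup>2 \<le> 8 * (Re x)\<^sup>2 + 2 * (Re y)\<^sup>2"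
        using zero_le_power2[of "2 * Re x - Re y"] by (simp add: power2_eq_square algebra_simps)
      moreover have "(Re x)\<^sup>2 \<le> (cmod x)\<^sup>2" "(Re y)\<^sup>2 \<le> (cmod y)\<^sup>2" by (simp_all add: cmod_power2)
      ultimately show ?thesis by linarith
    qed
    have "(Q r - m)\<^sup>2 \<le> 8 * (cmod (\<Sum>i\<in>J. \<kappa> i * ?X1 i r))\<^sup>2 + 2 * (cmod (\<Sum>ik\<in>J \<times> J. H (fst ik) (snd ik) * ?X2 ik r))\<^sup>2"
      unfolding Qm by (rule gen)
    then have "ennreal ((Q r - m)\<^sup>2) \<le> ennreal (8 * (cmod (\<Sum>i\<in>J. \<kappa> i * ?X1 i r))\<^sup>2 + 2 * (cmod (\<Sum>ik\<in>J \<times> J. H (fst ik) (snd ik) * ?X2 ik r))\<^sup>2)"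
      by (rule ennreal_leI)
    then show "ennreal ((Q r - m)\<^sup>2) \<le> 8 * ennreal ((cmod (\<Sum>i\<in>J. \<kappa> i * ?X1 i r))\<^sup>2)
      + 2 * ennreal ((cmod (\<Sum>ik\<in>J \<times> J. H (fst ik) (snd ik) * ?X2 ik r))\<^sup>2)"
      by (simp add: ennreal_plus ennreal_mult')
  qed
  also have "\<dots> = 8 * (\<integral>\<^sup>+r. ennreal ((cmod (\<Sum>i\<in>J. \<kappa> i * ?X1 i r))\<^sup>2) \<partial>?P)
      + 2 * (\<integral>\<^sup>+r. ennreal ((cmod (\<Sum>ik\<in>J \<times> J. H (fst ik) (snd ik) * ?X2 ik r))\<^sup>2) \<partial>?P)"
  proof -
    have [measurable]: "(\<lambda>r. \<Sum>i\<in>J. \<kappa> i * r i) \<in> borel_measurable ?P" by measurable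
    have "(\<lambda>r. cnj (r k)) \<in> borel_measurable ?P" if "k \<in> J" for k
      using that by (intro measurable_compose[OF _ measurable_cnj]) measurable
    then have [measurable]: "(\<lambda>r. \<Sum>ik\<in>J \<times> J. H (fst ik) (snd ik) * ?X2 ik r) \<in> borel_measurable ?P"
      by (intro borel_measurable_sum borel_measurable_times borel_measurable_diff borel_measurable_const) auto
    show ?thesis by (simp add: nn_integral_add nn_integral_cmult)
  qed
  also have "\<dots> = ennreal (8 * (\<Sum>i\<in>J. (cmod (\<kappa> i))\<^sup>2) + 2 * (\<Sum>ik\<in>J \<times> J. (cmod (H (fst ik) (snd ik)))\<^sup>2))"
    unfolding i1 i2 by (simp add: ennreal_plus ennreal_mult' sum_nonneg)
  also have "\<dots> \<le> ennreal (8 * B * m)"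
  proof (rule ennreal_leI)
    have "8 * (\<Sum>i\<in>J. (cmod (\<kappa> i))\<^sup>2) + 2 * (\<Sum>ik\<in>J \<times> J. (cmod (H (fst ik) (snd ik)))\<^sup>2)
      \<le> 8 * (B * (\<Sum>\<beta>\<in>\<B>. (cmod (q0 \<beta>))\<^sup>2)) + 8 * (B * t)"
      using c1 c2 mult_nonneg_nonneg[OF B0 t0] by simp
    then show "8 * (\<Sum>i\<in>J. (cmod (\<kappa> i))\<^sup>2) + 2 * (\<Sum>ik\<in>J \<times> J. (cmod (H (fst ik) (snd ik)))\<^sup>2) \<le> 8 * B * m"
      by (simp add: m_eq algebra_simps)
  qed
  finally show ?thesis by (simp add: Q_def)
qed

text \<open>The relative variance is at most 8 B / m, so the pointwise logarithmic bound is used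
  with \<open>s = sqrt (B / m)\<close>. Small values of the sum are excluded by a single coordinate
  of the row, one carrying at least the average share of \<open>t\<close>; this is the source of the
  logarithm of the number of coordinates.\<close>

lemma gauss_row_concentration:
  fixes q :: "'b \<Rightarrow> 'i \<Rightarrow> complex" and q0 :: "'b \<Rightarrow> complex"
  assumes J: "finite J" and \<B>: "finite \<B>"
    and B: "\<And>x. (\<Sum>\<beta>\<in>\<B>. (cmod (\<Sum>j\<in>J. x j * q \<beta> j))\<^sup>2) \<le> B * (\<Sum>j\<in>J. (cmod (x j))\<^sup>2)"
    and B0: "0 \<le> B" and Bt: "B \<le> (\<Sum>j\<in>J. \<Sum>\<beta>\<in>\<B>. (cmod (q \<beta> j))\<^sup>2)"
    and m: "m = (\<Sum>\<beta>\<in>\<B>. (cmod (q0 \<beta>))\<^sup>2 + (\<Sum>j\<in>J. (cmod (q \<beta> j))\<^sup>2))" "m > 0"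
  shows "(\<integral>\<^sup>+r. dist_ln (\<Sum>\<beta>\<in>\<B>. (cmod (q0 \<beta> + (\<Sum>j\<in>J. r j * q \<beta> j)))\<^sup>2) m \<partial>(\<Pi>\<^sub>M j\<in>J. cgauss))
    \<le> ennreal (sqrt (B / m) * (100 + 32 * ln (card J)))"
proof -
  interpret pp: product_prob_space "\<lambda>_ :: 'i. cgauss" by (rule product_prob_space_cgauss)
  define h where "h j = (\<Sum>\<beta>\<in>\<B>. (cmod (q \<beta> j))\<^sup>2)" for j
  define t where "t = (\<Sum>j\<in>J. h j)"
  have h0: "h j \<ge> 0" for j unfolding h_def by (intro sum_nonneg) auto
  have t0: "t \<ge> 0" unfolding t_def by (intro sum_nonneg h0)
  have Bt': "B \<le> t" using Bt by (simp add: t_def h_def)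
  have m_eq: "m = (\<Sum>\<beta>\<in>\<B>. (cmod (q0 \<beta>))\<^sup>2) + t"
    unfolding m(1) t_def h_def sum.distrib by (subst sum.swap) simp
  define Q where "Q r = (\<Sum>\<beta>\<in>\<B>. (cmod (q0 \<beta> + (\<Sum>j\<in>J. r j * q \<beta> j)))\<^sup>2)" for r
  show ?thesis
  proof (cases "t = 0")
    case True
    then have "h j = 0" if "j \<in> J" for j
      using that J h0 by (simp add: t_def sum_nonneg_eq_0_iff)
    then have "q \<beta> j = 0" if "j \<in> J" "\<beta> \<in> \<B>" for j \<beta>
      using that \<B> by (simp add: h_def sum_nonneg_eq_0_iff)
    then have "Q r = m" for r
      using True m_eq by (simp add: Q_def)
    then show ?thesis
      using m(2) by (simp add: Q_def dist_ln_self)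
  next
    case False
    with t0 have tpos: "t > 0" by simp
    then have Jne: "J \<noteq> {}" by (auto simp: t_def)
    have N1: "card J \<ge> 1" using Jne J by (simp add: Suc_le_eq card_gt_0_iff)
    have Bpos: "B > 0"
    proof (rule ccontr)
      assume "\<not> B > 0"
      with B0 have "B = 0" by simp
      have "h j = 0" if "j \<in> J" for j
      proof -
        have "h j \<le> (\<Sum>\<beta>\<in>\<B>. (cmod (\<Sum>k\<in>J. (if k = j then 1 else 0) * q \<beta> k))\<^sup>2)"
          using that J by (simp add: h_def if_distrib[where f = "\<lambda>x. x * _"] sum.delta cong: if_cong)
        also have "\<dots> \<le> 0" using B[of "\<lambda>k. if k = j then 1 else 0"] \<open>B = 0\<close> by simp
        finally show ?thesis using h0[of j] by simp
      qed
      with tpos show False by (simp add: t_def)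
    qed
    \<comment> \<open>Pigeonhole: some coordinate has at least the average weight. It alone serves
      for the small-ball estimate.\<close>
    obtain j where j: "j \<in> J" "t \<le> card J * h j"
    proof (rule ccontr)
      assume "\<not> thesis"
      with that have "card J * h i < t" if "i \<in> J" for i using that by (meson not_le)
      then have "(\<Sum>i\<in>J. card J * h i) < (\<Sum>i\<in>J. t)" using J Jne by (intro sum_strict_mono) auto
      also have "\<dots> = card J * t" by simp
      finally show False by (simp add: t_def sum_distrib_left)
    qed
    have hj: "h j > 0"
      using j tpos h0[of j] by (metis less_le_trans mult_zero_right order_le_less)
    define d where "d = B / m"
    define s where "s = sqrt d"
    have mt: "t \<le> m" using m_eq by (simp add: sum_nonneg)
    have d: "0 < d" "d \<le> 1" using Bpos m(2) Bt' mt by (auto simp: d_def field_simps)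
    have s: "0 < s" "s \<le> 1" "s * s = d" using d by (auto simp: s_def)
    define L where "L = ln (card J * m / t)"
    have L0: "L \<ge> 0"
    proof -
      have "1 * t \<le> card J * m" using N1 mt t0 by (intro mult_mono) auto
      then show ?thesis using tpos by (auto simp: L_def)
    qed
    let ?P = "\<Pi>\<^sub>M j\<in>J. cgauss"
    have var: "(\<integral>\<^sup>+r. ennreal ((Q r - m)\<^sup>2) \<partial>?P) \<le> ennreal (8 * B * m)"
      unfolding Q_def by (rule gauss_row_variance[OF J B B0 _ m_eq]) (simp add: t_def h_def)
    \<comment> \<open>Projecting the vector of all linear forms on the direction
      \<open>q \<beta> j\<close> gives \<open>h j * (r j + b r)\<close>; Cauchy-Schwarz then bounds
      \<open>Q r\<close> from below.\<close>
    define b where "b r = (\<Sum>\<beta>\<in>\<B>. cnj (q \<beta> j) * (q0 \<beta> + (\<Sum>k\<in>J - {j}. r k * q \<beta> k))) / complex_of_real (h j)" for r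
    have lower: "h j * (cmod (r j + b r))\<^sup>2 \<le> Q r" for r
    proof -
      let ?w = "\<lambda>\<beta>. q0 \<beta> + (\<Sum>k\<in>J. r k * q \<beta> k)"
      have "(\<Sum>\<beta>\<in>\<B>. cnj (q \<beta> j) * ?w \<beta>)
          = (\<Sum>\<beta>\<in>\<B>. cnj (q \<beta> j) * (q0 \<beta> + (\<Sum>k\<in>J - {j}. r k * q \<beta> k)) + r j * (q \<beta> j * cnj (q \<beta> j)))"
        using j J by (intro sum.cong refl) (simp add: sum.remove algebra_simps)
      also have "\<dots> = complex_of_real (h j) * (r j + b r)"
      proof -
        have "complex_of_real (h j) = (\<Sum>\<beta>\<in>\<B>. q \<beta> j * cnj (q \<beta> j))"
          by (simp add: h_def complex_norm_square del: of_real_power)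
        moreover have "complex_of_real (h j) * b r = (\<Sum>\<beta>\<in>\<B>. cnj (q \<beta> j) * (q0 \<beta> + (\<Sum>k\<in>J - {j}. r k * q \<beta> k)))"
          using hj by (simp add: b_def)
        ultimately show ?thesis
          by (simp only: sum.distrib sum_distrib_left[symmetric] distrib_left mult.commute add.commute) (simp add: ring_distribs)
      qed
      finally have "(h j * cmod (r j + b r))\<^sup>2 = (cmod (\<Sum>\<beta>\<in>\<B>. cnj (q \<beta> j) * ?w \<beta>))\<^sup>2"
        using hj by (simp add: norm_mult)
      also have "\<dots> \<le> h j * Q r"
        using complex_Cauchy_Schwarz_sum[of "\<lambda>\<beta>. cnj (q \<beta> j)" ?w \<B>] by (simp add: h_def Q_def)
      finally have "h j * (h j * (cmod (r j + b r))\<^sup>2) \<le> h j * Q r"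
        by (simp add: power2_eq_square mult_ac)
      then show ?thesis using hj by simp
    qed
    have pointwise: "dist_ln (Q r) m \<le> ennreal ((3 / s + 4 * L) / m\<^sup>2) * ennreal ((Q r - m)\<^sup>2) + ennreal s
        + ennreal (s / 2) * neg_ln_sq ((cmod (r j + b r))\<^sup>2)" for r
    proof (cases "r j + b r = 0")
      case True
      then show ?thesis using s by (simp add: neg_ln_sq_def ennreal_mult_top)
    next
      case False
      define w where "w = (cmod (r j + b r))\<^sup>2"
      have w: "w > 0" using False by (simp add: w_def)
      have Qpos: "Q r > 0" using lower[of r] mult_pos_pos[OF hj w] by (simp add: w_def)
      define y where "y = Q r / m"
      have y: "y > 0" using Qpos m(2) by (simp add: y_def)
      define Z where "Z = max 0 (- ln w)"
      have main: "\<bar>ln y\<bar> \<le> (3 / s + 4 * L) * (y - 1)\<^sup>2 + s + (s / 2) * Z\<^sup>2"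
        unfolding y_def Z_def
        by (rule abs_ln_ratio_le[OF m(2) s(1) tpos w _ Qpos j(2) N1 L_def L0]) (use lower[of r] in \<open>simp add: w_def\<close>)
      have "dist_ln (Q r) m = ennreal \<bar>ln y\<bar>"
        using Qpos m(2) by (simp add: dist_ln_def y_def ln_divide_pos)
      also have "\<dots> \<le> ennreal ((3 / s + 4 * L) * (y - 1)\<^sup>2 + s + (s / 2) * Z\<^sup>2)"
        by (rule ennreal_leI[OF main])
      also have "(y - 1)\<^sup>2 = (Q r - m)\<^sup>2 / m\<^sup>2"
        using m(2) by (simp add: y_def diff_divide_distrib power_divide[symmetric])
      also have "ennreal ((3 / s + 4 * L) * ((Q r - m)\<^sup>2 / m\<^sup>2) + s + (s / 2) * Z\<^sup>2)
          = ennreal ((3 / s + 4 * L) / m\<^sup>2) * ennreal ((Q r - m)\<^sup>2) + ennreal s + ennreal (s / 2) * ennreal (Z\<^sup>2)"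
        using s L0 by (simp add: ennreal_plus ennreal_mult'[symmetric] ennreal_mult''[symmetric])
      also have "ennreal (Z\<^sup>2) = neg_ln_sq w" using w by (simp add: neg_ln_sq_def Z_def)
      finally show ?thesis by (simp add: w_def)
    qed
    have small: "(\<integral>\<^sup>+r. neg_ln_sq ((cmod (r j + b r))\<^sup>2) \<partial>?P) \<le> 16"
    proof -
      have ins: "insert j (J - {j}) = J" using j by auto
      \<comment> \<open>The shift does not involve coordinate \<open>j\<close>, so it is constant
        while that coordinate is integrated.\<close>
      have bind: "b (x(j := y)) = b x" for x y by (simp add: b_def)
      have meas: "(\<lambda>r. neg_ln_sq ((cmod (r j + b r))\<^sup>2)) \<in> borel_measurable (\<Pi>\<^sub>M k\<in>insert j (J - {j}). cgauss)"
        unfolding ins b_def using j by measurable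
      have "(\<integral>\<^sup>+r. neg_ln_sq ((cmod (r j + b r))\<^sup>2) \<partial>?P)
        = (\<integral>\<^sup>+x. \<integral>\<^sup>+y. neg_ln_sq ((cmod ((x(j := y)) j + b (x(j := y))))\<^sup>2) \<partial>cgauss \<partial>(\<Pi>\<^sub>M k\<in>J - {j}. cgauss))"
        using pp.product_nn_integral_insert[OF _ _ meas] J j by (simp add: insert_absorb)
      also have "\<dots> \<le> (\<integral>\<^sup>+x. 16 \<partial>(\<Pi>\<^sub>M k\<in>J - {j}. cgauss))"
        by (intro nn_integral_mono) (simp add: bind cgauss_small_ball)
      also have "\<dots> = 16"
      proof -
        interpret p': prob_space "\<Pi>\<^sub>M k\<in>J - {j}. cgauss" by (intro prob_space_PiM prob_space_cgauss)
        show ?thesis by (simp add: p'.emeasure_space_1)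
      qed
      finally show ?thesis .
    qed
    interpret P: prob_space ?P by (intro prob_space_PiM prob_space_cgauss)
    have [measurable]: "Q \<in> borel_measurable ?P" unfolding Q_def by measurable
    have [measurable]: "(\<lambda>r. neg_ln_sq ((cmod (r j + b r))\<^sup>2)) \<in> borel_measurable ?P"
      unfolding b_def using j by measurable
    have "(\<integral>\<^sup>+r. dist_ln (Q r) m \<partial>?P) \<le> (\<integral>\<^sup>+r. ennreal ((3 / s + 4 * L) / m\<^sup>2) * ennreal ((Q r - m)\<^sup>2) + ennreal s
        + ennreal (s / 2) * neg_ln_sq ((cmod (r j + b r))\<^sup>2) \<partial>?P)"
      by (intro nn_integral_mono pointwise)
    also have "\<dots> = ennreal ((3 / s + 4 * L) / m\<^sup>2) * (\<integral>\<^sup>+r. ennreal ((Q r - m)\<^sup>2) \<partial>?P) + ennreal s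
        + ennreal (s / 2) * (\<integral>\<^sup>+r. neg_ln_sq ((cmod (r j + b r))\<^sup>2) \<partial>?P)"
      by (simp add: nn_integral_add nn_integral_cmult P.emeasure_space_1)
    also have "\<dots> \<le> ennreal ((3 / s + 4 * L) / m\<^sup>2) * ennreal (8 * B * m) + ennreal s + ennreal (s / 2) * 16"
      by (intro add_mono mult_left_mono var small order_refl) auto
    also have "\<dots> = ennreal ((3 / s + 4 * L) / m\<^sup>2 * (8 * B * m) + s + s / 2 * 16)"
    proof -
      have "ennreal (s / 2) * 16 = ennreal (s / 2 * 16)"
        using s by (subst ennreal_mult) auto
      moreover have "ennreal ((3 / s + 4 * L) / m\<^sup>2) * ennreal (8 * B * m) = ennreal ((3 / s + 4 * L) / m\<^sup>2 * (8 * B * m))"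
        using s L0 m(2) Bpos by (subst ennreal_mult) auto
      moreover have "ennreal x + ennreal u + ennreal v = ennreal (x + u + v)" if "0 \<le> x" "0 \<le> u" "0 \<le> v" for x u v
        using that by simp
      moreover have "0 \<le> (3 / s + 4 * L) / m\<^sup>2 * (8 * B * m)" "0 \<le> s" "0 \<le> s / 2 * 16"
        using s L0 m(2) Bpos by auto
      ultimately show ?thesis by (simp only:)
    qed
    \<comment> \<open>Altogether 24 + 64 + 1 + 8 = 97 multiples of \<open>s\<close>, rounded up to
      100.\<close>
    also have "\<dots> \<le> ennreal (sqrt (B / m) * (100 + 32 * ln (card J)))"
    proof (rule ennreal_leI)
      have ds: "d / s = s" using s by (auto simp: field_simps)
      have e1: "(3 / s + 4 * L) / m\<^sup>2 * (8 * B * m) = 24 * s + 32 * L * d"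
      proof -
        have "(3 / s + 4 * L) / m\<^sup>2 * (8 * B * m) = (3 / s + 4 * L) * (8 * d)"
          using m(2) by (simp add: d_def power2_eq_square)
        also have "\<dots> = 24 * (d / s) + 32 * L * d" by (simp add: algebra_simps)
        finally show ?thesis by (simp add: ds)
      qed
      have l1: "L = ln (card J) + ln (m / t)"
        using N1 m(2) tpos ln_mult_pos[of "card J" "m / t"] by (simp add: L_def)
      have l2: "ln (m / t) \<le> ln (1 / d)"
        using Bpos tpos m(2) Bt' by (intro ln_mono) (auto simp: d_def frac_le)
      have l3: "ln (1 / d) = 2 * ln (1 / s)"
      proof -
        have "1 / d = (1 / s) * (1 / s)" using s by (simp add: s(3))
        then show ?thesis using s ln_mult_pos[of "1 / s" "1 / s"] by simp
      qed
      have l4: "ln (1 / s) \<le> 1 / s"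
        using ln_le_minus_one[of "1 / s"] s by simp
      have Lle: "L \<le> ln (card J) + 2 / s" using l1 l2 l3 l4 by linarith
      have "32 * L * d \<le> 32 * (ln (card J) + 2 / s) * d" using Lle d by (intro mult_right_mono) auto
      also have "\<dots> = 32 * ln (card J) * d + 64 * (d / s)" by (simp add: algebra_simps)
      also have "\<dots> = 32 * ln (card J) * d + 64 * s" by (simp add: ds)
      finally have "32 * L * d \<le> 32 * ln (card J) * d + 64 * s" .
      moreover have "32 * ln (card J) * d \<le> 32 * ln (card J) * s"
      proof (rule mult_left_mono)
        show "d \<le> s" using s mult_left_mono[of s 1 s] by simp
      qed (use N1 in simp)
      ultimately have "32 * L * d \<le> 32 * ln (card J) * s + 64 * s" by linarith
      then show "(3 / s + 4 * L) / m\<^sup>2 * (8 * B * m) + s + s / 2 * 16 \<le> sqrt (B / m) * (100 + 32 * ln (card J))"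
        unfolding e1 d_def[symmetric] s_def[symmetric] using s by (simp add: algebra_simps)
    qed
    finally show ?thesis by (simp add: Q_def)
  qed
qed

section \<open>Alternating polynomials in Gaussian rows\<close>

lemma sum_PiE_remove:
  assumes "finite R" "a \<in> R" "\<And>i. i \<in> R \<Longrightarrow> finite (F i)"
  shows "(\<Sum>u\<in>Pi\<^sub>E R F. G u) = (\<Sum>v\<in>Pi\<^sub>E (R - {a}) F. \<Sum>j\<in>F a. G (v(a := j)))"
proof -
  have R: "R = insert a (R - {a})" using assms by auto
  have "(\<Sum>u\<in>Pi\<^sub>E R F. G u) = (\<Sum>u\<in>(\<lambda>(y, g). g(a := y)) ` (F a \<times> Pi\<^sub>E (R - {a}) F). G u)"
    by (subst R, subst PiE_insert_eq) (rule refl)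
  also have "\<dots> = (\<Sum>(y, g)\<in>F a \<times> Pi\<^sub>E (R - {a}) F. G (g(a := y)))"
    by (subst sum.reindex[OF inj_combinator]) (auto simp: case_prod_unfold comp_def)
  also have "\<dots> = (\<Sum>y\<in>F a. \<Sum>g\<in>Pi\<^sub>E (R - {a}) F. G (g(a := y)))"
    by (simp add: sum.cartesian_product)
  also have "\<dots> = (\<Sum>v\<in>Pi\<^sub>E (R - {a}) F. \<Sum>j\<in>F a. G (v(a := j)))"
    by (rule sum.swap)
  finally show ?thesis .
qed

text \<open>The maps \<open>pr a\<close> below insert the normalised vector \<open>x\<close> into slot \<open>a\<close> of an alternating
  tensor. Up to the factor \<open>X\<close> they are orthogonal projections, mutually orthogonal by
  alternation, and equal in norm by symmetry, so Bessel's inequality applies.\<close>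

lemma alternating_contraction_le:
  fixes p :: "('i \<Rightarrow> nat) \<Rightarrow> complex" and x :: "nat \<Rightarrow> complex"
  assumes R: "finite R" "S \<subseteq> R" "i \<in> S"
    and F: "F = (\<lambda>a. if a \<in> S then {..<n} else {n})"
    and alt: "\<And>u a b. u \<in> Pi\<^sub>E R F \<Longrightarrow> a \<in> S \<Longrightarrow> b \<in> S \<Longrightarrow> a \<noteq> b \<Longrightarrow> p (u(a := u b, b := u a)) = - p u"
  shows "card S * (\<Sum>v\<in>Pi\<^sub>E (R - {i}) F. (cmod (\<Sum>j<n. x j * p (v(i := j))))\<^sup>2)
    \<le> (\<Sum>j<n. (cmod (x j))\<^sup>2) * (\<Sum>u\<in>Pi\<^sub>E R F. (cmod (p u))\<^sup>2)"
proof -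
  let ?U = "Pi\<^sub>E R F"
  define X where "X = (\<Sum>j<n. (cmod (x j))\<^sup>2)"
  define P where "P = (\<Sum>u\<in>?U. (cmod (p u))\<^sup>2)"
  define Y where "Y a u = (\<Sum>j<n. x j * p (u(a := j)))" for a u
  define pr where "pr a u = cnj (x (u a)) * Y a u" for a u
  define t where "t a = (\<Sum>v\<in>Pi\<^sub>E (R - {a}) F. (cmod (Y a v))\<^sup>2)" for a
  have finS: "finite S" using R finite_subset by blast
  have finF: "finite (F a)" for a by (simp add: F)
  have FS: "F a = {..<n}" if "a \<in> S" for a using that by (simp add: F)
  have split: "(\<Sum>u\<in>?U. G u) = (\<Sum>v\<in>Pi\<^sub>E (R - {a}) F. \<Sum>j<n. G (v(a := j)))" if "a \<in> S" for a and G :: "_ \<Rightarrow> complex"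
    using sum_PiE_remove[of R a F G] that R finF FS by auto
  have Yupd: "Y a (v(a := j)) = Y a v" for a v j by (simp add: Y_def)
  have Xc: "complex_of_real X = (\<Sum>j<n. x j * cnj (x j))"
    by (simp add: X_def complex_norm_square del: of_real_power)
  have e1: "(\<Sum>u\<in>?U. cnj (p u) * pr a u) = complex_of_real (t a)" if "a \<in> S" for a
  proof -
    have "(\<Sum>u\<in>?U. cnj (p u) * pr a u) = (\<Sum>v\<in>Pi\<^sub>E (R - {a}) F. \<Sum>j<n. cnj (x j * p (v(a := j))) * Y a v)"
      by (subst split[OF that]) (simp add: pr_def Yupd mult_ac)
    also have "\<dots> = (\<Sum>v\<in>Pi\<^sub>E (R - {a}) F. Y a v * cnj (Y a v))"
      by (intro sum.cong refl) (simp only: Y_def cnj_sum sum_distrib_right[symmetric] mult.commute)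
    finally show ?thesis by (simp add: t_def complex_norm_square del: of_real_power)
  qed
  have e2: "(\<Sum>u\<in>?U. cnj (pr a u) * pr a u) = complex_of_real (X * t a)" if "a \<in> S" for a
  proof -
    have "(\<Sum>u\<in>?U. cnj (pr a u) * pr a u) = (\<Sum>v\<in>Pi\<^sub>E (R - {a}) F. \<Sum>j<n. (x j * cnj (x j)) * (Y a v * cnj (Y a v)))"
      by (subst split[OF that]) (simp add: pr_def Yupd mult_ac)
    also have "\<dots> = complex_of_real X * (\<Sum>v\<in>Pi\<^sub>E (R - {a}) F. Y a v * cnj (Y a v))"
      by (simp only: Xc sum_distrib_right[symmetric] sum_distrib_left)
    finally show ?thesis by (simp add: t_def complex_norm_square del: of_real_power)
  qed
  have e3: "(\<Sum>u\<in>?U. cnj (pr a u) * pr b u) = 0" if ab: "a \<in> S" "b \<in> S" "a \<noteq> b" for a b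
  proof -
    have "(\<Sum>u\<in>?U. cnj (pr a u) * pr b u)
        = (\<Sum>v\<in>Pi\<^sub>E (R - {a}) F. cnj (Y a v) * cnj (x (v b)) * (\<Sum>j<n. x j * Y b (v(a := j))))"
      using ab by (subst split[OF ab(1)]) (simp add: pr_def Yupd sum_distrib_left mult_ac)
    also have "\<dots> = 0"
    proof (intro sum.neutral ballI)
      fix v assume v: "v \<in> Pi\<^sub>E (R - {a}) F"
      \<comment> \<open>The product \<open>x j * x l\<close> is symmetric and \<open>p\<close> is
        alternating in the slots \<open>a\<close> and \<open>b\<close>, so exchanging the summation
        indices gives Z = -Z.\<close>
      define Z where "Z = (\<Sum>j<n. x j * Y b (v(a := j)))"
      have Z: "Z = (\<Sum>j<n. \<Sum>l<n. x j * x l * p (v(a := j, b := l)))"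
        by (simp add: Z_def Y_def sum_distrib_left mult_ac)
      have "(\<Sum>j<n. \<Sum>l<n. x j * x l * p (v(a := j, b := l))) = (\<Sum>j<n. \<Sum>l<n. - (x j * x l * p (v(a := l, b := j))))"
      proof (intro sum.cong refl)
        fix j l assume jl: "j \<in> {..<n}" "l \<in> {..<n}"
        have "v(a := l, b := j) \<in> ?U"
          using v ab R jl FS by (auto simp: PiE_iff extensional_def)
        from alt[OF this ab] have "p (v(a := j, b := l)) = - p (v(a := l, b := j))"
          using ab(3) by (simp add: fun_upd_twist)
        then show "x j * x l * p (v(a := j, b := l)) = - (x j * x l * p (v(a := l, b := j)))" by simp
      qed
      also have "\<dots> = - (\<Sum>l<n. \<Sum>j<n. x j * x l * p (v(a := l, b := j)))"
        by (subst sum.swap) (simp add: sum_negf)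
      also have "(\<Sum>l<n. \<Sum>j<n. x j * x l * p (v(a := l, b := j))) = Z"
        unfolding Z by (simp add: mult_ac)
      finally have "Z = - Z" by (subst Z)
      then show "cnj (Y a v) * cnj (x (v b)) * (\<Sum>j<n. x j * Y b (v(a := j))) = 0"
        unfolding Z_def[symmetric] by simp
    qed
    finally show ?thesis .
  qed
  \<comment> \<open>Transposing the slots \<open>a\<close> and \<open>i\<close> changes the sign of
    \<open>p\<close> and of the contraction; the product of the two is unchanged.\<close>
  have e4: "t a = t i" if "a \<in> S" for a
  proof (cases "a = i")
    case False
    let ?s = "\<lambda>u. u(a := u i, i := u a)"
    have aR: "a \<in> R" "i \<in> R" using that R by auto
    have bij: "bij_betw ?s ?U ?U"
    proof (rule bij_betwI[where g = ?s])
      show "?s \<in> ?U \<rightarrow> ?U" "?s \<in> ?U \<rightarrow> ?U"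
        using aR FS[OF that, folded FS[OF R(3)]] by (auto simp: PiE_iff extensional_def) metis+
    qed (use False in \<open>auto simp: fun_upd_twist fun_eq_iff\<close>)
    have "complex_of_real (t a) = (\<Sum>u\<in>?U. cnj (p (?s u)) * pr a (?s u))"
      unfolding e1[OF that, symmetric] by (rule sum.reindex_bij_betw[OF bij, symmetric])
    also have "\<dots> = (\<Sum>u\<in>?U. cnj (p u) * pr i u)"
    proof (intro sum.cong refl)
      fix u assume u: "u \<in> ?U"
      have p1: "p (?s u) = - p u" using alt[OF u that R(3)] False by simp
      have "p ((?s u)(a := j)) = - p (u(i := j))" if "j < n" for j
      proof -
        have "u(i := j) \<in> ?U" using u aR FS[OF R(3)] that by (auto simp: PiE_iff extensional_def)
        from alt[OF this \<open>a \<in> S\<close> R(3)] False show ?thesis by (simp add: fun_upd_twist)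
      qed
      then have "Y a (?s u) = - Y i u" by (simp add: Y_def sum_negf)
      then show "cnj (p (?s u)) * pr a (?s u) = cnj (p u) * pr i u"
        using p1 False by (simp add: pr_def)
    qed
    also have "\<dots> = complex_of_real (t i)" by (rule e1[OF R(3)])
    finally show ?thesis by simp
  qed simp
  have X0: "X \<ge> 0" unfolding X_def by (intro sum_nonneg) auto
  have key: "0 \<le> X * (X * P - card S * t i)"
  proof -
    \<comment> \<open>The squared norm of this residual is nonnegative, and that is the inequality.
      Scaling \<open>p\<close> by \<open>X\<close> instead of normalising \<open>x\<close> avoids
      dividing by a possibly zero norm.\<close>
    let ?V = "\<lambda>u. complex_of_real X * p u - (\<Sum>a\<in>S. pr a u)"
    have "complex_of_real (\<Sum>u\<in>?U. (cmod (?V u))\<^sup>2) = (\<Sum>u\<in>?U. cnj (?V u) * ?V u)"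
      by (simp add: complex_norm_square mult.commute del: of_real_power)
    also have "\<dots> = (\<Sum>u\<in>?U. complex_of_real (X * X) * (cnj (p u) * p u)
        - complex_of_real X * (\<Sum>a\<in>S. cnj (p u) * pr a u) - complex_of_real X * (\<Sum>a\<in>S. cnj (cnj (p u) * pr a u))
        + (\<Sum>a\<in>S. \<Sum>b\<in>S. cnj (pr a u) * pr b u))"
    proof (intro sum.cong refl)
      fix u
      define w where "w = (\<Sum>a\<in>S. pr a u)"
      have "(\<Sum>a\<in>S. \<Sum>b\<in>S. cnj (pr a u) * pr b u) = cnj w * w" by (simp add: w_def sum_product)
      moreover have "(\<Sum>a\<in>S. cnj (p u) * pr a u) = cnj (p u) * w" by (simp add: w_def sum_distrib_left)
      moreover have "(\<Sum>a\<in>S. cnj (cnj (p u) * pr a u)) = p u * cnj w" by (simp add: w_def sum_distrib_left)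
      ultimately show "cnj (?V u) * ?V u = complex_of_real (X * X) * (cnj (p u) * p u)
        - complex_of_real X * (\<Sum>a\<in>S. cnj (p u) * pr a u) - complex_of_real X * (\<Sum>a\<in>S. cnj (cnj (p u) * pr a u))
        + (\<Sum>a\<in>S. \<Sum>b\<in>S. cnj (pr a u) * pr b u)"
        unfolding w_def[symmetric] by (simp add: algebra_simps)
    qed
    also have "\<dots> = complex_of_real (X * X) * (\<Sum>u\<in>?U. cnj (p u) * p u)
        - complex_of_real X * (\<Sum>a\<in>S. \<Sum>u\<in>?U. cnj (p u) * pr a u)
        - complex_of_real X * (\<Sum>a\<in>S. cnj (\<Sum>u\<in>?U. cnj (p u) * pr a u))
        + (\<Sum>a\<in>S. \<Sum>b\<in>S. \<Sum>u\<in>?U. cnj (pr a u) * pr b u)"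
    proof -
      have "(\<Sum>u\<in>?U. \<Sum>a\<in>S. \<Sum>b\<in>S. cnj (pr a u) * pr b u) = (\<Sum>a\<in>S. \<Sum>b\<in>S. \<Sum>u\<in>?U. cnj (pr a u) * pr b u)"
        by (subst sum.swap, intro sum.cong refl, rule sum.swap)
      moreover have "(\<Sum>u\<in>?U. \<Sum>a\<in>S. cnj (p u) * pr a u) = (\<Sum>a\<in>S. \<Sum>u\<in>?U. cnj (p u) * pr a u)"
        by (rule sum.swap)
      moreover have "(\<Sum>u\<in>?U. \<Sum>a\<in>S. cnj (cnj (p u) * pr a u)) = (\<Sum>a\<in>S. cnj (\<Sum>u\<in>?U. cnj (p u) * pr a u))"
        unfolding cnj_sum by (rule sum.swap)
      ultimately show ?thesis by (simp only: sum.distrib sum_subtractf sum_distrib_left[symmetric])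
    qed
    also have "(\<Sum>a\<in>S. \<Sum>u\<in>?U. cnj (p u) * pr a u) = complex_of_real (card S * t i)"
      by (simp add: e1 e4)
    also have "(\<Sum>a\<in>S. cnj (\<Sum>u\<in>?U. cnj (p u) * pr a u)) = complex_of_real (card S * t i)"
      by (simp only: e1 e4 complex_cnj_complex_of_real cong: sum.cong) simp
    also have "(\<Sum>a\<in>S. \<Sum>b\<in>S. \<Sum>u\<in>?U. cnj (pr a u) * pr b u) = complex_of_real (X * (card S * t i))"
    proof -
      have "(\<Sum>b\<in>S. \<Sum>u\<in>?U. cnj (pr a u) * pr b u) = complex_of_real (X * t i)" if "a \<in> S" for a
      proof -
        have "(\<Sum>b\<in>S. \<Sum>u\<in>?U. cnj (pr a u) * pr b u) = (\<Sum>b\<in>S. if b = a then complex_of_real (X * t i) else 0)"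
          using that e3[OF that] e2[OF that] e4[OF that] by (intro sum.cong refl) auto
        also have "\<dots> = complex_of_real (X * t i)" using that finS by simp
        finally show ?thesis .
      qed
      then show ?thesis by simp
    qed
    also have "(\<Sum>u\<in>?U. cnj (p u) * p u) = complex_of_real P"
      by (simp add: P_def complex_norm_square mult.commute del: of_real_power)
    finally have "complex_of_real (\<Sum>u\<in>?U. (cmod (?V u))\<^sup>2) = complex_of_real (X * (X * P - card S * t i))"
      by (simp add: algebra_simps)
    then have "(\<Sum>u\<in>?U. (cmod (?V u))\<^sup>2) = X * (X * P - card S * t i)" by (simp only: of_real_eq_iff)
    then show ?thesis by (metis (no_types, lifting) sum_nonneg zero_le_power2)
  qed
  have "card S * t i \<le> X * P"
  proof (cases "X = 0")
    case True
    then have "x j = 0" if "j < n" for j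
      using that by (simp add: X_def sum_nonneg_eq_0_iff)
    then have "Y i v = 0" for v by (simp add: Y_def)
    then show ?thesis using True by (simp add: t_def)
  next
    case False
    with X0 key show ?thesis by (simp add: zero_le_mult_iff)
  qed
  then show ?thesis by (simp add: t_def X_def P_def Y_def)
qed

text \<open>The value \<open>n\<close> marks rows that contribute a constant, and alternation is
  available among the other rows only. The sum is grouped by the set \<open>S\<close> of rows other
  than \<open>i\<close> with a genuine column; within a group the tensor alternates in
  \<open>insert i S\<close>, so the contraction gains the factor 1 / card (insert i S).\<close>

lemma alternating_row_contraction_le:
  fixes p :: "('i \<Rightarrow> nat) \<Rightarrow> complex" and x :: "nat \<Rightarrow> complex"
  assumes R: "finite R" "i \<in> R"
    and alt: "\<And>u a b. u \<in> Pi\<^sub>E R (\<lambda>_. {..n}) \<Longrightarrow> a \<in> R \<Longrightarrow> b \<in> R \<Longrightarrow> a \<noteq> b \<Longrightarrow> u a < n \<Longrightarrow> u b < n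
      \<Longrightarrow> p (u(a := u b, b := u a)) = - p u"
  shows "(\<Sum>v\<in>Pi\<^sub>E (R - {i}) (\<lambda>_. {..n}). (cmod (\<Sum>j<n. x j * p (v(i := j))))\<^sup>2)
    \<le> (\<Sum>j<n. (cmod (x j))\<^sup>2) * (\<Sum>u | u \<in> Pi\<^sub>E R (\<lambda>_. {..n}) \<and> u i < n. (cmod (p u))\<^sup>2 / card {a \<in> R. u a < n})"
proof -
  define F where "F S = (\<lambda>a. if a \<in> S then {..<n} else {n})" for S :: "'i set"
  let ?R' = "R - {i}"
  let ?V = "Pi\<^sub>E ?R' (\<lambda>_. {..n})"
  let ?U = "{u. u \<in> Pi\<^sub>E R (\<lambda>_. {..n}) \<and> u i < n}"
  define X where "X = (\<Sum>j<n. (cmod (x j))\<^sup>2)"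
  have X0: "X \<ge> 0" unfolding X_def by (intro sum_nonneg) auto
  have fin: "finite ?V" "finite ?U"
  proof -
    show "finite ?V" using R by (intro finite_PiE) auto
    have "finite (Pi\<^sub>E R (\<lambda>_. {..n}))" using R by (intro finite_PiE) auto
    then show "finite ?U" by (rule rev_finite_subset) auto
  qed
  have mem: "v \<in> Pi\<^sub>E T (F S) \<longleftrightarrow> v \<in> Pi\<^sub>E T (\<lambda>_. {..n}) \<and> {a \<in> T. v a < n} = S \<inter> T" for v S T
  proof -
    have "v a \<in> F S a \<longleftrightarrow> v a \<in> {..n} \<and> (v a < n \<longleftrightarrow> a \<in> S)" for a by (auto simp: F_def)
    moreover have "{a \<in> T. v a < n} = S \<inter> T \<longleftrightarrow> (\<forall>a\<in>T. v a < n \<longleftrightarrow> a \<in> S)" by auto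
    ultimately show ?thesis unfolding PiE_iff by blast
  qed
  have V: "{v \<in> ?V. {a \<in> ?R'. v a < n} = S} = Pi\<^sub>E ?R' (F (insert i S))" if "S \<subseteq> ?R'" for S
  proof -
    have eq: "insert i S \<inter> ?R' = S" using that by auto
    show ?thesis by (rule Set.set_eqI) (simp only: mem mem_Collect_eq eq)
  qed
  have U: "{u \<in> ?U. {a \<in> ?R'. u a < n} = S} = Pi\<^sub>E R (F (insert i S))" if "S \<subseteq> ?R'" for S
  proof -
    have eq: "insert i S \<inter> R = insert i S" using that R by auto
    have eq2: "u i < n \<and> {a \<in> ?R'. u a < n} = S \<longleftrightarrow> {a \<in> R. u a < n} = insert i S" for u
    proof -
      have e1: "{a \<in> R. u a < n} = (if u i < n then insert i {a \<in> ?R'. u a < n} else {a \<in> ?R'. u a < n})"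
        using R by auto
      have e2: "i \<notin> {a \<in> ?R'. u a < n}" "i \<notin> S" using that by auto
      have g: "c \<and> T = S \<longleftrightarrow> A = insert i S" if "A = (if c then insert i T else T)" "i \<notin> T" "i \<notin> S"
        for A T S :: "'i set" and c
        using that by (cases c) (auto simp: insert_ident)
      show ?thesis by (rule g[OF e1 e2])
    qed
    show ?thesis by (rule Set.set_eqI) (simp only: mem mem_Collect_eq conj_assoc eq eq2)
  qed
  have "(\<Sum>v\<in>?V. (cmod (\<Sum>j<n. x j * p (v(i := j))))\<^sup>2)
    = (\<Sum>S\<in>Pow ?R'. \<Sum>v\<in>{v \<in> ?V. {a \<in> ?R'. v a < n} = S}. (cmod (\<Sum>j<n. x j * p (v(i := j))))\<^sup>2)"
    using R by (intro sum.group[OF fin(1), of "Pow ?R'" "\<lambda>v. {a \<in> ?R'. v a < n}", symmetric]) auto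
  also have "\<dots> \<le> (\<Sum>S\<in>Pow ?R'. \<Sum>u\<in>{u \<in> ?U. {a \<in> ?R'. u a < n} = S}. X * ((cmod (p u))\<^sup>2 / card {a \<in> R. u a < n}))"
  proof (rule sum_mono)
    fix S assume "S \<in> Pow ?R'"
    then have S: "S \<subseteq> ?R'" by auto
    have fS: "finite S" using S R finite_subset by blast
    let ?c = "real (card (insert i S))"
    have c: "?c > 0" using fS by (simp add: card_gt_0_iff)
    have "?c * (\<Sum>v\<in>Pi\<^sub>E ?R' (F (insert i S)). (cmod (\<Sum>j<n. x j * p (v(i := j))))\<^sup>2)
      \<le> X * (\<Sum>u\<in>Pi\<^sub>E R (F (insert i S)). (cmod (p u))\<^sup>2)"
      unfolding X_def
    proof (rule alternating_contraction_le[OF R(1) _ _ F_def])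
      fix u a b assume u: "u \<in> Pi\<^sub>E R (F (insert i S))" "a \<in> insert i S" "b \<in> insert i S" "a \<noteq> b"
      have "a \<in> R" "b \<in> R" using u S R by auto
      moreover have "u \<in> Pi\<^sub>E R (\<lambda>_. {..n})" using u(1) mem by blast
      moreover have "u a < n" "u b < n" using u \<open>a \<in> R\<close> \<open>b \<in> R\<close> mem[of u R "insert i S"] by blast+
      ultimately show "p (u(a := u b, b := u a)) = - p u" using u(4) by (intro alt) auto
    qed (use S R in auto)
    then have "(\<Sum>v\<in>Pi\<^sub>E ?R' (F (insert i S)). (cmod (\<Sum>j<n. x j * p (v(i := j))))\<^sup>2)
      \<le> X * (\<Sum>u\<in>Pi\<^sub>E R (F (insert i S)). (cmod (p u))\<^sup>2) / ?c"
      using c by (simp add: pos_le_divide_eq mult.commute)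
    also have "\<dots> = (\<Sum>u\<in>Pi\<^sub>E R (F (insert i S)). X * ((cmod (p u))\<^sup>2 / ?c))"
      by (simp add: sum_distrib_left sum_divide_distrib)
    also have "\<dots> = (\<Sum>u\<in>Pi\<^sub>E R (F (insert i S)). X * ((cmod (p u))\<^sup>2 / card {a \<in> R. u a < n}))"
    proof (intro sum.cong refl)
      fix u assume "u \<in> Pi\<^sub>E R (F (insert i S))"
      then have "{a \<in> R. u a < n} = insert i S" using S R mem[of u R "insert i S"] by auto
      then show "X * ((cmod (p u))\<^sup>2 / ?c) = X * ((cmod (p u))\<^sup>2 / card {a \<in> R. u a < n})" by simp
    qed
    finally show "(\<Sum>v\<in>{v \<in> ?V. {a \<in> ?R'. v a < n} = S}. (cmod (\<Sum>j<n. x j * p (v(i := j))))\<^sup>2)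
      \<le> (\<Sum>u\<in>{u \<in> ?U. {a \<in> ?R'. u a < n} = S}. X * ((cmod (p u))\<^sup>2 / card {a \<in> R. u a < n}))"
      unfolding V[OF S] U[OF S] .
  qed
  also have "\<dots> = (\<Sum>u\<in>?U. X * ((cmod (p u))\<^sup>2 / card {a \<in> R. u a < n}))"
    using R by (intro sum.group[OF fin(2), of "Pow ?R'" "\<lambda>u. {a \<in> ?R'. u a < n}"]) auto
  finally show ?thesis by (simp add: X_def sum_distrib_left)
qed

text \<open>The row is found by averaging the bound for a single row over all rows.\<close>

lemma exists_spread_row:
  fixes p :: "'a \<Rightarrow> ('i \<Rightarrow> nat) \<Rightarrow> complex"
  assumes R: "finite R" "R \<noteq> {}"
    and alt: "\<And>\<alpha> u a b. \<alpha> \<in> \<A> \<Longrightarrow> u \<in> Pi\<^sub>E R (\<lambda>_. {..n}) \<Longrightarrow> a \<in> R \<Longrightarrow> b \<in> R \<Longrightarrow> a \<noteq> b \<Longrightarrow> u a < n \<Longrightarrow> u b < n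
      \<Longrightarrow> p \<alpha> (u(a := u b, b := u a)) = - p \<alpha> u"
    and m: "m = (\<Sum>\<alpha>\<in>\<A>. \<Sum>u\<in>Pi\<^sub>E R (\<lambda>_. {..n}). (cmod (p \<alpha> u))\<^sup>2)"
  obtains i B where "i \<in> R" "0 \<le> B" "B \<le> m / card R"
    "B \<le> (\<Sum>j<n. \<Sum>\<alpha>\<in>\<A>. \<Sum>v\<in>Pi\<^sub>E (R - {i}) (\<lambda>_. {..n}). (cmod (p \<alpha> (v(i := j))))\<^sup>2)"
    "\<And>x. (\<Sum>\<alpha>\<in>\<A>. \<Sum>v\<in>Pi\<^sub>E (R - {i}) (\<lambda>_. {..n}). (cmod (\<Sum>j<n. x j * p \<alpha> (v(i := j))))\<^sup>2) \<le> B * (\<Sum>j<n. (cmod (x j))\<^sup>2)"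
proof -
  let ?U = "Pi\<^sub>E R (\<lambda>_. {..n})"
  have finU: "finite ?U" using R by (intro finite_PiE) auto
  define s where "s u = card {a \<in> R. u a < n}" for u
  define B where "B i = (\<Sum>\<alpha>\<in>\<A>. \<Sum>u | u \<in> ?U \<and> u i < n. (cmod (p \<alpha> u))\<^sup>2 / s u)" for i
  \<comment> \<open>A term \<open>u\<close> occurs once for each of its \<open>s u\<close> rows with
    a genuine column, each time with weight 1 / \<open>s u\<close>, so its contributions add up to
    at most its squared modulus.\<close>
  have "(\<Sum>i\<in>R. B i) \<le> m"
  proof -
    have "(\<Sum>i\<in>R. B i) = (\<Sum>\<alpha>\<in>\<A>. \<Sum>i\<in>R. \<Sum>u\<in>?U. if u i < n then (cmod (p \<alpha> u))\<^sup>2 / s u else 0)"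
      unfolding B_def by (subst sum.swap) (simp add: sum.inter_filter[OF finU, symmetric])
    also have "\<dots> = (\<Sum>\<alpha>\<in>\<A>. \<Sum>u\<in>?U. \<Sum>i\<in>R. if u i < n then (cmod (p \<alpha> u))\<^sup>2 / s u else 0)"
      by (intro sum.cong refl sum.swap)
    also have "\<dots> = (\<Sum>\<alpha>\<in>\<A>. \<Sum>u\<in>?U. s u * ((cmod (p \<alpha> u))\<^sup>2 / s u))"
      using R by (intro sum.cong refl) (simp add: sum.inter_filter[symmetric] s_def)
    also have "\<dots> \<le> m"
      unfolding m by (intro sum_mono) auto
    finally show ?thesis .
  qed
  have "\<exists>i\<in>R. B i \<le> m / card R"
  proof (rule ccontr)
    assume "\<not> ?thesis"
    then have "(\<Sum>i\<in>R. m / card R) < (\<Sum>i\<in>R. B i)" using R by (intro sum_strict_mono) auto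
    moreover have "(\<Sum>i\<in>R. m / card R) = m" using R by simp
    ultimately show False using \<open>(\<Sum>i\<in>R. B i) \<le> m\<close> by simp
  qed
  then obtain i where i: "i \<in> R" "B i \<le> m / card R" by blast
  show ?thesis
  proof (rule that[of i "B i"])
    show "0 \<le> B i" unfolding B_def by (intro sum_nonneg) auto
    have "B i \<le> (\<Sum>\<alpha>\<in>\<A>. \<Sum>u | u \<in> ?U \<and> u i < n. (cmod (p \<alpha> u))\<^sup>2)"
      unfolding B_def
    proof (intro sum_mono)
      fix \<alpha> u assume "u \<in> {u. u \<in> ?U \<and> u i < n}"
      then have "s u \<ge> 1" using i R by (auto simp: s_def Suc_le_eq card_gt_0_iff)
      then have "(cmod (p \<alpha> u))\<^sup>2 / s u \<le> (cmod (p \<alpha> u))\<^sup>2 / 1" by (intro divide_left_mono) auto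
      then show "(cmod (p \<alpha> u))\<^sup>2 / s u \<le> (cmod (p \<alpha> u))\<^sup>2" by simp
    qed
    also have "\<dots> = (\<Sum>\<alpha>\<in>\<A>. \<Sum>u\<in>?U. if u i < n then (cmod (p \<alpha> u))\<^sup>2 else 0)"
      by (simp add: sum.inter_filter[OF finU, symmetric])
    also have "\<dots> = (\<Sum>\<alpha>\<in>\<A>. \<Sum>v\<in>Pi\<^sub>E (R - {i}) (\<lambda>_. {..n}). \<Sum>j\<le>n. if j < n then (cmod (p \<alpha> (v(i := j))))\<^sup>2 else 0)"
      using R i by (subst sum_PiE_remove[of R i]) auto
    also have "\<dots> = (\<Sum>\<alpha>\<in>\<A>. \<Sum>v\<in>Pi\<^sub>E (R - {i}) (\<lambda>_. {..n}). \<Sum>j<n. (cmod (p \<alpha> (v(i := j))))\<^sup>2)"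
      by (simp add: lessThan_Suc_atMost[symmetric])
    also have "\<dots> = (\<Sum>j<n. \<Sum>\<alpha>\<in>\<A>. \<Sum>v\<in>Pi\<^sub>E (R - {i}) (\<lambda>_. {..n}). (cmod (p \<alpha> (v(i := j))))\<^sup>2)"
      by (subst sum.swap) (intro sum.cong refl sum.swap)
    finally show "B i \<le> (\<Sum>j<n. \<Sum>\<alpha>\<in>\<A>. \<Sum>v\<in>Pi\<^sub>E (R - {i}) (\<lambda>_. {..n}). (cmod (p \<alpha> (v(i := j))))\<^sup>2)" .
    fix x
    have "(\<Sum>\<alpha>\<in>\<A>. \<Sum>v\<in>Pi\<^sub>E (R - {i}) (\<lambda>_. {..n}). (cmod (\<Sum>j<n. x j * p \<alpha> (v(i := j))))\<^sup>2)
      \<le> (\<Sum>\<alpha>\<in>\<A>. (\<Sum>j<n. (cmod (x j))\<^sup>2) * (\<Sum>u | u \<in> ?U \<and> u i < n. (cmod (p \<alpha> u))\<^sup>2 / s u))"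
      unfolding s_def by (intro sum_mono alternating_row_contraction_le[OF R(1) i(1)] alt)
    also have "\<dots> = B i * (\<Sum>j<n. (cmod (x j))\<^sup>2)"
      by (simp add: B_def sum_distrib_left[symmetric] mult.commute)
    finally show "(\<Sum>\<alpha>\<in>\<A>. \<Sum>v\<in>Pi\<^sub>E (R - {i}) (\<lambda>_. {..n}). (cmod (\<Sum>j<n. x j * p \<alpha> (v(i := j))))\<^sup>2) \<le> B i * (\<Sum>j<n. (cmod (x j))\<^sup>2)" .
  qed (use i in auto)
qed

text \<open>The extra column index \<open>n\<close> stands for the constant \<open>1\<close>, so that polynomials that are affine in each
  row become multilinear.\<close>

definition affine_coord :: "nat \<Rightarrow> ('i \<times> nat \<Rightarrow> complex) \<Rightarrow> 'i \<Rightarrow> nat \<Rightarrow> complex" where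
  "affine_coord n A i j = (if j < n then A (i, j) else 1)"

definition row_poly :: "nat \<Rightarrow> 'i set \<Rightarrow> (('i \<Rightarrow> nat) \<Rightarrow> complex) \<Rightarrow> ('i \<times> nat \<Rightarrow> complex) \<Rightarrow> complex" where
  "row_poly n R p A = (\<Sum>u\<in>Pi\<^sub>E R (\<lambda>_. {..n}). p u * (\<Prod>i\<in>R. affine_coord n A i (u i)))"

text \<open>Only pairs of rows that both use a genuine column are concerned. Index \<open>n\<close>
  stands for the constant part, which differs from row to row, so exchanging it with a column has no
  sign rule.\<close>

definition alternating_coeffs :: "nat \<Rightarrow> 'i set \<Rightarrow> (('i \<Rightarrow> nat) \<Rightarrow> complex) \<Rightarrow> bool" where
  "alternating_coeffs n R p \<longleftrightarrow> (\<forall>u\<in>Pi\<^sub>E R (\<lambda>_. {..n}). \<forall>a\<in>R. \<forall>b\<in>R. a \<noteq> b \<longrightarrow> u a < n \<longrightarrow> u b < n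
      \<longrightarrow> p (u(a := u b, b := u a)) = - p u)"

lemma measurable_affine_coord:
  assumes "i \<in> R"
  shows "(\<lambda>A. affine_coord n A i j) \<in> borel_measurable (\<Pi>\<^sub>M e\<in>R \<times> {..<n}. cgauss)"
proof (cases "j < n")
  case True
  then have "(\<lambda>A :: 'a \<times> nat \<Rightarrow> complex. A (i, j)) \<in> borel_measurable (\<Pi>\<^sub>M e\<in>R \<times> {..<n}. cgauss)"
    using assms by (intro measurable_component_singleton[where M = "\<lambda>_. cgauss", simplified]) auto
  then show ?thesis using True by (simp add: affine_coord_def)
qed (simp add: affine_coord_def)

lemma measurable_row_poly:
  "row_poly n R p \<in> borel_measurable (\<Pi>\<^sub>M e\<in>R \<times> {..<n}. cgauss)"
  unfolding row_poly_def
  by (intro borel_measurable_sum borel_measurable_times borel_measurable_const borel_measurable_prod measurable_affine_coord)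

text \<open>Induction on the number of rows. The spread row \<open>i\<close> depends on the
  coefficients alone. For each value of that row the remaining polynomial is again alternating, with
  conditional mean \<open>m' x\<close>, so the induction hypothesis compares the sum with
  \<open>m' x\<close> and the one-row estimate compares \<open>m' x\<close> with \<open>m\<close>.
  The row treated next may depend on the value of row \<open>i\<close>.\<close>

lemma row_poly_concentration:
  fixes p :: "'a \<Rightarrow> ('i \<Rightarrow> nat) \<Rightarrow> complex"
  assumes "finite R" "finite \<A>" "\<And>\<alpha>. \<alpha> \<in> \<A> \<Longrightarrow> alternating_coeffs n R (p \<alpha>)"
    and "m = (\<Sum>\<alpha>\<in>\<A>. \<Sum>u\<in>Pi\<^sub>E R (\<lambda>_. {..n}). (cmod (p \<alpha> u))\<^sup>2)" "m > 0"
  shows "(\<integral>\<^sup>+A. dist_ln (\<Sum>\<alpha>\<in>\<A>. (cmod (row_poly n R (p \<alpha>) A))\<^sup>2) m \<partial>(\<Pi>\<^sub>M e\<in>R \<times> {..<n}. cgauss))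
    \<le> ennreal ((100 + 32 * ln n) * (\<Sum>d=1..card R. 1 / sqrt d))"
  using assms
proof (induction "card R" arbitrary: R p m)
  case 0
  then have R: "R = {}" by simp
  have "(\<Sum>\<alpha>\<in>\<A>. (cmod (row_poly n R (p \<alpha>) A))\<^sup>2) = m" for A
    by (simp add: R 0(5) row_poly_def)
  then show ?case using 0(6) by (simp add: dist_ln_self)
next
  case (Suc d)
  note R = \<open>finite R\<close> and m = \<open>m = _\<close>
  have Rne: "R \<noteq> {}" using Suc(2) by auto
  have cR: "card R = Suc d" using Suc(2) by simp
  from Suc(5) have alt: "p \<alpha> (u(a := u b, b := u a)) = - p \<alpha> u"
    if "\<alpha> \<in> \<A>" "u \<in> Pi\<^sub>E R (\<lambda>_. {..n})" "a \<in> R" "b \<in> R" "a \<noteq> b" "u a < n" "u b < n" for \<alpha> u a b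
    using that by (auto simp: alternating_coeffs_def)
  obtain i B where i: "i \<in> R" and B: "0 \<le> B" "B \<le> m / card R"
    "B \<le> (\<Sum>j<n. \<Sum>\<alpha>\<in>\<A>. \<Sum>v\<in>Pi\<^sub>E (R - {i}) (\<lambda>_. {..n}). (cmod (p \<alpha> (v(i := j))))\<^sup>2)"
    "\<And>x. (\<Sum>\<alpha>\<in>\<A>. \<Sum>v\<in>Pi\<^sub>E (R - {i}) (\<lambda>_. {..n}). (cmod (\<Sum>j<n. x j * p \<alpha> (v(i := j))))\<^sup>2) \<le> B * (\<Sum>j<n. (cmod (x j))\<^sup>2)"
    using exists_spread_row[OF R Rne alt m] by blast
  define R' where "R' = R - {i}"
  have R': "finite R'" "card R' = d" "i \<notin> R'" using R i cR by (auto simp: R'_def)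
  let ?V = "Pi\<^sub>E R' (\<lambda>_. {..n})"
  have finV: "finite ?V" using R' by (intro finite_PiE) auto
  let ?I = "{i} \<times> {..<n}" and ?J = "R' \<times> {..<n}"
  let ?PI = "\<Pi>\<^sub>M e\<in>?I. cgauss" and ?PJ = "\<Pi>\<^sub>M e\<in>?J. cgauss"
  have IJ: "?I \<union> ?J = R \<times> {..<n}" "?I \<inter> ?J = {}" using i by (auto simp: R'_def)
  interpret pp: product_prob_space "\<lambda>_ :: 'i \<times> nat. cgauss" by (rule product_prob_space_cgauss)
  interpret PJ: prob_space ?PJ by (intro prob_space_PiM prob_space_cgauss)
  interpret PI: prob_space ?PI by (intro prob_space_PiM prob_space_cgauss)
  \<comment> \<open>The coefficients in the other rows once row \<open>i\<close> has the value
    \<open>x\<close>.\<close>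
  define p' where "p' x \<alpha> v = (\<Sum>j\<le>n. affine_coord n x i j * p \<alpha> (v(i := j)))" for x \<alpha> v
  define m' where "m' x = (\<Sum>\<alpha>\<in>\<A>. \<Sum>v\<in>?V. (cmod (p' x \<alpha> v))\<^sup>2)" for x
  define F where "F A = (\<Sum>\<alpha>\<in>\<A>. (cmod (row_poly n R (p \<alpha>) A))\<^sup>2)" for A
  define F' where "F' x y = (\<Sum>\<alpha>\<in>\<A>. (cmod (row_poly n R' (p' x \<alpha>) y))\<^sup>2)" for x y
  define K where "K = (100 + 32 * ln n) * (\<Sum>d=1..d. 1 / sqrt d)"
  have ln0: "0 \<le> ln (real n)" by (cases n) auto
  have K0: "0 \<le> K" unfolding K_def using ln0 by (intro mult_nonneg_nonneg sum_nonneg) auto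
  have Fm: "F (merge ?I ?J (x, y)) = F' x y" for x y
  proof -
    have "row_poly n R (p \<alpha>) (merge ?I ?J (x, y)) = row_poly n R' (p' x \<alpha>) y" for \<alpha>
    proof -
      let ?A = "merge ?I ?J (x, y)"
      have a1: "affine_coord n ?A i j = affine_coord n x i j" for j by (simp add: affine_coord_def merge_def)
      have a2: "affine_coord n ?A a j = affine_coord n y a j" if "a \<in> R'" for a j
        using that R' by (auto simp: affine_coord_def merge_def)
      have "row_poly n R (p \<alpha>) ?A = (\<Sum>v\<in>?V. \<Sum>j\<le>n. p \<alpha> (v(i := j)) * (\<Prod>a\<in>R. affine_coord n ?A a ((v(i := j)) a)))"
        unfolding row_poly_def R'_def using R i by (subst sum_PiE_remove[of R i]) auto
      also have "\<dots> = (\<Sum>v\<in>?V. \<Sum>j\<le>n. (affine_coord n x i j * p \<alpha> (v(i := j))) * (\<Prod>a\<in>R'. affine_coord n y a (v a)))"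
      proof (intro sum.cong refl)
        fix v j
        have "(\<Prod>a\<in>R. affine_coord n ?A a ((v(i := j)) a)) = affine_coord n x i j * (\<Prod>a\<in>R'. affine_coord n ?A a ((v(i := j)) a))"
          unfolding prod.remove[OF R i] R'_def[symmetric] by (simp add: a1)
        also have "(\<Prod>a\<in>R'. affine_coord n ?A a ((v(i := j)) a)) = (\<Prod>a\<in>R'. affine_coord n y a (v a))"
          using R' by (intro prod.cong refl) (auto simp: a2)
        finally show "p \<alpha> (v(i := j)) * (\<Prod>a\<in>R. affine_coord n ?A a ((v(i := j)) a))
          = (affine_coord n x i j * p \<alpha> (v(i := j))) * (\<Prod>a\<in>R'. affine_coord n y a (v a))" by simp
      qed
      also have "\<dots> = row_poly n R' (p' x \<alpha>) y"
        by (simp add: row_poly_def p'_def sum_distrib_right)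
      finally show ?thesis .
    qed
    then show ?thesis by (simp add: F_def F'_def)
  qed
  have measF: "F \<in> borel_measurable (\<Pi>\<^sub>M e\<in>?I \<union> ?J. cgauss)"
    unfolding IJ F_def using measurable_row_poly[measurable] by measurable
  have measF': "F' x \<in> borel_measurable ?PJ" for x
    unfolding F'_def using measurable_row_poly[measurable] by measurable
  have alt': "alternating_coeffs n R' (p' x \<alpha>)" if "\<alpha> \<in> \<A>" for x \<alpha>
    unfolding alternating_coeffs_def
  proof (intro ballI impI)
    fix v a b assume v: "v \<in> ?V" "a \<in> R'" "b \<in> R'" "a \<noteq> b" "v a < n" "v b < n"
    have "p \<alpha> ((v(a := v b, b := v a))(i := j)) = - p \<alpha> (v(i := j))" if "j \<le> n" for j
    proof -
      let ?u = "v(i := j)"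
      have "?u \<in> Pi\<^sub>E R (\<lambda>_. {..n})" using v(1) that i by (auto simp: PiE_iff extensional_def R'_def)
      then have "p \<alpha> (?u(a := ?u b, b := ?u a)) = - p \<alpha> ?u"
        using v R' \<open>\<alpha> \<in> \<A>\<close> by (intro alt) (auto simp: R'_def)
      moreover have "?u(a := ?u b, b := ?u a) = (v(a := v b, b := v a))(i := j)"
        using v R' by (auto simp: fun_eq_iff)
      ultimately show ?thesis by simp
    qed
    then show "p' x \<alpha> (v(a := v b, b := v a)) = - p' x \<alpha> v"
      by (simp add: p'_def sum_negf)
  qed
  have inner: "(\<integral>\<^sup>+y. dist_ln (F' x y) m \<partial>?PJ) \<le> ennreal K + dist_ln (m' x) m" for x
  proof (cases "m' x > 0")
    case True
    have "(\<integral>\<^sup>+y. dist_ln (F' x y) m \<partial>?PJ) \<le> (\<integral>\<^sup>+y. dist_ln (F' x y) (m' x) + dist_ln (m' x) m \<partial>?PJ)"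
      by (intro nn_integral_mono dist_ln_triangle)
    also have "\<dots> = (\<integral>\<^sup>+y. dist_ln (F' x y) (m' x) \<partial>?PJ) + dist_ln (m' x) m"
      using measF' by (subst nn_integral_add) (auto simp: PJ.emeasure_space_1)
    also have "(\<integral>\<^sup>+y. dist_ln (F' x y) (m' x) \<partial>?PJ) \<le> ennreal K"
      unfolding F'_def K_def R'(2)[symmetric]
      by (rule Suc(1)) (use R' alt' True Suc(4) in \<open>auto simp: m'_def\<close>)
    finally show ?thesis by simp
  next
    case False
    \<comment> \<open>If the conditional mean vanishes, the right-hand side is infinite.\<close>
    then show ?thesis by (simp add: dist_ln_def)
  qed
  \<comment> \<open>The pairs of a polynomial and an index map of the other rows serve as the index
    \<beta> of the one-row estimate; \<open>q0\<close> is the part constant in row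
    \<open>i\<close>.\<close>
  define q where "q = (\<lambda>(\<alpha>, v) (e :: 'i \<times> nat). p \<alpha> (v(i := snd e)))"
  define q0 where "q0 = (\<lambda>(\<alpha>, v). p \<alpha> (v(i := n)))"
  have sum_I: "(\<Sum>e\<in>?I. f e) = (\<Sum>j<n. f (i, j))" for f :: "'i \<times> nat \<Rightarrow> 'x :: comm_monoid_add"
    by (subst sum.cartesian_product[symmetric, of "\<lambda>a b. f (a, b)", simplified]) simp
  have m'_eq: "m' x = (\<Sum>\<beta>\<in>\<A> \<times> ?V. (cmod (q0 \<beta> + (\<Sum>e\<in>?I. x e * q \<beta> e)))\<^sup>2)" for x
  proof -
    have "p' x \<alpha> v = q0 (\<alpha>, v) + (\<Sum>e\<in>?I. x e * q (\<alpha>, v) e)" for \<alpha> v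
      unfolding p'_def sum_I by (simp add: q_def q0_def affine_coord_def lessThan_Suc_atMost[symmetric])
    then show ?thesis by (simp add: m'_def sum.cartesian_product split_beta')
  qed
  have outer: "(\<integral>\<^sup>+x. dist_ln (m' x) m \<partial>?PI) \<le> ennreal (sqrt (B / m) * (100 + 32 * ln (card ?I)))"
    unfolding m'_eq
  proof (rule gauss_row_concentration)
    show "finite ?I" "finite (\<A> \<times> ?V)" using finV Suc(4) by auto
    show "0 \<le> B" "m > 0" by fact+
    fix x :: "'i \<times> nat \<Rightarrow> complex"
    show "(\<Sum>\<beta>\<in>\<A> \<times> ?V. (cmod (\<Sum>j\<in>?I. x j * q \<beta> j))\<^sup>2) \<le> B * (\<Sum>j\<in>?I. (cmod (x j))\<^sup>2)"
      using B(4)[of "\<lambda>j. x (i, j)"]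
      unfolding sum_I R'_def[symmetric] by (simp add: q_def sum.cartesian_product split_beta')
  next
    show "B \<le> (\<Sum>j\<in>?I. \<Sum>\<beta>\<in>\<A> \<times> ?V. (cmod (q \<beta> j))\<^sup>2)"
      using B(3) unfolding sum_I R'_def[symmetric] by (simp add: q_def sum.cartesian_product split_beta')
    have "m = (\<Sum>\<alpha>\<in>\<A>. \<Sum>v\<in>?V. \<Sum>j\<le>n. (cmod (p \<alpha> (v(i := j))))\<^sup>2)"
      unfolding m R'_def using R i by (subst sum_PiE_remove[of R i]) auto
    then show "m = (\<Sum>\<beta>\<in>\<A> \<times> ?V. (cmod (q0 \<beta>))\<^sup>2 + (\<Sum>j\<in>?I. (cmod (q \<beta> j))\<^sup>2))"
      unfolding sum_I by (simp add: q_def q0_def sum.cartesian_product split_beta' lessThan_Suc_atMost[symmetric] add.commute)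
  qed
  have meas_m': "m' \<in> borel_measurable ?PI"
    unfolding m'_eq by measurable
  have "(\<integral>\<^sup>+A. dist_ln (F A) m \<partial>(\<Pi>\<^sub>M e\<in>R \<times> {..<n}. cgauss)) = (\<integral>\<^sup>+x. \<integral>\<^sup>+y. dist_ln (F (merge ?I ?J (x, y))) m \<partial>?PJ \<partial>?PI)"
    unfolding IJ(1)[symmetric] using R' measF
    by (intro pp.product_nn_integral_fold IJ) auto
  also have "\<dots> \<le> (\<integral>\<^sup>+x. ennreal K + dist_ln (m' x) m \<partial>?PI)"
    unfolding Fm by (intro nn_integral_mono inner)
  also have "\<dots> = ennreal K + (\<integral>\<^sup>+x. dist_ln (m' x) m \<partial>?PI)"
    using meas_m' by (subst nn_integral_add) (auto simp: PI.emeasure_space_1)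
  also have "\<dots> \<le> ennreal K + ennreal (sqrt (B / m) * (100 + 32 * ln (card ?I)))"
    by (intro add_left_mono outer)
  also have "\<dots> \<le> ennreal K + ennreal (1 / sqrt (card R) * (100 + 32 * ln n))"
  proof (intro add_left_mono ennreal_leI)
    have "B / m \<le> (m / card R) / m" using B(2) Suc(7) by (intro divide_right_mono) auto
    also have "\<dots> = 1 / card R" using Suc(7) by simp
    finally have "sqrt (B / m) \<le> 1 / sqrt (card R)"
      by (metis real_sqrt_le_iff real_sqrt_divide real_sqrt_one)
    then show "sqrt (B / m) * (100 + 32 * ln (card ?I)) \<le> 1 / sqrt (card R) * (100 + 32 * ln n)"
      using ln0 by (intro mult_mono) (auto simp: card_cartesian_product)
  qed
  also have "\<dots> = ennreal ((100 + 32 * ln n) * (\<Sum>d=1..card R. 1 / sqrt d))"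
    using K0 ln0 unfolding cR by (subst ennreal_plus[symmetric]) (auto simp: K_def algebra_simps)
  finally show ?case unfolding F_def .
qed

section \<open>Determinants and sums of squared minors\<close>

text \<open>The determinant of a function of two indices, so that rows and columns can be selected,
  repeated and permuted by composition with maps, without carrier conditions.\<close>

definition fdet :: "nat \<Rightarrow> (nat \<Rightarrow> nat \<Rightarrow> complex) \<Rightarrow> complex" where
  "fdet n f = det (mat n n (\<lambda>(i, l). f i l))"

lemma fdet_cong:
  assumes "\<And>i l. i < n \<Longrightarrow> l < n \<Longrightarrow> f i l = g i l"
  shows "fdet n f = fdet n g"
proof -
  have "mat n n (\<lambda>(i, l). f i l) = mat n n (\<lambda>(i, l). g i l)"
    using assms by (intro cong_mat) simp_all
  then show ?thesis by (simp add: fdet_def)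
qed

lemma fdet_leibniz:
  "fdet n f = (\<Sum>\<pi> | \<pi> permutes {..<n}. signof \<pi> * (\<Prod>i<n. f i (\<pi> i)))"
proof -
  let ?M = "mat n n (\<lambda>(i, l). f i l)"
  have *: "(\<Prod>i=0..<n. ?M $$ (i, \<pi> i)) = (\<Prod>i<n. f i (\<pi> i))" if "\<pi> permutes {..<n}" for \<pi>
  proof -
    have "\<pi> i < n" if "i < n" for i using permutes_in_image[OF \<open>\<pi> permutes _\<close>, of i] that by simp
    then show ?thesis unfolding atLeast0LessThan by (intro prod.cong refl) simp
  qed
  have "fdet n f = (\<Sum>\<pi> | \<pi> permutes {..<n}. signof \<pi> * (\<Prod>i=0..<n. ?M $$ (i, \<pi> i)))"
    unfolding fdet_def by (subst det_def'[of _ n]) (simp_all add: atLeast0LessThan)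
  also have "\<dots> = (\<Sum>\<pi> | \<pi> permutes {..<n}. signof \<pi> * (\<Prod>i<n. f i (\<pi> i)))"
    by (intro sum.cong refl) (simp only: * mem_Collect_eq)
  finally show ?thesis .
qed

lemma fdet_transpose: "fdet n (\<lambda>i l. f l i) = fdet n f"
proof -
  have "mat n n (\<lambda>(i, l). f l i) = transpose_mat (mat n n (\<lambda>(i, l). f i l))"
    by (intro eq_matI) auto
  then show ?thesis unfolding fdet_def by (simp add: det_transpose[of _ n])
qed

lemma fdet_permute_rows:
  assumes "\<pi> permutes {..<n}"
  shows "fdet n (\<lambda>i l. f (\<pi> i) l) = signof \<pi> * fdet n f"
proof -
  have "\<pi> i < n" if "i < n" for i using permutes_in_image[OF assms, of i] that by simp
  then have "mat n n (\<lambda>(i, l). f (\<pi> i) l) = mat n n (\<lambda>(i, l). mat n n (\<lambda>(i, l). f i l) $$ (\<pi> i, l))"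
    by (intro cong_mat) simp_all
  then show ?thesis
    unfolding fdet_def using det_permute_rows[of "mat n n (\<lambda>(i, l). f i l)" n \<pi>] assms
    by (simp add: atLeast0LessThan)
qed

lemma cmod_fdet_permute_rows:
  "\<pi> permutes {..<n} \<Longrightarrow> cmod (fdet n (\<lambda>i l. f (\<pi> i) l)) = cmod (fdet n f)"
  by (simp add: fdet_permute_rows norm_mult sign_def)

lemma cmod_fdet_permute_cols:
  "\<pi> permutes {..<n} \<Longrightarrow> cmod (fdet n (\<lambda>i l. f i (\<pi> l))) = cmod (fdet n f)"
  using cmod_fdet_permute_rows[of \<pi> n "\<lambda>i l. f l i"]
    fdet_transpose[of n "\<lambda>i l. f i (\<pi> l)"] fdet_transpose[of n f] by simp

lemma fdet_swap_rows:
  assumes "a < n" "b < n" "a \<noteq> b"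
  shows "fdet n (f(a := f b, b := f a)) = - fdet n f"
proof -
  have p: "Transposition.transpose a b permutes {..<n}" using assms by (intro permutes_swap_id) auto
  have "fdet n (f(a := f b, b := f a)) = fdet n (\<lambda>i l. f (Transposition.transpose a b i) l)"
    by (intro fdet_cong) (auto simp: Transposition.transpose_def)
  then show ?thesis
    using fdet_permute_rows[OF p, of f] assms by (simp add: sign_swap_id)
qed

lemma fdet_identical_rows:
  assumes "a < n" "b < n" "a \<noteq> b" "\<And>l. l < n \<Longrightarrow> f a l = f b l"
  shows "fdet n f = 0"
  unfolding fdet_def
  by (rule det_identical_rows[of _ n a b]) (use assms in \<open>auto intro!: eq_vecI\<close>)

lemma fdet_identical_cols:
  assumes "a < n" "b < n" "a \<noteq> b" "\<And>i. i < n \<Longrightarrow> f i a = f i b"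
  shows "fdet n f = 0"
proof -
  have "fdet n (\<lambda>i l. f l i) = 0"
    by (rule fdet_identical_rows[OF assms(1-3)]) (rule assms(4))
  then show ?thesis unfolding fdet_transpose[of n f] .
qed

lemma fdet_linear_cols:
  assumes S: "S \<subseteq> {..<n}" and J: "\<And>l. l \<in> S \<Longrightarrow> finite (J l)"
  shows "fdet n (\<lambda>i l. if l \<in> S then \<Sum>k\<in>J l. a l k * w l k i else f i l)
    = (\<Sum>u\<in>Pi\<^sub>E S J. (\<Prod>l\<in>S. a l (u l)) * fdet n (\<lambda>i l. if l \<in> S then w l (u l) i else f i l))"
proof -
  have fS: "finite S" using S finite_subset by blast
  have pr: "(\<Prod>l<n. if l \<in> S then g l else h l) = (\<Prod>l\<in>S. g l) * (\<Prod>l\<in>{..<n} - S. h l)" for g h :: "nat \<Rightarrow> complex"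
    using S by (subst prod.If_cases) (auto simp: Int_absorb1 Diff_eq intro!: arg_cong2[where f = "(*)"] prod.cong)
  have "fdet n (\<lambda>i l. if l \<in> S then \<Sum>k\<in>J l. a l k * w l k i else f i l)
    = fdet n (\<lambda>l i. if l \<in> S then \<Sum>k\<in>J l. a l k * w l k i else f i l)"
    by (rule fdet_transpose)
  also have "\<dots> = (\<Sum>\<pi> | \<pi> permutes {..<n}. signof \<pi> *
      ((\<Prod>l\<in>S. \<Sum>k\<in>J l. a l k * w l k (\<pi> l)) * (\<Prod>l\<in>{..<n} - S. f (\<pi> l) l)))"
    unfolding fdet_leibniz pr ..
  also have "\<dots> = (\<Sum>\<pi> | \<pi> permutes {..<n}. \<Sum>u\<in>Pi\<^sub>E S J. (\<Prod>l\<in>S. a l (u l)) *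
      (signof \<pi> * ((\<Prod>l\<in>S. w l (u l) (\<pi> l)) * (\<Prod>l\<in>{..<n} - S. f (\<pi> l) l))))"
    using J fS by (intro sum.cong refl) (simp add: prod_sum_PiE sum_distrib_left sum_distrib_right prod.distrib mult_ac)
  also have "\<dots> = (\<Sum>u\<in>Pi\<^sub>E S J. (\<Prod>l\<in>S. a l (u l)) * fdet n (\<lambda>l i. if l \<in> S then w l (u l) i else f i l))"
    unfolding fdet_leibniz pr by (subst sum.swap) (simp add: sum_distrib_left)
  also have "\<dots> = (\<Sum>u\<in>Pi\<^sub>E S J. (\<Prod>l\<in>S. a l (u l)) * fdet n (\<lambda>i l. if l \<in> S then w l (u l) i else f i l))"
    by (intro sum.cong refl arg_cong2[where f = "(*)"] fdet_transpose)
  finally show ?thesis .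
qed

lemma fdet_linear_rows:
  assumes J: "\<And>i. i < n \<Longrightarrow> finite (J i)"
  shows "fdet n (\<lambda>i l. \<Sum>k\<in>J i. a i k * w i k l)
    = (\<Sum>u\<in>Pi\<^sub>E {..<n} J. (\<Prod>i<n. a i (u i)) * fdet n (\<lambda>i l. w i (u i) l))"
proof -
  have "fdet n (\<lambda>i l. \<Sum>k\<in>J i. a i k * w i k l) = fdet n (\<lambda>l i. if i \<in> {..<n} then \<Sum>k\<in>J i. a i k * w i k l else 0)"
    unfolding fdet_transpose[of n "\<lambda>i l. \<Sum>k\<in>J i. a i k * w i k l", symmetric] by (intro fdet_cong) simp
  also have "\<dots> = (\<Sum>u\<in>Pi\<^sub>E {..<n} J. (\<Prod>i<n. a i (u i)) * fdet n (\<lambda>l i. if i \<in> {..<n} then w i (u i) l else 0))"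
    using J by (intro fdet_linear_cols) auto
  also have "\<dots> = (\<Sum>u\<in>Pi\<^sub>E {..<n} J. (\<Prod>i<n. a i (u i)) * fdet n (\<lambda>i l. w i (u i) l))"
  proof (intro sum.cong refl arg_cong2[where f = "(*)"])
    fix u
    show "fdet n (\<lambda>l i. if i \<in> {..<n} then w i (u i) l else 0) = fdet n (\<lambda>i l. w i (u i) l)"
      unfolding fdet_transpose[of n "\<lambda>i l. w i (u i) l", symmetric] by (intro fdet_cong) simp
  qed
  finally show ?thesis .
qed

text \<open>The matrix is block lower triangular with an identity as its lower right block.\<close>

lemma fdet_unit_cols:
  assumes "m \<le> n" "\<And>i l. i < n \<Longrightarrow> m \<le> l \<Longrightarrow> l < n \<Longrightarrow> f i l = of_bool (i = l)"
  shows "fdet n f = fdet m f"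
proof -
  let ?M = "four_block_mat (mat m m (\<lambda>(i, l). f i l)) (0\<^sub>m m (n - m)) (mat (n - m) m (\<lambda>(i, l). f (i + m) l)) (1\<^sub>m (n - m))"
  have "mat n n (\<lambda>(i, l). f i l) = ?M"
    using assms by (intro eq_matI) auto
  then have "fdet n f = det (mat m m (\<lambda>(i, l). f i l)) * det (1\<^sub>m (n - m))"
    unfolding fdet_def by (simp add: det_four_block_mat_upper_right_zero[of _ m _ "n - m"])
  then show ?thesis by (simp add: fdet_def)
qed

lemma fdet_unit_rows:
  assumes "m \<le> n" "\<And>i l. l < n \<Longrightarrow> m \<le> i \<Longrightarrow> i < n \<Longrightarrow> f i l = of_bool (i = l)"
  shows "fdet n f = fdet m f"
proof -
  have "fdet n (\<lambda>i l. f l i) = fdet m (\<lambda>i l. f l i)"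
    by (rule fdet_unit_cols[OF assms(1)]) (use assms(2) in auto)
  then show ?thesis unfolding fdet_transpose[of n f] fdet_transpose[of m f] .
qed

section \<open>Counting injections\<close>

lemma prod_falling_mult_fact:
  "a \<le> N \<Longrightarrow> (\<Prod>i=0..<a. N - i) * fact (N - a) = (fact N :: nat)"
proof (induction a)
  case (Suc a)
  have "(fact (N - a) :: nat) = (N - a) * fact (N - Suc a)"
  proof -
    have "N - a = Suc (N - Suc a)" using Suc.prems by simp
    then show ?thesis by (metis fact_Suc of_nat_id)
  qed
  then show ?case using Suc by (simp add: mult_ac)
qed simp

lemma card_PiE_inj:
  assumes "finite A" "finite B" "card A \<le> card B"
  shows "card {h \<in> Pi\<^sub>E A (\<lambda>_. B). inj_on h A} = fact (card B) div fact (card B - card A)"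
proof -
  have "card {h \<in> Pi\<^sub>E A (\<lambda>_. B). inj_on h A} = (\<Prod>i=0..<card A. card B - i)"
    using card_inj_on_subset_funcset[OF assms(1,2) subset_refl] by simp
  then show ?thesis
    using prod_falling_mult_fact[OF assms(3)] by (metis fact_nonzero nonzero_mult_div_cancel_right)
qed

text \<open>Every set with as many elements as \<open>A\<close> is the image of exactly
  \<open>fact (card A)\<close> injections.\<close>

lemma sum_injections_by_image:
  fixes G :: "'b set \<Rightarrow> real"
  assumes A: "finite A" and N: "finite N" and le: "card A \<le> card N"
  shows "(\<Sum>h | h \<in> Pi\<^sub>E A (\<lambda>_. N) \<and> inj_on h A. G (h ` A))
    = fact (card A) * (\<Sum>K | K \<subseteq> N \<and> card K = card A. G K)"
proof -
  let ?H = "{h. h \<in> Pi\<^sub>E A (\<lambda>_. N) \<and> inj_on h A}" and ?T = "{K. K \<subseteq> N \<and> card K = card A}"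
  have finH: "finite ?H"
    by (rule finite_subset[of _ "Pi\<^sub>E A (\<lambda>_. N)"]) (use A N in \<open>auto intro: finite_PiE\<close>)
  have "(\<Sum>h\<in>?H. G (h ` A)) = (\<Sum>K\<in>?T. \<Sum>h | h \<in> ?H \<and> h ` A = K. G (h ` A))"
    by (rule sum.group[OF finH, symmetric]) (use N in \<open>auto simp: card_image\<close>)
  also have "\<dots> = (\<Sum>K\<in>?T. fact (card A) * G K)"
  proof (intro sum.cong refl)
    fix K assume K: "K \<in> ?T"
    then have fK: "finite K" using N finite_subset by auto
    have "{h. h \<in> ?H \<and> h ` A = K} = {h \<in> Pi\<^sub>E A (\<lambda>_. K). inj_on h A}"
    proof (rule Set.set_eqI)
      fix h
      have "h ` A = K" if "h \<in> Pi\<^sub>E A (\<lambda>_. K)" "inj_on h A"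
      proof (rule card_subset_eq[OF fK])
        show "h ` A \<subseteq> K" using that by auto
        show "card (h ` A) = card K" using that K by (simp add: card_image)
      qed
      then show "h \<in> {h. h \<in> ?H \<and> h ` A = K} \<longleftrightarrow> h \<in> {h \<in> Pi\<^sub>E A (\<lambda>_. K). inj_on h A}"
        using K by (auto simp: PiE_iff)
    qed
    then have "card {h. h \<in> ?H \<and> h ` A = K} = fact (card A)"
      using card_PiE_inj[OF A fK] K by simp
    moreover have "(\<Sum>h | h \<in> ?H \<and> h ` A = K. G (h ` A)) = (\<Sum>h | h \<in> ?H \<and> h ` A = K. G K)"
      by (intro sum.cong) auto
    ultimately show "(\<Sum>h | h \<in> ?H \<and> h ` A = K. G (h ` A)) = fact (card A) * G K"
      by simp
  qed
  finally show ?thesis by (simp add: sum_distrib_left)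
qed

lemma injection_extends_to_permutation:
  fixes h :: "nat \<Rightarrow> nat"
  assumes h: "h \<in> A \<rightarrow> {..<n}" "inj_on h A" and A: "A \<subseteq> {..<n}"
  obtains \<tau> where "\<tau> permutes {..<n}" "\<And>l. l \<in> A \<Longrightarrow> \<tau> l = h l"
    "bij_betw \<tau> ({..<n} - A) ({..<n} - h ` A)"
proof -
  have fA: "finite A" using A finite_subset by blast
  have hA: "h ` A \<subseteq> {..<n}" using h by auto
  have "card ({..<n} - A) = card ({..<n} - h ` A)"
    using A hA fA h(2) by (simp add: card_Diff_subset card_image)
  then obtain g where g: "bij_betw g ({..<n} - A) ({..<n} - h ` A)"
    using finite_same_card_bij[of "{..<n} - A" "{..<n} - h ` A"] by auto
  define \<tau> where "\<tau> l = (if l \<in> A then h l else if l < n then g l else l)" for l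
  have b1: "bij_betw \<tau> A (h ` A)"
    using h(2) by (subst bij_betw_cong[of _ _ h]) (auto simp: \<tau>_def bij_betw_def)
  have b2: "bij_betw \<tau> ({..<n} - A) ({..<n} - h ` A)"
    using g by (subst bij_betw_cong[of _ _ g]) (auto simp: \<tau>_def)
  have "bij_betw \<tau> (A \<union> ({..<n} - A)) (h ` A \<union> ({..<n} - h ` A))"
    by (rule bij_betw_combine[OF b1 b2]) auto
  moreover have "A \<union> ({..<n} - A) = {..<n}" "h ` A \<union> ({..<n} - h ` A) = {..<n}" using A hA by auto
  ultimately have "bij_betw \<tau> {..<n} {..<n}" by simp
  moreover have "\<tau> l = l" if "l \<notin> {..<n}" for l using that A by (auto simp: \<tau>_def)
  ultimately have "\<tau> permutes {..<n}" by (rule bij_imp_permutes)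
  with b2 show ?thesis by (intro that[of \<tau>]) (auto simp: \<tau>_def)
qed

text \<open>Two enumerations of \<open>K\<close> differ by a permutation, which costs only a
  sign.\<close>

lemma cmod_minor_depends_on_rows:
  assumes f: "bij_betw f {..<m} K" and g: "bij_betw g {..<m} K"
  shows "cmod (fdet m (\<lambda>a b. Y (f a) b)) = cmod (fdet m (\<lambda>a b. Y (g a) b))"
proof -
  define \<sigma> where "\<sigma> a = (if a < m then inv_into {..<m} g (f a) else a)" for a
  have "bij_betw (inv_into {..<m} g \<circ> f) {..<m} {..<m}"
    using f bij_betw_inv_into[OF g] by (rule bij_betw_trans)
  then have "bij_betw \<sigma> {..<m} {..<m}"
    by (subst bij_betw_cong[of _ _ "inv_into {..<m} g \<circ> f"]) (auto simp: \<sigma>_def)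
  then have p: "\<sigma> permutes {..<m}" by (rule bij_imp_permutes) (auto simp: \<sigma>_def)
  have "fdet m (\<lambda>a b. Y (f a) b) = fdet m (\<lambda>a b. Y (g (\<sigma> a)) b)"
  proof (rule fdet_cong)
    fix a b assume "a < m" "b < m"
    then have "g (inv_into {..<m} g (f a)) = f a"
      using f g by (intro f_inv_into_f) (auto simp: bij_betw_def)
    then show "Y (f a) b = Y (g (\<sigma> a)) b" using \<open>a < m\<close> by (simp add: \<sigma>_def)
  qed
  then show ?thesis using cmod_fdet_permute_rows[OF p, of "\<lambda>a b. Y (g a) b"] by simp
qed

text \<open>Completing \<open>m\<close> columns by unit vectors gives zero if a unit vector is
  repeated, and otherwise, up to sign, the minor on the rows that no unit vector occupies. Each row
  set arises from \<open>(n - m)!\<close> maps \<open>y\<close> on the left and from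
  \<open>m!\<close> enumerations \<open>f\<close> on the right.\<close>

lemma sum_unit_cols_eq_sum_minors:
  assumes mn: "m \<le> n"
  shows "(\<Sum>y\<in>Pi\<^sub>E {m..<n} (\<lambda>_. {..<n}). (cmod (fdet n (\<lambda>i l. if l < m then Y i l else of_bool (i = y l))))\<^sup>2)
    = fact (n - m) / fact m * (\<Sum>f\<in>Pi\<^sub>E {..<m} (\<lambda>_. {..<n}). (cmod (fdet m (\<lambda>a b. Y (f a) b)))\<^sup>2)"
proof -
  let ?N = "{..<n}" and ?A = "{m..<n}"
  \<comment> \<open>An arbitrary enumeration of \<open>K\<close>; the modulus of the minor does not
    depend on it, so \<open>g\<close> is a function of the row set.\<close>
  define sel where "sel K = (SOME f. bij_betw f {..<m} K)" for K :: "nat set"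
  define g where "g K = (cmod (fdet m (\<lambda>a b. Y (sel K a) b)))\<^sup>2" for K
  have g: "(cmod (fdet m (\<lambda>a b. Y (f a) b)))\<^sup>2 = g K" if "bij_betw f {..<m} K" for f K
  proof -
    have "bij_betw (sel K) {..<m} K" unfolding sel_def by (rule someI[of "\<lambda>f. bij_betw f {..<m} K", OF that])
    from cmod_minor_depends_on_rows[OF that this] show ?thesis by (simp add: g_def)
  qed
  have inj_y: "(cmod (fdet n (\<lambda>i l. if l < m then Y i l else of_bool (i = y l))))\<^sup>2 = g (?N - y ` ?A)"
    if y: "y \<in> Pi\<^sub>E ?A (\<lambda>_. ?N)" "inj_on y ?A" for y
  proof -
    obtain \<tau> where \<tau>: "\<tau> permutes ?N" "\<And>l. l \<in> ?A \<Longrightarrow> \<tau> l = y l" "bij_betw \<tau> (?N - ?A) (?N - y ` ?A)"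
      by (rule injection_extends_to_permutation[of y ?A n]) (use y in \<open>auto simp: PiE_iff\<close>)
    have Nm: "?N - ?A = {..<m}" using mn by auto
    let ?M = "\<lambda>i l. if l < m then Y i l else of_bool (i = y l)"
    have "cmod (fdet n ?M) = cmod (fdet n (\<lambda>i l. ?M (\<tau> i) l))"
      by (rule cmod_fdet_permute_rows[OF \<tau>(1), symmetric])
    also have "fdet n (\<lambda>i l. ?M (\<tau> i) l) = fdet m (\<lambda>i l. ?M (\<tau> i) l)"
    proof (rule fdet_unit_cols[OF mn])
      fix i l assume "i < n" "m \<le> l" "l < n"
      then have "y l = \<tau> l" using \<tau>(2)[of l] by simp
      moreover have "\<tau> i = \<tau> l \<longleftrightarrow> i = l" by (rule inj_eq[OF permutes_inj[OF \<tau>(1)]])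
      ultimately show "?M (\<tau> i) l = of_bool (i = l)" using \<open>m \<le> l\<close> by simp
    qed
    also have "\<dots> = fdet m (\<lambda>i l. Y (\<tau> i) l)" by (rule fdet_cong) auto
    finally show ?thesis using g[OF \<tau>(3)[unfolded Nm]] by simp
  qed
  have fin: "finite (Pi\<^sub>E ?A (\<lambda>_. ?N))" "finite (Pi\<^sub>E {..<m} (\<lambda>_. ?N))" by (auto intro: finite_PiE)
  have "(\<Sum>y\<in>Pi\<^sub>E ?A (\<lambda>_. ?N). (cmod (fdet n (\<lambda>i l. if l < m then Y i l else of_bool (i = y l))))\<^sup>2)
    = (\<Sum>y | y \<in> Pi\<^sub>E ?A (\<lambda>_. ?N) \<and> inj_on y ?A. g (?N - y ` ?A))"
  proof (rule sum.mono_neutral_cong_right[OF fin(1)])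
    show "\<forall>y\<in>Pi\<^sub>E ?A (\<lambda>_. ?N) - {y \<in> Pi\<^sub>E ?A (\<lambda>_. ?N). inj_on y ?A}.
        (cmod (fdet n (\<lambda>i l. if l < m then Y i l else of_bool (i = y l))))\<^sup>2 = 0"
    proof
      fix y assume "y \<in> Pi\<^sub>E ?A (\<lambda>_. ?N) - {y \<in> Pi\<^sub>E ?A (\<lambda>_. ?N). inj_on y ?A}"
      then obtain a b where "a \<in> ?A" "b \<in> ?A" "a \<noteq> b" "y a = y b" by (auto simp: inj_on_def)
      then have "fdet n (\<lambda>i l. if l < m then Y i l else of_bool (i = y l)) = 0"
        by (intro fdet_identical_cols[of a n b]) auto
      then show "(cmod (fdet n (\<lambda>i l. if l < m then Y i l else of_bool (i = y l))))\<^sup>2 = 0" by simp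
    qed
  qed (use inj_y in auto)
  also have "\<dots> = fact (n - m) * (\<Sum>K | K \<subseteq> ?N \<and> card K = n - m. g (?N - K))"
    using sum_injections_by_image[of ?A ?N "\<lambda>K. g (?N - K)"] by simp
  also have "(\<Sum>K | K \<subseteq> ?N \<and> card K = n - m. g (?N - K)) = (\<Sum>K | K \<subseteq> ?N \<and> card K = m. g K)"
  proof (rule sum.reindex_bij_witness[of _ "\<lambda>K. ?N - K" "\<lambda>K. ?N - K"])
    fix K assume "K \<in> {K. K \<subseteq> ?N \<and> card K = n - m}"
    then show "?N - K \<in> {K. K \<subseteq> ?N \<and> card K = m}"
      using mn finite_subset[of K ?N] by (auto simp: card_Diff_subset)
  next
    fix K assume "K \<in> {K. K \<subseteq> ?N \<and> card K = m}"
    then show "?N - K \<in> {K. K \<subseteq> ?N \<and> card K = n - m}"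
      using mn finite_subset[of K ?N] by (auto simp: card_Diff_subset)
  qed (auto simp: double_diff)
  also have "\<dots> = (\<Sum>f | f \<in> Pi\<^sub>E {..<m} (\<lambda>_. ?N) \<and> inj_on f {..<m}. g (f ` {..<m})) / fact m"
    using sum_injections_by_image[of "{..<m}" ?N g] mn by simp
  also have "(\<Sum>f | f \<in> Pi\<^sub>E {..<m} (\<lambda>_. ?N) \<and> inj_on f {..<m}. g (f ` {..<m}))
    = (\<Sum>f\<in>Pi\<^sub>E {..<m} (\<lambda>_. ?N). (cmod (fdet m (\<lambda>a b. Y (f a) b)))\<^sup>2)"
  proof (rule sum.mono_neutral_cong_left[OF fin(2)])
    show "\<forall>f\<in>Pi\<^sub>E {..<m} (\<lambda>_. ?N) - {f \<in> Pi\<^sub>E {..<m} (\<lambda>_. ?N). inj_on f {..<m}}.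
        (cmod (fdet m (\<lambda>a b. Y (f a) b)))\<^sup>2 = 0"
    proof
      fix f assume "f \<in> Pi\<^sub>E {..<m} (\<lambda>_. ?N) - {f \<in> Pi\<^sub>E {..<m} (\<lambda>_. ?N). inj_on f {..<m}}"
      then obtain a b where "a < m" "b < m" "a \<noteq> b" "f a = f b" by (auto simp: inj_on_def)
      then have "fdet m (\<lambda>a b. Y (f a) b) = 0" by (intro fdet_identical_rows[of a m b]) auto
      then show "(cmod (fdet m (\<lambda>a b. Y (f a) b)))\<^sup>2 = 0" by simp
    qed
    fix f assume "f \<in> {f \<in> Pi\<^sub>E {..<m} (\<lambda>_. ?N). inj_on f {..<m}}"
    then show "g (f ` {..<m}) = (cmod (fdet m (\<lambda>a b. Y (f a) b)))\<^sup>2"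
      by (intro g[symmetric]) (auto simp: bij_betw_def)
  qed auto
  finally show ?thesis by simp
qed

text \<open>Up to the factor \<open>m! (n - m)!\<close>, the sum of the squared moduli of all \<open>m \<times> m\<close> minors of \<open>B\<close>,
  written with \<open>n \<times> n\<close> determinants so that expectations over Gaussian columns are immediate.\<close>

definition sq_minors :: "nat \<Rightarrow> nat \<Rightarrow> (nat \<Rightarrow> nat \<Rightarrow> complex) \<Rightarrow> real" where
  "sq_minors n m B = (\<Sum>h\<in>Pi\<^sub>E {..<m} (\<lambda>_. {..<n}). \<Sum>y\<in>Pi\<^sub>E {m..<n} (\<lambda>_. {..<n}).
     (cmod (fdet n (\<lambda>i l. if l < m then B i (h l) else of_bool (i = y l))))\<^sup>2)"

lemma sq_minors_eq:
  assumes "m \<le> n"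
  shows "sq_minors n m B = fact (n - m) / fact m * (\<Sum>h\<in>Pi\<^sub>E {..<m} (\<lambda>_. {..<n}). \<Sum>f\<in>Pi\<^sub>E {..<m} (\<lambda>_. {..<n}).
     (cmod (fdet m (\<lambda>a b. B (f a) (h b))))\<^sup>2)"
  unfolding sq_minors_def sum_unit_cols_eq_sum_minors[OF assms, of "\<lambda>i l. B i (_ l)"] by (simp add: sum_distrib_left)

lemma sq_minors_nonneg: "0 \<le> sq_minors n m B"
  unfolding sq_minors_def by (intro sum_nonneg) auto

lemma fdet_0: "fdet 0 f = 1"
  by (simp add: fdet_def)

lemma sq_minors_0: "sq_minors n 0 B = fact n"
  by (subst sq_minors_eq) (simp_all add: fdet_0)

lemma sum_PiE_union:
  assumes "A \<inter> B = {}"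
  shows "(\<Sum>u\<in>Pi\<^sub>E (A \<union> B) F. G u) = (\<Sum>h\<in>Pi\<^sub>E A F. \<Sum>y\<in>Pi\<^sub>E B F. G (\<lambda>i. if i \<in> A then h i else y i))"
proof -
  have "(\<Sum>u\<in>Pi\<^sub>E (A \<union> B) F. G u) = (\<Sum>p\<in>Pi\<^sub>E A F \<times> Pi\<^sub>E B F. G (\<lambda>i. if i \<in> A then fst p i else snd p i))"
    by (rule sum.reindex_bij_witness[where j = "\<lambda>u. (restrict u A, restrict u B)"
        and i = "\<lambda>p i. if i \<in> A then fst p i else snd p i"])
      (use assms in \<open>auto simp: PiE_iff extensional_def restrict_def fun_eq_iff
        intro!: arg_cong[where f = G] split: if_splits\<close>)
  then show ?thesis by (simp add: sum.cartesian_product split_beta')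
qed

text \<open>For the identity both kinds of columns are unit vectors, so \<open>h\<close> and
  \<open>y\<close> join into one map \<open>u\<close> on all columns. The sum is then independent of
  \<open>m\<close> and equals its value at 0.\<close>

lemma sq_minors_one:
  assumes "m \<le> n"
  shows "sq_minors n m (\<lambda>i j. of_bool (i = j)) = fact n"
proof -
  have U: "{..<m} \<union> {m..<n} = {..<n}" "{..<m} \<inter> {m..<n} = {}" using assms by auto
  have "sq_minors n m (\<lambda>i j. of_bool (i = j)) = (\<Sum>u\<in>Pi\<^sub>E ({..<m} \<union> {m..<n}) (\<lambda>_. {..<n}).
      (cmod (fdet n (\<lambda>i l. of_bool (i = u l))))\<^sup>2)"
    unfolding sq_minors_def sum_PiE_union[OF U(2)]
    by (intro sum.cong refl arg_cong[where f = "\<lambda>x. (cmod x)\<^sup>2"] fdet_cong) auto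
  also have "\<dots> = sq_minors n 0 (\<lambda>i j. 0)"
    unfolding U sq_minors_def by (simp add: atLeast0LessThan)
  finally show ?thesis by (simp add: sq_minors_0)
qed

lemma sum_group_by_card:
  fixes \<phi> :: "nat \<Rightarrow> real"
  assumes V: "finite V" and S: "\<And>v. v \<in> V \<Longrightarrow> S v \<subseteq> {..<n}"
  shows "(\<Sum>v\<in>V. \<phi> (card (S v)) * G v)
    = (\<Sum>m\<le>n. \<phi> m * (\<Sum>K | K \<subseteq> {..<n} \<and> card K = m. \<Sum>v | v \<in> V \<and> S v = K. G v))"
proof -
  have "(\<Sum>v\<in>V. \<phi> (card (S v)) * G v)
    = (\<Sum>K\<in>Pow {..<n}. \<Sum>v | v \<in> V \<and> S v = K. \<phi> (card (S v)) * G v)"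
    by (rule sum.group[OF V, symmetric]) (use S in auto)
  also have "\<dots> = (\<Sum>K\<in>Pow {..<n}. \<phi> (card K) * (\<Sum>v | v \<in> V \<and> S v = K. G v))"
    by (intro sum.cong refl) (simp add: sum_distrib_left)
  also have "\<dots> = (\<Sum>m\<le>n. \<Sum>K | K \<in> Pow {..<n} \<and> card K = m. \<phi> (card K) * (\<Sum>v | v \<in> V \<and> S v = K. G v))"
    by (rule sum.group[symmetric]) (auto intro: order_trans[OF card_mono[of "{..<n}"]])
  also have "\<dots> = (\<Sum>m\<le>n. \<phi> m * (\<Sum>K | K \<subseteq> {..<n} \<and> card K = m. \<Sum>v | v \<in> V \<and> S v = K. G v))"
    by (intro sum.cong refl) (auto simp: sum_distrib_left intro!: sum.cong)
  finally show ?thesis .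
qed

lemma fdet_non_inj_cols_0:
  assumes "h \<in> Pi\<^sub>E {..<m} (\<lambda>_. {..<n}) - {h. h \<in> Pi\<^sub>E {..<m} (\<lambda>_. {..<n}) \<and> inj_on h {..<m}}" "m \<le> k"
    and "\<And>a b i. a < m \<Longrightarrow> b < m \<Longrightarrow> h a = h b \<Longrightarrow> i < k \<Longrightarrow> f i a = f i b"
  shows "fdet k f = 0"
proof -
  obtain a b where ab: "a < m" "b < m" "a \<noteq> b" "h a = h b" using assms(1) by (auto simp: inj_on_def)
  show ?thesis
  proof (rule fdet_identical_cols[of a k b])
    show "a < k" "b < k" using ab assms(2) by simp_all
    show "f i a = f i b" if "i < k" for i by (rule assms(3)[OF ab(1,2,4) that])
  qed (rule ab(3))
qed

text \<open>Here \<open>v l = n\<close> keeps the column of \<open>B\<close>, and any other value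
  replaces it by a unit vector. Moving the kept columns to the front turns a fixed set of
  \<open>m\<close> kept columns into the inner sum of \<open>sq_minors\<close>; the same set is
  reached from \<open>m!\<close> injections \<open>h\<close>, whence the division by
  \<open>m!\<close>.\<close>

lemma sum_mixed_unit_cols:
  fixes \<phi> :: "nat \<Rightarrow> real"
  shows "(\<Sum>v\<in>Pi\<^sub>E {..<n} (\<lambda>_. {..n}). \<phi> (card {l \<in> {..<n}. v l = n}) *
      (cmod (fdet n (\<lambda>i l. if v l < n then of_bool (i = v l) else B i l)))\<^sup>2)
    = (\<Sum>m\<le>n. \<phi> m / fact m * sq_minors n m B)"
proof -
  let ?N = "{..<n}" and ?V = "Pi\<^sub>E {..<n} (\<lambda>_. {..n})"
  let ?C = "\<lambda>v i l. if v l < n then of_bool (i = v l) else B i l"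
  define G where "G v = (cmod (fdet n (?C v)))\<^sup>2" for v
  define g where "g K = (\<Sum>v | v \<in> ?V \<and> {l \<in> ?N. v l = n} = K. G v)" for K
  have finV: "finite ?V" by (auto intro: finite_PiE)
  have main: "sq_minors n m B = fact m * (\<Sum>K | K \<subseteq> ?N \<and> card K = m. g K)" if m: "m \<le> n" for m
  proof -
    let ?H = "{h. h \<in> Pi\<^sub>E {..<m} (\<lambda>_. ?N) \<and> inj_on h {..<m}}"
    have "sq_minors n m B = (\<Sum>h\<in>?H. \<Sum>y\<in>Pi\<^sub>E {m..<n} (\<lambda>_. ?N).
        (cmod (fdet n (\<lambda>i l. if l < m then B i (h l) else of_bool (i = y l))))\<^sup>2)"
      unfolding sq_minors_def
    proof (rule sum.mono_neutral_right)
      show "\<forall>h\<in>Pi\<^sub>E {..<m} (\<lambda>_. ?N) - ?H. (\<Sum>y\<in>Pi\<^sub>E {m..<n} (\<lambda>_. ?N).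
        (cmod (fdet n (\<lambda>i l. if l < m then B i (h l) else of_bool (i = y l))))\<^sup>2) = 0"
      proof (intro ballI sum.neutral)
        fix h y assume h: "h \<in> Pi\<^sub>E {..<m} (\<lambda>_. ?N) - ?H"
        have "fdet n (\<lambda>i l. if l < m then B i (h l) else of_bool (i = y l)) = 0"
          by (rule fdet_non_inj_cols_0[OF h m]) auto
        then show "(cmod (fdet n (\<lambda>i l. if l < m then B i (h l) else of_bool (i = y l))))\<^sup>2 = 0" by simp
      qed
    qed (auto intro: finite_PiE)
    also have "\<dots> = (\<Sum>h\<in>?H. g (h ` {..<m}))"
    proof (intro sum.cong refl)
      fix h assume h: "h \<in> ?H"
      have mN: "{..<m} \<subseteq> ?N" using m by auto
      obtain \<tau> where \<tau>: "\<tau> permutes ?N" "\<And>l. l \<in> {..<m} \<Longrightarrow> \<tau> l = h l"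
        by (rule injection_extends_to_permutation[of h "{..<m}" n]) (use h mN in \<open>auto simp: PiE_iff\<close>)
      define \<sigma> where "\<sigma> = Hilbert_Choice.inv \<tau>"
      have \<sigma>: "\<tau> (\<sigma> l) = l" "\<sigma> (\<tau> l) = l" for l
        using permutes_inverses[OF \<tau>(1)] by (auto simp: \<sigma>_def)
      have \<tau>N: "\<tau> l < n \<longleftrightarrow> l < n" for l using permutes_in_image[OF \<tau>(1), of l] by simp
      have \<sigma>N: "\<sigma> l < n \<longleftrightarrow> l < n" for l using \<tau>N[of "\<sigma> l"] \<sigma>(1) by simp
      have im: "h ` {..<m} = {k. \<sigma> k < m}"
      proof (rule Set.set_eqI)
        fix k
        have "k \<in> h ` {..<m} \<longleftrightarrow> (\<exists>l<m. k = \<tau> l)" using \<tau>(2) by auto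
        also have "\<dots> \<longleftrightarrow> \<sigma> k < m" using \<sigma> by metis
        finally show "k \<in> h ` {..<m} \<longleftrightarrow> k \<in> {k. \<sigma> k < m}" by simp
      qed
      \<comment> \<open>The maps \<open>up\<close> and \<open>down\<close> translate between
        unit-vector choices on the last \<open>n - m\<close> columns and index maps whose value is
        \<open>n\<close> exactly on the image of \<open>h\<close>.\<close>
      define up where "up y k = (if k < n then if \<sigma> k < m then n else y (\<sigma> k) else undefined)" for y :: "nat \<Rightarrow> nat" and k
      define down where "down v = restrict (\<lambda>l. v (\<tau> l)) {m..<n}" for v :: "nat \<Rightarrow> nat"
      show "(\<Sum>y\<in>Pi\<^sub>E {m..<n} (\<lambda>_. ?N). (cmod (fdet n (\<lambda>i l. if l < m then B i (h l) else of_bool (i = y l))))\<^sup>2) = g (h ` {..<m})"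
        unfolding g_def im
      proof (rule sum.reindex_bij_witness[where i = down and j = up])
        fix y assume y: "y \<in> Pi\<^sub>E {m..<n} (\<lambda>_. ?N)"
        have yN: "y l < n" if "m \<le> l" "l < n" for l using y that by (auto simp: PiE_iff)
        show "down (up y) = y"
        proof
          fix l
          have "y l = undefined" if "l \<notin> {m..<n}" using y that by (auto simp: PiE_iff extensional_def)
          then show "down (up y) l = y l" by (auto simp: down_def up_def restrict_def \<sigma> \<tau>N)
        qed
        have "up y k \<le> n" if "k < n" for k
          using yN[of "\<sigma> k"] that \<sigma>N[of k] by (auto simp: up_def not_less less_imp_le)
        moreover have "up y k = n \<longleftrightarrow> \<sigma> k < m" if "k < n" for k
          using yN[of "\<sigma> k"] that \<sigma>N[of k] by (auto simp: up_def not_less)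
        moreover have "k < n" if "\<sigma> k < m" for k using that m \<sigma>N[of k] by simp
        ultimately show "up y \<in> {v. v \<in> ?V \<and> {l \<in> ?N. v l = n} = {k. \<sigma> k < m}}"
          by (auto simp: PiE_iff extensional_def) (auto simp: up_def)
        have "cmod (fdet n (?C (up y))) = cmod (fdet n (\<lambda>i l. ?C (up y) i (\<tau> l)))"
          by (rule cmod_fdet_permute_cols[OF \<tau>(1), symmetric])
        also have "fdet n (\<lambda>i l. ?C (up y) i (\<tau> l)) = fdet n (\<lambda>i l. if l < m then B i (h l) else of_bool (i = y l))"
        proof (rule fdet_cong)
          fix i l assume il: "i < n" "l < n"
          show "?C (up y) i (\<tau> l) = (if l < m then B i (h l) else of_bool (i = y l))"
            using il yN[of l] \<tau>(2)[of l] by (auto simp: up_def \<sigma> \<tau>N)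
        qed
        finally show "G (up y) = (cmod (fdet n (\<lambda>i l. if l < m then B i (h l) else of_bool (i = y l))))\<^sup>2"
          by (simp add: G_def)
      next
        fix v assume v: "v \<in> {v. v \<in> ?V \<and> {l \<in> ?N. v l = n} = {k. \<sigma> k < m}}"
        have vn: "v k = n \<longleftrightarrow> \<sigma> k < m" if "k < n" for k using v that by auto
        have vle: "v k \<le> n" if "k < n" for k using v that by (auto simp: PiE_iff)
        show "down v \<in> Pi\<^sub>E {m..<n} (\<lambda>_. ?N)"
        proof (rule PiE_I)
          fix l assume l: "l \<in> {m..<n}"
          then have "v (\<tau> l) \<noteq> n" "v (\<tau> l) \<le> n" using vn[of "\<tau> l"] vle[of "\<tau> l"] by (auto simp: \<tau>N \<sigma>)
          then show "down v l \<in> ?N" using l by (simp add: down_def)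
        qed (auto simp: down_def)
        show "up (down v) = v"
        proof
          fix k
          have "v k = undefined" if "\<not> k < n" using v that by (auto simp: PiE_iff extensional_def)
          moreover have "v k = n" if "k < n" "\<sigma> k < m" using vn that by simp
          ultimately show "up (down v) k = v k" by (auto simp: down_def up_def \<sigma> \<sigma>N)
        qed
      qed
    qed
    also have "\<dots> = fact m * (\<Sum>K | K \<subseteq> ?N \<and> card K = m. g K)"
      using sum_injections_by_image[of "{..<m}" ?N g] m by simp
    finally show ?thesis .
  qed
  have "(\<Sum>v\<in>?V. \<phi> (card {l \<in> ?N. v l = n}) * G v) = (\<Sum>m\<le>n. \<phi> m * (\<Sum>K | K \<subseteq> ?N \<and> card K = m. g K))"
    unfolding g_def by (rule sum_group_by_card[OF finV]) auto
  also have "\<dots> = (\<Sum>m\<le>n. \<phi> m / fact m * sq_minors n m B)"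
    by (intro sum.cong refl) (simp add: main)
  finally show ?thesis by (simp add: G_def)
qed

text \<open>A replaced row is the unit row in its own position, so the determinant collapses to a
  minor of \<open>B\<close>: the columns are the unreplaced positions, and the rows are the values
  of \<open>u\<close> there. The \<open>m!\<close> injections onto a set of positions cancel the
  denominator in \<open>sq_minors_eq\<close> and leave \<open>(n - m)!\<close>.\<close>

lemma sum_mixed_unit_rows:
  fixes \<phi> :: "nat \<Rightarrow> real"
  shows "(\<Sum>u\<in>Pi\<^sub>E {..<n} (\<lambda>_. {..n}). \<phi> (card {i \<in> {..<n}. u i < n}) *
      (cmod (fdet n (\<lambda>i l. if u i < n then B (u i) l else of_bool (i = l))))\<^sup>2)
    = (\<Sum>m\<le>n. \<phi> m / fact (n - m) * sq_minors n m B)"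
proof -
  let ?N = "{..<n}" and ?V = "Pi\<^sub>E {..<n} (\<lambda>_. {..n})"
  let ?C = "\<lambda>u i l. if u i < n then B (u i) l else of_bool (i = l)"
  define G where "G u = (cmod (fdet n (?C u)))\<^sup>2" for u
  define g where "g K = (\<Sum>u | u \<in> ?V \<and> {i \<in> ?N. u i < n} = K. G u)" for K
  have finV: "finite ?V" by (auto intro: finite_PiE)
  have main: "sq_minors n m B = fact (n - m) * (\<Sum>K | K \<subseteq> ?N \<and> card K = m. g K)" if m: "m \<le> n" for m
  proof -
    let ?H = "{h. h \<in> Pi\<^sub>E {..<m} (\<lambda>_. ?N) \<and> inj_on h {..<m}}"
    have "(\<Sum>h\<in>Pi\<^sub>E {..<m} (\<lambda>_. ?N). \<Sum>f\<in>Pi\<^sub>E {..<m} (\<lambda>_. ?N). (cmod (fdet m (\<lambda>a b. B (f a) (h b))))\<^sup>2)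
      = (\<Sum>h\<in>?H. \<Sum>f\<in>Pi\<^sub>E {..<m} (\<lambda>_. ?N). (cmod (fdet m (\<lambda>a b. B (f a) (h b))))\<^sup>2)"
    proof (rule sum.mono_neutral_right)
      show "\<forall>h\<in>Pi\<^sub>E {..<m} (\<lambda>_. ?N) - ?H. (\<Sum>f\<in>Pi\<^sub>E {..<m} (\<lambda>_. ?N).
        (cmod (fdet m (\<lambda>a b. B (f a) (h b))))\<^sup>2) = 0"
      proof (intro ballI sum.neutral)
        fix h f assume h: "h \<in> Pi\<^sub>E {..<m} (\<lambda>_. ?N) - ?H"
        have "fdet m (\<lambda>a b. B (f a) (h b)) = 0"
          by (rule fdet_non_inj_cols_0[OF h order_refl]) auto
        then show "(cmod (fdet m (\<lambda>a b. B (f a) (h b))))\<^sup>2 = 0" by simp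
      qed
    qed (auto intro: finite_PiE)
    also have "\<dots> = (\<Sum>h\<in>?H. g (h ` {..<m}))"
    proof (intro sum.cong refl)
      fix h assume h: "h \<in> ?H"
      have mN: "{..<m} \<subseteq> ?N" using m by auto
      obtain \<tau> where \<tau>: "\<tau> permutes ?N" "\<And>l. l \<in> {..<m} \<Longrightarrow> \<tau> l = h l"
        by (rule injection_extends_to_permutation[of h "{..<m}" n]) (use h mN in \<open>auto simp: PiE_iff\<close>)
      define \<sigma> where "\<sigma> = Hilbert_Choice.inv \<tau>"
      have \<sigma>: "\<tau> (\<sigma> l) = l" "\<sigma> (\<tau> l) = l" for l
        using permutes_inverses[OF \<tau>(1)] by (auto simp: \<sigma>_def)
      have \<tau>N: "\<tau> l < n \<longleftrightarrow> l < n" for l using permutes_in_image[OF \<tau>(1), of l] by simp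
      have \<sigma>N: "\<sigma> l < n \<longleftrightarrow> l < n" for l using \<tau>N[of "\<sigma> l"] \<sigma>(1) by simp
      have im: "h ` {..<m} = {k. \<sigma> k < m}"
      proof (rule Set.set_eqI)
        fix k
        have "k \<in> h ` {..<m} \<longleftrightarrow> (\<exists>l<m. k = \<tau> l)" using \<tau>(2) by auto
        also have "\<dots> \<longleftrightarrow> \<sigma> k < m" using \<sigma> by metis
        finally show "k \<in> h ` {..<m} \<longleftrightarrow> k \<in> {k. \<sigma> k < m}" by simp
      qed
      define up where "up f k = (if k < n then if \<sigma> k < m then f (\<sigma> k) else n else undefined)" for f :: "nat \<Rightarrow> nat" and k
      define down where "down u = restrict (\<lambda>a. u (\<tau> a)) {..<m}" for u :: "nat \<Rightarrow> nat"
      show "(\<Sum>f\<in>Pi\<^sub>E {..<m} (\<lambda>_. ?N). (cmod (fdet m (\<lambda>a b. B (f a) (h b))))\<^sup>2) = g (h ` {..<m})"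
        unfolding g_def im
      proof (rule sum.reindex_bij_witness[where i = down and j = up])
        fix f assume f: "f \<in> Pi\<^sub>E {..<m} (\<lambda>_. ?N)"
        have fN: "f a < n" if "a < m" for a using f that by (auto simp: PiE_iff)
        show "down (up f) = f"
        proof
          fix a
          have "f a = undefined" if "\<not> a < m" using f that by (auto simp: PiE_iff extensional_def)
          then show "down (up f) a = f a" using m by (auto simp: down_def up_def restrict_def \<sigma> \<tau>N)
        qed
        have "up f k \<le> n" if "k < n" for k
          using fN[of "\<sigma> k"] that by (auto simp: up_def less_imp_le)
        moreover have "up f k < n \<longleftrightarrow> \<sigma> k < m" if "k < n" for k
          using fN[of "\<sigma> k"] that by (auto simp: up_def)
        moreover have "k < n" if "\<sigma> k < m" for k using that m \<sigma>N[of k] by simp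
        ultimately show "up f \<in> {u. u \<in> ?V \<and> {i \<in> ?N. u i < n} = {k. \<sigma> k < m}}"
          by (auto simp: PiE_iff extensional_def) (auto simp: up_def)
        have "cmod (fdet n (?C (up f))) = cmod (fdet n (\<lambda>i l. ?C (up f) i (\<tau> l)))"
          by (rule cmod_fdet_permute_cols[OF \<tau>(1), symmetric])
        also have "\<dots> = cmod (fdet n (\<lambda>i l. ?C (up f) (\<tau> i) (\<tau> l)))"
          by (rule cmod_fdet_permute_rows[OF \<tau>(1), symmetric, of "\<lambda>i l. ?C (up f) i (\<tau> l)"])
        also have "fdet n (\<lambda>i l. ?C (up f) (\<tau> i) (\<tau> l)) = fdet m (\<lambda>i l. ?C (up f) (\<tau> i) (\<tau> l))"
        proof (rule fdet_unit_rows[OF m])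
          fix i l assume il: "l < n" "m \<le> i" "i < n"
          have "\<tau> i = \<tau> l \<longleftrightarrow> i = l" using \<sigma>(2) by metis
          then show "?C (up f) (\<tau> i) (\<tau> l) = of_bool (i = l)"
            using il by (simp add: up_def \<sigma> \<tau>N)
        qed
        also have "\<dots> = fdet m (\<lambda>a b. B (f a) (h b))"
        proof (rule fdet_cong)
          fix a b assume ab: "a < m" "b < m"
          then show "?C (up f) (\<tau> a) (\<tau> b) = B (f a) (h b)"
            using m fN[of a] \<tau>(2)[of b] by (simp add: up_def \<sigma> \<tau>N)
        qed
        finally show "G (up f) = (cmod (fdet m (\<lambda>a b. B (f a) (h b))))\<^sup>2"
          by (simp add: G_def)
      next
        fix u assume u: "u \<in> {u. u \<in> ?V \<and> {i \<in> ?N. u i < n} = {k. \<sigma> k < m}}"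
        have un: "u k < n \<longleftrightarrow> \<sigma> k < m" if "k < n" for k using u that by auto
        have ule: "u k \<le> n" if "k < n" for k using u that by (auto simp: PiE_iff)
        show "down u \<in> Pi\<^sub>E {..<m} (\<lambda>_. ?N)"
        proof (rule PiE_I)
          fix a assume a: "a \<in> {..<m}"
          then have "u (\<tau> a) < n" using un[of "\<tau> a"] m by (auto simp: \<tau>N \<sigma>)
          then show "down u a \<in> ?N" using a by (simp add: down_def)
        qed (auto simp: down_def)
        show "up (down u) = u"
        proof
          fix k
          have "u k = undefined" if "\<not> k < n" using u that by (auto simp: PiE_iff extensional_def)
          moreover have "u k = n" if "k < n" "\<not> \<sigma> k < m" using un[of k] ule[of k] that by simp
          ultimately show "up (down u) k = u k" by (auto simp: down_def up_def \<sigma> \<sigma>N)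
        qed
      qed
    qed
    also have "\<dots> = fact m * (\<Sum>K | K \<subseteq> ?N \<and> card K = m. g K)"
      using sum_injections_by_image[of "{..<m}" ?N g] m by simp
    finally show ?thesis by (simp add: sq_minors_eq[OF m])
  qed
  have "(\<Sum>u\<in>?V. \<phi> (card {i \<in> ?N. u i < n}) * G u) = (\<Sum>m\<le>n. \<phi> m * (\<Sum>K | K \<subseteq> ?N \<and> card K = m. g K))"
    unfolding g_def by (rule sum_group_by_card[OF finV]) auto
  also have "\<dots> = (\<Sum>m\<le>n. \<phi> m / fact (n - m) * sq_minors n m B)"
    by (intro sum.cong refl) (simp add: main)
  finally show ?thesis by (simp add: G_def)
qed

section \<open>Determinants of Gaussian matrices\<close>

abbreviation gmat :: "nat \<Rightarrow> (nat \<times> nat \<Rightarrow> complex) measure" where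
  "gmat n \<equiv> \<Pi>\<^sub>M e\<in>{..<n} \<times> {..<n}. cgauss"

text \<open>The common form of all determinants to be averaged (minors, characteristic polynomials,
  plain determinants): row \<open>i\<close> is an affine function of row \<open>i\<close> of
  \<open>A\<close>.\<close>

definition det_affine :: "nat \<Rightarrow> (nat \<Rightarrow> nat \<Rightarrow> complex) \<Rightarrow> (nat \<Rightarrow> nat \<Rightarrow> complex) \<Rightarrow> (nat \<times> nat \<Rightarrow> complex) \<Rightarrow> complex" where
  "det_affine n W D A = fdet n (\<lambda>i l. (\<Sum>j<n. A (i, j) * W j l) + D i l)"

definition det_affine_coeff :: "nat \<Rightarrow> (nat \<Rightarrow> nat \<Rightarrow> complex) \<Rightarrow> (nat \<Rightarrow> nat \<Rightarrow> complex) \<Rightarrow> (nat \<Rightarrow> nat) \<Rightarrow> complex" where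
  "det_affine_coeff n W D u = fdet n (\<lambda>i l. if u i < n then W (u i) l else D i l)"

lemma det_affine_row_poly: "det_affine n W D A = row_poly n {..<n} (det_affine_coeff n W D) A"
proof -
  have "det_affine n W D A = fdet n (\<lambda>i l. \<Sum>k\<le>n. affine_coord n A i k * (if k < n then W k l else D i l))"
    unfolding det_affine_def by (intro fdet_cong) (simp add: affine_coord_def lessThan_Suc_atMost[symmetric])
  also have "\<dots> = (\<Sum>u\<in>Pi\<^sub>E {..<n} (\<lambda>_. {..n}). (\<Prod>i<n. affine_coord n A i (u i)) * det_affine_coeff n W D u)"
    unfolding det_affine_coeff_def
    by (rule fdet_linear_rows[where a = "affine_coord n A" and w = "\<lambda>i k l. if k < n then W k l else D i l" and J = "\<lambda>_. {..n}"]) simp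
  finally show ?thesis by (simp add: row_poly_def mult.commute)
qed

lemma alternating_det_affine_coeff: "alternating_coeffs n {..<n} (det_affine_coeff n W D)"
  unfolding alternating_coeffs_def
proof (intro ballI impI)
  fix u :: "nat \<Rightarrow> nat" and a b assume ab: "a \<in> {..<n}" "b \<in> {..<n}" "a \<noteq> b" "u a < n" "u b < n"
  define M where "M i l = (if u i < n then W (u i) l else D i l)" for i l
  have "det_affine_coeff n W D (u(a := u b, b := u a)) = fdet n (M(a := M b, b := M a))"
    unfolding det_affine_coeff_def using ab by (intro fdet_cong) (auto simp: M_def)
  also have "\<dots> = - fdet n M" using ab by (intro fdet_swap_rows) auto
  finally show "det_affine_coeff n W D (u(a := u b, b := u a)) = - det_affine_coeff n W D u"
    by (simp add: det_affine_coeff_def M_def[abs_def])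
qed

lemma nn_integral_monomials:
  assumes I: "finite I" and T: "finite \<T>" "inj_on T \<T>" "\<And>t. t \<in> \<T> \<Longrightarrow> T t \<subseteq> I"
  shows "(\<integral>\<^sup>+A. ennreal ((cmod (\<Sum>t\<in>\<T>. a t * (\<Prod>e\<in>T t. A e)))\<^sup>2) \<partial>(\<Pi>\<^sub>M e\<in>I. cgauss)) = ennreal (\<Sum>t\<in>\<T>. (cmod (a t))\<^sup>2)"
proof (rule nn_integral_orthonormal[OF T(1)])
  fix s t assume st: "s \<in> \<T>" "t \<in> \<T>"
  then have "T s = T t \<longleftrightarrow> s = t" using T(2) by (auto dest: inj_onD)
  then show "has_bochner_integral (\<Pi>\<^sub>M e\<in>I. cgauss) (\<lambda>A. (\<Prod>e\<in>T s. A e) * cnj (\<Prod>e\<in>T t. A e)) (if s = t then 1 else 0)"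
    using cgauss_monomials_orthonormal[OF I T(3)[OF st(1)] T(3)[OF st(2)]] by simp
qed

text \<open>Different index maps \<open>u\<close> select different sets of entries, so the monomials
  are orthonormal and Parseval's identity applies.\<close>

lemma nn_integral_row_poly:
  assumes R: "finite R"
  shows "(\<integral>\<^sup>+A. ennreal ((cmod (row_poly n R p A))\<^sup>2) \<partial>(\<Pi>\<^sub>M e\<in>R \<times> {..<n}. cgauss))
    = ennreal (\<Sum>u\<in>Pi\<^sub>E R (\<lambda>_. {..n}). (cmod (p u))\<^sup>2)"
proof -
  define T where "T u = (\<lambda>i. (i, u i)) ` {i \<in> R. u i < n}" for u :: "'a \<Rightarrow> nat"
  have prod: "(\<Prod>i\<in>R. affine_coord n A i (u i)) = (\<Prod>e\<in>T u. A e)" for A u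
  proof -
    have "(\<Prod>e\<in>T u. A e) = (\<Prod>i | i \<in> R \<and> u i < n. A (i, u i))"
      unfolding T_def by (subst prod.reindex) (auto intro!: inj_onI)
    also have "\<dots> = (\<Prod>i\<in>R. affine_coord n A i (u i))"
      using R by (intro prod.mono_neutral_cong_left) (auto simp: affine_coord_def)
    finally show ?thesis by simp
  qed
  have "(\<integral>\<^sup>+A. ennreal ((cmod (\<Sum>u\<in>Pi\<^sub>E R (\<lambda>_. {..n}). p u * (\<Prod>e\<in>T u. A e)))\<^sup>2) \<partial>(\<Pi>\<^sub>M e\<in>R \<times> {..<n}. cgauss))
    = ennreal (\<Sum>u\<in>Pi\<^sub>E R (\<lambda>_. {..n}). (cmod (p u))\<^sup>2)"
  proof (rule nn_integral_monomials)
    show "inj_on T (Pi\<^sub>E R (\<lambda>_. {..n}))"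
    proof (rule inj_onI)
      fix u v assume uv: "u \<in> Pi\<^sub>E R (\<lambda>_. {..n})" "v \<in> Pi\<^sub>E R (\<lambda>_. {..n})" and T: "T u = T v"
      have m: "(i, k) \<in> T w \<longleftrightarrow> i \<in> R \<and> k < n \<and> w i = k" for i k w by (auto simp: T_def)
      have "u i = v i" if i: "i \<in> R" for i
      proof -
        have "u i \<le> n" "v i \<le> n" using uv i by (auto simp: PiE_iff)
        moreover have "u i < n \<Longrightarrow> v i = u i" using m[of i "u i" u] m[of i "u i" v] T i by simp
        moreover have "v i < n \<Longrightarrow> u i = v i" using m[of i "v i" u] m[of i "v i" v] T i by simp
        ultimately show ?thesis by linarith
      qed
      then show "u = v" using uv by (intro PiE_ext) auto
    qed
  qed (use R in \<open>auto simp: T_def intro: finite_PiE\<close>)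
  then show ?thesis by (simp add: row_poly_def prod)
qed

lemma measurable_det_affine[measurable]: "det_affine n W D \<in> borel_measurable (gmat n)"
  unfolding det_affine_row_poly[abs_def] by (rule measurable_row_poly)

text \<open>The total cost of averaging out all \<open>n\<close> rows, of order
  \<open>sqrt n * ln n\<close>.\<close>

definition fluct_bound :: "nat \<Rightarrow> real" where
  "fluct_bound n = (100 + 32 * ln n) * (\<Sum>d\<in>{1..n}. 1 / sqrt (real d))"

text \<open>The reference value enters only as the mean of \<open>F\<close>, so each application may
  compute that mean in whatever form is convenient, for instance through minors.\<close>

lemma det_affine_concentration:
  assumes A: "finite \<A>" and w: "\<And>\<alpha>. \<alpha> \<in> \<A> \<Longrightarrow> 0 \<le> w \<alpha>"
    and F: "\<And>A. F A = (\<Sum>\<alpha>\<in>\<A>. w \<alpha> * (cmod (det_affine n (W \<alpha>) (D \<alpha>) A))\<^sup>2)"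
    and m: "(\<integral>\<^sup>+A. ennreal (F A) \<partial>gmat n) = ennreal m" "0 < m"
  shows "(\<integral>\<^sup>+A. dist_ln (F A) m \<partial>gmat n) \<le> ennreal (fluct_bound n)"
proof -
  \<comment> \<open>Nonnegative weights are absorbed into the coefficients as square roots;
    alternation is preserved.\<close>
  define p where "p \<alpha> u = complex_of_real (sqrt (w \<alpha>)) * det_affine_coeff n (W \<alpha>) (D \<alpha>) u" for \<alpha> u
  have rp: "(cmod (row_poly n {..<n} (p \<alpha>) A))\<^sup>2 = w \<alpha> * (cmod (det_affine n (W \<alpha>) (D \<alpha>) A))\<^sup>2" if "\<alpha> \<in> \<A>" for \<alpha> A
  proof -
    have "row_poly n {..<n} (p \<alpha>) A = complex_of_real (sqrt (w \<alpha>)) * det_affine n (W \<alpha>) (D \<alpha>) A"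
      unfolding det_affine_row_poly by (simp add: row_poly_def p_def sum_distrib_left mult.assoc)
    then show ?thesis using w[OF that] by (simp add: norm_mult power_mult_distrib)
  qed
  have F': "F = (\<lambda>A. \<Sum>\<alpha>\<in>\<A>. (cmod (row_poly n {..<n} (p \<alpha>) A))\<^sup>2)"
    by (simp add: fun_eq_iff F rp cong: sum.cong)
  define m' where "m' = (\<Sum>\<alpha>\<in>\<A>. \<Sum>u\<in>Pi\<^sub>E {..<n} (\<lambda>_. {..n}). (cmod (p \<alpha> u))\<^sup>2)"
  have "ennreal m = (\<Sum>\<alpha>\<in>\<A>. \<integral>\<^sup>+A. ennreal ((cmod (row_poly n {..<n} (p \<alpha>) A))\<^sup>2) \<partial>gmat n)"
    unfolding m(1)[symmetric] F' using measurable_row_poly[measurable]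
    by (subst nn_integral_sum[symmetric]) (auto simp: sum_ennreal)
  also have "\<dots> = ennreal m'"
    by (subst nn_integral_row_poly) (auto simp: m'_def sum_ennreal sum_nonneg)
  finally have eq: "ennreal m = ennreal m'" .
  have m'0: "0 \<le> m'" unfolding m'_def by (intro sum_nonneg) simp
  have "m = m'" by (rule iffD1[OF ennreal_inj[OF less_imp_le[OF m(2)] m'0] eq])
  have "alternating_coeffs n {..<n} (p \<alpha>)" for \<alpha>
    using alternating_det_affine_coeff[of n "W \<alpha>" "D \<alpha>"] unfolding alternating_coeffs_def p_def by simp
  from row_poly_concentration[OF _ A this \<open>m = m'\<close>[unfolded m'_def] m(2)]
  show ?thesis unfolding F' fluct_bound_def by simp
qed

section \<open>Second moments of Gaussian determinants and minors\<close>

lemma nn_integral_gauss_cols: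
  assumes S: "S \<subseteq> {..<n}" and y: "y \<in> S \<rightarrow> {..<n}" "inj_on y S"
  shows "(\<integral>\<^sup>+A. ennreal ((cmod (fdet n (\<lambda>i l. if l \<in> S then c * A (i, y l) else f i l)))\<^sup>2) \<partial>gmat n)
    = ennreal ((cmod c)\<^sup>2 ^ card S * (\<Sum>u\<in>Pi\<^sub>E S (\<lambda>_. {..<n}). (cmod (fdet n (\<lambda>i l. if l \<in> S then of_bool (i = u l) else f i l)))\<^sup>2))"
proof -
  have fS: "finite S" using S finite_subset by blast
  \<comment> \<open>The entries occurring in the monomial of \<open>u\<close>. As \<open>y\<close>
    is injective, different \<open>u\<close> give different sets, even if \<open>u\<close> repeats
    rows.\<close>
  define T where "T u = (\<lambda>l. (u l, y l)) ` S" for u :: "nat \<Rightarrow> nat"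
  let ?D = "\<lambda>u. fdet n (\<lambda>i l. if l \<in> S then of_bool (i = u l) else f i l)"
  have exp: "fdet n (\<lambda>i l. if l \<in> S then c * A (i, y l) else f i l)
    = (\<Sum>u\<in>Pi\<^sub>E S (\<lambda>_. {..<n}). (c ^ card S * ?D u) * (\<Prod>e\<in>T u. A e))" for A
  proof -
    have "fdet n (\<lambda>i l. if l \<in> S then c * A (i, y l) else f i l)
      = fdet n (\<lambda>i l. if l \<in> S then \<Sum>k\<in>{..<n}. (c * A (k, y l)) * of_bool (i = k) else f i l)"
      by (intro fdet_cong) (auto simp: of_bool_def if_distrib[where f = "\<lambda>x. _ * x"] sum.delta cong: if_cong)
    also have "\<dots> = (\<Sum>u\<in>Pi\<^sub>E S (\<lambda>_. {..<n}). (\<Prod>l\<in>S. c * A (u l, y l)) * ?D u)"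
      by (rule fdet_linear_cols[OF S, where a = "\<lambda>l k. c * A (k, y l)" and w = "\<lambda>l k i. of_bool (i = k)"]) simp
    also have "\<dots> = (\<Sum>u\<in>Pi\<^sub>E S (\<lambda>_. {..<n}). (c ^ card S * ?D u) * (\<Prod>e\<in>T u. A e))"
    proof (intro sum.cong refl)
      fix u
      have "(\<Prod>e\<in>T u. A e) = (\<Prod>l\<in>S. A (u l, y l))"
        unfolding T_def using y(2) by (subst prod.reindex) (auto intro!: inj_onI dest: inj_onD)
      then show "(\<Prod>l\<in>S. c * A (u l, y l)) * ?D u = (c ^ card S * ?D u) * (\<Prod>e\<in>T u. A e)"
        by (simp add: prod.distrib)
    qed
    finally show ?thesis .
  qed
  have "(\<integral>\<^sup>+A. ennreal ((cmod (fdet n (\<lambda>i l. if l \<in> S then c * A (i, y l) else f i l)))\<^sup>2) \<partial>gmat n)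
    = ennreal (\<Sum>u\<in>Pi\<^sub>E S (\<lambda>_. {..<n}). (cmod (c ^ card S * ?D u))\<^sup>2)"
    unfolding exp
  proof (rule nn_integral_monomials)
    show "inj_on T (Pi\<^sub>E S (\<lambda>_. {..<n}))"
    proof (rule inj_onI)
      fix u v assume uv: "u \<in> Pi\<^sub>E S (\<lambda>_. {..<n})" "v \<in> Pi\<^sub>E S (\<lambda>_. {..<n})" and "T u = T v"
      have "u l = v l" if l: "l \<in> S" for l
      proof -
        have "(u l, y l) \<in> T v" using \<open>T u = T v\<close> l by (auto simp: T_def)
        then obtain l' where "l' \<in> S" "u l = v l'" "y l = y l'" by (auto simp: T_def)
        then show ?thesis using y(2) l by (auto dest: inj_onD)
      qed
      then show "u = v" using uv by (intro PiE_ext) auto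
    qed
    show "T u \<subseteq> {..<n} \<times> {..<n}" if "u \<in> Pi\<^sub>E S (\<lambda>_. {..<n})" for u
      using that y(1) by (auto simp: T_def PiE_iff)
  qed (use fS in \<open>auto intro: finite_PiE\<close>)
  then show ?thesis by (simp add: norm_mult power_mult_distrib norm_power sum_distrib_left power_mult[symmetric] mult.commute)
qed

lemma fdet_scale_rows: "fdet n (\<lambda>i l. s i * f i l) = (\<Prod>i<n. s i) * fdet n f"
  unfolding fdet_leibniz by (simp add: prod.distrib sum_distrib_left mult_ac)

lemma nn_integral_ennreal_sum:
  assumes "\<And>i. i \<in> I \<Longrightarrow> f i \<in> borel_measurable M" "\<And>i x. i \<in> I \<Longrightarrow> 0 \<le> f i x"
  shows "(\<integral>\<^sup>+x. ennreal (\<Sum>i\<in>I. f i x) \<partial>M) = (\<Sum>i\<in>I. \<integral>\<^sup>+x. ennreal (f i x) \<partial>M)"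
proof -
  have "(\<integral>\<^sup>+x. ennreal (\<Sum>i\<in>I. f i x) \<partial>M) = (\<integral>\<^sup>+x. (\<Sum>i\<in>I. ennreal (f i x)) \<partial>M)"
    by (intro nn_integral_cong) (simp add: sum_ennreal assms(2))
  also have "\<dots> = (\<Sum>i\<in>I. \<integral>\<^sup>+x. ennreal (f i x) \<partial>M)"
    by (rule nn_integral_sum) (use assms(1) in measurable)
  finally show ?thesis .
qed

lemma nn_integral_ennreal_cmult:
  assumes "f \<in> borel_measurable M" "0 \<le> k"
  shows "(\<integral>\<^sup>+x. ennreal (k * f x) \<partial>M) = ennreal k * (\<integral>\<^sup>+x. ennreal (f x) \<partial>M)"
  using assms by (subst nn_integral_cmult[symmetric]) (auto simp: ennreal_mult')

lemma nn_integral_det_gauss: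
  "(\<integral>\<^sup>+A. ennreal ((cmod (fdet n (\<lambda>i l. c * A (i, l))))\<^sup>2) \<partial>gmat n) = ennreal ((cmod c)\<^sup>2 ^ n * fact n)"
proof -
  have "sq_minors n 0 (\<lambda>_ _. 0) = (\<Sum>u\<in>Pi\<^sub>E {..<n} (\<lambda>_. {..<n}). (cmod (fdet n (\<lambda>i l. of_bool (i = u l))))\<^sup>2)"
    unfolding sq_minors_def by (simp add: atLeast0LessThan)
  also have "\<dots> = (\<Sum>u\<in>Pi\<^sub>E {..<n} (\<lambda>_. {..<n}). (cmod (fdet n (\<lambda>i l. if l \<in> {..<n} then of_bool (i = u l) else 0)))\<^sup>2)"
    by (intro sum.cong refl arg_cong[where f = "\<lambda>x. (cmod x)\<^sup>2"] fdet_cong) simp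
  finally have *: "(\<Sum>u\<in>Pi\<^sub>E {..<n} (\<lambda>_. {..<n}). (cmod (fdet n (\<lambda>i l. if l \<in> {..<n} then of_bool (i = u l) else 0)))\<^sup>2) = fact n"
    by (simp add: sq_minors_0)
  have "fdet n (\<lambda>i l. c * A (i, l)) = fdet n (\<lambda>i l. if l \<in> {..<n} then c * A (i, l) else 0)" for A
    by (intro fdet_cong) simp
  then show ?thesis
    using nn_integral_gauss_cols[of "{..<n}" n "\<lambda>l. l" c "\<lambda>_ _. 0"] * by (simp add: inj_on_def)
qed

text \<open>A repeated Gaussian column makes the determinant vanish. For each of the n! / m!
  injective \<open>y\<close>, averaging replaces the Gaussian columns by the sum over all unit
  columns, which is the definition of \<open>sq_minors\<close>.\<close>

lemma nn_integral_sq_minors_inverse_step: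
  assumes m: "m \<le> n"
  shows "(\<integral>\<^sup>+A. ennreal (\<Sum>h\<in>Pi\<^sub>E {..<m} (\<lambda>_. {..<n}). \<Sum>y\<in>Pi\<^sub>E {m..<n} (\<lambda>_. {..<n}).
      (cmod (fdet n (\<lambda>i l. if l < m then B i (h l) else c * A (i, y l))))\<^sup>2) \<partial>gmat n)
    = ennreal ((cmod c)\<^sup>2 ^ (n - m) * (fact n / fact m) * sq_minors n m B)"
proof -
  let ?H = "Pi\<^sub>E {..<m} (\<lambda>_. {..<n})" and ?Y = "Pi\<^sub>E {m..<n} (\<lambda>_. {..<n})"
  define q where "q h = (\<Sum>u\<in>?Y. (cmod (fdet n (\<lambda>i l. if l < m then B i (h l) else of_bool (i = u l))))\<^sup>2)" for h
  have fin: "finite ?H" "finite ?Y" by (auto intro: finite_PiE)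
  have S: "{m..<n} \<subseteq> {..<n}" by auto
  have conv: "fdet n (\<lambda>i l. if l < m then f i l else g i l) = fdet n (\<lambda>i l. if l \<in> {m..<n} then g i l else f i l)" for f g
    by (intro fdet_cong) auto
  have one: "(\<integral>\<^sup>+A. ennreal ((cmod (fdet n (\<lambda>i l. if l < m then B i (h l) else c * A (i, y l))))\<^sup>2) \<partial>gmat n)
    = (if inj_on y {m..<n} then ennreal ((cmod c)\<^sup>2 ^ (n - m) * q h) else 0)" if y: "y \<in> ?Y" for y h
  proof (cases "inj_on y {m..<n}")
    case True
    then show ?thesis
      unfolding conv q_def using nn_integral_gauss_cols[OF S _ True, of c "\<lambda>i l. B i (h l)"] y by (auto simp: PiE_iff)
  next
    case False
    then obtain a b where "a \<in> {m..<n}" "b \<in> {m..<n}" "a \<noteq> b" "y a = y b" by (auto simp: inj_on_def)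
    then have "fdet n (\<lambda>i l. if l < m then B i (h l) else c * A (i, y l)) = 0" for A
      by (intro fdet_identical_cols[of a n b]) auto
    then show ?thesis using False by simp
  qed
  have meas: "(\<lambda>A. fdet n (\<lambda>i l. if l < m then B i (h l) else c * A (i, y l))) \<in> borel_measurable (gmat n)"
    if y: "y \<in> ?Y" for y h
  proof -
    have "fdet n (\<lambda>i l. if l < m then B i (h l) else c * A (i, y l))
      = det_affine n (\<lambda>j l. if l < m then 0 else c * of_bool (j = y l)) (\<lambda>i l. if l < m then B i (h l) else 0) A" for A
      unfolding det_affine_def
    proof (rule fdet_cong)
      fix i l assume "i < n" "l < n"
      then have "\<not> l < m \<Longrightarrow> y l < n" using y by (auto simp: PiE_iff)
      then show "(if l < m then B i (h l) else c * A (i, y l)) =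
        (\<Sum>j<n. A (i, j) * (if l < m then 0 else c * of_bool (j = y l))) + (if l < m then B i (h l) else 0)"
        by (auto simp: of_bool_def if_distrib[where f = "\<lambda>x. _ * x"] sum.delta cong: if_cong)
    qed
    then show ?thesis by simp
  qed
  have "(\<integral>\<^sup>+A. ennreal (\<Sum>h\<in>?H. \<Sum>y\<in>?Y. (cmod (fdet n (\<lambda>i l. if l < m then B i (h l) else c * A (i, y l))))\<^sup>2) \<partial>gmat n)
    = (\<Sum>h\<in>?H. \<Sum>y\<in>?Y. \<integral>\<^sup>+A. ennreal ((cmod (fdet n (\<lambda>i l. if l < m then B i (h l) else c * A (i, y l))))\<^sup>2) \<partial>gmat n)"
    using meas by (subst nn_integral_ennreal_sum, simp, simp add: sum_nonneg)
      (intro sum.cong refl nn_integral_ennreal_sum; simp)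
  also have "\<dots> = (\<Sum>h\<in>?H. \<Sum>y\<in>?Y. ennreal (if inj_on y {m..<n} then (cmod c)\<^sup>2 ^ (n - m) * q h else 0))"
    by (intro sum.cong refl) (simp add: one)
  also have "\<dots> = ennreal (\<Sum>h\<in>?H. \<Sum>y\<in>?Y. if inj_on y {m..<n} then (cmod c)\<^sup>2 ^ (n - m) * q h else 0)"
    by (simp add: sum_ennreal sum_nonneg q_def)
  also have "(\<Sum>h\<in>?H. \<Sum>y\<in>?Y. if inj_on y {m..<n} then (cmod c)\<^sup>2 ^ (n - m) * q h else 0)
    = (\<Sum>h\<in>?H. card {y \<in> ?Y. inj_on y {m..<n}} * ((cmod c)\<^sup>2 ^ (n - m) * q h))"
    using fin by (intro sum.cong refl) (simp add: sum.inter_filter[symmetric])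
  also have "\<dots> = card {y \<in> ?Y. inj_on y {m..<n}} * (cmod c)\<^sup>2 ^ (n - m) * sq_minors n m B"
    by (simp add: sq_minors_def q_def sum_distrib_left mult_ac)
  also have "real (card {y \<in> ?Y. inj_on y {m..<n}}) = fact n / fact m"
    using m by (subst card_PiE_inj) (auto simp: real_of_nat_div fact_dvd)
  finally show ?thesis by (simp add: mult_ac)
qed

lemma fdet_matrix_product_expand:
  fixes f h :: "nat \<Rightarrow> nat" and n :: nat
  assumes "\<And>a. a < m \<Longrightarrow> f a < n"
  shows "fdet m (\<lambda>a b. c * (\<Sum>j<n. A (f a, j) * B j (h b)))
    = (\<Sum>w\<in>Pi\<^sub>E {..<m} (\<lambda>_. {..<n}). (c ^ m * fdet m (\<lambda>a b. B (w a) (h b))) * (\<Prod>a<m. A (f a, w a)))"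
proof -
  have "fdet m (\<lambda>a b. c * (\<Sum>j<n. A (f a, j) * B j (h b))) = fdet m (\<lambda>a b. \<Sum>j\<in>{..<n}. (c * A (f a, j)) * B j (h b))"
    by (simp add: sum_distrib_left mult_ac)
  also have "\<dots> = (\<Sum>w\<in>Pi\<^sub>E {..<m} (\<lambda>_. {..<n}). (\<Prod>a<m. c * A (f a, w a)) * fdet m (\<lambda>a b. B (w a) (h b)))"
    by (rule fdet_linear_rows[where a = "\<lambda>a j. c * A (f a, j)" and w = "\<lambda>a j b. B j (h b)"]) simp
  finally show ?thesis by (simp add: prod.distrib mult_ac)
qed

text \<open>Expanding the rows of the product writes the minor as a polynomial in the entries of
  \<open>A\<close> whose coefficients are minors of \<open>B\<close>. Distinct rows \<open>f\<close>
  give orthonormal monomials, repeated rows give zero.\<close>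

lemma nn_integral_minor_product:
  fixes f h :: "nat \<Rightarrow> nat" and n :: nat
  assumes f: "f \<in> Pi\<^sub>E {..<m} (\<lambda>_. {..<n})"
  shows "(\<integral>\<^sup>+A. ennreal ((cmod (fdet m (\<lambda>a b. c * (\<Sum>j<n. A (f a, j) * B j (h b)))))\<^sup>2) \<partial>gmat n)
    = (if inj_on f {..<m} then ennreal ((cmod c)\<^sup>2 ^ m *
        (\<Sum>w\<in>Pi\<^sub>E {..<m} (\<lambda>_. {..<n}). (cmod (fdet m (\<lambda>a b. B (w a) (h b))))\<^sup>2)) else 0)"
proof (cases "inj_on f {..<m}")
  case True
  have fn: "f a < n" if "a < m" for a using f that by (auto simp: PiE_iff)
  define T where "T w = (\<lambda>a. (f a, w a)) ` {..<m}" for w :: "nat \<Rightarrow> nat"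
  have pr: "(\<Prod>a<m. A (f a, w a)) = (\<Prod>e\<in>T w. A e)" for A :: "nat \<times> nat \<Rightarrow> complex" and w
    unfolding T_def using True by (subst prod.reindex) (auto intro!: inj_onI dest: inj_onD)
  have exp: "fdet m (\<lambda>a b. c * (\<Sum>j<n. A (f a, j) * B j (h b)))
    = (\<Sum>w\<in>Pi\<^sub>E {..<m} (\<lambda>_. {..<n}). (c ^ m * fdet m (\<lambda>a b. B (w a) (h b))) * (\<Prod>e\<in>T w. A e))" for A
    unfolding pr[symmetric] by (rule fdet_matrix_product_expand) (rule fn)
  have "(\<integral>\<^sup>+A. ennreal ((cmod (fdet m (\<lambda>a b. c * (\<Sum>j<n. A (f a, j) * B j (h b)))))\<^sup>2) \<partial>gmat n)
    = (\<integral>\<^sup>+A. ennreal ((cmod (\<Sum>w\<in>Pi\<^sub>E {..<m} (\<lambda>_. {..<n}).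
        (c ^ m * fdet m (\<lambda>a b. B (w a) (h b))) * (\<Prod>e\<in>T w. A e)))\<^sup>2) \<partial>gmat n)"
    by (intro nn_integral_cong arg_cong[where f = "\<lambda>x. ennreal ((cmod x)\<^sup>2)"] exp)
  also have "\<dots> = ennreal (\<Sum>w\<in>Pi\<^sub>E {..<m} (\<lambda>_. {..<n}). (cmod (c ^ m * fdet m (\<lambda>a b. B (w a) (h b))))\<^sup>2)"
  proof (rule nn_integral_monomials)
    show "inj_on T (Pi\<^sub>E {..<m} (\<lambda>_. {..<n}))"
    proof (rule inj_onI)
      fix u v assume uv: "u \<in> Pi\<^sub>E {..<m} (\<lambda>_. {..<n})" "v \<in> Pi\<^sub>E {..<m} (\<lambda>_. {..<n})" and "T u = T v"
      have "u l = v l" if l: "l \<in> {..<m}" for l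
      proof -
        have "(f l, u l) \<in> T v" using \<open>T u = T v\<close> l by (auto simp: T_def)
        then obtain l' where "l' \<in> {..<m}" "u l = v l'" "f l = f l'" by (auto simp: T_def)
        then show ?thesis using True l by (auto dest: inj_onD)
      qed
      then show "u = v" using uv by (intro PiE_ext) auto
    qed
    show "T u \<subseteq> {..<n} \<times> {..<n}" if "u \<in> Pi\<^sub>E {..<m} (\<lambda>_. {..<n})" for u
      using that fn by (auto simp: T_def PiE_iff)
  qed (auto intro: finite_PiE)
  also have "(\<Sum>w\<in>Pi\<^sub>E {..<m} (\<lambda>_. {..<n}). (cmod (c ^ m * fdet m (\<lambda>a b. B (w a) (h b))))\<^sup>2)
    = (cmod c)\<^sup>2 ^ m * (\<Sum>w\<in>Pi\<^sub>E {..<m} (\<lambda>_. {..<n}). (cmod (fdet m (\<lambda>a b. B (w a) (h b))))\<^sup>2)"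
    by (simp add: norm_mult power_mult_distrib norm_power sum_distrib_left power_mult[symmetric] mult.commute)
  finally show ?thesis using True by simp
next
  case False
  then obtain a b where "a < m" "b < m" "a \<noteq> b" "f a = f b" by (auto simp: inj_on_def)
  then have "fdet m (\<lambda>a b. c * (\<Sum>j<n. A (f a, j) * B j (h b))) = 0" for A
    by (intro fdet_identical_rows[of a m b]) auto
  then show ?thesis using False by simp
qed

text \<open>All injective \<open>f\<close> contribute the same amount, and there are n! / (n - m)!
  of them.\<close>

lemma nn_integral_sq_minors_product:
  assumes m: "m \<le> n"
  shows "(\<integral>\<^sup>+A. ennreal (sq_minors n m (\<lambda>i l. c * (\<Sum>j<n. A (i, j) * B j l))) \<partial>gmat n)
    = ennreal ((cmod c)\<^sup>2 ^ m * (fact n / fact (n - m)) * sq_minors n m B)"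
proof -
  let ?H = "Pi\<^sub>E {..<m} (\<lambda>_. {..<n})"
  define q where "q h = (\<Sum>w\<in>?H. (cmod (fdet m (\<lambda>a b. B (w a) (h b))))\<^sup>2)" for h
  let ?K = "fact (n - m) / fact m :: real"
  have fin: "finite ?H" by (auto intro: finite_PiE)
  have meas: "(\<lambda>A. fdet m (\<lambda>a b. c * (\<Sum>j<n. A (f a, j) * B j (h b)))) \<in> borel_measurable (gmat n)"
    if f: "f \<in> ?H" for f h
  proof -
    have fn: "f a < n" if "a < m" for a using f that by (auto simp: PiE_iff)
    have "(\<lambda>A. A (f a, w a)) \<in> borel_measurable (gmat n)" if "w \<in> ?H" "a < m" for w a
      using that fn by (intro measurable_component_singleton[where M = "\<lambda>_. cgauss", simplified]) (auto simp: PiE_iff)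
    then have "(\<lambda>A. \<Sum>w\<in>?H. (c ^ m * fdet m (\<lambda>a b. B (w a) (h b))) * (\<Prod>a<m. A (f a, w a))) \<in> borel_measurable (gmat n)"
      by (intro borel_measurable_sum borel_measurable_times borel_measurable_const borel_measurable_prod) auto
    moreover have "fdet m (\<lambda>a b. c * (\<Sum>j<n. A (f a, j) * B j (h b)))
      = (\<Sum>w\<in>?H. (c ^ m * fdet m (\<lambda>a b. B (w a) (h b))) * (\<Prod>a<m. A (f a, w a)))" for A
      by (rule fdet_matrix_product_expand) (rule fn)
    ultimately show ?thesis by (subst measurable_cong) assumption+
  qed
  have "(\<integral>\<^sup>+A. ennreal (sq_minors n m (\<lambda>i l. c * (\<Sum>j<n. A (i, j) * B j l))) \<partial>gmat n)
    = ennreal ?K * (\<Sum>h\<in>?H. \<Sum>f\<in>?H. \<integral>\<^sup>+A. ennreal ((cmod (fdet m (\<lambda>a b. c * (\<Sum>j<n. A (f a, j) * B j (h b)))))\<^sup>2) \<partial>gmat n)"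
  proof -
    let ?G = "\<lambda>A. \<Sum>h\<in>?H. \<Sum>f\<in>?H. (cmod (fdet m (\<lambda>a b. c * (\<Sum>j<n. A (f a, j) * B j (h b)))))\<^sup>2"
    have "(\<integral>\<^sup>+A. ennreal (?K * ?G A) \<partial>gmat n) = ennreal ?K * (\<integral>\<^sup>+A. ennreal (?G A) \<partial>gmat n)"
      by (rule nn_integral_ennreal_cmult) (use meas in auto)
    also have "(\<integral>\<^sup>+A. ennreal (?G A) \<partial>gmat n)
      = (\<Sum>h\<in>?H. \<Sum>f\<in>?H. \<integral>\<^sup>+A. ennreal ((cmod (fdet m (\<lambda>a b. c * (\<Sum>j<n. A (f a, j) * B j (h b)))))\<^sup>2) \<partial>gmat n)"
      using meas by (subst nn_integral_ennreal_sum, simp, simp add: sum_nonneg)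
        (intro sum.cong refl nn_integral_ennreal_sum; simp)
    finally show ?thesis unfolding sq_minors_eq[OF m] .
  qed
  also have "(\<Sum>h\<in>?H. \<Sum>f\<in>?H. \<integral>\<^sup>+A. ennreal ((cmod (fdet m (\<lambda>a b. c * (\<Sum>j<n. A (f a, j) * B j (h b)))))\<^sup>2) \<partial>gmat n)
    = (\<Sum>h\<in>?H. \<Sum>f\<in>?H. ennreal (if inj_on f {..<m} then (cmod c)\<^sup>2 ^ m * q h else 0))"
    by (intro sum.cong refl) (simp add: nn_integral_minor_product q_def)
  also have "\<dots> = ennreal (\<Sum>h\<in>?H. \<Sum>f\<in>?H. if inj_on f {..<m} then (cmod c)\<^sup>2 ^ m * q h else 0)"
    by (simp add: sum_ennreal sum_nonneg q_def)
  also have "(\<Sum>h\<in>?H. \<Sum>f\<in>?H. if inj_on f {..<m} then (cmod c)\<^sup>2 ^ m * q h else 0)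
    = (\<Sum>h\<in>?H. card {f \<in> ?H. inj_on f {..<m}} * ((cmod c)\<^sup>2 ^ m * q h))"
    using fin by (intro sum.cong refl) (simp add: sum.inter_filter[symmetric])
  also have "\<dots> = card {f \<in> ?H. inj_on f {..<m}} * (cmod c)\<^sup>2 ^ m * (\<Sum>h\<in>?H. q h)"
    unfolding sum_distrib_left by (simp add: mult_ac)
  also have "real (card {f \<in> ?H. inj_on f {..<m}}) = fact n / fact (n - m)"
    using m by (subst card_PiE_inj) (auto simp: real_of_nat_div fact_dvd)
  also have "ennreal ?K * ennreal (fact n / fact (n - m) * (cmod c)\<^sup>2 ^ m * (\<Sum>h\<in>?H. q h))
    = ennreal ((cmod c)\<^sup>2 ^ m * (fact n / fact (n - m)) * sq_minors n m B)"
    unfolding sq_minors_eq[OF m] by (subst ennreal_mult[symmetric]) (auto simp: q_def sum_nonneg mult_ac)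
  finally show ?thesis .
qed

text \<open>Every row is the sum of a multiple of a unit row and a Gaussian combination of the rows
  of \<open>B\<close>, so the coefficients are determinants in which rows of \<open>B\<close> are
  mixed with unit rows.\<close>

lemma nn_integral_char_product:
  "(\<integral>\<^sup>+A. ennreal ((cmod (fdet n (\<lambda>i l. z * of_bool (i = l) - c * (\<Sum>j<n. A (i, j) * B j l))))\<^sup>2) \<partial>gmat n)
    = ennreal (\<Sum>m\<le>n. ((cmod z)\<^sup>2) ^ (n - m) * ((cmod c)\<^sup>2) ^ m / fact (n - m) * sq_minors n m B)"
proof -
  let ?W = "\<lambda>j l. - c * B j l" and ?D = "\<lambda>i l. z * of_bool (i = l)"
  have aff: "fdet n (\<lambda>i l. z * of_bool (i = l) - c * (\<Sum>j<n. A (i, j) * B j l)) = det_affine n ?W ?D A" for A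
    unfolding det_affine_def by (intro fdet_cong) (simp add: sum_distrib_left sum_negf mult_ac)
  have co: "(cmod (det_affine_coeff n ?W ?D u))\<^sup>2
    = (((cmod c)\<^sup>2) ^ card {i \<in> {..<n}. u i < n} * ((cmod z)\<^sup>2) ^ (n - card {i \<in> {..<n}. u i < n}))
      * (cmod (fdet n (\<lambda>i l. if u i < n then B (u i) l else of_bool (i = l))))\<^sup>2" for u
  proof -
    have "det_affine_coeff n ?W ?D u
      = fdet n (\<lambda>i l. (if u i < n then - c else z) * (if u i < n then B (u i) l else of_bool (i = l)))"
      unfolding det_affine_coeff_def by (intro fdet_cong) simp
    also have "\<dots> = (\<Prod>i<n. if u i < n then - c else z) * fdet n (\<lambda>i l. if u i < n then B (u i) l else of_bool (i = l))"
      by (rule fdet_scale_rows)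
    also have "(\<Prod>i<n. if u i < n then - c else z) = (- c) ^ card {i \<in> {..<n}. u i < n} * z ^ (n - card {i \<in> {..<n}. u i < n})"
    proof -
      have "card ({..<n} - {i \<in> {..<n}. u i < n}) = n - card {i \<in> {..<n}. u i < n}"
        by (subst card_Diff_subset) auto
      moreover have "{..<n} \<inter> - {i. u i < n} = {..<n} - {i \<in> {..<n}. u i < n}" "{..<n} \<inter> {i. u i < n} = {i \<in> {..<n}. u i < n}" by auto
      ultimately show ?thesis by (simp add: prod.If_cases)
    qed
    finally show ?thesis
      by (simp add: norm_mult norm_power power_mult_distrib power_mult[symmetric] mult.commute)
  qed
  have "(\<integral>\<^sup>+A. ennreal ((cmod (det_affine n ?W ?D A))\<^sup>2) \<partial>gmat n)
    = ennreal (\<Sum>u\<in>Pi\<^sub>E {..<n} (\<lambda>_. {..n}). (cmod (det_affine_coeff n ?W ?D u))\<^sup>2)"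
    unfolding det_affine_row_poly by (rule nn_integral_row_poly) simp
  also have "(\<Sum>u\<in>Pi\<^sub>E {..<n} (\<lambda>_. {..n}). (cmod (det_affine_coeff n ?W ?D u))\<^sup>2)
    = (\<Sum>m\<le>n. (((cmod c)\<^sup>2) ^ m * ((cmod z)\<^sup>2) ^ (n - m)) / fact (n - m) * sq_minors n m B)"
    unfolding co by (rule sum_mixed_unit_rows[where \<phi> = "\<lambda>k. ((cmod c)\<^sup>2) ^ k * ((cmod z)\<^sup>2) ^ (n - k)"])
  finally show ?thesis by (simp only: aff) (simp only: mult_ac)
qed

text \<open>Expanded along columns this time: a column of \<open>A\<close> is a Gaussian combination
  of unit vectors, and the alternative is a column of \<open>-B\<close>.\<close>

lemma nn_integral_char_inverse:
  "(\<integral>\<^sup>+A. ennreal ((cmod (fdet n (\<lambda>i l. c * A (i, l) - B i l)))\<^sup>2) \<partial>gmat n)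
    = ennreal (\<Sum>m\<le>n. ((cmod c)\<^sup>2) ^ (n - m) / fact m * sq_minors n m B)"
proof -
  let ?N = "{..<n}" and ?V = "Pi\<^sub>E {..<n} (\<lambda>_. {..n})"
  define T where "T v = (\<lambda>l. (v l, l)) ` {l \<in> ?N. v l < n}" for v :: "nat \<Rightarrow> nat"
  define k where "k v = card {l \<in> ?N. v l = n}" for v :: "nat \<Rightarrow> nat"
  let ?C = "\<lambda>v. fdet n (\<lambda>i l. if v l < n then of_bool (i = v l) else B i l)"
  have exp: "fdet n (\<lambda>i l. c * A (i, l) - B i l) = (\<Sum>v\<in>?V. (c ^ (n - k v) * (- 1) ^ k v * ?C v) * (\<Prod>e\<in>T v. A e))" for A
  proof -
    have "fdet n (\<lambda>i l. c * A (i, l) - B i l)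
      = fdet n (\<lambda>i l. if l \<in> ?N then \<Sum>k\<in>{..n}. (if k < n then c * A (k, l) else - 1) * (if k < n then of_bool (i = k) else B i l) else 0)"
    proof (rule fdet_cong)
      fix i l assume "i < n" "l < n"
      then show "c * A (i, l) - B i l = (if l \<in> ?N then \<Sum>k\<in>{..n}. (if k < n then c * A (k, l) else - 1) * (if k < n then of_bool (i = k) else B i l) else 0)"
        by (simp add: lessThan_Suc_atMost[symmetric] of_bool_def if_distrib[where f = "\<lambda>x. _ * x"] sum.delta cong: if_cong)
    qed
    also have "\<dots> = (\<Sum>v\<in>?V. (\<Prod>l\<in>?N. if v l < n then c * A (v l, l) else - 1)
        * fdet n (\<lambda>i l. if l \<in> ?N then (if v l < n then of_bool (i = v l) else B i l) else 0))"
      by (rule fdet_linear_cols[where a = "\<lambda>l k. if k < n then c * A (k, l) else - 1"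
          and w = "\<lambda>l k i. if k < n then of_bool (i = k) else B i l" and J = "\<lambda>_. {..n}"]) auto
    also have "\<dots> = (\<Sum>v\<in>?V. (c ^ (n - k v) * (- 1) ^ k v * ?C v) * (\<Prod>e\<in>T v. A e))"
    proof (intro sum.cong refl)
      fix v assume v: "v \<in> ?V"
      have pT: "(\<Prod>e\<in>T v. A e) = (\<Prod>l | l \<in> ?N \<and> v l < n. A (v l, l))"
        unfolding T_def by (subst prod.reindex) (auto intro!: inj_onI)
      have s1: "?N \<inter> {l. v l < n} = {l. l \<in> ?N \<and> v l < n}" by auto
      have s2: "?N \<inter> - {l. v l < n} = {l \<in> ?N. v l = n}"
        using v by (auto simp: PiE_iff) (metis atMost_iff lessThan_iff order_le_less)
      have s3: "card {l. l \<in> ?N \<and> v l < n} = n - k v"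
      proof -
        have "{l. l \<in> ?N \<and> v l < n} = ?N - {l \<in> ?N. v l = n}"
          using s2 by auto
        moreover have "card (?N - {l \<in> ?N. v l = n}) = card ?N - card {l \<in> ?N. v l = n}"
          by (rule card_Diff_subset) auto
        ultimately show ?thesis unfolding k_def by (simp only: card_lessThan)
      qed
      have "(\<Prod>l\<in>?N. if v l < n then c * A (v l, l) else - 1) = c ^ (n - k v) * (\<Prod>e\<in>T v. A e) * (- 1) ^ k v"
        unfolding pT prod.If_cases[OF finite_lessThan] s1 s2 prod.distrib prod_constant s3
        by (simp only: k_def)
      moreover have "fdet n (\<lambda>i l. if l \<in> ?N then (if v l < n then of_bool (i = v l) else B i l) else 0) = ?C v"
        by (intro fdet_cong) simp
      ultimately show "(\<Prod>l\<in>?N. if v l < n then c * A (v l, l) else - 1)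
        * fdet n (\<lambda>i l. if l \<in> ?N then (if v l < n then of_bool (i = v l) else B i l) else 0)
        = (c ^ (n - k v) * (- 1) ^ k v * ?C v) * (\<Prod>e\<in>T v. A e)" by simp
    qed
    finally show ?thesis .
  qed
  have "(\<integral>\<^sup>+A. ennreal ((cmod (fdet n (\<lambda>i l. c * A (i, l) - B i l)))\<^sup>2) \<partial>gmat n)
    = ennreal (\<Sum>v\<in>?V. (cmod (c ^ (n - k v) * (- 1) ^ k v * ?C v))\<^sup>2)"
    unfolding exp
  proof (rule nn_integral_monomials)
    show "inj_on T ?V"
    proof (rule inj_onI)
      fix u v assume uv: "u \<in> ?V" "v \<in> ?V" and T: "T u = T v"
      have m: "(k, i) \<in> T w \<longleftrightarrow> i \<in> ?N \<and> k < n \<and> w i = k" for i k w by (auto simp: T_def)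
      have "u i = v i" if i: "i \<in> ?N" for i
      proof -
        have "u i \<le> n" "v i \<le> n" using uv i by (auto simp: PiE_iff)
        moreover have "u i < n \<Longrightarrow> v i = u i" using m[of "u i" i u] m[of "u i" i v] T i by simp
        moreover have "v i < n \<Longrightarrow> u i = v i" using m[of "v i" i u] m[of "v i" i v] T i by simp
        ultimately show ?thesis by linarith
      qed
      then show "u = v" using uv by (intro PiE_ext) auto
    qed
  qed (auto simp: T_def intro: finite_PiE)
  also have "(\<Sum>v\<in>?V. (cmod (c ^ (n - k v) * (- 1) ^ k v * ?C v))\<^sup>2) = (\<Sum>v\<in>?V. ((cmod c)\<^sup>2) ^ (n - k v) * (cmod (?C v))\<^sup>2)"
    by (simp add: norm_mult norm_power power_mult_distrib power_mult[symmetric] mult.commute)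
  also have "\<dots> = (\<Sum>m\<le>n. ((cmod c)\<^sup>2) ^ (n - m) / fact m * sq_minors n m B)"
    unfolding k_def by (rule sum_mixed_unit_cols[where \<phi> = "\<lambda>m. ((cmod c)\<^sup>2) ^ (n - m)"])
  finally show ?thesis .
qed

text \<open>A class of functionals closed under averaging over one more left factor, which only
  changes the weights \<open>b\<close>. This closure lets the factors be removed one after the
  other.\<close>

definition minor_poly :: "nat \<Rightarrow> (nat \<Rightarrow> real) \<Rightarrow> (nat \<Rightarrow> nat \<Rightarrow> complex) \<Rightarrow> real" where
  "minor_poly n b B = (\<Sum>m\<le>n. b m * sq_minors n m B)"

lemma minor_poly_pos:
  assumes "\<And>m. 0 < b m"
  shows "0 < minor_poly n b B"
proof -
  have nn: "0 \<le> b m * sq_minors n m B" for m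
    using assms[of m] by (simp add: sq_minors_nonneg less_imp_le)
  have "0 < b 0 * sq_minors n 0 B" using assms by (simp add: sq_minors_0)
  also have "\<dots> \<le> minor_poly n b B"
    unfolding minor_poly_def using nn
    by (intro member_le_sum[of 0 "{..n}" "\<lambda>m. b m * sq_minors n m B"]) simp_all
  finally show ?thesis .
qed

lemma sum_Sigma_cols:
  fixes n :: nat and b :: "nat \<Rightarrow> real" and g :: "nat \<Rightarrow> (nat \<Rightarrow> nat) \<Rightarrow> (nat \<Rightarrow> nat) \<Rightarrow> real"
  shows "(\<Sum>(m, h, y)\<in>(SIGMA m:{..n}. Pi\<^sub>E {..<m} (\<lambda>_. {..<n}) \<times> Pi\<^sub>E {m..<n} (\<lambda>_. {..<n})). b m * g m h y)
    = (\<Sum>m\<le>n. b m * (\<Sum>h\<in>Pi\<^sub>E {..<m} (\<lambda>_. {..<n}). \<Sum>y\<in>Pi\<^sub>E {m..<n} (\<lambda>_. {..<n}). g m h y))"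
proof -
  have "(\<Sum>(m, h, y)\<in>(SIGMA m:{..n}. Pi\<^sub>E {..<m} (\<lambda>_. {..<n}) \<times> Pi\<^sub>E {m..<n} (\<lambda>_. {..<n})). b m * g m h y)
    = (\<Sum>m\<le>n. \<Sum>(h, y)\<in>Pi\<^sub>E {..<m} (\<lambda>_. {..<n}) \<times> Pi\<^sub>E {m..<n} (\<lambda>_. {..<n}). b m * g m h y)"
    by (rule sum.Sigma[symmetric]) (auto intro: finite_PiE)
  also have "\<dots> = (\<Sum>m\<le>n. b m * (\<Sum>h\<in>Pi\<^sub>E {..<m} (\<lambda>_. {..<n}). \<Sum>y\<in>Pi\<^sub>E {m..<n} (\<lambda>_. {..<n}). g m h y))"
    by (simp add: sum.cartesian_product[symmetric] sum_distrib_left)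
  finally show ?thesis .
qed

lemma minor_poly_product_step:
  assumes b: "\<And>m. 0 < b m" and c: "0 < (c :: real)"
  shows "(\<integral>\<^sup>+A. dist_ln (minor_poly n b (\<lambda>i l. c * (\<Sum>j<n. A (i, j) * B j l)))
      (minor_poly n (\<lambda>m. b m * (c\<^sup>2 ^ m * (fact n / fact (n - m)))) B) \<partial>gmat n) \<le> ennreal (fluct_bound n)"
proof (rule det_affine_concentration)
  \<comment> \<open>A triple \<open>(m, h, y)\<close> stands for one determinant in
    \<open>sq_minors n m\<close>; its weight is \<open>b m\<close>.\<close>
  let ?\<A> = "SIGMA m:{..n}. Pi\<^sub>E {..<m} (\<lambda>_. {..<n}) \<times> Pi\<^sub>E {m..<n} (\<lambda>_. {..<n})"
  let ?W = "\<lambda>(m, h, y) j l. if l < m then c * B j (h l) else 0"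
  let ?D = "\<lambda>(m, h, y) i l. if l < m then 0 else of_bool (i = y l)"
  show "finite ?\<A>" by (auto intro!: finite_SigmaI finite_PiE)
  show "0 \<le> (\<lambda>(m, h, y). b m) \<alpha>" for \<alpha> :: "nat \<times> (nat \<Rightarrow> nat) \<times> (nat \<Rightarrow> nat)"
    using b by (auto simp: less_imp_le split: prod.split)
  fix A :: "nat \<times> nat \<Rightarrow> complex"
  have "fdet n (\<lambda>i l. if l < m then c * (\<Sum>j<n. A (i, j) * B j (h l)) else of_bool (i = y l))
    = det_affine n (?W (m, h, y)) (?D (m, h, y)) A" for m h y
    unfolding det_affine_def by (intro fdet_cong) (simp add: sum_distrib_left mult_ac)
  then have "minor_poly n b (\<lambda>i l. c * (\<Sum>j<n. A (i, j) * B j l))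
    = (\<Sum>m\<le>n. b m * (\<Sum>h\<in>Pi\<^sub>E {..<m} (\<lambda>_. {..<n}). \<Sum>y\<in>Pi\<^sub>E {m..<n} (\<lambda>_. {..<n}).
        (cmod (det_affine n (?W (m, h, y)) (?D (m, h, y)) A))\<^sup>2))"
    by (simp only: minor_poly_def sq_minors_def)
  also have "\<dots> = (\<Sum>(m, h, y)\<in>?\<A>. b m * (cmod (det_affine n (?W (m, h, y)) (?D (m, h, y)) A))\<^sup>2)"
    by (rule sum_Sigma_cols[symmetric])
  also have "\<dots> = (\<Sum>\<alpha>\<in>?\<A>. (\<lambda>(m, h, y). b m) \<alpha> * (cmod (det_affine n (?W \<alpha>) (?D \<alpha>) A))\<^sup>2)"
    by (intro sum.cong refl) (simp only: split_paired_all prod.case)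
  finally show "minor_poly n b (\<lambda>i l. c * (\<Sum>j<n. A (i, j) * B j l))
    = (\<Sum>\<alpha>\<in>?\<A>. (\<lambda>(m, h, y). b m) \<alpha> * (cmod (det_affine n (?W \<alpha>) (?D \<alpha>) A))\<^sup>2)" .
next
  show "0 < minor_poly n (\<lambda>m. b m * (c\<^sup>2 ^ m * (fact n / fact (n - m)))) B"
    using b c by (intro minor_poly_pos) simp
  have meas: "(\<lambda>A. sq_minors n m (\<lambda>i l. c * (\<Sum>j<n. A (i, j) * B j l))) \<in> borel_measurable (gmat n)" for m
  proof -
    have "fdet n (\<lambda>i l. if l < m then c * (\<Sum>j<n. A (i, j) * B j (h l)) else of_bool (i = y l))
      = det_affine n (\<lambda>j l. if l < m then c * B j (h l) else 0) (\<lambda>i l. if l < m then 0 else of_bool (i = y l)) A" for h y A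
      unfolding det_affine_def by (intro fdet_cong) (simp add: sum_distrib_left mult_ac)
    then show ?thesis unfolding sq_minors_def by simp
  qed
  have "(\<integral>\<^sup>+A. ennreal (minor_poly n b (\<lambda>i l. c * (\<Sum>j<n. A (i, j) * B j l))) \<partial>gmat n)
    = (\<Sum>m\<le>n. ennreal (b m) * (\<integral>\<^sup>+A. ennreal (sq_minors n m (\<lambda>i l. c * (\<Sum>j<n. A (i, j) * B j l))) \<partial>gmat n))"
  proof -
    have "(\<integral>\<^sup>+A. ennreal (minor_poly n b (\<lambda>i l. c * (\<Sum>j<n. A (i, j) * B j l))) \<partial>gmat n)
      = (\<Sum>m\<le>n. \<integral>\<^sup>+A. ennreal (b m * sq_minors n m (\<lambda>i l. c * (\<Sum>j<n. A (i, j) * B j l))) \<partial>gmat n)"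
      unfolding minor_poly_def using b meas
      by (intro nn_integral_ennreal_sum) (simp_all add: sq_minors_nonneg less_imp_le)
    also have "\<dots> = (\<Sum>m\<le>n. ennreal (b m) * (\<integral>\<^sup>+A. ennreal (sq_minors n m (\<lambda>i l. c * (\<Sum>j<n. A (i, j) * B j l))) \<partial>gmat n))"
      using b meas by (intro sum.cong refl)
        (rule nn_integral_ennreal_cmult, simp_all add: less_imp_le)
    finally show ?thesis .
  qed
  also have "\<dots> = (\<Sum>m\<le>n. ennreal (b m * (c\<^sup>2 ^ m * (fact n / fact (n - m))) * sq_minors n m B))"
  proof (intro sum.cong refl)
    fix m assume "m \<in> {..n}"
    then have "(\<integral>\<^sup>+A. ennreal (sq_minors n m (\<lambda>i l. c * (\<Sum>j<n. A (i, j) * B j l))) \<partial>gmat n)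
      = ennreal (c\<^sup>2 ^ m * (fact n / fact (n - m)) * sq_minors n m B)"
      using nn_integral_sq_minors_product[of m n "complex_of_real c" B] c by simp
    then show "ennreal (b m) * (\<integral>\<^sup>+A. ennreal (sq_minors n m (\<lambda>i l. c * (\<Sum>j<n. A (i, j) * B j l))) \<partial>gmat n)
      = ennreal (b m * (c\<^sup>2 ^ m * (fact n / fact (n - m))) * sq_minors n m B)"
      using b[of m] by (simp only: ennreal_mult'[OF less_imp_le, symmetric] mult.assoc)
  qed
  also have "\<dots> = ennreal (minor_poly n (\<lambda>m. b m * (c\<^sup>2 ^ m * (fact n / fact (n - m)))) B)"
    unfolding minor_poly_def using b by (intro sum_ennreal) (simp add: sq_minors_nonneg less_imp_le)
  finally show "(\<integral>\<^sup>+A. ennreal (minor_poly n b (\<lambda>i l. c * (\<Sum>j<n. A (i, j) * B j l))) \<partial>gmat n)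
    = ennreal (minor_poly n (\<lambda>m. b m * (c\<^sup>2 ^ m * (fact n / fact (n - m)))) B)" .
qed

text \<open>The first argument of \<open>dist_ln\<close> is the numerator for an inverse factor: the
  functional \<open>minor_poly n b\<close> of the product of the inverse with \<open>B\<close>,
  multiplied by the squared modulus of the determinant. It is polynomial in \<open>A\<close> and so
  has moments.\<close>

lemma minor_poly_inverse_step:
  assumes b: "\<And>m. 0 < b m" and c: "0 < (c :: real)"
  shows "(\<integral>\<^sup>+A. dist_ln (\<Sum>m\<le>n. b m * (\<Sum>h\<in>Pi\<^sub>E {..<m} (\<lambda>_. {..<n}). \<Sum>y\<in>Pi\<^sub>E {m..<n} (\<lambda>_. {..<n}).
        (cmod (fdet n (\<lambda>i l. if l < m then B i (h l) else complex_of_real c * A (i, y l))))\<^sup>2))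
      (minor_poly n (\<lambda>m. b m * (c\<^sup>2 ^ (n - m) * (fact n / fact m))) B) \<partial>gmat n) \<le> ennreal (fluct_bound n)"
proof (rule det_affine_concentration)
  let ?\<A> = "SIGMA m:{..n}. Pi\<^sub>E {..<m} (\<lambda>_. {..<n}) \<times> Pi\<^sub>E {m..<n} (\<lambda>_. {..<n})"
  let ?W = "\<lambda>(m, h, y) j l. if l < m then 0 else complex_of_real c * of_bool (j = y l)"
  let ?D = "\<lambda>(m, h, y) i l. if l < m then B i (h l) else 0"
  let ?q = "\<lambda>A m h y. fdet n (\<lambda>i l. if l < m then B i (h l) else complex_of_real c * A (i, y l))"
  show "finite ?\<A>" by (auto intro!: finite_SigmaI finite_PiE)
  show "0 \<le> (\<lambda>(m, h, y). b m) \<alpha>" for \<alpha> :: "nat \<times> (nat \<Rightarrow> nat) \<times> (nat \<Rightarrow> nat)"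
    using b by (auto simp: less_imp_le split: prod.split)
  have aff: "?q A m h y = det_affine n (?W (m, h, y)) (?D (m, h, y)) A" if y: "y \<in> Pi\<^sub>E {m..<n} (\<lambda>_. {..<n})" for A m h y
    unfolding det_affine_def
  proof (rule fdet_cong)
    fix i l assume "i < n" "l < n"
    then have "\<not> l < m \<Longrightarrow> y l < n" using y by (auto simp: PiE_iff)
    then show "(if l < m then B i (h l) else complex_of_real c * A (i, y l)) = (\<Sum>j<n. A (i, j) * ?W (m, h, y) j l) + ?D (m, h, y) i l"
      by (auto simp: of_bool_def if_distrib[where f = "\<lambda>x. _ * x"] sum.delta cong: if_cong)
  qed
  show "(\<Sum>m\<le>n. b m * (\<Sum>h\<in>Pi\<^sub>E {..<m} (\<lambda>_. {..<n}). \<Sum>y\<in>Pi\<^sub>E {m..<n} (\<lambda>_. {..<n}). (cmod (?q A m h y))\<^sup>2))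
    = (\<Sum>\<alpha>\<in>?\<A>. (\<lambda>(m, h, y). b m) \<alpha> * (cmod (det_affine n (?W \<alpha>) (?D \<alpha>) A))\<^sup>2)" for A
  proof -
    have "(\<Sum>m\<le>n. b m * (\<Sum>h\<in>Pi\<^sub>E {..<m} (\<lambda>_. {..<n}). \<Sum>y\<in>Pi\<^sub>E {m..<n} (\<lambda>_. {..<n}). (cmod (?q A m h y))\<^sup>2))
      = (\<Sum>m\<le>n. b m * (\<Sum>h\<in>Pi\<^sub>E {..<m} (\<lambda>_. {..<n}). \<Sum>y\<in>Pi\<^sub>E {m..<n} (\<lambda>_. {..<n}).
        (cmod (det_affine n (?W (m, h, y)) (?D (m, h, y)) A))\<^sup>2))"
      by (intro sum.cong refl arg_cong2[where f = "(*)"]) (simp only: aff)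
    also have "\<dots> = (\<Sum>(m, h, y)\<in>?\<A>. b m * (cmod (det_affine n (?W (m, h, y)) (?D (m, h, y)) A))\<^sup>2)"
      by (rule sum_Sigma_cols[symmetric])
    also have "\<dots> = (\<Sum>\<alpha>\<in>?\<A>. (\<lambda>(m, h, y). b m) \<alpha> * (cmod (det_affine n (?W \<alpha>) (?D \<alpha>) A))\<^sup>2)"
      by (intro sum.cong refl) (simp only: split_paired_all prod.case)
    finally show ?thesis .
  qed
  show "0 < minor_poly n (\<lambda>m. b m * (c\<^sup>2 ^ (n - m) * (fact n / fact m))) B"
    using b c by (intro minor_poly_pos) simp
  have meas: "(\<lambda>A. \<Sum>h\<in>Pi\<^sub>E {..<m} (\<lambda>_. {..<n}). \<Sum>y\<in>Pi\<^sub>E {m..<n} (\<lambda>_. {..<n}). (cmod (?q A m h y))\<^sup>2) \<in> borel_measurable (gmat n)" for m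
    by (intro borel_measurable_sum borel_measurable_power) (simp add: aff)
  have "(\<integral>\<^sup>+A. ennreal (\<Sum>m\<le>n. b m * (\<Sum>h\<in>Pi\<^sub>E {..<m} (\<lambda>_. {..<n}). \<Sum>y\<in>Pi\<^sub>E {m..<n} (\<lambda>_. {..<n}). (cmod (?q A m h y))\<^sup>2)) \<partial>gmat n)
    = (\<Sum>m\<le>n. \<integral>\<^sup>+A. ennreal (b m * (\<Sum>h\<in>Pi\<^sub>E {..<m} (\<lambda>_. {..<n}). \<Sum>y\<in>Pi\<^sub>E {m..<n} (\<lambda>_. {..<n}). (cmod (?q A m h y))\<^sup>2)) \<partial>gmat n)"
    using b meas by (intro nn_integral_ennreal_sum) (simp_all add: sum_nonneg less_imp_le)
  also have "\<dots> = (\<Sum>m\<le>n. ennreal (b m) * (\<integral>\<^sup>+A. ennreal (\<Sum>h\<in>Pi\<^sub>E {..<m} (\<lambda>_. {..<n}). \<Sum>y\<in>Pi\<^sub>E {m..<n} (\<lambda>_. {..<n}). (cmod (?q A m h y))\<^sup>2) \<partial>gmat n))"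
    using b meas by (intro sum.cong refl nn_integral_ennreal_cmult) (simp_all add: less_imp_le)
  also have "\<dots> = (\<Sum>m\<le>n. ennreal (b m * (c\<^sup>2 ^ (n - m) * (fact n / fact m)) * sq_minors n m B))"
  proof (intro sum.cong refl)
    fix m assume "m \<in> {..n}"
    then have "(\<integral>\<^sup>+A. ennreal (\<Sum>h\<in>Pi\<^sub>E {..<m} (\<lambda>_. {..<n}). \<Sum>y\<in>Pi\<^sub>E {m..<n} (\<lambda>_. {..<n}). (cmod (?q A m h y))\<^sup>2) \<partial>gmat n)
      = ennreal (c\<^sup>2 ^ (n - m) * (fact n / fact m) * sq_minors n m B)"
      using nn_integral_sq_minors_inverse_step[of m n B "complex_of_real c"] c by simp
    then show "ennreal (b m) * (\<integral>\<^sup>+A. ennreal (\<Sum>h\<in>Pi\<^sub>E {..<m} (\<lambda>_. {..<n}). \<Sum>y\<in>Pi\<^sub>E {m..<n} (\<lambda>_. {..<n}). (cmod (?q A m h y))\<^sup>2) \<partial>gmat n)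
      = ennreal (b m * (c\<^sup>2 ^ (n - m) * (fact n / fact m)) * sq_minors n m B)"
      using b[of m] by (simp only: ennreal_mult'[OF less_imp_le, symmetric] mult.assoc)
  qed
  also have "\<dots> = ennreal (minor_poly n (\<lambda>m. b m * (c\<^sup>2 ^ (n - m) * (fact n / fact m))) B)"
    unfolding minor_poly_def using b by (intro sum_ennreal) (simp add: sq_minors_nonneg less_imp_le)
  finally show "(\<integral>\<^sup>+A. ennreal (\<Sum>m\<le>n. b m * (\<Sum>h\<in>Pi\<^sub>E {..<m} (\<lambda>_. {..<n}). \<Sum>y\<in>Pi\<^sub>E {m..<n} (\<lambda>_. {..<n}). (cmod (?q A m h y))\<^sup>2)) \<partial>gmat n)
    = ennreal (minor_poly n (\<lambda>m. b m * (c\<^sup>2 ^ (n - m) * (fact n / fact m))) B)" .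
qed

text \<open>The denominator that belongs to an inverse factor.\<close>

lemma det_gauss_concentration:
  assumes c: "0 < (c :: real)"
  shows "(\<integral>\<^sup>+A. dist_ln ((cmod (fdet n (\<lambda>i l. complex_of_real c * A (i, l))))\<^sup>2) (c\<^sup>2 ^ n * fact n) \<partial>gmat n) \<le> ennreal (fluct_bound n)"
proof (rule det_affine_concentration[where \<A> = "{()}" and w = "\<lambda>_. 1" and W = "\<lambda>_ j l. complex_of_real c * of_bool (j = l)" and D = "\<lambda>_ _ _. 0"])
  show "(cmod (fdet n (\<lambda>i l. complex_of_real c * A (i, l))))\<^sup>2 = (\<Sum>\<alpha>\<in>{()}. 1 * (cmod (det_affine n (\<lambda>j l. complex_of_real c * of_bool (j = l)) (\<lambda>_ _. 0) A))\<^sup>2)" for A :: "nat \<times> nat \<Rightarrow> complex"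
  proof -
    have "fdet n (\<lambda>i l. complex_of_real c * A (i, l)) = det_affine n (\<lambda>j l. complex_of_real c * of_bool (j = l)) (\<lambda>_ _. 0) A"
      unfolding det_affine_def
      by (rule fdet_cong) (auto simp: of_bool_def if_distrib[where f = "\<lambda>x. _ * x"] sum.delta cong: if_cong)
    then show ?thesis by simp
  qed
  show "(\<integral>\<^sup>+A. ennreal ((cmod (fdet n (\<lambda>i l. complex_of_real c * A (i, l))))\<^sup>2) \<partial>gmat n) = ennreal (c\<^sup>2 ^ n * fact n)"
    using nn_integral_det_gauss[of n "complex_of_real c"] c by simp
qed (use c in auto)

lemma char_product_concentration:
  assumes z: "z \<noteq> 0" and c: "0 < (c :: real)"
  shows "(\<integral>\<^sup>+A. dist_ln ((cmod (fdet n (\<lambda>i l. z * of_bool (i = l) - complex_of_real c * (\<Sum>j<n. A (i, j) * B j l))))\<^sup>2)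
      (minor_poly n (\<lambda>m. ((cmod z)\<^sup>2) ^ (n - m) * c\<^sup>2 ^ m / fact (n - m)) B) \<partial>gmat n) \<le> ennreal (fluct_bound n)"
proof (rule det_affine_concentration[where \<A> = "{()}" and w = "\<lambda>_. 1" and W = "\<lambda>_ j l. - complex_of_real c * B j l" and D = "\<lambda>_ i l. z * of_bool (i = l)"])
  show "(cmod (fdet n (\<lambda>i l. z * of_bool (i = l) - complex_of_real c * (\<Sum>j<n. A (i, j) * B j l))))\<^sup>2
    = (\<Sum>\<alpha>\<in>{()}. 1 * (cmod (det_affine n (\<lambda>j l. - complex_of_real c * B j l) (\<lambda>i l. z * of_bool (i = l)) A))\<^sup>2)" for A :: "nat \<times> nat \<Rightarrow> complex"
  proof -
    have "fdet n (\<lambda>i l. z * of_bool (i = l) - complex_of_real c * (\<Sum>j<n. A (i, j) * B j l))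
      = det_affine n (\<lambda>j l. - complex_of_real c * B j l) (\<lambda>i l. z * of_bool (i = l)) A"
      unfolding det_affine_def by (rule fdet_cong) (simp add: sum_distrib_left sum_negf mult_ac)
    then show ?thesis by simp
  qed
  show "(\<integral>\<^sup>+A. ennreal ((cmod (fdet n (\<lambda>i l. z * of_bool (i = l) - complex_of_real c * (\<Sum>j<n. A (i, j) * B j l))))\<^sup>2) \<partial>gmat n)
    = ennreal (minor_poly n (\<lambda>m. ((cmod z)\<^sup>2) ^ (n - m) * c\<^sup>2 ^ m / fact (n - m)) B)"
    using nn_integral_char_product[of n z "complex_of_real c" B] c by (simp add: minor_poly_def)
  show "0 < minor_poly n (\<lambda>m. ((cmod z)\<^sup>2) ^ (n - m) * c\<^sup>2 ^ m / fact (n - m)) B"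
    using z c by (intro minor_poly_pos) simp
qed auto

lemma char_inverse_concentration:
  assumes z: "z \<noteq> 0" and c: "0 < (c :: real)"
  shows "(\<integral>\<^sup>+A. dist_ln ((cmod (fdet n (\<lambda>i l. z * complex_of_real c * A (i, l) - B i l)))\<^sup>2)
      (minor_poly n (\<lambda>m. ((cmod z)\<^sup>2 * c\<^sup>2) ^ (n - m) / fact m) B) \<partial>gmat n) \<le> ennreal (fluct_bound n)"
proof (rule det_affine_concentration[where \<A> = "{()}" and w = "\<lambda>_. 1" and W = "\<lambda>_ j l. z * complex_of_real c * of_bool (j = l)" and D = "\<lambda>_ i l. - B i l"])
  show "(cmod (fdet n (\<lambda>i l. z * complex_of_real c * A (i, l) - B i l)))\<^sup>2
    = (\<Sum>\<alpha>\<in>{()}. 1 * (cmod (det_affine n (\<lambda>j l. z * complex_of_real c * of_bool (j = l)) (\<lambda>i l. - B i l) A))\<^sup>2)" for A :: "nat \<times> nat \<Rightarrow> complex"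
  proof -
    have "fdet n (\<lambda>i l. z * complex_of_real c * A (i, l) - B i l)
      = det_affine n (\<lambda>j l. z * complex_of_real c * of_bool (j = l)) (\<lambda>i l. - B i l) A"
      unfolding det_affine_def
      by (rule fdet_cong) (auto simp: of_bool_def if_distrib[where f = "\<lambda>x. _ * x"] sum.delta mult_ac cong: if_cong)
    then show ?thesis by simp
  qed
  show "(\<integral>\<^sup>+A. ennreal ((cmod (fdet n (\<lambda>i l. z * complex_of_real c * A (i, l) - B i l)))\<^sup>2) \<partial>gmat n)
    = ennreal (minor_poly n (\<lambda>m. ((cmod z)\<^sup>2 * c\<^sup>2) ^ (n - m) / fact m) B)"
    using nn_integral_char_inverse[of n "z * complex_of_real c" B] c by (simp add: minor_poly_def norm_mult power_mult_distrib)
  show "0 < minor_poly n (\<lambda>m. ((cmod z)\<^sup>2 * c\<^sup>2) ^ (n - m) / fact m) B"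
    using z c by (intro minor_poly_pos) simp
qed auto

section \<open>Products of Gaussian matrices and inverses\<close>

lemma det_eq_fdet:
  assumes "M \<in> carrier_mat n n"
  shows "det M = fdet n (\<lambda>i j. M $$ (i, j))"
proof -
  have "mat n n (\<lambda>(i, j). M $$ (i, j)) = M" using assms by (intro eq_matI) auto
  then show ?thesis by (simp add: fdet_def)
qed

lemma mult_mat_index:
  assumes "M \<in> carrier_mat n n" "B \<in> carrier_mat n n" "i < n" "j < n"
  shows "(M * B) $$ (i, j) = (\<Sum>k<n. M $$ (i, k) * B $$ (k, j))"
  using assms by (simp add: scalar_prod_def atLeast0LessThan)

lemma mat_inv_carrier:
  assumes "M \<in> carrier_mat n n"
  shows "mat_inv M \<in> carrier_mat n n"
  using mat_inverse(2)[OF assms] assms by (auto simp: mat_inv_def split: option.split)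

lemma mat_inv_mult:
  assumes M: "M \<in> carrier_mat n n" and d: "det M \<noteq> 0"
  shows "M * mat_inv M = 1\<^sub>m n" "mat_inv M * M = 1\<^sub>m n"
proof -
  have "M \<in> Units (ring_mat TYPE(complex) n ())"
    by (rule det_non_zero_imp_unit[OF M d])
  then obtain X where "mat_inverse M = Some X"
    using mat_inverse(1)[OF M, where b = "()"] by (cases "mat_inverse M") auto
  then show "M * mat_inv M = 1\<^sub>m n" "mat_inv M * M = 1\<^sub>m n"
    using mat_inverse(2)[OF M] by (auto simp: mat_inv_def)
qed

text \<open>An inverse would make the determinant a divisor of 1, so a singular matrix receives the
  default value.\<close>

lemma mat_inv_singular:
  assumes M: "M \<in> carrier_mat n n" and d: "det M = 0"
  shows "mat_inv M = 0\<^sub>m n n"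
proof (cases "mat_inverse M")
  case (Some X)
  then have X: "M * X = 1\<^sub>m n" "X \<in> carrier_mat n n" using mat_inverse(2)[OF M] by auto
  then have "det M * det X = 1" using det_mult[OF M X(2)] by simp
  then show ?thesis using d by simp
qed (use M in \<open>simp add: mat_inv_def\<close>)

lemma mat_inv_eq_adj:
  assumes M: "M \<in> carrier_mat n n" and d: "det M \<noteq> 0"
  shows "mat_inv M = (1 / det M) \<cdot>\<^sub>m adj_mat M"
proof -
  note adj = adj_mat[OF M]
  let ?J = "(1 / det M) \<cdot>\<^sub>m adj_mat M"
  have J: "?J \<in> carrier_mat n n" using adj by simp
  have "M * ?J = (1 / det M) \<cdot>\<^sub>m (M * adj_mat M)"
    using M adj by (intro mult_smult_distrib)
  also have "\<dots> = 1\<^sub>m n" using adj d by (auto intro!: eq_matI)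
  finally have MJ: "M * ?J = 1\<^sub>m n" .
  have "mat_inv M = mat_inv M * (M * ?J)" using MJ mat_inv_carrier[OF M] by simp
  also have "\<dots> = (mat_inv M * M) * ?J"
    by (rule assoc_mult_mat[symmetric, OF mat_inv_carrier[OF M] M J])
  also have "\<dots> = ?J" by (simp only: mat_inv_mult(2)[OF M d] left_mult_one_mat[OF J])
  finally show ?thesis .
qed

lemma mat_powi_sign:
  assumes "M \<in> carrier_mat n n"
  shows "mat_powi M 1 = M" "mat_powi M (-1) = mat_inv M"
  using assms mat_inv_carrier[OF assms] by (auto simp: mat_powi_def)

lemma mat_powi_carrier:
  assumes "M \<in> carrier_mat n n" "e \<in> {1, -1}"
  shows "mat_powi M e \<in> carrier_mat n n"
  using assms mat_powi_sign[OF assms(1)] mat_inv_carrier[OF assms(1)] by auto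

lemma measurable_fdet:
  assumes "\<And>i l. i < n \<Longrightarrow> l < n \<Longrightarrow> (\<lambda>\<omega>. f \<omega> i l) \<in> borel_measurable M"
  shows "(\<lambda>\<omega>. fdet n (f \<omega>)) \<in> borel_measurable M"
  unfolding fdet_leibniz
proof (intro borel_measurable_sum borel_measurable_times borel_measurable_const borel_measurable_prod)
  fix \<pi> i assume "\<pi> \<in> {\<pi>. \<pi> permutes {..<n}}" "i \<in> {..<n}"
  then have "\<pi> i < n" using permutes_in_image[of \<pi> "{..<n}" i] by simp
  with \<open>i \<in> {..<n}\<close> show "(\<lambda>\<omega>. f \<omega> i (\<pi> i)) \<in> borel_measurable M" by (intro assms) auto
qed

text \<open>By Cramer's rule an entry of the inverse is a quotient of polynomials in the entries
  where the determinant is nonzero, and it is 0 elsewhere.\<close>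

lemma measurable_mat_inv:
  assumes c: "\<And>\<omega>. M \<omega> \<in> carrier_mat n n"
    and meas: "\<And>i j. i < n \<Longrightarrow> j < n \<Longrightarrow> (\<lambda>\<omega>. M \<omega> $$ (i, j)) \<in> borel_measurable N"
    and ij: "i < n" "j < n"
  shows "(\<lambda>\<omega>. mat_inv (M \<omega>) $$ (i, j)) \<in> borel_measurable N"
proof -
  have md: "(\<lambda>\<omega>. det (M \<omega>)) \<in> borel_measurable N"
    unfolding det_eq_fdet[OF c] by (rule measurable_fdet) (rule meas)
  have "(\<lambda>\<omega>. det (mat_delete (M \<omega>) j i)) \<in> borel_measurable N"
  proof -
    have cd: "mat_delete (M \<omega>) j i \<in> carrier_mat (n - 1) (n - 1)" for \<omega>
      by (intro carrier_matI) (simp_all add: mat_delete_def carrier_matD[OF c])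
    show ?thesis
      unfolding det_eq_fdet[OF cd]
    proof (rule measurable_fdet)
      fix k l assume kl: "k < n - 1" "l < n - 1"
      have "mat_delete (M \<omega>) j i $$ (k, l) = M \<omega> $$ (if k < j then k else Suc k, if l < i then l else Suc l)" for \<omega>
        using c[of \<omega>] kl by (auto simp: mat_delete_def)
      then show "(\<lambda>\<omega>. mat_delete (M \<omega>) j i $$ (k, l)) \<in> borel_measurable N"
        using kl by (auto intro!: meas)
    qed
  qed
  then have ma: "(\<lambda>\<omega>. adj_mat (M \<omega>) $$ (i, j)) \<in> borel_measurable N"
    using ij c by (simp add: adj_mat_def cofactor_def carrier_matD[OF c])
  have "mat_inv (M \<omega>) $$ (i, j) = (if det (M \<omega>) = 0 then 0 else adj_mat (M \<omega>) $$ (i, j) / det (M \<omega>))" for \<omega>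
    using mat_inv_singular[OF c[of \<omega>]] mat_inv_eq_adj[OF c[of \<omega>]] adj_mat(1)[OF c[of \<omega>]] ij by auto
  then show ?thesis using md ma by simp
qed

text \<open>The factor by which left multiplication by a normalised Gaussian matrix, or by its inverse, increases
  the sum of the squared \<open>m \<times> m\<close> minors. It is an expectation only for the matrix itself: the inverse has
  no second moments, and its gain is a ratio of two expectations.\<close>

definition gain :: "nat \<Rightarrow> int \<Rightarrow> nat \<Rightarrow> real" where
  "gain n e m = (if e = 1 then (1 / n) ^ m * (fact n / fact (n - m)) else real n ^ m / fact m)"

lemma gain_pos: "1 \<le> n \<Longrightarrow> 0 < gain n e m"
  by (simp add: gain_def)

abbreviation scaled_mat :: "nat \<Rightarrow> (nat \<times> nat \<Rightarrow> complex) \<Rightarrow> complex mat" where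
  "scaled_mat n A \<equiv> mat n n (\<lambda>ij. complex_of_real (1 / sqrt n) * A ij)"

section \<open>Averaging over one factor\<close>

lemma dist_ln_divide:
  assumes "0 < b'"
  shows "dist_ln (a / b) (a' / b') \<le> dist_ln a a' + dist_ln b b'"
proof (cases "a \<le> 0 \<or> a' \<le> 0 \<or> b \<le> 0")
  case False
  then have "dist_ln (a / b) (a' / b') = ennreal \<bar>(ln a - ln b) - (ln a' - ln b')\<bar>"
    using assms by (simp add: dist_ln_def ln_divide_pos zero_less_divide_iff not_le)
  also have "\<dots> \<le> ennreal (\<bar>ln a - ln a'\<bar> + \<bar>ln b - ln b'\<bar>)"
    by (rule ennreal_leI) linarith
  finally show ?thesis using False assms by (simp add: dist_ln_def)
qed (auto simp: dist_ln_def)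

lemma minor_poly_cmult: "minor_poly n (\<lambda>m. b m * s) B = minor_poly n b B * s"
  by (simp add: minor_poly_def sum_distrib_right mult.assoc mult.commute[of s])

lemma minor_poly_cong: "(\<And>m. m \<le> n \<Longrightarrow> b m = b' m) \<Longrightarrow> minor_poly n b B = minor_poly n b' B"
  by (simp add: minor_poly_def)

lemma sq_minors_cong:
  assumes "\<And>i j. i < n \<Longrightarrow> j < n \<Longrightarrow> B i j = B' i j"
  shows "sq_minors n m B = sq_minors n m B'"
  unfolding sq_minors_def
proof (intro sum.cong refl arg_cong[where f = "\<lambda>x. (cmod x)\<^sup>2"] fdet_cong)
  fix h y i l assume h: "h \<in> Pi\<^sub>E {..<m} (\<lambda>_. {..<n})" and il: "i < n" "l < n"
  have "l < m \<Longrightarrow> h l < n" using h by (auto simp: PiE_iff)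
  then show "(if l < m then B i (h l) else of_bool (i = y l)) = (if l < m then B' i (h l) else of_bool (i = y l))"
    using assms il by simp
qed

lemma minor_poly_B_cong:
  assumes "\<And>i j. i < n \<Longrightarrow> j < n \<Longrightarrow> B i j = B' i j"
  shows "minor_poly n b B = minor_poly n b B'"
  unfolding minor_poly_def using sq_minors_cong[OF assms] by simp

text \<open>Left multiplication by \<open>M\<close> sends the columns of the product of the inverse
  with \<open>B\<close> to columns of \<open>B\<close>, and unit columns to columns of
  \<open>M\<close>. Multiplicativity of the determinant then separates the factor
  \<open>det M\<close>.\<close>

lemma minor_poly_mat_inv:
  assumes M: "M \<in> carrier_mat n n" and d: "det M \<noteq> 0" and B: "B \<in> carrier_mat n n"
  shows "(\<Sum>m\<le>n. b m * (\<Sum>h\<in>Pi\<^sub>E {..<m} (\<lambda>_. {..<n}). \<Sum>y\<in>Pi\<^sub>E {m..<n} (\<lambda>_. {..<n}).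
      (cmod (fdet n (\<lambda>i l. if l < m then B $$ (i, h l) else M $$ (i, y l))))\<^sup>2))
    = minor_poly n b (\<lambda>i j. (mat_inv M * B) $$ (i, j)) * (cmod (det M))\<^sup>2"
proof -
  let ?X = "mat_inv M * B"
  note X = mult_carrier_mat[OF mat_inv_carrier[OF M] B]
  have MX: "M * ?X = B"
  proof -
    have "M * ?X = (M * mat_inv M) * B"
      by (rule assoc_mult_mat[symmetric, OF M mat_inv_carrier[OF M] B])
    then show ?thesis using mat_inv_mult[OF M d] B by simp
  qed
  have "(cmod (fdet n (\<lambda>i l. if l < m then B $$ (i, h l) else M $$ (i, y l))))\<^sup>2
    = (cmod (fdet n (\<lambda>i l. if l < m then ?X $$ (i, h l) else of_bool (i = y l))))\<^sup>2 * (cmod (det M))\<^sup>2"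
    if hy: "h \<in> Pi\<^sub>E {..<m} (\<lambda>_. {..<n})" "y \<in> Pi\<^sub>E {m..<n} (\<lambda>_. {..<n})" for m h y
  proof -
    let ?Q = "mat n n (\<lambda>(i, l). if l < m then ?X $$ (i, h l) else of_bool (i = y l))"
    have Q: "?Q \<in> carrier_mat n n" by simp
    have "fdet n (\<lambda>i l. if l < m then B $$ (i, h l) else M $$ (i, y l)) = det (M * ?Q)"
      unfolding det_eq_fdet[OF mult_carrier_mat[OF M Q]]
    proof (rule fdet_cong)
      fix i l assume il: "i < n" "l < n"
      have e: "(M * ?Q) $$ (i, l) = (\<Sum>k<n. M $$ (i, k) * (if l < m then ?X $$ (k, h l) else of_bool (k = y l)))"
        unfolding mult_mat_index[OF M Q il] using il by (intro sum.cong refl) simp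
      show "(if l < m then B $$ (i, h l) else M $$ (i, y l)) = (M * ?Q) $$ (i, l)"
      proof (cases "l < m")
        case True
        then have "h l < n" using hy by (auto simp: PiE_iff)
        then show ?thesis using True e mult_mat_index[OF M X il(1)] MX by simp
      next
        case False
        then have "y l < n" using hy il by (auto simp: PiE_iff)
        then show ?thesis using False e
          by (simp add: of_bool_def if_distrib[where f = "\<lambda>x. _ * x"] sum.delta' cong: if_cong)
      qed
    qed
    also have "\<dots> = det M * fdet n (\<lambda>i l. if l < m then ?X $$ (i, h l) else of_bool (i = y l))"
      unfolding det_mult[OF M Q] by (simp add: fdet_def)
    finally show ?thesis by (simp add: norm_mult power_mult_distrib)
  qed
  then show ?thesis
    by (simp add: minor_poly_def sq_minors_def sum_distrib_right mult.assoc)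
qed

lemma measurable_gmat_component:
  "i < n \<Longrightarrow> j < n \<Longrightarrow> (\<lambda>A. A (i, j)) \<in> borel_measurable (gmat n)"
  by (intro measurable_component_singleton[where M = "\<lambda>_. cgauss", simplified]) auto

text \<open>The mean of the numerator over the mean of the denominator: the origin of the gain of an
  inverse factor.\<close>

lemma inverse_coeff_eq:
  assumes "1 \<le> n" "m \<le> n"
  shows "((1 / sqrt n)\<^sup>2 ^ (n - m) * (fact n / fact m)) / ((1 / sqrt n)\<^sup>2 ^ n * fact n) = real n ^ m / fact m"
proof -
  have "(real n) ^ n = real n ^ m * real n ^ (n - m)" using assms by (simp add: power_add[symmetric])
  then show ?thesis using assms by (simp add: power_divide field_simps)
qed

text \<open>A plain factor costs one \<open>fluct_bound\<close>. An inverse factor costs two, one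
  for the numerator and one for the determinant.\<close>

lemma minor_poly_step:
  assumes n: "1 \<le> n" and e: "e \<in> {1, -1}" and B: "B \<in> carrier_mat n n" and b: "\<And>m. 0 < b m"
  shows "(\<integral>\<^sup>+A. dist_ln (minor_poly n b (\<lambda>i j. (mat_powi (scaled_mat n A) e * B) $$ (i, j)))
      (minor_poly n (\<lambda>m. b m * gain n e m) (\<lambda>i j. B $$ (i, j))) \<partial>gmat n) \<le> ennreal (2 * fluct_bound n)"
proof -
  define c where "c = 1 / sqrt (real n)"
  have c: "0 < c" using n by (simp add: c_def)
  have M: "scaled_mat n A \<in> carrier_mat n n" for A by simp
  have fb: "0 \<le> fluct_bound n"
    unfolding fluct_bound_def using n by (intro mult_nonneg_nonneg sum_nonneg) auto
  from e consider "e = 1" | "e = -1" by auto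
  then show ?thesis
  proof cases
    case 1
    have "minor_poly n b (\<lambda>i j. (mat_powi (scaled_mat n A) e * B) $$ (i, j))
      = minor_poly n b (\<lambda>i l. c * (\<Sum>j<n. A (i, j) * B $$ (j, l)))" for A
      unfolding 1 mat_powi_sign[OF M]
    proof (rule minor_poly_B_cong)
      fix i j assume ij: "i < n" "j < n"
      show "(scaled_mat n A * B) $$ (i, j) = c * (\<Sum>k<n. A (i, k) * B $$ (k, j))"
        unfolding mult_mat_index[OF M B ij] using ij by (simp add: sum_distrib_left c_def)
    qed
    moreover have "minor_poly n (\<lambda>m. b m * gain n e m) (\<lambda>i j. B $$ (i, j))
      = minor_poly n (\<lambda>m. b m * (c\<^sup>2 ^ m * (fact n / fact (n - m)))) (\<lambda>i j. B $$ (i, j))"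
      using n by (intro minor_poly_cong) (simp add: gain_def 1 c_def power_divide)
    ultimately have "(\<integral>\<^sup>+A. dist_ln (minor_poly n b (\<lambda>i j. (mat_powi (scaled_mat n A) e * B) $$ (i, j)))
      (minor_poly n (\<lambda>m. b m * gain n e m) (\<lambda>i j. B $$ (i, j))) \<partial>gmat n) \<le> ennreal (fluct_bound n)"
      using minor_poly_product_step[OF b c, where B = "\<lambda>i j. B $$ (i, j)"] by simp
    also have "\<dots> \<le> ennreal (2 * fluct_bound n)" using fb by (intro ennreal_leI) simp
    finally show ?thesis .
  next
    case 2
    let ?F = "\<lambda>A. \<Sum>m\<le>n. b m * (\<Sum>h\<in>Pi\<^sub>E {..<m} (\<lambda>_. {..<n}). \<Sum>y\<in>Pi\<^sub>E {m..<n} (\<lambda>_. {..<n}).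
        (cmod (fdet n (\<lambda>i l. if l < m then B $$ (i, h l) else complex_of_real c * A (i, y l))))\<^sup>2)"
    let ?E = "minor_poly n (\<lambda>m. b m * (c\<^sup>2 ^ (n - m) * (fact n / fact m))) (\<lambda>i j. B $$ (i, j))"
    let ?d = "\<lambda>A. (cmod (fdet n (\<lambda>i l. complex_of_real c * A (i, l))))\<^sup>2"
    have target: "minor_poly n (\<lambda>m. b m * gain n e m) (\<lambda>i j. B $$ (i, j)) = ?E / (c\<^sup>2 ^ n * fact n)"
    proof -
      have "minor_poly n (\<lambda>m. b m * gain n e m) (\<lambda>i j. B $$ (i, j))
        = minor_poly n (\<lambda>m. b m * (c\<^sup>2 ^ (n - m) * (fact n / fact m)) * (1 / (c\<^sup>2 ^ n * fact n))) (\<lambda>i j. B $$ (i, j))"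
      proof (rule minor_poly_cong)
        fix m assume "m \<le> n"
        have g: "gain n e m = (c\<^sup>2 ^ (n - m) * (fact n / fact m)) / (c\<^sup>2 ^ n * fact n)"
          unfolding c_def inverse_coeff_eq[OF n \<open>m \<le> n\<close>] by (simp add: gain_def 2)
        show "b m * gain n e m = b m * (c\<^sup>2 ^ (n - m) * (fact n / fact m)) * (1 / (c\<^sup>2 ^ n * fact n))"
          unfolding g by simp
      qed
      then show ?thesis unfolding minor_poly_cmult by simp
    qed
    have "dist_ln (minor_poly n b (\<lambda>i j. (mat_powi (scaled_mat n A) e * B) $$ (i, j)))
        (minor_poly n (\<lambda>m. b m * gain n e m) (\<lambda>i j. B $$ (i, j)))
      \<le> dist_ln (?F A) ?E + dist_ln (?d A) (c\<^sup>2 ^ n * fact n)" for A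
    proof (cases "det (scaled_mat n A) = 0")
      case True
      \<comment> \<open>For a singular matrix the determinant term on the right is infinite and
        bounds any value.\<close>
      then have "?d A = 0"
        unfolding det_eq_fdet[OF M] by (simp add: c_def cong: fdet_cong)
      then show ?thesis by (simp add: dist_ln_def)
    next
      case False
      have d: "?d A = (cmod (det (scaled_mat n A)))\<^sup>2"
        unfolding det_eq_fdet[OF M] c_def by (intro arg_cong[where f = "\<lambda>x. (cmod x)\<^sup>2"] fdet_cong) simp
      have "?F A = (\<Sum>m\<le>n. b m * (\<Sum>h\<in>Pi\<^sub>E {..<m} (\<lambda>_. {..<n}). \<Sum>y\<in>Pi\<^sub>E {m..<n} (\<lambda>_. {..<n}).
        (cmod (fdet n (\<lambda>i l. if l < m then B $$ (i, h l) else scaled_mat n A $$ (i, y l))))\<^sup>2))"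
      proof (intro sum.cong refl arg_cong2[where f = "(*)"] arg_cong[where f = "\<lambda>x. (cmod x)\<^sup>2"] fdet_cong)
        fix m h y i l assume "y \<in> Pi\<^sub>E {m..<n} (\<lambda>_. {..<n})" "i < n" "l < n"
        then show "(if l < m then B $$ (i, h l) else complex_of_real c * A (i, y l))
          = (if l < m then B $$ (i, h l) else scaled_mat n A $$ (i, y l))"
          by (auto simp: c_def PiE_iff)
      qed
      also have "\<dots> = minor_poly n b (\<lambda>i j. (mat_inv (scaled_mat n A) * B) $$ (i, j)) * ?d A"
        unfolding d by (rule minor_poly_mat_inv[OF M False B])
      finally have "minor_poly n b (\<lambda>i j. (mat_powi (scaled_mat n A) e * B) $$ (i, j)) = ?F A / ?d A"
        using False by (simp only: 2 mat_powi_sign[OF M] d) simp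
      then show ?thesis unfolding target using c by (simp only:) (rule dist_ln_divide, simp)
    qed
    then have "(\<integral>\<^sup>+A. dist_ln (minor_poly n b (\<lambda>i j. (mat_powi (scaled_mat n A) e * B) $$ (i, j)))
        (minor_poly n (\<lambda>m. b m * gain n e m) (\<lambda>i j. B $$ (i, j))) \<partial>gmat n)
      \<le> (\<integral>\<^sup>+A. dist_ln (?F A) ?E + dist_ln (?d A) (c\<^sup>2 ^ n * fact n) \<partial>gmat n)"
      by (rule nn_integral_mono)
    also have "\<dots> = (\<integral>\<^sup>+A. dist_ln (?F A) ?E \<partial>gmat n) + (\<integral>\<^sup>+A. dist_ln (?d A) (c\<^sup>2 ^ n * fact n) \<partial>gmat n)"
    proof (rule nn_integral_add)
      have "(\<lambda>A. fdet n (\<lambda>i l. if l < m then B $$ (i, h l) else complex_of_real c * A (i, y l))) \<in> borel_measurable (gmat n)"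
        if "y \<in> Pi\<^sub>E {m..<n} (\<lambda>_. {..<n})" for m h y
      proof (rule measurable_fdet)
        fix i l assume il: "i < n" "l < n"
        then have "l < m \<or> y l < n" using that by (auto simp: PiE_iff)
        then show "(\<lambda>A. if l < m then B $$ (i, h l) else complex_of_real c * A (i, y l)) \<in> borel_measurable (gmat n)"
          using measurable_gmat_component[OF il(1), of "y l"] by (cases "l < m") auto
      qed
      then have "?F \<in> borel_measurable (gmat n)"
        by (intro borel_measurable_sum borel_measurable_times borel_measurable_const borel_measurable_power) simp
      then show "(\<lambda>A. dist_ln (?F A) ?E) \<in> borel_measurable (gmat n)" by simp
      have "(\<lambda>A. fdet n (\<lambda>i l. complex_of_real c * A (i, l))) \<in> borel_measurable (gmat n)"
        by (rule measurable_fdet) (use measurable_gmat_component in auto)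
      then show "(\<lambda>A. dist_ln (?d A) (c\<^sup>2 ^ n * fact n)) \<in> borel_measurable (gmat n)" by simp
    qed
    also have "\<dots> \<le> ennreal (fluct_bound n) + ennreal (fluct_bound n)"
      by (intro add_mono minor_poly_inverse_step[OF b c] det_gauss_concentration[OF c])
    also have "\<dots> = ennreal (2 * fluct_bound n)" using fb by (simp flip: ennreal_plus)
    finally show ?thesis .
  qed
qed

text \<open>For an inverse factor, det (z - M\<inverse> B) = det (z M - B) / det M, with both
  determinants affine in the rows of the Gaussian matrix. In either case the mean is a combination
  of sums of squared minors of \<open>B\<close>, so the characteristic polynomial occurs for the
  leftmost factor only.\<close>

lemma char_step:
  assumes n: "1 \<le> n" and e: "e \<in> {1, -1}" and B: "B \<in> carrier_mat n n" and z: "z \<noteq> 0"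
  shows "(\<integral>\<^sup>+A. dist_ln ((cmod (det (z \<cdot>\<^sub>m 1\<^sub>m n - mat_powi (scaled_mat n A) e * B)))\<^sup>2)
      (minor_poly n (\<lambda>m. ((cmod z)\<^sup>2) ^ (n - m) / fact n * gain n e m) (\<lambda>i j. B $$ (i, j))) \<partial>gmat n) \<le> ennreal (2 * fluct_bound n)"
proof -
  define c where "c = 1 / sqrt (real n)"
  have c: "0 < c" using n by (simp add: c_def)
  have M: "scaled_mat n A \<in> carrier_mat n n" for A by simp
  have zc: "z \<cdot>\<^sub>m 1\<^sub>m n \<in> carrier_mat n n" by simp
  have fb: "0 \<le> fluct_bound n"
    unfolding fluct_bound_def using n by (intro mult_nonneg_nonneg sum_nonneg) auto
  from e consider "e = 1" | "e = -1" by auto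
  then show ?thesis
  proof cases
    case 1
    have "det (z \<cdot>\<^sub>m 1\<^sub>m n - mat_powi (scaled_mat n A) e * B)
      = fdet n (\<lambda>i l. z * of_bool (i = l) - c * (\<Sum>j<n. A (i, j) * B $$ (j, l)))" for A
    proof -
      note MB = mult_carrier_mat[OF M B, of A]
      show ?thesis
        unfolding 1 mat_powi_sign[OF M] det_eq_fdet[OF minus_carrier_mat[OF MB]]
      proof (rule fdet_cong)
        fix i l assume il: "i < n" "l < n"
        have "(z \<cdot>\<^sub>m 1\<^sub>m n - scaled_mat n A * B) $$ (i, l) = (z \<cdot>\<^sub>m 1\<^sub>m n) $$ (i, l) - (scaled_mat n A * B) $$ (i, l)"
          by (rule index_minus_mat(1)) (use MB il in auto)
        also have "\<dots> = z * of_bool (i = l) - c * (\<Sum>j<n. A (i, j) * B $$ (j, l))"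
          unfolding mult_mat_index[OF M B il] using il by (simp add: sum_distrib_left c_def)
        finally show "(z \<cdot>\<^sub>m 1\<^sub>m n - scaled_mat n A * B) $$ (i, l) = z * of_bool (i = l) - c * (\<Sum>j<n. A (i, j) * B $$ (j, l))" .
      qed
    qed
    moreover have "minor_poly n (\<lambda>m. ((cmod z)\<^sup>2) ^ (n - m) / fact n * gain n e m) (\<lambda>i j. B $$ (i, j))
      = minor_poly n (\<lambda>m. ((cmod z)\<^sup>2) ^ (n - m) * c\<^sup>2 ^ m / fact (n - m)) (\<lambda>i j. B $$ (i, j))"
      using n by (intro minor_poly_cong) (simp add: gain_def 1 c_def power_divide)
    ultimately have "(\<integral>\<^sup>+A. dist_ln ((cmod (det (z \<cdot>\<^sub>m 1\<^sub>m n - mat_powi (scaled_mat n A) e * B)))\<^sup>2)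
      (minor_poly n (\<lambda>m. ((cmod z)\<^sup>2) ^ (n - m) / fact n * gain n e m) (\<lambda>i j. B $$ (i, j))) \<partial>gmat n) \<le> ennreal (fluct_bound n)"
      using char_product_concentration[OF z c, where B = "\<lambda>i j. B $$ (i, j)"] by simp
    also have "\<dots> \<le> ennreal (2 * fluct_bound n)" using fb by (intro ennreal_leI) simp
    finally show ?thesis .
  next
    case 2
    let ?F = "\<lambda>A. (cmod (fdet n (\<lambda>i l. z * complex_of_real c * A (i, l) - B $$ (i, l))))\<^sup>2"
    let ?E = "minor_poly n (\<lambda>m. ((cmod z)\<^sup>2 * c\<^sup>2) ^ (n - m) / fact m) (\<lambda>i j. B $$ (i, j))"
    let ?d = "\<lambda>A. (cmod (fdet n (\<lambda>i l. complex_of_real c * A (i, l))))\<^sup>2"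
    have target: "minor_poly n (\<lambda>m. ((cmod z)\<^sup>2) ^ (n - m) / fact n * gain n e m) (\<lambda>i j. B $$ (i, j)) = ?E / (c\<^sup>2 ^ n * fact n)"
    proof -
      have "minor_poly n (\<lambda>m. ((cmod z)\<^sup>2) ^ (n - m) / fact n * gain n e m) (\<lambda>i j. B $$ (i, j))
        = minor_poly n (\<lambda>m. ((cmod z)\<^sup>2 * c\<^sup>2) ^ (n - m) / fact m * (1 / (c\<^sup>2 ^ n * fact n))) (\<lambda>i j. B $$ (i, j))"
      proof (rule minor_poly_cong)
        fix m assume "m \<le> n"
        have "((cmod z)\<^sup>2 * c\<^sup>2) ^ (n - m) / fact m * (1 / (c\<^sup>2 ^ n * fact n))
          = ((cmod z)\<^sup>2) ^ (n - m) / fact n * ((c\<^sup>2 ^ (n - m) * (fact n / fact m)) / (c\<^sup>2 ^ n * fact n))"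
          by (simp add: power_mult_distrib)
        then show "((cmod z)\<^sup>2) ^ (n - m) / fact n * gain n e m = ((cmod z)\<^sup>2 * c\<^sup>2) ^ (n - m) / fact m * (1 / (c\<^sup>2 ^ n * fact n))"
          using inverse_coeff_eq[OF n \<open>m \<le> n\<close>] by (simp only: gain_def 2 c_def) simp
      qed
      then show ?thesis unfolding minor_poly_cmult by simp
    qed
    have "dist_ln ((cmod (det (z \<cdot>\<^sub>m 1\<^sub>m n - mat_powi (scaled_mat n A) e * B)))\<^sup>2)
        (minor_poly n (\<lambda>m. ((cmod z)\<^sup>2) ^ (n - m) / fact n * gain n e m) (\<lambda>i j. B $$ (i, j)))
      \<le> dist_ln (?F A) ?E + dist_ln (?d A) (c\<^sup>2 ^ n * fact n)" for A
    proof (cases "det (scaled_mat n A) = 0")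
      case True
      then have "?d A = 0"
        unfolding det_eq_fdet[OF M] by (simp add: c_def cong: fdet_cong)
      then show ?thesis by (simp add: dist_ln_def)
    next
      case False
      let ?M = "scaled_mat n A"
      have d: "?d A = (cmod (det ?M))\<^sup>2"
        unfolding det_eq_fdet[OF M] c_def by (intro arg_cong[where f = "\<lambda>x. (cmod x)\<^sup>2"] fdet_cong) simp
      let ?X = "mat_inv ?M * B"
      note X = mult_carrier_mat[OF mat_inv_carrier[OF M] B]
      have "?M * ?X = (?M * mat_inv ?M) * B"
        by (rule assoc_mult_mat[symmetric, OF M mat_inv_carrier[OF M] B])
      then have MX: "?M * ?X = B" using mat_inv_mult[OF M False] B by simp
      have "?M * (z \<cdot>\<^sub>m 1\<^sub>m n - ?X) = ?M * (z \<cdot>\<^sub>m 1\<^sub>m n) - ?M * ?X"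
        by (rule mult_minus_distrib_mat[OF M zc X])
      also have "\<dots> = z \<cdot>\<^sub>m ?M - B"
        unfolding MX using mult_smult_distrib[OF M one_carrier_mat, where k = z] by simp
      finally have Mz: "?M * (z \<cdot>\<^sub>m 1\<^sub>m n - ?X) = z \<cdot>\<^sub>m ?M - B" .
      have "det ?M * det (z \<cdot>\<^sub>m 1\<^sub>m n - ?X) = det (?M * (z \<cdot>\<^sub>m 1\<^sub>m n - ?X))"
        by (rule det_mult[OF M minus_carrier_mat[OF X], symmetric])
      also have "\<dots> = det (z \<cdot>\<^sub>m ?M - B)" by (simp only: Mz)
      also have "\<dots> = fdet n (\<lambda>i l. z * complex_of_real c * A (i, l) - B $$ (i, l))"
        unfolding det_eq_fdet[OF minus_carrier_mat[OF B]]
        by (rule fdet_cong) (use B in \<open>simp add: c_def\<close>)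
      finally have "?F A = (cmod (det ?M * det (z \<cdot>\<^sub>m 1\<^sub>m n - ?X)))\<^sup>2" by simp
      then have "(cmod (det (z \<cdot>\<^sub>m 1\<^sub>m n - mat_powi ?M e * B)))\<^sup>2 = ?F A / ?d A"
        using False by (simp only: 2 mat_powi_sign[OF M] d norm_mult power_mult_distrib) simp
      then show ?thesis unfolding target using c by (simp only:) (rule dist_ln_divide, simp)
    qed
    then have "(\<integral>\<^sup>+A. dist_ln ((cmod (det (z \<cdot>\<^sub>m 1\<^sub>m n - mat_powi (scaled_mat n A) e * B)))\<^sup>2)
        (minor_poly n (\<lambda>m. ((cmod z)\<^sup>2) ^ (n - m) / fact n * gain n e m) (\<lambda>i j. B $$ (i, j))) \<partial>gmat n)
      \<le> (\<integral>\<^sup>+A. dist_ln (?F A) ?E + dist_ln (?d A) (c\<^sup>2 ^ n * fact n) \<partial>gmat n)"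
      by (rule nn_integral_mono)
    also have "\<dots> = (\<integral>\<^sup>+A. dist_ln (?F A) ?E \<partial>gmat n) + (\<integral>\<^sup>+A. dist_ln (?d A) (c\<^sup>2 ^ n * fact n) \<partial>gmat n)"
    proof (rule nn_integral_add)
      have "(\<lambda>A. fdet n (\<lambda>i l. z * complex_of_real c * A (i, l) - B $$ (i, l))) \<in> borel_measurable (gmat n)"
        by (rule measurable_fdet) (use measurable_gmat_component in auto)
      then show "(\<lambda>A. dist_ln (?F A) ?E) \<in> borel_measurable (gmat n)" by simp
      have "(\<lambda>A. fdet n (\<lambda>i l. complex_of_real c * A (i, l))) \<in> borel_measurable (gmat n)"
        by (rule measurable_fdet) (use measurable_gmat_component in auto)
      then show "(\<lambda>A. dist_ln (?d A) (c\<^sup>2 ^ n * fact n)) \<in> borel_measurable (gmat n)" by simp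
    qed
    also have "\<dots> \<le> ennreal (fluct_bound n) + ennreal (fluct_bound n)"
      by (intro add_mono char_inverse_concentration[OF z c] det_gauss_concentration[OF c])
    also have "\<dots> = ennreal (2 * fluct_bound n)" using fb by (simp flip: ennreal_plus)
    finally show ?thesis .
  qed
qed

section \<open>Products of several factors\<close>

definition prodmat :: "nat \<Rightarrow> (nat \<Rightarrow> int) \<Rightarrow> nat list \<Rightarrow> (nat \<Rightarrow> nat \<times> nat \<Rightarrow> complex) \<Rightarrow> complex mat" where
  "prodmat n \<epsilon> js x = foldr (\<lambda>i B. mat_powi (scaled_mat n (x i)) (\<epsilon> i) * B) js (1\<^sub>m n)"

lemma prodmat_Nil: "prodmat n \<epsilon> [] x = 1\<^sub>m n"
  by (simp add: prodmat_def)

lemma prodmat_Cons: "prodmat n \<epsilon> (i # js) x = mat_powi (scaled_mat n (x i)) (\<epsilon> i) * prodmat n \<epsilon> js x"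
  by (simp add: prodmat_def)

lemma prodmat_carrier:
  assumes "\<And>i. i \<in> set js \<Longrightarrow> \<epsilon> i \<in> {1, -1}"
  shows "prodmat n \<epsilon> js x \<in> carrier_mat n n"
  using assms
proof (induction js)
  case Nil
  show ?case by (simp add: prodmat_Nil)
next
  case (Cons i js)
  have "mat_powi (scaled_mat n (x i)) (\<epsilon> i) \<in> carrier_mat n n"
    by (rule mat_powi_carrier) (use Cons.prems[of i] in simp_all)
  moreover have "prodmat n \<epsilon> js x \<in> carrier_mat n n" using Cons by simp
  ultimately show ?case unfolding prodmat_Cons by (rule mult_carrier_mat)
qed

lemma prodmat_cong:
  assumes "\<And>i. i \<in> set js \<Longrightarrow> x i = y i"
  shows "prodmat n \<epsilon> js x = prodmat n \<epsilon> js y"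
  unfolding prodmat_def using assms by (intro foldr_cong) auto

lemma measurable_prodmat:
  assumes signs: "\<And>i. i \<in> set js \<Longrightarrow> \<epsilon> i \<in> {1, -1}"
    and meas: "\<And>l i j. l \<in> set js \<Longrightarrow> i < n \<Longrightarrow> j < n \<Longrightarrow> (\<lambda>\<omega>. x \<omega> l (i, j)) \<in> borel_measurable N"
    and ij: "i < n" "j < n"
  shows "(\<lambda>\<omega>. prodmat n \<epsilon> js (x \<omega>) $$ (i, j)) \<in> borel_measurable N"
  using assms
proof (induction js arbitrary: i j)
  case Nil
  then show ?case by (simp add: prodmat_Nil)
next
  case (Cons l js)
  have M: "scaled_mat n (x \<omega> l) \<in> carrier_mat n n" for \<omega> by simp
  have el: "\<epsilon> l \<in> {1, -1}" using Cons.prems(1) by simp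
  have c1: "mat_powi (scaled_mat n (x \<omega> l)) (\<epsilon> l) \<in> carrier_mat n n" for \<omega>
    by (rule mat_powi_carrier[OF M el])
  have c2: "prodmat n \<epsilon> js (x \<omega>) \<in> carrier_mat n n" for \<omega>
    by (rule prodmat_carrier) (use Cons.prems(1) in simp)
  have sm: "(\<lambda>\<omega>. scaled_mat n (x \<omega> l) $$ (a, b)) \<in> borel_measurable N" if "a < n" "b < n" for a b
    using Cons.prems(2)[of l a b] that by simp
  have "(\<lambda>\<omega>. mat_powi (scaled_mat n (x \<omega> l)) (\<epsilon> l) $$ (a, b)) \<in> borel_measurable N" if ab: "a < n" "b < n" for a b
  proof (cases "\<epsilon> l = 1")
    case True
    then show ?thesis unfolding True mat_powi_sign(1)[OF M] by (intro sm ab)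
  next
    case False
    then have e: "\<epsilon> l = -1" using el by simp
    show ?thesis unfolding e mat_powi_sign(2)[OF M] by (rule measurable_mat_inv[OF M sm ab])
  qed
  then show ?case
    unfolding prodmat_Cons mult_mat_index[OF c1 c2 Cons.prems(3,4)]
    using Cons by (intro borel_measurable_sum borel_measurable_times) auto
qed

lemma measurable_minor_poly:
  fixes B :: "'w \<Rightarrow> nat \<Rightarrow> nat \<Rightarrow> complex"
  assumes "\<And>i j. i < n \<Longrightarrow> j < n \<Longrightarrow> (\<lambda>\<omega>. B \<omega> i j) \<in> borel_measurable N"
  shows "(\<lambda>\<omega>. minor_poly n b (B \<omega>)) \<in> borel_measurable N"
  unfolding minor_poly_def sq_minors_def
proof (intro borel_measurable_sum borel_measurable_times borel_measurable_const borel_measurable_power)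
  fix m :: nat and h y :: "nat \<Rightarrow> nat" assume h: "h \<in> Pi\<^sub>E {..<m} (\<lambda>_. {..<n})"
  have "(\<lambda>\<omega>. fdet n (\<lambda>i (l::nat). if l < m then B \<omega> i (h l) else of_bool (i = y l))) \<in> borel_measurable N"
  proof (rule measurable_fdet)
    fix i l :: nat assume il: "i < n" "l < n"
    show "(\<lambda>\<omega>. if l < m then B \<omega> i (h l) else of_bool (i = y l)) \<in> borel_measurable N"
    proof (cases "l < m")
      case True
      then have "h l < n" using h by (auto simp: PiE_iff)
      then show ?thesis using True assms[OF il(1)] by simp
    qed simp
  qed
  then show "(\<lambda>\<omega>. cmod (fdet n (\<lambda>i (l::nat). if l < m then B \<omega> i (h l) else of_bool (i = y l)))) \<in> borel_measurable N"
    by simp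
qed

abbreviation gmats :: "nat \<Rightarrow> nat set \<Rightarrow> (nat \<Rightarrow> nat \<times> nat \<Rightarrow> complex) measure" where
  "gmats n I \<equiv> \<Pi>\<^sub>M i\<in>I. gmat n"

lemma prob_space_gmat: "prob_space (gmat n)"
  by (intro prob_space_PiM prob_space_cgauss)

lemma product_prob_space_gmat: "product_prob_space (\<lambda>_::nat. gmat n)"
  by (intro product_prob_spaceI prob_space_gmat)

lemma measurable_gmats_component:
  assumes "l \<in> I" "i < n" "j < n"
  shows "(\<lambda>x. x l (i, j)) \<in> borel_measurable (gmats n I)"
  by (rule measurable_compose[OF measurable_component_singleton[OF assms(1)] measurable_gmat_component[OF assms(2,3)]])

text \<open>The leftmost factor is integrated with the others fixed, where \<open>F\<close> may be
  replaced by \<open>G\<close> at cost \<open>c1\<close>. The rest concerns \<open>G\<close> of the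
  shorter product, and the triangle inequality adds the costs.\<close>

lemma chain_step:
  fixes F G :: "complex mat \<Rightarrow> real"
  assumes j: "finite (set js)" "j \<notin> set js"
    and signs: "\<And>i. i \<in> insert j (set js) \<Longrightarrow> \<epsilon> i \<in> {1, -1}"
    and F: "\<And>B. B \<in> carrier_mat n n \<Longrightarrow>
      (\<integral>\<^sup>+A. dist_ln (F (mat_powi (scaled_mat n A) (\<epsilon> j) * B)) (G B) \<partial>gmat n) \<le> ennreal c1"
    and G: "(\<integral>\<^sup>+x. dist_ln (G (prodmat n \<epsilon> js x)) K \<partial>gmats n (set js)) \<le> ennreal c2"
    and mF: "(\<lambda>x. F (prodmat n \<epsilon> (j # js) x)) \<in> borel_measurable (gmats n (set (j # js)))"
    and mG: "(\<lambda>x. G (prodmat n \<epsilon> js x)) \<in> borel_measurable (gmats n (set js))"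
    and c: "0 \<le> c1" "0 \<le> c2"
  shows "(\<integral>\<^sup>+x. dist_ln (F (prodmat n \<epsilon> (j # js) x)) K \<partial>gmats n (set (j # js))) \<le> ennreal (c1 + c2)"
proof -
  interpret P: product_prob_space "\<lambda>_::nat. gmat n" by (rule product_prob_space_gmat)
  have gs: "prob_space (gmats n (set js))" by (intro prob_space_PiM prob_space_gmat)
  have upd: "prodmat n \<epsilon> (j # js) (x(j := A)) = mat_powi (scaled_mat n A) (\<epsilon> j) * prodmat n \<epsilon> js x" for x A
  proof -
    have "prodmat n \<epsilon> js (x(j := A)) = prodmat n \<epsilon> js x"
      by (rule prodmat_cong) (use j in auto)
    then show ?thesis by (simp add: prodmat_Cons)
  qed
  have "(\<integral>\<^sup>+x. dist_ln (F (prodmat n \<epsilon> (j # js) x)) K \<partial>gmats n (set (j # js)))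
    = (\<integral>\<^sup>+x. \<integral>\<^sup>+A. dist_ln (F (prodmat n \<epsilon> (j # js) (x(j := A)))) K \<partial>gmat n \<partial>gmats n (set js))"
    unfolding list.set
    by (rule P.product_nn_integral_insert[OF j]) (use mF in simp)
  also have "\<dots> \<le> (\<integral>\<^sup>+x. ennreal c1 + dist_ln (G (prodmat n \<epsilon> js x)) K \<partial>gmats n (set js))"
  proof (rule nn_integral_mono)
    fix x assume x: "x \<in> space (gmats n (set js))"
    let ?B = "prodmat n \<epsilon> js x"
    have B: "?B \<in> carrier_mat n n" by (rule prodmat_carrier) (use signs in auto)
    have "(\<lambda>A. x(j := A)) \<in> measurable (gmat n) (gmats n (insert j (set js)))"
      using x j(2) by (rule measurable_component_update)
    then have "(\<lambda>A. F (prodmat n \<epsilon> (j # js) (x(j := A)))) \<in> borel_measurable (gmat n)"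
      using mF by (auto intro: measurable_compose)
    then have m: "(\<lambda>A. F (mat_powi (scaled_mat n A) (\<epsilon> j) * ?B)) \<in> borel_measurable (gmat n)"
      unfolding upd .
    have "(\<integral>\<^sup>+A. dist_ln (F (prodmat n \<epsilon> (j # js) (x(j := A)))) K \<partial>gmat n)
      \<le> (\<integral>\<^sup>+A. dist_ln (F (mat_powi (scaled_mat n A) (\<epsilon> j) * ?B)) (G ?B) + dist_ln (G ?B) K \<partial>gmat n)"
      unfolding upd by (intro nn_integral_mono dist_ln_triangle)
    also have "\<dots> = (\<integral>\<^sup>+A. dist_ln (F (mat_powi (scaled_mat n A) (\<epsilon> j) * ?B)) (G ?B) \<partial>gmat n) + (\<integral>\<^sup>+A. dist_ln (G ?B) K \<partial>gmat n)"
      using m by (intro nn_integral_add) simp_all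
    also have "\<dots> \<le> ennreal c1 + dist_ln (G ?B) K"
      by (intro add_mono F B) (simp add: prob_space.emeasure_space_1[OF prob_space_gmat])
    finally show "(\<integral>\<^sup>+A. dist_ln (F (prodmat n \<epsilon> (j # js) (x(j := A)))) K \<partial>gmat n) \<le> ennreal c1 + dist_ln (G ?B) K" .
  qed
  also have "\<dots> = ennreal c1 + (\<integral>\<^sup>+x. dist_ln (G (prodmat n \<epsilon> js x)) K \<partial>gmats n (set js))"
    using mG by (subst nn_integral_add) (simp_all add: prob_space.emeasure_space_1[OF gs])
  also have "\<dots> \<le> ennreal c1 + ennreal c2" by (intro add_mono G order_refl)
  also have "\<dots> = ennreal (c1 + c2)" using c by (simp add: ennreal_plus)
  finally show ?thesis .
qed

lemma fluct_bound_nonneg: "0 \<le> fluct_bound n"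
  by (cases "n = 0") (auto simp: fluct_bound_def intro!: mult_nonneg_nonneg sum_nonneg)

text \<open>Each factor multiplies the weight of order \<open>m\<close> by its gain. At the end the
  identity matrix is left, all of whose sums of squared minors are \<open>fact n\<close>.\<close>

lemma minor_poly_chain:
  assumes n: "1 \<le> n" and signs: "\<And>i. i \<in> set js \<Longrightarrow> \<epsilon> i \<in> {1, -1}" and js: "distinct js"
    and b: "\<And>m. 0 < b m"
  shows "(\<integral>\<^sup>+x. dist_ln (minor_poly n b (\<lambda>i j. prodmat n \<epsilon> js x $$ (i, j)))
      (\<Sum>m\<le>n. b m * fact n * (\<Prod>i\<in>set js. gain n (\<epsilon> i) m)) \<partial>gmats n (set js)) \<le> ennreal (2 * real (length js) * fluct_bound n)"
  using signs js b
proof (induction js arbitrary: b)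
  case Nil
  have "minor_poly n b (\<lambda>i j. (1\<^sub>m n :: complex mat) $$ (i, j)) = minor_poly n b (\<lambda>i j. of_bool (i = j))"
    by (rule minor_poly_B_cong) simp
  also have "\<dots> = (\<Sum>m\<le>n. b m * fact n)"
    unfolding minor_poly_def by (intro sum.cong refl) (simp add: sq_minors_one)
  finally have "minor_poly n b (\<lambda>i j. (1\<^sub>m n :: complex mat) $$ (i, j)) = (\<Sum>m\<le>n. b m * fact n)" .
  moreover have "0 < (\<Sum>m\<le>n. b m * fact n)" using Nil.prems(3) by (intro sum_pos) auto
  ultimately have "dist_ln (minor_poly n b (\<lambda>i j. prodmat n \<epsilon> [] x $$ (i, j))) (\<Sum>m\<le>n. b m * fact n * (\<Prod>i\<in>set []. gain n (\<epsilon> i) m)) = 0" for x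
    by (simp add: prodmat_Nil dist_ln_self del: index_one_mat)
  then show ?case by simp
next
  case (Cons j js)
  let ?F = "\<lambda>B. minor_poly n b (\<lambda>i l. B $$ (i, l))"
  let ?G = "\<lambda>B. minor_poly n (\<lambda>m. b m * gain n (\<epsilon> j) m) (\<lambda>i l. B $$ (i, l))"
  let ?K = "\<Sum>m\<le>n. b m * fact n * (\<Prod>i\<in>set (j # js). gain n (\<epsilon> i) m)"
  have "(\<integral>\<^sup>+x. dist_ln (?F (prodmat n \<epsilon> (j # js) x)) ?K \<partial>gmats n (set (j # js)))
    \<le> ennreal (2 * fluct_bound n + 2 * real (length js) * fluct_bound n)"
  proof (rule chain_step[where G = ?G])
    show "finite (set js)" "j \<notin> set js" using Cons.prems by auto
    show "\<epsilon> i \<in> {1, -1}" if "i \<in> insert j (set js)" for i using that Cons.prems(1) by simp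
    show "(\<integral>\<^sup>+A. dist_ln (?F (mat_powi (scaled_mat n A) (\<epsilon> j) * B)) (?G B) \<partial>gmat n) \<le> ennreal (2 * fluct_bound n)"
      if "B \<in> carrier_mat n n" for B
      by (rule minor_poly_step[OF n _ that]) (use Cons.prems in auto)
    have K: "?K = (\<Sum>m\<le>n. (b m * gain n (\<epsilon> j) m) * fact n * (\<Prod>i\<in>set js. gain n (\<epsilon> i) m))"
      using Cons.prems(2) by (intro sum.cong refl) (simp add: mult_ac)
    show "(\<integral>\<^sup>+x. dist_ln (?G (prodmat n \<epsilon> js x)) ?K \<partial>gmats n (set js)) \<le> ennreal (2 * real (length js) * fluct_bound n)"
      unfolding K using Cons.prems gain_pos[OF n] by (intro Cons.IH) auto
    show "(\<lambda>x. ?F (prodmat n \<epsilon> (j # js) x)) \<in> borel_measurable (gmats n (set (j # js)))"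
      by (intro measurable_minor_poly measurable_prodmat measurable_gmats_component) (use Cons.prems in auto)
    show "(\<lambda>x. ?G (prodmat n \<epsilon> js x)) \<in> borel_measurable (gmats n (set js))"
      by (intro measurable_minor_poly measurable_prodmat measurable_gmats_component) (use Cons.prems in auto)
  qed (simp_all add: fluct_bound_nonneg)
  also have "2 * fluct_bound n + 2 * real (length js) * fluct_bound n = 2 * real (length (j # js)) * fluct_bound n"
    by (simp add: algebra_simps)
  finally show ?case .
qed

text \<open>The point \<open>z\<close> may vary with \<omega>, which later gives joint measurability
  in the matrix and in the point of the circle.\<close>

lemma measurable_det_char:
  fixes B :: "'w \<Rightarrow> complex mat"
  assumes B: "\<And>\<omega>. B \<omega> \<in> carrier_mat n n"
    and meas: "\<And>i j. i < n \<Longrightarrow> j < n \<Longrightarrow> (\<lambda>\<omega>. B \<omega> $$ (i, j)) \<in> borel_measurable N"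
    and z: "z \<in> borel_measurable N"
  shows "(\<lambda>\<omega>. det (z \<omega> \<cdot>\<^sub>m 1\<^sub>m n - B \<omega>)) \<in> borel_measurable N"
  unfolding det_eq_fdet[OF minus_carrier_mat[OF B]]
proof (rule measurable_fdet)
  fix i l assume il: "i < n" "l < n"
  have "(z \<omega> \<cdot>\<^sub>m 1\<^sub>m n - B \<omega>) $$ (i, l) = z \<omega> * of_bool (i = l) - B \<omega> $$ (i, l)" for \<omega>
    using B[of \<omega>] il by (auto simp: index_minus_mat)
  then show "(\<lambda>\<omega>. (z \<omega> \<cdot>\<^sub>m 1\<^sub>m n - B \<omega>) $$ (i, l)) \<in> borel_measurable N"
    using meas[OF il] z by simp
qed

lemma char_chain:
  assumes n: "1 \<le> n" and signs: "\<And>i. i \<in> set js \<Longrightarrow> \<epsilon> i \<in> {1, -1}" and js: "distinct js" "js \<noteq> []"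
    and z: "z \<noteq> 0"
  shows "(\<integral>\<^sup>+x. dist_ln ((cmod (det (z \<cdot>\<^sub>m 1\<^sub>m n - prodmat n \<epsilon> js x)))\<^sup>2)
      (\<Sum>m\<le>n. ((cmod z)\<^sup>2) ^ (n - m) * (\<Prod>i\<in>set js. gain n (\<epsilon> i) m)) \<partial>gmats n (set js)) \<le> ennreal (2 * real (length js) * fluct_bound n)"
proof -
  obtain j js' where eq: "js = j # js'" using js by (cases js) auto
  \<comment> \<open>The division by \<open>fact n\<close> cancels the \<open>fact n\<close> that the
    identity matrix leaves at the end of the chain.\<close>
  let ?b = "\<lambda>m. ((cmod z)\<^sup>2) ^ (n - m) / fact n * gain n (\<epsilon> j) m"
  let ?F = "\<lambda>B. (cmod (det (z \<cdot>\<^sub>m 1\<^sub>m n - B)))\<^sup>2"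
  let ?G = "\<lambda>B. minor_poly n ?b (\<lambda>i l. B $$ (i, l))"
  let ?K = "\<Sum>m\<le>n. ((cmod z)\<^sup>2) ^ (n - m) * (\<Prod>i\<in>set (j # js'). gain n (\<epsilon> i) m)"
  have sg: "\<And>i. i \<in> insert j (set js') \<Longrightarrow> \<epsilon> i \<in> {1, -1}" using signs by (simp add: eq)
  have d: "j \<notin> set js'" "distinct js'" using js by (auto simp: eq)
  have b: "0 < ?b m" for m using z gain_pos[OF n] by simp
  have "(\<integral>\<^sup>+x. dist_ln (?F (prodmat n \<epsilon> (j # js') x)) ?K \<partial>gmats n (set (j # js')))
    \<le> ennreal (2 * fluct_bound n + 2 * real (length js') * fluct_bound n)"
  proof (rule chain_step[where G = ?G])
    show "\<epsilon> i \<in> {1, -1}" if "i \<in> insert j (set js')" for i using that by (rule sg)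
    show "(\<integral>\<^sup>+A. dist_ln (?F (mat_powi (scaled_mat n A) (\<epsilon> j) * B)) (?G B) \<partial>gmat n) \<le> ennreal (2 * fluct_bound n)"
      if "B \<in> carrier_mat n n" for B
      by (rule char_step[OF n _ that z]) (rule sg, simp)
    have K: "?K = (\<Sum>m\<le>n. ?b m * fact n * (\<Prod>i\<in>set js'. gain n (\<epsilon> i) m))"
      using d by (intro sum.cong refl) simp
    show "(\<integral>\<^sup>+x. dist_ln (?G (prodmat n \<epsilon> js' x)) ?K \<partial>gmats n (set js')) \<le> ennreal (2 * real (length js') * fluct_bound n)"
      unfolding K by (rule minor_poly_chain[OF n sg d(2) b]) simp
    have "(\<lambda>x. det (z \<cdot>\<^sub>m 1\<^sub>m n - prodmat n \<epsilon> (j # js') x)) \<in> borel_measurable (gmats n (set (j # js')))"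
      by (intro measurable_det_char prodmat_carrier measurable_prodmat measurable_gmats_component borel_measurable_const)
        (use sg in auto)
    then show "(\<lambda>x. ?F (prodmat n \<epsilon> (j # js') x)) \<in> borel_measurable (gmats n (set (j # js')))" by simp
    show "(\<lambda>x. ?G (prodmat n \<epsilon> js' x)) \<in> borel_measurable (gmats n (set js'))"
      by (intro measurable_minor_poly measurable_prodmat measurable_gmats_component) (use sg in auto)
  qed (use d in \<open>simp_all add: fluct_bound_nonneg\<close>)
  also have "2 * fluct_bound n + 2 * real (length js') * fluct_bound n = 2 * real (length (j # js')) * fluct_bound n"
    by (simp add: algebra_simps)
  finally show ?thesis unfolding eq .
qed

section \<open>Logarithmic potentials\<close>

text \<open>A sum of n + 1 nonnegative terms lies between its largest term and n + 1 times it.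
  Because \<rho> decreases, the factors exceeding \<open>x\<close> form an initial segment, so the
  product of all maxima occurs among the terms.\<close>

lemma ln_sum_prod_approx:
  fixes \<rho> :: "nat \<Rightarrow> real"
  assumes pos: "\<And>l. l < n \<Longrightarrow> 0 < \<rho> l"
    and decr: "\<And>l l'. l \<le> l' \<Longrightarrow> l' < n \<Longrightarrow> \<rho> l' \<le> \<rho> l"
    and x: "0 < x"
  shows "\<bar>ln (\<Sum>m\<le>n. x ^ (n - m) * (\<Prod>l<m. \<rho> l)) - (\<Sum>l<n. ln (max x (\<rho> l)))\<bar> \<le> ln (real n + 1)"
proof -
  let ?S = "\<Sum>m\<le>n. x ^ (n - m) * (\<Prod>l<m. \<rho> l)"
  let ?P = "\<Prod>l<n. max x (\<rho> l)"
  have term_eq: "x ^ (n - m) * (\<Prod>l<m. \<rho> l) = (\<Prod>l<n. if l < m then \<rho> l else x)" if "m \<le> n" for m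
  proof -
    have "(\<Prod>l<n. if l < m then \<rho> l else x) = (\<Prod>l\<in>{..<m} \<union> {m..<n}. if l < m then \<rho> l else x)"
      using that by (intro prod.cong) auto
    also have "\<dots> = (\<Prod>l<m. if l < m then \<rho> l else x) * (\<Prod>l\<in>{m..<n}. if l < m then \<rho> l else x)"
      by (rule prod.union_disjoint) auto
    also have "\<dots> = (\<Prod>l<m. \<rho> l) * x ^ (n - m)" by simp
    finally show ?thesis by (simp add: mult.commute)
  qed
  have P: "0 < ?P" using x by (intro prod_pos) (simp add: less_max_iff_disj)
  have nn: "0 \<le> x ^ (n - m) * (\<Prod>l<m. \<rho> l)" if "m \<le> n" for m
    using that x pos by (intro mult_nonneg_nonneg prod_nonneg) (auto simp: less_imp_le)
  \<comment> \<open>The first index at which \<rho> has dropped to \<open>x\<close>, or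
    \<open>n\<close> if there is none; the disjunct \<open>m = n\<close> ensures that the minimum
    exists.\<close>
  define m where "m = (LEAST m. m = n \<or> \<rho> m \<le> x)"
  have m: "m = n \<or> \<rho> m \<le> x" unfolding m_def by (rule LeastI[of _ n]) simp
  have mn: "m \<le> n" unfolding m_def by (rule Least_le) simp
  have "?P = x ^ (n - m) * (\<Prod>l<m. \<rho> l)"
    unfolding term_eq[OF mn]
  proof (intro prod.cong refl)
    fix l assume l: "l \<in> {..<n}"
    show "max x (\<rho> l) = (if l < m then \<rho> l else x)"
    proof (cases "l < m")
      case True
      then have "\<not> (l = n \<or> \<rho> l \<le> x)" unfolding m_def by (rule not_less_Least)
      then show ?thesis using True by simp
    next
      case False
      then have "\<rho> m \<le> x" using m l by auto
      moreover have "\<rho> l \<le> \<rho> m" using False l by (intro decr) auto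
      ultimately show ?thesis using False by simp
    qed
  qed
  then have lower: "?P \<le> ?S"
    using nn mn member_le_sum[of m "{..n}" "\<lambda>m. x ^ (n - m) * (\<Prod>l<m. \<rho> l)"] by simp
  have "?S \<le> (\<Sum>m\<le>n. ?P)"
  proof (rule sum_mono)
    fix m assume "m \<in> {..n}"
    then have "m \<le> n" by simp
    show "x ^ (n - m) * (\<Prod>l<m. \<rho> l) \<le> ?P"
      unfolding term_eq[OF \<open>m \<le> n\<close>] using x pos by (intro prod_mono) (auto simp: less_imp_le)
  qed
  then have upper: "?S \<le> (real n + 1) * ?P" by (simp add: algebra_simps)
  have "ln ?P \<le> ln ?S" using lower P by simp
  moreover have "ln ?S \<le> ln ((real n + 1) * ?P)" using upper lower P by (intro ln_mono) auto
  moreover have "ln ((real n + 1) * ?P) = ln (real n + 1) + ln ?P" using P by (intro ln_mult_pos) auto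
  moreover have "ln ?P = (\<Sum>l<n. ln (max x (\<rho> l)))"
    using x by (intro ln_prod) (auto simp: less_max_iff_disj)
  ultimately show ?thesis by linarith
qed

text \<open>The quotient of the total gains of orders \<open>l + 1\<close> and \<open>l\<close> for
  \<open>p\<close> plain and \<open>q\<close> inverse factors.\<close>

definition sq_radius :: "nat \<Rightarrow> nat \<Rightarrow> nat \<Rightarrow> nat \<Rightarrow> real" where
  "sq_radius p q n l = ((real n - real l) / real n) ^ p * (real n / (real l + 1)) ^ q"

lemma sq_radius_pos: "l < n \<Longrightarrow> 0 < sq_radius p q n l"
  by (simp add: sq_radius_def)

lemma sq_radius_antimono:
  assumes "l \<le> l'" "l' < n"
  shows "sq_radius p q n l' \<le> sq_radius p q n l"
  unfolding sq_radius_def using assms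
  by (intro mult_mono power_mono divide_right_mono divide_left_mono) auto

section \<open>Jensen's formula on a circle\<close>

definition unit_unif :: "real measure" where
  "unit_unif = density lborel (indicator {0..1})"

lemma sets_unit_unif[simp, measurable_cong]: "sets unit_unif = sets borel"
  by (simp add: unit_unif_def)

lemma space_unit_unif[simp]: "space unit_unif = UNIV"
  by (simp add: unit_unif_def)

lemma prob_space_unit_unif: "prob_space unit_unif"
  by (rule prob_spaceI) (simp add: unit_unif_def emeasure_density)

definition circ :: "real \<Rightarrow> complex" where
  "circ t = exp (2 * of_real pi * \<i> * of_real t)"

lemma cmod_circ[simp]: "cmod (circ t) = 1"
  by (simp add: circ_def norm_exp)

lemma continuous_circ[continuous_intros]: "continuous_on S circ"
  unfolding circ_def by (intro continuous_intros)

lemma measurable_circ[measurable]: "circ \<in> borel_measurable borel"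
  by (intro borel_measurable_continuous_onI continuous_circ)

text \<open>By periodicity the fibre is a translate of the integers or empty, hence
  countable.\<close>

lemma AE_circ_neq: "AE t in unit_unif. circ t \<noteq> u"
proof -
  have "countable {t. circ t = u}"
  proof (cases "\<exists>t0. circ t0 = u")
    case True
    then obtain t0 where t0: "circ t0 = u" by auto
    have "{t. circ t = u} \<subseteq> (\<lambda>j::int. t0 + of_int j) ` UNIV"
    proof
      fix t assume "t \<in> {t. circ t = u}"
      then have "exp (2 * of_real pi * \<i> * of_real t) = exp (2 * of_real pi * \<i> * of_real t0)"
        using t0 by (simp add: circ_def)
      then obtain j :: int where "2 * of_real pi * \<i> * complex_of_real t = 2 * of_real pi * \<i> * of_real t0 + (of_int (2 * j) * pi) * \<i>"
        unfolding exp_eq by auto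
      then have "Im (2 * of_real pi * \<i> * complex_of_real t) = Im (2 * of_real pi * \<i> * of_real t0 + (of_int (2 * j) * pi) * \<i>)" by simp
      then have "2 * pi * t = 2 * pi * t0 + 2 * pi * of_int j" by simp
      then have "pi * t = pi * (t0 + of_int j)" by (simp add: algebra_simps)
      then have "t = t0 + of_int j" by simp
      then show "t \<in> (\<lambda>j::int. t0 + of_int j) ` UNIV" by auto
    qed
    then show ?thesis by (rule countable_subset) simp
  next
    case False
    then have "{t. circ t = u} = {}" by auto
    then show ?thesis by simp
  qed
  then have "AE t in lborel. t \<notin> {t. circ t = u}"
    by (intro AE_not_in countable_imp_null_set_lborel)
  then show ?thesis unfolding unit_unif_def by (subst AE_density) auto
qed

text \<open>The function \<open>Ln (1 - w * u)\<close> is holomorphic on the closed unit disc, so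
  its circle mean is its value 0 at the centre. The claim is the real part.\<close>

lemma circle_log_mean_lt:
  assumes w: "cmod w < 1"
  shows "(\<integral>t. ln (cmod (1 - w * circ t)) \<partial>unit_unif) = 0"
proof -
  have wu: "cmod (w * u) < 1" if "cmod u \<le> 1" for u
  proof -
    have "cmod w * cmod u \<le> cmod w * 1" by (intro mult_left_mono that) simp
    then show ?thesis using w by (simp add: norm_mult)
  qed
  \<comment> \<open>A positive real part keeps the argument away from the branch cut of
    \<open>Ln\<close>.\<close>
  have re: "0 < Re (1 - w * u)" if "cmod u \<le> 1" for u
    using wu[OF that] complex_Re_le_cmod[of "w * u"] by simp
  have nz: "1 - w * circ t \<noteq> 0" for t
  proof -
    have "0 < Re (1 - w * circ t)" by (rule re) simp
    then show ?thesis by (metis less_irrefl zero_complex.sel(1))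
  qed
  define f where "f u = Ln (1 - w * u)" for u
  have "f holomorphic_on cball 0 1"
    unfolding f_def
  proof (intro holomorphic_intros)
    fix u assume "u \<in> cball (0::complex) 1"
    then have "0 < Re (1 - w * u)" by (intro re) simp
    then show "1 - w * u \<notin> \<real>\<^sub>\<le>\<^sub>0" by (auto simp: complex_nonpos_Reals_iff)
  qed
  then have "((\<lambda>u. f u / (u - 0)) has_contour_integral (2 * of_real pi * \<i> * f 0)) (circlepath 0 1)"
    by (rule Cauchy_integral_circlepath_simple) simp
  then have "((\<lambda>t. f (circlepath 0 1 t) / circlepath 0 1 t * vector_derivative (circlepath 0 1) (at t within {0..1}))
      has_integral 0) {0..1}"
    by (simp add: has_contour_integral_def f_def)
  then have "((\<lambda>t. 2 * of_real pi * \<i> * f (circ t)) has_integral 0) {0..1}"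
    by (rule has_integral_eq[rotated])
      (simp add: vector_derivative_circlepath01, simp add: circlepath circ_def)
  then have "((\<lambda>t. 1 / (2 * of_real pi * \<i>) * (2 * of_real pi * \<i> * f (circ t))) has_integral 1 / (2 * of_real pi * \<i>) * 0) {0..1}"
    by (rule has_integral_mult_right)
  then have "((\<lambda>t. f (circ t)) has_integral 0) {0..1}" by simp
  then have "(Re \<circ> (\<lambda>t. f (circ t)) has_integral Re 0) {0..1}"
    by (rule has_integral_linear[OF _ bounded_linear_Re])
  moreover have "(Re \<circ> (\<lambda>t. f (circ t))) = (\<lambda>t. ln (cmod (1 - w * circ t)))"
  proof
    fix t
    show "(Re \<circ> (\<lambda>t. f (circ t))) t = ln (cmod (1 - w * circ t))" using nz[of t] by (simp add: f_def)
  qed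
  ultimately have int: "((\<lambda>t. ln (cmod (1 - w * circ t))) has_integral 0) {0..1}" by simp
  have cont: "continuous_on {0..1} (\<lambda>t. ln (cmod (1 - w * circ t)))"
  proof (intro continuous_intros ballI)
    fix t show "cmod (1 - w * circ t) \<noteq> 0" using nz[of t] by simp
  qed
  have "(LINT t:{0..1}|lborel. ln (cmod (1 - w * circ t))) = 0"
    using set_borel_integral_eq_integral(2)[OF borel_integrable_atLeastAtMost'[OF cont]] int by (simp add: integral_unique)
  moreover have "(\<integral>t. ln (cmod (1 - w * circ t)) \<partial>unit_unif) = (LINT t:{0..1}|lborel. ln (cmod (1 - w * circ t)))"
  proof -
    have u: "unit_unif = density lborel (\<lambda>t. ennreal (indicator {0..1} t))"
      by (simp add: unit_unif_def ennreal_indicator)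
    show ?thesis
      unfolding u set_lebesgue_integral_def by (rule integral_density) auto
  qed
  ultimately show ?thesis by simp
qed

text \<open>When |w| = 1, the logarithm has a singularity on the circle itself. The means for
  \<open>s j * w\<close> with \<open>s j\<close> increasing to 1 vanish; Fatou's lemma makes the
  limit integrable, and then dominated convergence applies.\<close>

lemma circle_log_mean_le:
  assumes w: "cmod w \<le> 1"
  shows "integrable unit_unif (\<lambda>t. ln (cmod (1 - w * circ t)))"
    and "(\<integral>t. ln (cmod (1 - w * circ t)) \<partial>unit_unif) = 0"
proof -
  interpret U: prob_space unit_unif by (rule prob_space_unit_unif)
  \<comment> \<open>The shift by 2 keeps \<open>s 0\<close> positive.\<close>
  define s where "s j = 1 - 1 / (real j + 2)" for j :: nat
  have s: "0 < s j" "s j < 1" for j by (auto simp: s_def field_simps)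
  have slim: "s \<longlonglongrightarrow> 1"
    unfolding s_def by real_asymp
  define h where "h j t = ln (cmod (1 - complex_of_real (s j) * w * circ t))" for j t
  define g where "g t = ln (cmod (1 - w * circ t))" for t
  have hm[measurable]: "h j \<in> borel_measurable unit_unif" for j unfolding h_def by measurable
  have gm[measurable]: "g \<in> borel_measurable unit_unif" unfolding g_def by measurable
  have sw: "cmod (complex_of_real (s j) * w) < 1" for j
  proof -
    have "s j * cmod w \<le> s j * 1" using s[of j] w by (intro mult_left_mono) auto
    then have "s j * cmod w < 1" using s[of j] by linarith
    then show ?thesis using s[of j] by (simp add: norm_mult)
  qed
  have mean: "(\<integral>t. h j t \<partial>unit_unif) = 0" for j
    unfolding h_def by (rule circle_log_mean_lt[OF sw])
  have nz: "AE t in unit_unif. 1 - w * circ t \<noteq> 0"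
  proof (cases "w = 0")
    case False
    have "AE t in unit_unif. circ t \<noteq> 1 / w" by (rule AE_circ_neq)
    then show ?thesis by eventually_elim (use False in \<open>auto simp: field_simps\<close>)
  qed simp
  have ub: "h j t \<le> ln 2" for j t
  proof -
    have "cmod (1 - complex_of_real (s j) * w * circ t) \<le> 1 + cmod (complex_of_real (s j) * w * circ t)"
      using norm_triangle_ineq4[of 1] by (metis norm_one)
    also have "\<dots> \<le> 2" using sw[of j] by (simp add: norm_mult)
    finally have le: "cmod (1 - complex_of_real (s j) * w * circ t) \<le> 2" .
    moreover have "complex_of_real (s j) * w * circ t \<noteq> 1" using sw[of j] by (metis cmod_circ mult.right_neutral norm_mult norm_one order_less_irrefl)
    ultimately show ?thesis unfolding h_def by (intro ln_mono) auto
  qed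
  \<comment> \<open>With |v| \<le> 1, (1 - s) |v| \<le> 1 - s |v| \<le> |1 - s v|, so |1 - v| \<le>
    2 |1 - s v|. Hence \<open>h j\<close> is bounded below by an integrable function that does not
    depend on \<open>j\<close>.\<close>
  have lb: "g t - ln 2 \<le> h j t" if "1 - w * circ t \<noteq> 0" for j t
  proof -
    let ?v = "w * circ t"
    have v: "cmod ?v \<le> 1" using w by (simp add: norm_mult)
    have "cmod (1 - ?v) \<le> cmod (1 - s j * ?v) + cmod (s j * ?v - ?v)"
      using norm_triangle_ineq[of "1 - s j * ?v" "s j * ?v - ?v"] by simp
    also have "cmod (s j * ?v - ?v) = (1 - s j) * cmod ?v"
    proof -
      have "s j * ?v - ?v = - (complex_of_real (1 - s j) * ?v)" by (simp add: algebra_simps)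
      then show ?thesis using s[of j] by (simp only: norm_minus_cancel norm_mult norm_of_real)
    qed
    also have "(1 - s j) * cmod ?v \<le> 1 - s j * cmod ?v"
      using v by (simp add: algebra_simps)
    also have "1 - s j * cmod ?v \<le> cmod (1 - s j * ?v)"
      using norm_triangle_ineq2[of 1 "s j * ?v"] s[of j] by (simp add: norm_mult)
    finally have "cmod (1 - ?v) \<le> 2 * cmod (1 - s j * ?v)" by simp
    moreover have "0 < cmod (1 - ?v)" using that by simp
    ultimately have "ln (cmod (1 - ?v)) \<le> ln (2 * cmod (1 - s j * ?v))" by (intro ln_mono) auto
    also have "\<dots> = ln 2 + ln (cmod (1 - s j * ?v))"
      using \<open>0 < cmod (1 - ?v)\<close> \<open>cmod (1 - ?v) \<le> 2 * cmod (1 - s j * ?v)\<close> by (intro ln_mult_pos) auto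
    finally show ?thesis by (simp add: g_def h_def mult.assoc)
  qed
  have conv: "(\<lambda>j. h j t) \<longlonglongrightarrow> g t" if "1 - w * circ t \<noteq> 0" for t
  proof -
    have "(\<lambda>j. ln (cmod (1 - complex_of_real (s j) * w * circ t))) \<longlonglongrightarrow> ln (cmod (1 - complex_of_real 1 * w * circ t))"
      using that slim by (intro tendsto_intros) auto
    then show ?thesis by (simp add: h_def g_def)
  qed
  have hint: "integrable unit_unif (h j)" for j
  proof -
    have "0 < 1 - cmod (complex_of_real (s j) * w)" using sw[of j] by simp
    moreover have "1 - cmod (complex_of_real (s j) * w) \<le> cmod (1 - complex_of_real (s j) * w * circ t)" for t
      using norm_triangle_ineq2[of 1 "complex_of_real (s j) * w * circ t"] by (simp add: norm_mult)
    ultimately have "ln (1 - cmod (complex_of_real (s j) * w)) \<le> h j t" for t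
      unfolding h_def by (intro ln_mono) auto
    then have "\<bar>h j t\<bar> \<le> max (ln 2) (- ln (1 - cmod (complex_of_real (s j) * w)))" for t
      using ub[of j t] by (auto simp: abs_le_iff le_max_iff_disj)
        (smt (verit) \<open>\<And>t. ln (1 - cmod (complex_of_real (s j) * w)) \<le> h j t\<close>)+
    then show ?thesis by (intro U.integrable_const_bound[of _ "max (ln 2) (- ln (1 - cmod (complex_of_real (s j) * w)))"]) auto
  qed
  have "(\<integral>\<^sup>+t. ennreal (ln 2 - g t) \<partial>unit_unif) = (\<integral>\<^sup>+t. liminf (\<lambda>j. ennreal (ln 2 - h j t)) \<partial>unit_unif)"
  proof (rule nn_integral_cong_AE)
    show "AE t in unit_unif. ennreal (ln 2 - g t) = liminf (\<lambda>j. ennreal (ln 2 - h j t))"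
      using nz
    proof eventually_elim
      case (elim t)
      have "(\<lambda>j. ennreal (ln 2 - h j t)) \<longlonglongrightarrow> ennreal (ln 2 - g t)"
        by (intro tendsto_ennrealI tendsto_intros conv elim)
      then show ?case by (intro lim_imp_Liminf[symmetric]) auto
    qed
  qed
  also have "\<dots> \<le> liminf (\<lambda>j. \<integral>\<^sup>+t. ennreal (ln 2 - h j t) \<partial>unit_unif)"
    by (rule nn_integral_liminf) measurable
  also have "(\<lambda>j. \<integral>\<^sup>+t. ennreal (ln 2 - h j t) \<partial>unit_unif) = (\<lambda>j. ennreal (ln 2))"
  proof
    fix j
    have "(\<integral>\<^sup>+t. ennreal (ln 2 - h j t) \<partial>unit_unif) = ennreal (\<integral>t. ln 2 - h j t \<partial>unit_unif)"
      using ub hint by (intro nn_integral_eq_integral) auto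
    then show "(\<integral>\<^sup>+t. ennreal (ln 2 - h j t) \<partial>unit_unif) = ennreal (ln 2)"
      using hint mean U.prob_space by (simp add: space_unit_unif)
  qed
  finally have fin: "(\<integral>\<^sup>+t. ennreal (ln 2 - g t) \<partial>unit_unif) \<le> ennreal (ln 2)" by (simp add: Liminf_const)
  have gub: "AE t in unit_unif. 0 \<le> ln 2 - g t"
    using nz
  proof eventually_elim
    case (elim t)
    have "g t \<le> ln 2" using conv[OF elim] ub by (intro LIMSEQ_le_const2[of "\<lambda>j. h j t"]) auto
    then show ?case by simp
  qed
  have "integrable unit_unif (\<lambda>t. ln 2 - g t)"
    using fin gub by (intro integrableI_nonneg) (auto intro: order_le_less_trans)
  then have gint: "integrable unit_unif g"
    using Bochner_Integration.integrable_diff[OF U.integrable_const[of "ln 2"], of "\<lambda>t. ln 2 - g t"] by simp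
  then show "integrable unit_unif (\<lambda>t. ln (cmod (1 - w * circ t)))" by (simp add: g_def[abs_def])
  have "(\<lambda>j. \<integral>t. h j t \<partial>unit_unif) \<longlonglongrightarrow> (\<integral>t. g t \<partial>unit_unif)"
  proof (rule integral_dominated_convergence[where w = "\<lambda>t. \<bar>g t\<bar> + 2 * ln 2"])
    show "integrable unit_unif (\<lambda>t. \<bar>g t\<bar> + 2 * ln 2)" using gint by auto
    show "AE t in unit_unif. (\<lambda>j. h j t) \<longlonglongrightarrow> g t" using nz by eventually_elim (rule conv)
    show "AE t in unit_unif. norm (h j t) \<le> \<bar>g t\<bar> + 2 * ln 2" for j
      using nz
    proof eventually_elim
      case (elim t)
      have "0 \<le> ln (2::real)" by simp
      then show ?case using lb[OF elim, of j] ub[of j t] unfolding real_norm_def by linarith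
    qed
  qed auto
  then show "(\<integral>t. ln (cmod (1 - w * circ t)) \<partial>unit_unif) = 0"
    unfolding mean g_def[symmetric] by (simp add: LIMSEQ_const_iff)
qed

text \<open>Factoring out the larger of \<open>r\<close> and |u| leaves |1 - w
  \<open>circ t\<close>| with |w| \<le> 1. If |u| \<le> r this takes a conjugation, with w =
  \<open>cnj u / r\<close>, which is permitted because \<open>circ t\<close> has modulus 1.\<close>

lemma circle_log:
  assumes r: "0 < r"
  shows "integrable unit_unif (\<lambda>t. ln (cmod (of_real r * circ t - u)))"
    and "(\<integral>t. ln (cmod (of_real r * circ t - u)) \<partial>unit_unif) = ln (max r (cmod u))"
proof -
  interpret U: prob_space unit_unif by (rule prob_space_unit_unif)
  have "\<exists>w. cmod w \<le> 1 \<and> (\<forall>t. cmod (of_real r * circ t - u) = max r (cmod u) * cmod (1 - w * circ t))"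
  proof (cases "cmod u \<le> r")
    case True
    let ?w = "cnj u / of_real r"
    have "cmod (of_real r * circ t - u) = r * cmod (1 - ?w * circ t)" for t
    proof -
      have cc: "cnj (circ t) * circ t = 1" using complex_norm_square[of "circ t"] by (simp add: mult.commute)
      have "r * cmod (1 - ?w * circ t) = cmod (cnj (of_real r * (1 - ?w * circ t)))"
        using r by (simp only: complex_mod_cnj norm_mult norm_of_real)
      also have "cnj (of_real r * (1 - ?w * circ t)) = of_real r - u * cnj (circ t)"
        using r by (simp add: algebra_simps)
      also have "cmod (of_real r - u * cnj (circ t)) = cmod ((of_real r - u * cnj (circ t)) * circ t)"
        by (simp only: norm_mult cmod_circ)
      also have "(of_real r - u * cnj (circ t)) * circ t = of_real r * circ t - u"
        by (simp only: left_diff_distrib mult.assoc cc) simp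
      finally show ?thesis by simp
    qed
    then show ?thesis using True r by (intro exI[of _ ?w]) (simp add: norm_divide max_def)
  next
    case False
    then have u0: "u \<noteq> 0" using r by auto
    let ?w = "of_real r / u"
    have "cmod (of_real r * circ t - u) = cmod u * cmod (1 - ?w * circ t)" for t
    proof -
      have "u * (1 - ?w * circ t) = - (of_real r * circ t - u)" using u0 by (simp add: field_simps)
      then show ?thesis by (metis norm_minus_cancel norm_mult)
    qed
    then show ?thesis using False r u0 by (intro exI[of _ ?w]) (simp add: norm_divide max_def)
  qed
  then obtain w where w: "cmod w \<le> 1" and eq: "\<And>t. cmod (of_real r * circ t - u) = max r (cmod u) * cmod (1 - w * circ t)"
    by blast
  have mx: "0 < max r (cmod u)" using r by simp
  \<comment> \<open>Where the argument of the logarithm vanishes, the product rule would fail for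
    the default value of \<open>ln 0\<close>; this concerns a null set only.\<close>
  have "AE t in unit_unif. circ t \<noteq> u / of_real r" by (rule AE_circ_neq)
  then have ae: "AE t in unit_unif. ln (max r (cmod u)) + ln (cmod (1 - w * circ t)) = ln (cmod (of_real r * circ t - u))"
  proof eventually_elim
    case (elim t)
    then have "of_real r * circ t - u \<noteq> 0" using r by (auto simp: field_simps)
    then have "0 < cmod (1 - w * circ t)" using eq[of t] by auto
    then show ?case unfolding eq using mx by (intro ln_mult_pos[symmetric])
  qed
  have m: "(\<lambda>t. ln (cmod (of_real r * circ t - u))) \<in> borel_measurable unit_unif" by measurable
  have i: "integrable unit_unif (\<lambda>t. ln (max r (cmod u)) + ln (cmod (1 - w * circ t)))"
    using circle_log_mean_le(1)[OF w] by auto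
  show "integrable unit_unif (\<lambda>t. ln (cmod (of_real r * circ t - u)))"
    by (rule integrable_cong_AE_imp[OF i m ae])
  have "(\<integral>t. ln (cmod (of_real r * circ t - u)) \<partial>unit_unif) = (\<integral>t. ln (max r (cmod u)) + ln (cmod (1 - w * circ t)) \<partial>unit_unif)"
    using ae i m by (intro integral_cong_AE) (auto intro: borel_measurable_integrable)
  also have "\<dots> = ln (max r (cmod u))"
    using circle_log_mean_le[OF w] U.prob_space by simp
  finally show "(\<integral>t. ln (cmod (of_real r * circ t - u)) \<partial>unit_unif) = ln (max r (cmod u))" .
qed

text \<open>The three claims share one induction: the product rule for logarithms needs the product
  over the smaller multiset to be nonzero almost everywhere.\<close>

lemma circle_log_prod_mset:
  assumes r: "0 < r"
  shows "integrable unit_unif (\<lambda>t. ln (cmod (\<Prod>u\<in>#S. (of_real r * circ t - u))))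
    \<and> (\<integral>t. ln (cmod (\<Prod>u\<in>#S. (of_real r * circ t - u))) \<partial>unit_unif) = (\<Sum>u\<in>#S. ln (max r (cmod u)))
    \<and> (AE t in unit_unif. (\<Prod>u\<in>#S. (of_real r * circ t - u)) \<noteq> 0)"
proof (induction S)
  case empty
  show ?case by simp
next
  case (add u S)
  let ?P = "\<lambda>S t. \<Prod>u\<in>#S. (of_real r * circ t - u)"
  have nz: "AE t in unit_unif. of_real r * circ t - u \<noteq> 0"
    using AE_circ_neq[of "u / of_real r"] by eventually_elim (use r in \<open>auto simp: field_simps\<close>)
  have nzS: "AE t in unit_unif. ?P S t \<noteq> 0" using add by simp
  have ae: "AE t in unit_unif. ln (cmod (of_real r * circ t - u)) + ln (cmod (?P S t)) = ln (cmod (?P (add_mset u S) t))"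
    using nz nzS
  proof eventually_elim
    case (elim t)
    then show ?case by (simp add: norm_mult ln_mult_pos)
  qed
  have i: "integrable unit_unif (\<lambda>t. ln (cmod (of_real r * circ t - u)) + ln (cmod (?P S t)))"
    using add circle_log(1)[OF r] by (intro Bochner_Integration.integrable_add) auto
  have mP: "?P S' \<in> borel_measurable unit_unif" for S'
    by (induction S') auto
  have m: "(\<lambda>t. ln (cmod (?P (add_mset u S) t))) \<in> borel_measurable unit_unif"
    by (intro borel_measurable_ln measurable_compose[OF mP borel_measurable_norm])
  have "integrable unit_unif (\<lambda>t. ln (cmod (?P (add_mset u S) t)))"
    by (rule integrable_cong_AE_imp[OF i m ae])
  moreover have "(\<integral>t. ln (cmod (?P (add_mset u S) t)) \<partial>unit_unif) = (\<integral>t. ln (cmod (of_real r * circ t - u)) + ln (cmod (?P S t)) \<partial>unit_unif)"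
    by (rule integral_cong_AE[OF m borel_measurable_integrable[OF i]]) (use ae in \<open>auto elim: eventually_mono\<close>)
  moreover have "\<dots> = ln (max r (cmod u)) + (\<Sum>u\<in>#S. ln (max r (cmod u)))"
    using add circle_log[OF r, of u] by (subst Bochner_Integration.integral_add) auto
  moreover have "AE t in unit_unif. ?P (add_mset u S) t \<noteq> 0"
    using nz nzS by eventually_elim simp
  ultimately show ?case by simp
qed

lemma poly_eq_prod_mset:
  assumes "lead_coeff P = (1 :: complex)"
  shows "poly P z = (\<Prod>u\<in>#proots P. (z - u))"
proof -
  have "P = (\<Prod>u\<in>#proots P. [:-u, 1:])"
    using complex_poly_decompose_multiset[of P] assms by simp
  then have "poly P z = poly (\<Prod>u\<in>#proots P. [:-u, 1:]) z" by simp
  also have "\<dots> = (\<Prod>u\<in>#proots P. (z - u))"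
    by (simp add: poly_prod_mset)
  finally show ?thesis .
qed

lemma ln_power2: "0 \<le> a \<Longrightarrow> ln (a\<^sup>2) = 2 * ln (a :: real)"
  by (cases "a = 0") (simp_all add: ln_realpow)

lemma circle_log_poly:
  assumes r: "0 < r" and P: "lead_coeff P = (1 :: complex)"
  shows "integrable unit_unif (\<lambda>t. ln ((cmod (poly P (of_real r * circ t)))\<^sup>2))"
    and "(\<integral>t. ln ((cmod (poly P (of_real r * circ t)))\<^sup>2) \<partial>unit_unif) = (\<Sum>u\<in>#proots P. ln (max (r\<^sup>2) ((cmod u)\<^sup>2)))"
proof -
  note * = circle_log_prod_mset[OF r, of "proots P", folded poly_eq_prod_mset[OF P]]
  have sq: "ln (max (r\<^sup>2) ((cmod u)\<^sup>2)) = 2 * ln (max r (cmod u))" for u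
  proof -
    have "max (r\<^sup>2) ((cmod u)\<^sup>2) = (max r (cmod u))\<^sup>2"
      using r by (auto simp: max_def power_mono_iff)
    then show ?thesis using r by (simp add: ln_power2)
  qed
  show "integrable unit_unif (\<lambda>t. ln ((cmod (poly P (of_real r * circ t)))\<^sup>2))"
    unfolding ln_power2[OF norm_ge_zero] using * by simp
  show "(\<integral>t. ln ((cmod (poly P (of_real r * circ t)))\<^sup>2) \<partial>unit_unif) = (\<Sum>u\<in>#proots P. ln (max (r\<^sup>2) ((cmod u)\<^sup>2)))"
    unfolding ln_power2[OF norm_ge_zero] sq using * by (simp add: sum_mset_distrib_left multiset.map_comp o_def)
qed

text \<open>By Jensen's formula the difference is a circle mean of a difference of logarithms, and
  \<open>dist_ln\<close> dominates the modulus of the latter pointwise.\<close>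

lemma log_potential_bound:
  assumes r: "0 < r" and P: "lead_coeff P = (1 :: complex)"
  shows "ennreal \<bar>(\<Sum>u\<in>#proots P. ln (max (r\<^sup>2) ((cmod u)\<^sup>2))) - ln K\<bar>
    \<le> (\<integral>\<^sup>+t. dist_ln ((cmod (poly P (of_real r * circ t)))\<^sup>2) K \<partial>unit_unif)"
proof -
  interpret U: prob_space unit_unif by (rule prob_space_unit_unif)
  let ?L = "\<lambda>t. ln ((cmod (poly P (of_real r * circ t)))\<^sup>2)"
  note i = circle_log_poly(1)[OF r P]
  have "(\<Sum>u\<in>#proots P. ln (max (r\<^sup>2) ((cmod u)\<^sup>2))) - ln K = (\<integral>t. ?L t - ln K \<partial>unit_unif)"
    using i circle_log_poly(2)[OF r P] U.prob_space by simp
  also have "\<bar>\<dots>\<bar> \<le> (\<integral>t. \<bar>?L t - ln K\<bar> \<partial>unit_unif)" by (rule integral_abs_bound)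
  finally have "ennreal \<bar>(\<Sum>u\<in>#proots P. ln (max (r\<^sup>2) ((cmod u)\<^sup>2))) - ln K\<bar> \<le> ennreal (\<integral>t. \<bar>?L t - ln K\<bar> \<partial>unit_unif)"
    by (rule ennreal_leI)
  also have "\<dots> = (\<integral>\<^sup>+t. ennreal \<bar>?L t - ln K\<bar> \<partial>unit_unif)"
    using i by (intro nn_integral_eq_integral[symmetric]) auto
  also have "\<dots> \<le> (\<integral>\<^sup>+t. dist_ln ((cmod (poly P (of_real r * circ t)))\<^sup>2) K \<partial>unit_unif)"
    by (intro nn_integral_mono) (simp add: dist_ln_def)
  finally show ?thesis .
qed

text \<open>The gain of a plain factor is a falling factorial over a power of \<open>n\<close>, that
  of an inverse a power of \<open>n\<close> over a factorial. Both are products over l < m, and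
  collecting the factors with equal \<open>l\<close> gives \<open>sq_radius\<close>.\<close>

lemma prod_gain:
  assumes I: "finite I" and m: "m \<le> n" and n: "1 \<le> n" and signs: "\<And>i. i \<in> I \<Longrightarrow> \<epsilon> i \<in> {1, -1}"
  shows "(\<Prod>i\<in>I. gain n (\<epsilon> i) m) = (\<Prod>l<m. sq_radius (card {i \<in> I. \<epsilon> i = 1}) (card I - card {i \<in> I. \<epsilon> i = 1}) n l)"
proof -
  have g1: "gain n 1 m = (\<Prod>l<m. (real n - real l) / real n)"
    using m
  proof (induction m)
    case (Suc m)
    define d where "d = real (n - m)"
    have d: "d \<noteq> 0" using Suc.prems by (simp add: d_def)
    have "fact (n - m) = d * fact (n - Suc m)"
      using Suc.prems by (simp add: fact_reduce[of "n - m"] d_def)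
    then have "gain n 1 (Suc m) = gain n 1 m * (d / real n)"
      using d by (simp add: gain_def)
    then show ?case using Suc by (simp add: d_def of_nat_diff)
  qed (simp add: gain_def)
  have g2: "gain n (-1) m = (\<Prod>l<m. real n / (real l + 1))"
  proof (induction m)
    case (Suc m)
    have "gain n (-1) (Suc m) = gain n (-1) m * (real n / (real m + 1))"
      by (simp add: gain_def times_divide_times_eq mult.commute add.commute)
    then show ?case using Suc by simp
  qed (simp add: gain_def)
  have "(\<Prod>i\<in>I. gain n (\<epsilon> i) m) = (\<Prod>i\<in>I. \<Prod>l<m. if \<epsilon> i = 1 then (real n - real l) / real n else real n / (real l + 1))"
  proof (rule prod.cong[OF refl])
    fix i assume "i \<in> I"
    then have "\<epsilon> i = 1 \<or> \<epsilon> i = -1" using signs by auto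
    then show "gain n (\<epsilon> i) m = (\<Prod>l<m. if \<epsilon> i = 1 then (real n - real l) / real n else real n / (real l + 1))"
      by (auto simp: g1 g2)
  qed
  also have "\<dots> = (\<Prod>l<m. \<Prod>i\<in>I. if \<epsilon> i = 1 then (real n - real l) / real n else real n / (real l + 1))"
    by (rule prod.swap)
  also have "\<dots> = (\<Prod>l<m. sq_radius (card {i \<in> I. \<epsilon> i = 1}) (card I - card {i \<in> I. \<epsilon> i = 1}) n l)"
  proof (rule prod.cong[OF refl])
    fix l
    have e1: "I \<inter> {i. \<epsilon> i = 1} = {i \<in> I. \<epsilon> i = 1}" by auto
    have "card (I \<inter> - {i. \<epsilon> i = 1}) = card (I - {i \<in> I. \<epsilon> i = 1})" by (rule arg_cong[where f = card]) auto
    also have "\<dots> = card I - card {i \<in> I. \<epsilon> i = 1}" using I by (intro card_Diff_subset) auto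
    finally show "(\<Prod>i\<in>I. if \<epsilon> i = 1 then (real n - real l) / real n else real n / (real l + 1))
      = sq_radius (card {i \<in> I. \<epsilon> i = 1}) (card I - card {i \<in> I. \<epsilon> i = 1}) n l"
      by (simp only: prod.If_cases[OF I] prod_constant e1 sq_radius_def)
  qed
  finally show ?thesis .
qed

section \<open>Eigenvalue counts\<close>

lemma distr_mat_entries:
  assumes M: "prob_space M" and n: "1 \<le> n" and X: "gaussian_matrix M n X"
  shows "(\<lambda>\<omega>. mat_entries n (X \<omega>)) \<in> measurable M (\<Pi>\<^sub>M ij\<in>{..<n} \<times> {..<n}. borel)"
    and "distr M (\<Pi>\<^sub>M ij\<in>{..<n} \<times> {..<n}. borel) (\<lambda>\<omega>. mat_entries n (X \<omega>)) = gmat n"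
proof -
  interpret prob_space M by fact
  let ?E = "{..<n} \<times> {..<n}"
  have d: "distributed M lborel (\<lambda>\<omega>. X \<omega> $$ e) std_complex_gaussian_density" if "e \<in> ?E" for e
    using X that by (auto simp: gaussian_matrix_def)
  have rv: "random_variable borel (\<lambda>\<omega>. X \<omega> $$ e)" if "e \<in> ?E" for e
    using distributed_measurable[OF d[OF that]] by simp
  have dist: "distr M borel (\<lambda>\<omega>. X \<omega> $$ e) = cgauss" if "e \<in> ?E" for e
  proof -
    have "distr M borel (\<lambda>\<omega>. X \<omega> $$ e) = distr M lborel (\<lambda>\<omega>. X \<omega> $$ e)"
      by (rule distr_cong) auto
    then show ?thesis using d[OF that] by (simp add: distributed_def)
  qed
  show "(\<lambda>\<omega>. mat_entries n (X \<omega>)) \<in> measurable M (\<Pi>\<^sub>M ij\<in>?E. borel)"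
    unfolding mat_entries_def by (rule measurable_restrict) (rule rv)
  have ne: "?E \<noteq> {}" using n by (auto simp: lessThan_empty_iff)
  have "indep_vars (\<lambda>_. borel) (\<lambda>ij \<omega>. X \<omega> $$ ij) ?E" using X by (simp add: gaussian_matrix_def)
  then have "distr M (\<Pi>\<^sub>M i\<in>?E. borel) (\<lambda>\<omega>. \<lambda>ij\<in>?E. X \<omega> $$ ij) = (\<Pi>\<^sub>M i\<in>?E. distr M borel (\<lambda>\<omega>. X \<omega> $$ i))"
    by (subst (asm) indep_vars_iff_distr_eq_PiM'[OF ne]) (use rv in auto)
  also have "\<dots> = gmat n" by (rule PiM_cong) (use dist in auto)
  finally show "distr M (\<Pi>\<^sub>M ij\<in>?E. borel) (\<lambda>\<omega>. mat_entries n (X \<omega>)) = gmat n"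
    by (simp add: mat_entries_def)
qed

lemma sets_gmats: "sets (gmats n I) = sets (\<Pi>\<^sub>M i\<in>I. \<Pi>\<^sub>M ij\<in>{..<n} \<times> {..<n}. borel)"
  by (intro sets_PiM_cong refl) simp_all

lemma distr_independent_matrices:
  assumes M: "prob_space M" and n: "1 \<le> n" and I: "I \<noteq> {}"
    and X: "\<And>i. i \<in> I \<Longrightarrow> gaussian_matrix M n (X i)" and ind: "indep_matrices M n X I"
  shows "(\<lambda>\<omega>. \<lambda>i\<in>I. mat_entries n (X i \<omega>)) \<in> measurable M (gmats n I)"
    and "distr M (gmats n I) (\<lambda>\<omega>. \<lambda>i\<in>I. mat_entries n (X i \<omega>)) = gmats n I"
proof -
  interpret prob_space M by fact
  let ?B = "\<Pi>\<^sub>M ij\<in>{..<n} \<times> {..<n}. (borel :: complex measure)"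
  have rv: "random_variable ?B (\<lambda>\<omega>. mat_entries n (X i \<omega>))" if "i \<in> I" for i
    by (rule distr_mat_entries(1)[OF M n X[OF that]])
  have "(\<lambda>\<omega>. \<lambda>i\<in>I. mat_entries n (X i \<omega>)) \<in> measurable M (\<Pi>\<^sub>M i\<in>I. ?B)"
    by (rule measurable_restrict) (rule rv)
  then show "(\<lambda>\<omega>. \<lambda>i\<in>I. mat_entries n (X i \<omega>)) \<in> measurable M (gmats n I)"
    unfolding measurable_cong_sets[OF refl sets_gmats] .
  have "indep_vars (\<lambda>_. ?B) (\<lambda>i \<omega>. mat_entries n (X i \<omega>)) I" using ind by (simp add: indep_matrices_def)
  then have "distr M (\<Pi>\<^sub>M i\<in>I. ?B) (\<lambda>\<omega>. \<lambda>i\<in>I. mat_entries n (X i \<omega>)) = (\<Pi>\<^sub>M i\<in>I. distr M ?B (\<lambda>\<omega>. mat_entries n (X i \<omega>)))"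
    by (subst (asm) indep_vars_iff_distr_eq_PiM'[OF I]) (use rv in auto)
  also have "\<dots> = gmats n I" by (rule PiM_cong) (use distr_mat_entries(2)[OF M n X] in auto)
  also have "distr M (\<Pi>\<^sub>M i\<in>I. ?B) (\<lambda>\<omega>. \<lambda>i\<in>I. mat_entries n (X i \<omega>)) = distr M (gmats n I) (\<lambda>\<omega>. \<lambda>i\<in>I. mat_entries n (X i \<omega>))"
    by (rule distr_cong) (simp_all only: sets_gmats refl)
  finally show "distr M (gmats n I) (\<lambda>\<omega>. \<lambda>i\<in>I. mat_entries n (X i \<omega>)) = gmats n I" .
qed

lemma scaled_mat_entries:
  assumes "X \<in> carrier_mat n n"
  shows "scaled_mat n (mat_entries n X) = complex_of_real (1 / sqrt n) \<cdot>\<^sub>m X"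
  by (rule eq_matI) (use assms in \<open>auto simp: mat_entries_def\<close>)

lemma signed_product_eq_prodmat:
  assumes "\<And>i. i \<in> {1..k} \<Longrightarrow> X i \<in> carrier_mat n n"
  shows "signed_product n k \<epsilon> X = prodmat n \<epsilon> [1..<Suc k] (\<lambda>i. mat_entries n (X i))"
  unfolding signed_product_def prodmat_def
proof (rule foldr_cong[OF refl refl])
  fix i B assume "i \<in> set [1..<Suc k]"
  then have "X i \<in> carrier_mat n n" by (intro assms) auto
  then show "mat_powi (complex_of_real (1 / sqrt (real n)) \<cdot>\<^sub>m X i) (\<epsilon> i) * B = mat_powi (scaled_mat n (mat_entries n (X i))) (\<epsilon> i) * B"
    by (simp only: scaled_mat_entries)
qed

section \<open>Potential and counting function of the eigenvalues\<close>

lemma poly_char_poly: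
  assumes "B \<in> carrier_mat n n"
  shows "poly (char_poly B) z = det (z \<cdot>\<^sub>m 1\<^sub>m n - (B :: complex mat))"
proof -
  have "- char_matrix B z = z \<cdot>\<^sub>m 1\<^sub>m n - B"
    by (rule eq_matI) (use assms in \<open>auto simp: char_matrix_def\<close>)
  then show ?thesis by (simp add: char_poly_matrix[OF assms])
qed

lemma lead_coeff_char_poly:
  assumes "B \<in> carrier_mat n n"
  shows "lead_coeff (char_poly B) = (1 :: complex)"
  using degree_monic_char_poly[OF assms] by auto

lemma size_eigenvalue_mset:
  assumes "B \<in> carrier_mat n n"
  shows "size (eigenvalue_mset B) = n"
  using degree_monic_char_poly[OF assms] by (simp add: eigenvalue_mset_def size_proots_complex)

definition log_potential :: "complex multiset \<Rightarrow> real \<Rightarrow> real" where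
  "log_potential S x = (\<Sum>u\<in>#S. ln (max x ((cmod u)\<^sup>2)))"

definition radial_count :: "complex multiset \<Rightarrow> real \<Rightarrow> real" where
  "radial_count S x = real (size {#u \<in># S. (cmod u)\<^sup>2 \<le> x#})"

lemma log_potential_add: "log_potential (add_mset u S) x = ln (max x ((cmod u)\<^sup>2)) + log_potential S x"
  by (simp add: log_potential_def)

lemma radial_count_add: "radial_count (add_mset u S) x = of_bool ((cmod u)\<^sup>2 \<le> x) + radial_count S x"
  by (simp add: radial_count_def)

text \<open>As a function of ln x, each summand ln (max x v) is convex and piecewise linear, with
  slope 0 below v and slope 1 above it. The count is thus the right derivative of the potential in
  ln x, and difference quotients lie between its values at the endpoints.\<close>

lemma log_potential_diff_bounds:
  assumes "0 < a" "a < b"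
  shows "radial_count S a * ln (b / a) \<le> log_potential S b - log_potential S a" "log_potential S b - log_potential S a \<le> radial_count S b * ln (b / a)"
proof -
  have "radial_count S a * ln (b / a) \<le> log_potential S b - log_potential S a \<and> log_potential S b - log_potential S a \<le> radial_count S b * ln (b / a)"
  proof (induction S)
    case empty
    then show ?case by (simp add: radial_count_def log_potential_def)
  next
    case (add u S)
    let ?v = "(cmod u)\<^sup>2"
    have l: "ln (b / a) = ln b - ln a" using assms by (intro ln_divide_pos) auto
    have la: "ln a \<le> ln b" using assms by simp
    have "of_bool (?v \<le> a) * ln (b / a) \<le> ln (max b ?v) - ln (max a ?v)
      \<and> ln (max b ?v) - ln (max a ?v) \<le> of_bool (?v \<le> b) * ln (b / a)"
    proof -
      consider "?v \<le> a" | "a < ?v" "?v \<le> b" | "b < ?v" by linarith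
      then show ?thesis
      proof cases
        case 2
        have "ln a \<le> ln ?v" by (intro ln_mono; use 2 assms in linarith)
        moreover have "ln ?v \<le> ln b" by (intro ln_mono; use 2 assms in linarith)
        ultimately show ?thesis using 2 l by (simp add: max_def)
      qed (use assms l la in \<open>auto simp: max_def\<close>)
    qed
    then show ?case using add by (simp add: log_potential_add radial_count_add distrib_right)
  qed
  then show "radial_count S a * ln (b / a) \<le> log_potential S b - log_potential S a" "log_potential S b - log_potential S a \<le> radial_count S b * ln (b / a)" by auto
qed

text \<open>Eigenvalues are not chosen measurably. The potential is measurable as a parameter integral, and the
  count inherits this as its right derivative in \<open>ln x\<close>.\<close>

lemma radial_count_eq_log_potential_derivative:
  assumes x: "0 < x"
  shows "(\<lambda>j. (log_potential S (x * exp (1 / real (Suc j))) - log_potential S x) * real (Suc j)) \<longlonglongrightarrow> radial_count S x"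
proof (induction S)
  case empty
  then show ?case by (simp add: radial_count_def log_potential_def)
next
  case (add u S)
  let ?v = "(cmod u)\<^sup>2"
  let ?y = "\<lambda>j. x * exp (1 / real (Suc j))"
  have "(\<lambda>j. (ln (max (?y j) ?v) - ln (max x ?v)) * real (Suc j)) \<longlonglongrightarrow> of_bool (?v \<le> x)"
  proof (cases "?v \<le> x")
    case True
    have "(ln (max (?y j) ?v) - ln (max x ?v)) * real (Suc j) = 1" for j
    proof -
      have "x * 1 \<le> ?y j" using x by (intro mult_left_mono) auto
      then have "max (?y j) ?v = ?y j" using True by simp
      moreover have "ln (?y j) = ln x + 1 / real (Suc j)" using x by (simp add: ln_mult_pos)
      ultimately show ?thesis using True by (simp add: max_def)
    qed
    then show ?thesis using True by simp
  next
    case False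
    have "?y \<longlonglongrightarrow> x * exp 0"
      by (intro tendsto_intros LIMSEQ_Suc lim_1_over_n)
    then have "eventually (\<lambda>j. ?y j < ?v) sequentially"
      using False by (intro order_tendstoD(2)) auto
    then have "eventually (\<lambda>j. 0 = (ln (max (?y j) ?v) - ln (max x ?v)) * real (Suc j)) sequentially"
      by eventually_elim (use False in \<open>simp add: max_def\<close>)
    then show ?thesis using False by (simp add: tendsto_eventually eventually_mono)
  qed
  from tendsto_add[OF this add] show ?case
    by (simp add: log_potential_add radial_count_add algebra_simps)
qed

text \<open>The derivative in ln x says nothing at 0, where right continuity takes its
  place.\<close>

lemma radial_count_at_zero: "(\<lambda>j. radial_count S (1 / real (Suc j))) \<longlonglongrightarrow> radial_count S 0"
proof (induction S)
  case (add u S)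
  have "(\<lambda>j. of_bool ((cmod u)\<^sup>2 \<le> 1 / real (Suc j)) :: real) \<longlonglongrightarrow> of_bool ((cmod u)\<^sup>2 \<le> 0)"
  proof (cases "u = 0")
    case False
    have "(\<lambda>j. 1 / real (Suc j)) \<longlonglongrightarrow> 0" by (intro LIMSEQ_Suc lim_1_over_n)
    then have "eventually (\<lambda>j. 1 / real (Suc j) < (cmod u)\<^sup>2) sequentially"
      using False by (intro order_tendstoD(2)) auto
    then have "eventually (\<lambda>j. of_bool ((cmod u)\<^sup>2 \<le> 1 / real (Suc j)) = (0::real)) sequentially"
      by eventually_elim auto
    then show ?thesis using False by (simp add: tendsto_eventually)
  qed simp
  from tendsto_add[OF this add] show ?case by (simp only: radial_count_add)
qed (simp add: radial_count_def)

lemma radial_count_mono: "x \<le> y \<Longrightarrow> radial_count S x \<le> radial_count S y"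
  by (induction S) (auto simp: radial_count_add, simp add: radial_count_def)

lemma measurable_log_potential_eigenvalues:
  fixes P :: "'w \<Rightarrow> complex mat"
  assumes P: "\<And>\<omega>. P \<omega> \<in> carrier_mat n n"
    and meas: "\<And>i j. i < n \<Longrightarrow> j < n \<Longrightarrow> (\<lambda>\<omega>. P \<omega> $$ (i, j)) \<in> borel_measurable M"
    and x: "0 < x"
  shows "(\<lambda>\<omega>. log_potential (eigenvalue_mset (P \<omega>)) x) \<in> borel_measurable M"
proof -
  interpret U: prob_space unit_unif by (rule prob_space_unit_unif)
  define r where "r = sqrt x"
  have r: "0 < r" "r\<^sup>2 = x" using x by (auto simp: r_def)
  have eq: "log_potential (eigenvalue_mset (P \<omega>)) x = (\<integral>t. ln ((cmod (det ((of_real r * circ t) \<cdot>\<^sub>m 1\<^sub>m n - P \<omega>)))\<^sup>2) \<partial>unit_unif)" for \<omega>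
    using circle_log_poly(2)[OF r(1) lead_coeff_char_poly[OF P]]
    by (simp add: log_potential_def eigenvalue_mset_def r poly_char_poly[OF P])
  have "(\<lambda>p. det ((of_real r * circ (snd p)) \<cdot>\<^sub>m 1\<^sub>m n - P (fst p))) \<in> borel_measurable (M \<Otimes>\<^sub>M unit_unif)"
    by (rule measurable_det_char) (use P meas in \<open>auto intro: measurable_compose[OF measurable_fst]\<close>)
  then have "(\<lambda>(\<omega>, t). ln ((cmod (det ((of_real r * circ t) \<cdot>\<^sub>m 1\<^sub>m n - P \<omega>)))\<^sup>2)) \<in> borel_measurable (M \<Otimes>\<^sub>M unit_unif)"
    by (simp add: case_prod_beta)
  then show ?thesis unfolding eq by (rule U.borel_measurable_lebesgue_integral)
qed

lemma measurable_radial_count_eigenvalues: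
  fixes P :: "'w \<Rightarrow> complex mat"
  assumes P: "\<And>\<omega>. P \<omega> \<in> carrier_mat n n"
    and meas: "\<And>i j. i < n \<Longrightarrow> j < n \<Longrightarrow> (\<lambda>\<omega>. P \<omega> $$ (i, j)) \<in> borel_measurable M"
  shows "(\<lambda>\<omega>. radial_count (eigenvalue_mset (P \<omega>)) x) \<in> borel_measurable M"
proof -
  have pos: "(\<lambda>\<omega>. radial_count (eigenvalue_mset (P \<omega>)) x) \<in> borel_measurable M" if x: "0 < x" for x
    by (rule borel_measurable_LIMSEQ_real[OF radial_count_eq_log_potential_derivative[OF x]])
      (use x in \<open>intro borel_measurable_times borel_measurable_diff borel_measurable_const measurable_log_potential_eigenvalues[OF P meas], auto\<close>)
  consider "0 < x" | "x = 0" | "x < 0" by linarith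
  then show ?thesis
  proof cases
    case 2
    show ?thesis unfolding 2
      by (rule borel_measurable_LIMSEQ_real[OF radial_count_at_zero]) (rule pos, simp)
  next
    case 3
    then have "radial_count S x = 0" for S
      by (induction S) (auto simp: radial_count_add not_le intro: less_le_trans[OF _ zero_le_power2], simp add: radial_count_def)
    then show ?thesis by simp
  qed (rule pos)
qed

section \<open>The limiting distribution\<close>

text \<open>Telescoping, since 1 / sqrt d \<le> 2 (sqrt d - sqrt (d - 1)).\<close>

lemma sum_inverse_sqrt_le: "(\<Sum>d\<in>{1..n}. 1 / sqrt (real d)) \<le> 2 * sqrt (real n)"
proof (induction n)
  case (Suc n)
  define s t where "s = sqrt (real n)" and "t = sqrt (real (Suc n))"
  have t: "0 < t" "s \<le> t" "0 \<le> s" "t * t = s * s + 1" by (auto simp: s_def t_def)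
  have "0 \<le> (t - s)\<^sup>2" by simp
  then have "1 \<le> (2 * (t - s)) * t"
    using t(4) by (simp add: power2_eq_square algebra_simps)
  then have "1 / t \<le> 2 * (t - s)" using t(1) by (simp only: pos_divide_le_eq)
  then show ?case using Suc by (simp add: s_def t_def)
qed simp

lemma fluct_bound_sublinear: "(\<lambda>n. (real k * fluct_bound n + ln (real n + 1)) / real n) \<longlonglongrightarrow> 0"
proof (rule tendsto_sandwich[of "\<lambda>_. 0"])
  let ?u = "\<lambda>n. (real k * ((100 + 32 * ln (real n)) * (2 * sqrt (real n))) + ln (real n + 1)) / real n"
  show "eventually (\<lambda>n. 0 \<le> (real k * fluct_bound n + ln (real n + 1)) / real n) sequentially"
    using eventually_gt_at_top[of 0]
    by eventually_elim (auto simp: fluct_bound_def intro!: divide_nonneg_nonneg add_nonneg_nonneg mult_nonneg_nonneg sum_nonneg)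
  show "eventually (\<lambda>n. (real k * fluct_bound n + ln (real n + 1)) / real n \<le> ?u n) sequentially"
    using eventually_gt_at_top[of 0]
    by eventually_elim (auto simp: fluct_bound_def intro!: divide_right_mono mult_left_mono sum_inverse_sqrt_le[simplified])
  show "?u \<longlonglongrightarrow> 0" by real_asymp
qed simp

section \<open>The limit distribution function and its grid approximation\<close>

definition radial_map :: "nat \<Rightarrow> nat \<Rightarrow> real \<Rightarrow> real" where
  "radial_map p q u = u ^ p * (1 / (1 - u)) ^ q"

definition radial_cdf :: "nat \<Rightarrow> nat \<Rightarrow> real \<Rightarrow> real" where
  "radial_cdf p q x = measure lborel {u \<in> {0..1}. radial_map p q u \<le> x}"

lemma measurable_radial_map[measurable]: "radial_map p q \<in> borel_measurable borel"
  unfolding radial_map_def by measurable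

lemma radial_set_measurable: "{u \<in> {0..1}. radial_map p q u \<le> x} \<in> sets borel"
  by measurable

lemma Icc_fmeasurable: "{a..b::real} \<in> fmeasurable lborel"
  by (intro fmeasurableI) (auto simp: emeasure_lborel_Icc_eq)

lemma radial_set_fmeasurable: "{u \<in> {0..1}. radial_map p q u \<le> x} \<in> fmeasurable lborel"
proof (rule fmeasurableI2[of "{0..1}"])
  show "{u \<in> {0..1}. radial_map p q u \<le> x} \<in> sets lborel" using radial_set_measurable by simp
qed (auto simp: Icc_fmeasurable)

text \<open>With \<open>l\<close> the least index whose value is at most \<open>b\<close>, at most n
  - l indices count. By monotonicity, every \<open>u\<close> up to (n - l - 1) / n has a value of
  \<open>radial_map\<close> below that of index \<open>l\<close>; the missing grid cell costs 1 /
  n.\<close>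

lemma card_sq_radius_le_upper:
  assumes n: "1 \<le> n"
  shows "real (card {l \<in> {..<n}. sq_radius p q n l \<le> b}) / n \<le> radial_cdf p q b + 1 / n"
proof (cases "{l \<in> {..<n}. sq_radius p q n l \<le> b} = {}")
  case True
  show ?thesis unfolding True by (simp add: radial_cdf_def)
next
  case False
  let ?C = "{l \<in> {..<n}. sq_radius p q n l \<le> b}"
  have fin: "finite ?C" by simp
  define l where "l = Min ?C"
  have l: "l < n" "sq_radius p q n l \<le> b" using Min_in[OF fin False] by (auto simp: l_def)
  have "?C \<subseteq> {l..<n}" using Min_le[OF fin] by (auto simp: l_def)
  then have "card ?C \<le> n - l" using card_mono[of "{l..<n}" ?C] by simp
  then have C: "real (card ?C) \<le> real n - real l" using l by linarith
  \<comment> \<open>On this interval both u \<le> (n - l) / n and 1 - u \<ge> (l + 1) / n hold. The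
    two factors of \<open>sq_radius\<close> use grid points one cell apart, and the second condition
    determines the endpoint.\<close>
  let ?e = "(real n - real l - 1) / real n"
  have "{0..?e} \<subseteq> {u \<in> {0..1}. radial_map p q u \<le> b}"
  proof
    fix u assume u: "u \<in> {0..?e}"
    have "u * real n \<le> real n - real l - 1" using u n by (simp add: field_simps)
    then have u1: "(real l + 1) / real n \<le> 1 - u" using n by (simp add: field_simps)
    have "u \<le> (real n - real l) / real n" using \<open>u * real n \<le> real n - real l - 1\<close> n by (simp add: field_simps)
    moreover have l0: "0 < (real l + 1) / real n" using n by simp
    moreover have u0: "0 < 1 - u" using l0 u1 by linarith
    moreover have "1 / (1 - u) \<le> real n / (real l + 1)"
    proof -
      have "1 / (1 - u) \<le> 1 / ((real l + 1) / real n)"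
        using u1 u0 l0 by (intro divide_left_mono mult_pos_pos) auto
      then show ?thesis by simp
    qed
    ultimately have "radial_map p q u \<le> sq_radius p q n l"
      unfolding radial_map_def sq_radius_def using u
      by (intro mult_mono power_mono) auto
    then show "u \<in> {u \<in> {0..1}. radial_map p q u \<le> b}" using u u0 l by auto
  qed
  then have "measure lborel {0..?e} \<le> radial_cdf p q b"
    unfolding radial_cdf_def by (intro measure_mono_fmeasurable radial_set_fmeasurable) auto
  moreover have "measure lborel {0..?e} = ?e" using l n by simp
  ultimately have "?e \<le> radial_cdf p q b" by simp
  moreover have "real (card ?C) / n \<le> ?e + 1 / n"
    using C n by (simp add: field_simps)
  ultimately show ?thesis by linarith
qed

lemma radial_cdf_le_1: "radial_cdf p q x \<le> 1"
proof -
  have "radial_cdf p q x \<le> measure lborel {0..1::real}"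
    unfolding radial_cdf_def using radial_set_measurable
    by (intro measure_mono_fmeasurable) (auto simp: Icc_fmeasurable)
  then show ?thesis by simp
qed

text \<open>With \<open>l\<close> the largest index whose value exceeds \<open>a\<close>, every
  \<open>u\<close> strictly between (n - l) / n and 1 has a value above \<open>a\<close>, so the
  sublevel set has measure at most (n - l) / n.\<close>

lemma card_sq_radius_le_lower:
  assumes n: "1 \<le> n"
  shows "radial_cdf p q a - 1 / n \<le> real (card {l \<in> {..<n}. sq_radius p q n l \<le> a}) / n"
proof -
  let ?D = "{l \<in> {..<n}. sq_radius p q n l \<le> a}" and ?C = "{l \<in> {..<n}. a < sq_radius p q n l}"
  have "card {..<n} = card (?D \<union> ?C)" by (rule arg_cong[where f = card]) auto
  also have "\<dots> = card ?D + card ?C" by (rule card_Un_disjoint) auto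
  finally have DC: "n = card ?D + card ?C" by simp
  show ?thesis
  proof (cases "?C = {}")
    case True
    then have "card ?D = n" using DC by (simp only: card.empty)
    then have "real (card ?D) / n = 1" using n by simp
    moreover have "0 \<le> 1 / real n" by simp
    ultimately show ?thesis using radial_cdf_le_1[of p q a] by linarith
  next
    case False
    have fin: "finite ?C" by simp
    define l where "l = Max ?C"
    have l: "l < n" "a < sq_radius p q n l" using Max_in[OF fin False] by (auto simp: l_def)
    have "?C \<subseteq> {..l}" using Max_ge[OF fin] by (auto simp: l_def)
    then have "card ?C \<le> l + 1" using card_mono[of "{..l}" ?C] by simp
    then have C: "real n \<le> real (card ?D) + real l + 1" using DC by linarith
    let ?e = "(real n - real l) / real n"
    \<comment> \<open>At \<open>u = 1\<close> the quotient 1 / (1 - u) has the default value 0, so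
      this point may belong to the sublevel set; it has measure zero.\<close>
    have "{u \<in> {0..1}. radial_map p q u \<le> a} \<subseteq> {0..?e} \<union> {1}"
    proof
      fix u assume u: "u \<in> {u \<in> {0..1}. radial_map p q u \<le> a}"
      show "u \<in> {0..?e} \<union> {1}"
      proof (rule ccontr)
        assume "u \<notin> {0..?e} \<union> {1}"
        then have u2: "?e < u" "u < 1" using u by auto
        have u1: "1 - u \<le> (real l + 1) / real n"
        proof -
          have "real n - real l \<le> u * real n" using u2 n by (simp add: field_simps)
          then have "(1 - u) * real n \<le> real l + 1" by (simp add: algebra_simps)
          then show ?thesis using n by (simp add: field_simps)
        qed
        have "real n / (real l + 1) \<le> 1 / (1 - u)"
        proof -
          have "1 / ((real l + 1) / real n) \<le> 1 / (1 - u)" using u1 u2 n by (intro divide_left_mono) auto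
          then show ?thesis by simp
        qed
        then have "sq_radius p q n l \<le> radial_map p q u"
          unfolding radial_map_def sq_radius_def using u u2 l
          by (intro mult_mono power_mono) auto
        then show False using u l by auto
      qed
    qed
    moreover have "{0..?e} \<union> {1} \<in> fmeasurable lborel"
      using Icc_fmeasurable[of 1 1] by (intro fmeasurable.Un Icc_fmeasurable) simp
    ultimately have "radial_cdf p q a \<le> measure lborel ({0..?e} \<union> {1})"
      unfolding radial_cdf_def using radial_set_measurable[of p q a]
      by (intro measure_mono_fmeasurable) simp_all
    also have "\<dots> \<le> measure lborel {0..?e} + measure lborel {1::real}"
      by (rule measure_Un_le) auto
    also have "\<dots> = ?e" using l n by simp
    finally have "radial_cdf p q a \<le> ?e" .
    moreover have "(real n - real l - 1) / n \<le> real (card ?D) / n"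
      using C by (intro divide_right_mono) auto
    then have "?e - 1 / n \<le> real (card ?D) / n" by (simp add: diff_divide_distrib)
    ultimately show ?thesis by linarith
  qed
qed

lemma radial_cdf_nonpos:
  assumes "x \<le> 0"
  shows "radial_cdf p q x = 0"
proof -
  \<comment> \<open>On the open interval the map is positive. Only \<open>u = 0\<close> and, through
    division by zero, \<open>u = 1\<close> can have value 0.\<close>
  have "{u \<in> {0..1}. radial_map p q u \<le> x} \<subseteq> {0, 1}"
  proof
    fix u assume u: "u \<in> {u \<in> {0..1}. radial_map p q u \<le> x}"
    show "u \<in> {0, 1}"
    proof (rule ccontr)
      assume "u \<notin> {0, 1}"
      then have "0 < u" "u < 1" using u by auto
      then have "0 < radial_map p q u" by (simp add: radial_map_def)
      then show False using u assms by auto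
    qed
  qed
  then have "radial_cdf p q x \<le> measure lborel {0, 1::real}"
    unfolding radial_cdf_def using radial_set_measurable[of p q x]
    by (intro measure_mono_fmeasurable) (auto simp: fmeasurable_def emeasure_lborel_countable)
  also have "\<dots> = 0" by (simp add: measure_def emeasure_lborel_countable)
  finally show ?thesis by (simp add: radial_cdf_def order_antisym)
qed

text \<open>The comparison of \<open>F n\<close> with \<open>H\<close> loses a shift from
  \<open>a\<close> to \<open>b\<close> and an error that grows as b / a approaches 1. The two
  arguments are therefore fixed near \<open>x\<close> by continuity of \<open>H\<close> before
  \<open>n\<close> tends to infinity. Arguments up to 0, out of reach of the comparison, are covered
  by \<open>neg\<close> and \<open>H0\<close>.\<close>

lemma LIMSEQ_cdf_squeeze:
  fixes F :: "nat \<Rightarrow> real \<Rightarrow> real" and H :: "real \<Rightarrow> real"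
  assumes cont: "isCont H x"
    and mono: "\<And>n x y. 1 \<le> n \<Longrightarrow> x \<le> y \<Longrightarrow> F n x \<le> F n y"
    and nonneg: "\<And>n x. 1 \<le> n \<Longrightarrow> 0 \<le> F n x" and neg: "\<And>n x. 1 \<le> n \<Longrightarrow> x < 0 \<Longrightarrow> F n x = 0"
    and H0: "\<And>x. x \<le> 0 \<Longrightarrow> H x = 0"
    and upper: "\<And>n a b. 1 \<le> n \<Longrightarrow> 0 < a \<Longrightarrow> a < b \<Longrightarrow> F n a \<le> H b + \<delta> n * (1 + 1 / ln (b / a))"
    and lower: "\<And>n a b. 1 \<le> n \<Longrightarrow> 0 < a \<Longrightarrow> a < b \<Longrightarrow> H a - \<delta> n * (1 + 1 / ln (b / a)) \<le> F n b"
    and \<delta>: "\<delta> \<longlonglongrightarrow> 0"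
  shows "(\<lambda>n. F n x) \<longlonglongrightarrow> H x"
proof (rule LIMSEQ_I)
  fix e :: real assume e: "0 < e"
  obtain d where d: "0 < d" "\<And>y. \<bar>y - x\<bar> < d \<Longrightarrow> \<bar>H y - H x\<bar> < e / 2"
    using cont e unfolding isCont_def LIM_def by (metis (no_types, lifting) dist_real_def dist_self half_gt_zero)
  have small: "\<exists>n0. \<forall>n\<ge>n0. \<delta> n * (1 + 1 / ln (b / a)) < e / 2" for a b :: real
  proof -
    have "(\<lambda>n. \<delta> n * (1 + 1 / ln (b / a))) \<longlonglongrightarrow> 0 * (1 + 1 / ln (b / a))" by (intro tendsto_intros \<delta>)
    then have "eventually (\<lambda>n. \<delta> n * (1 + 1 / ln (b / a)) < e / 2) sequentially"
      using e by (intro order_tendstoD(2)) auto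
    then show ?thesis by (simp add: eventually_sequentially)
  qed
  show "\<exists>n0. \<forall>n\<ge>n0. norm (F n x - H x) < e"
  proof (cases "x < 0")
    case True
    then show ?thesis using neg H0[of x] e by (intro exI[of _ 1]) auto
  next
    case False
    then have x: "0 \<le> x" by simp
    \<comment> \<open>As \<open>x\<close> may be 0, a positive \<open>a\<close> slightly above
      \<open>x\<close> is used, together with monotonicity of \<open>F n\<close>.\<close>
    define a b where "a = x + d / 4" and "b = x + d / 2"
    have ab: "0 < a" "a < b" "x \<le> a" "\<bar>b - x\<bar> < d" using d x by (auto simp: a_def b_def)
    obtain n1 where n1: "\<And>n. n1 \<le> n \<Longrightarrow> \<delta> n * (1 + 1 / ln (b / a)) < e / 2" using small by blast
    have up: "F n x < H x + e" if n: "1 \<le> n" "n1 \<le> n" for n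
    proof -
      have "F n x \<le> F n a" by (rule mono[OF n(1) ab(3)])
      also have "\<dots> \<le> H b + \<delta> n * (1 + 1 / ln (b / a))" by (rule upper[OF n(1) ab(1,2)])
      finally show ?thesis using d(2)[OF ab(4)] n1[OF n(2)] by linarith
    qed
    have "\<exists>n2. \<forall>n\<ge>n2. 1 \<le> n \<longrightarrow> H x - e < F n x"
    proof (cases "x = 0")
      case True
      have "H x - e < F n x" if "1 \<le> n" for n
        using H0[of x] nonneg[OF that, of x] e True by simp
      then show ?thesis by blast
    next
      case False
      \<comment> \<open>The maximum with x / 2 keeps \<open>a'\<close> positive.\<close>
      define a' where "a' = max (x / 2) (x - d / 2)"
      have a': "0 < a'" "a' < x" "\<bar>a' - x\<bar> < d" using x False d by (auto simp: a'_def max_def)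
      obtain n2 where n2: "\<And>n. n2 \<le> n \<Longrightarrow> \<delta> n * (1 + 1 / ln (x / a')) < e / 2" using small by blast
      have "H x - e < F n x" if n: "1 \<le> n" "n2 \<le> n" for n
        using lower[OF n(1) a'(1,2)] d(2)[OF a'(3)] n2[OF n(2)] by linarith
      then show ?thesis by blast
    qed
    then obtain n2 where n2: "\<And>n. n2 \<le> n \<Longrightarrow> 1 \<le> n \<Longrightarrow> H x - e < F n x" by blast
    show ?thesis
    proof (intro exI[of _ "max 1 (max n1 n2)"] allI impI)
      fix n assume "max 1 (max n1 n2) \<le> n"
      then have "1 \<le> n" "n1 \<le> n" "n2 \<le> n" by auto
      then show "norm (F n x - H x) < e" using up[of n] n2[of n] by (simp add: abs_less_iff)
    qed
  qed
qed

section \<open>Comparison of the eigenvalues with the grid\<close>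

lemma log_potential_image_mset_set: "log_potential (image_mset f (mset_set A)) x = (\<Sum>l\<in>A. ln (max x ((cmod (f l))\<^sup>2)))"
  by (simp add: log_potential_def multiset.map_comp o_def sum_unfold_sum_mset)

lemma radial_count_image_mset_set:
  assumes "finite A"
  shows "radial_count (image_mset f (mset_set A)) x = real (card {l \<in> A. (cmod (f l))\<^sup>2 \<le> x})"
proof -
  have "radial_count S x = (\<Sum>u\<in>#S. of_bool ((cmod u)\<^sup>2 \<le> x))" for S
    by (induction S) (simp_all add: radial_count_add, simp add: radial_count_def)
  then have "radial_count (image_mset f (mset_set A)) x = (\<Sum>l\<in>A. of_bool ((cmod (f l))\<^sup>2 \<le> x))"
    using assms by (simp add: multiset.map_comp o_def sum_unfold_sum_mset)
  also have "\<dots> = real (card (A \<inter> {l. (cmod (f l))\<^sup>2 \<le> x}))"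
    using assms by simp
  also have "A \<inter> {l. (cmod (f l))\<^sup>2 \<le> x} = {l \<in> A. (cmod (f l))\<^sup>2 \<le> x}" by auto
  finally show ?thesis .
qed

text \<open>The deterministic values as a multiset of complex numbers, so that potential and count
  are the same functions as for the eigenvalues and the same inequalities apply.\<close>

definition sq_radius_mset :: "nat \<Rightarrow> nat \<Rightarrow> nat \<Rightarrow> complex multiset" where
  "sq_radius_mset p q n = image_mset (\<lambda>l. complex_of_real (sqrt (sq_radius p q n l))) (mset_set {..<n})"

lemma log_potential_sq_radius: "log_potential (sq_radius_mset p q n) x = (\<Sum>l<n. ln (max x (sq_radius p q n l)))"
  unfolding sq_radius_mset_def log_potential_image_mset_set
  by (intro sum.cong refl) (simp add: less_imp_le[OF sq_radius_pos])

lemma radial_count_sq_radius: "radial_count (sq_radius_mset p q n) x = real (card {l \<in> {..<n}. sq_radius p q n l \<le> x})"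
proof -
  have "{l \<in> {..<n}. (cmod (complex_of_real (sqrt (sq_radius p q n l))))\<^sup>2 \<le> x} = {l \<in> {..<n}. sq_radius p q n l \<le> x}"
    by (intro Collect_cong conj_cong refl) (simp add: less_imp_le[OF sq_radius_pos])
  then show ?thesis unfolding sq_radius_mset_def by (subst radial_count_image_mset_set) simp_all
qed

lemma measurable_mat_entry:
  assumes "gaussian_matrix M n X" "i < n" "j < n"
  shows "(\<lambda>\<omega>. mat_entries n (X \<omega>) (i, j)) \<in> borel_measurable M"
proof -
  have "distributed M lborel (\<lambda>\<omega>. X \<omega> $$ (i, j)) std_complex_gaussian_density"
    using assms by (auto simp: gaussian_matrix_def)
  then have "(\<lambda>\<omega>. X \<omega> $$ (i, j)) \<in> borel_measurable M"
    using distributed_measurable by fastforce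
  then show ?thesis using assms by (simp add: mat_entries_def)
qed

text \<open>For a fixed point of the circle the chain of factors gives a bound in which the point
  enters only through its squared modulus \<open>x\<close>. Averaging over the circle and exchanging
  the integrals turns this into a bound for the potential; \<open>ln (real n + 1)\<close> pays for
  keeping only the largest term of \<open>K\<close>.\<close>

lemma potential_concentration:
  fixes \<epsilon> :: "nat \<Rightarrow> int"
  assumes M: "prob_space M" and n: "1 \<le> n" and k: "1 \<le> k"
    and signs: "\<And>i. i \<in> {1..k} \<Longrightarrow> \<epsilon> i \<in> {1, -1}"
    and X: "\<And>i. i \<in> {1..k} \<Longrightarrow> gaussian_matrix M n (X i)" and ind: "indep_matrices M n X {1..k}"
    and P_def: "P = (\<lambda>\<omega>. prodmat n \<epsilon> [1..<Suc k] (\<lambda>i. mat_entries n (X i \<omega>)))"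
    and p: "p = card {i \<in> {1..k}. \<epsilon> i = 1}" and x: "0 < x"
  shows "(\<integral>\<^sup>+\<omega>. ennreal \<bar>log_potential (eigenvalue_mset (P \<omega>)) x - log_potential (sq_radius_mset p (k - p) n) x\<bar> \<partial>M)
    \<le> ennreal (real (2 * k) * fluct_bound n + ln (real n + 1))"
proof -
  interpret M: prob_space M by fact
  interpret U: prob_space unit_unif by (rule prob_space_unit_unif)
  interpret MU: pair_sigma_finite M unit_unif ..
  let ?js = "[1..<Suc k]"
  have js: "set ?js = {1..k}" "distinct ?js" "?js \<noteq> []" "length ?js = k" using k by auto
  have sg: "\<epsilon> i \<in> {1, -1}" if "i \<in> set ?js" for i using signs that by (simp only: js)
  let ?f = "\<lambda>\<omega>. \<lambda>i\<in>{1..k}. mat_entries n (X i \<omega>)"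
  have P: "P \<omega> \<in> carrier_mat n n" for \<omega>
    unfolding P_def by (rule prodmat_carrier) (rule sg)
  have Pf: "P \<omega> = prodmat n \<epsilon> ?js (?f \<omega>)" for \<omega>
    unfolding P_def by (rule prodmat_cong) (simp only: js restrict_apply if_True)
  have mP: "(\<lambda>\<omega>. P \<omega> $$ (i, j)) \<in> borel_measurable M" if "i < n" "j < n" for i j
    unfolding P_def
  proof (rule measurable_prodmat[OF sg _ that])
    fix l i j assume "l \<in> set ?js" "i < n" "j < n"
    then show "(\<lambda>\<omega>. mat_entries n (X l \<omega>) (i, j)) \<in> borel_measurable M"
      by (intro measurable_mat_entry X) (simp_all only: js)
  qed
  define K where "K = (\<Sum>m\<le>n. x ^ (n - m) * (\<Prod>i\<in>{1..k}. gain n (\<epsilon> i) m))"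
  define r where "r = sqrt x"
  have r: "0 < r" "r\<^sup>2 = x" using x by (auto simp: r_def)
  let ?z = "\<lambda>t. complex_of_real r * circ t"
  have z: "?z t \<noteq> 0" "(cmod (?z t))\<^sup>2 = x" for t
  proof -
    have "cmod (?z t) = r" using r by (simp add: norm_mult)
    then show "?z t \<noteq> 0" "(cmod (?z t))\<^sup>2 = x" using r by auto
  qed
  let ?B = "2 * real k * fluct_bound n"
  have fixed: "(\<integral>\<^sup>+\<omega>. dist_ln ((cmod (det (?z t \<cdot>\<^sub>m 1\<^sub>m n - P \<omega>)))\<^sup>2) K \<partial>M) \<le> ennreal ?B" for t
  proof -
    let ?h = "\<lambda>y. dist_ln ((cmod (det (?z t \<cdot>\<^sub>m 1\<^sub>m n - prodmat n \<epsilon> ?js y)))\<^sup>2) K"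
    have "(\<lambda>y. det (?z t \<cdot>\<^sub>m 1\<^sub>m n - prodmat n \<epsilon> ?js y)) \<in> borel_measurable (gmats n {1..k})"
      by (intro measurable_det_char prodmat_carrier measurable_prodmat measurable_gmats_component borel_measurable_const sg)
        (use js in auto)
    then have hm: "?h \<in> borel_measurable (gmats n {1..k})" by simp
    have ne: "{1..k} \<noteq> {}" using k by simp
    note d = distr_independent_matrices[OF M n ne X ind]
    have "(\<integral>\<^sup>+\<omega>. dist_ln ((cmod (det (?z t \<cdot>\<^sub>m 1\<^sub>m n - P \<omega>)))\<^sup>2) K \<partial>M) = (\<integral>\<^sup>+\<omega>. ?h (?f \<omega>) \<partial>M)"
      by (simp only: Pf)
    also have "\<dots> = (\<integral>\<^sup>+y. ?h y \<partial>distr M (gmats n {1..k}) ?f)"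
      by (rule nn_integral_distr[symmetric, OF d(1)]) (use hm in simp_all)
    also have "\<dots> = (\<integral>\<^sup>+y. ?h y \<partial>gmats n {1..k})" by (simp only: d(2))
    also have "\<dots> \<le> ennreal ?B"
      using char_chain[OF n sg js(2,3) z(1)[of t]] unfolding js z(2) K_def .
    finally show ?thesis .
  qed
  have "(\<lambda>q. det (?z (snd q) \<cdot>\<^sub>m 1\<^sub>m n - P (fst q))) \<in> borel_measurable (M \<Otimes>\<^sub>M unit_unif)"
    by (rule measurable_det_char) (use P mP in \<open>auto intro: measurable_compose[OF measurable_fst]\<close>)
  then have joint: "case_prod (\<lambda>\<omega> t. dist_ln ((cmod (det (?z t \<cdot>\<^sub>m 1\<^sub>m n - P \<omega>)))\<^sup>2) K) \<in> borel_measurable (M \<Otimes>\<^sub>M unit_unif)"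
    unfolding case_prod_beta by simp
  have mpot: "(\<lambda>\<omega>. log_potential (eigenvalue_mset (P \<omega>)) x) \<in> borel_measurable M"
    by (rule measurable_log_potential_eigenvalues[OF P mP x])
  have "(\<integral>\<^sup>+\<omega>. ennreal \<bar>log_potential (eigenvalue_mset (P \<omega>)) x - ln K\<bar> \<partial>M)
    \<le> (\<integral>\<^sup>+\<omega>. \<integral>\<^sup>+t. dist_ln ((cmod (det (?z t \<cdot>\<^sub>m 1\<^sub>m n - P \<omega>)))\<^sup>2) K \<partial>unit_unif \<partial>M)"
  proof (rule nn_integral_mono)
    fix \<omega>
    show "ennreal \<bar>log_potential (eigenvalue_mset (P \<omega>)) x - ln K\<bar> \<le> (\<integral>\<^sup>+t. dist_ln ((cmod (det (?z t \<cdot>\<^sub>m 1\<^sub>m n - P \<omega>)))\<^sup>2) K \<partial>unit_unif)"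
      using log_potential_bound[OF r(1) lead_coeff_char_poly[OF P], of \<omega> K]
      unfolding log_potential_def eigenvalue_mset_def r(2) poly_char_poly[OF P] .
  qed
  also have "\<dots> = (\<integral>\<^sup>+t. \<integral>\<^sup>+\<omega>. dist_ln ((cmod (det (?z t \<cdot>\<^sub>m 1\<^sub>m n - P \<omega>)))\<^sup>2) K \<partial>M \<partial>unit_unif)"
    by (rule MU.Fubini'[OF joint, symmetric])
  also have "\<dots> \<le> (\<integral>\<^sup>+t. ennreal ?B \<partial>unit_unif)" by (intro nn_integral_mono fixed)
  also have "\<dots> = ennreal ?B" by (simp add: U.emeasure_space_1[simplified])
  finally have bound: "(\<integral>\<^sup>+\<omega>. ennreal \<bar>log_potential (eigenvalue_mset (P \<omega>)) x - ln K\<bar> \<partial>M) \<le> ennreal ?B" .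
  have "K = (\<Sum>m\<le>n. x ^ (n - m) * (\<Prod>l<m. sq_radius p (k - p) n l))"
    unfolding K_def p
    by (intro sum.cong refl arg_cong2[where f = "(*)"]) (subst prod_gain[OF _ _ n signs], simp_all)
  then have lnK: "\<bar>ln K - log_potential (sq_radius_mset p (k - p) n) x\<bar> \<le> ln (real n + 1)"
    unfolding log_potential_sq_radius
    using ln_sum_prod_approx[of n "sq_radius p (k - p) n" x, OF sq_radius_pos sq_radius_antimono x] by simp
  have ln0: "0 \<le> ln (real n + 1)" by simp
  have "(\<integral>\<^sup>+\<omega>. ennreal \<bar>log_potential (eigenvalue_mset (P \<omega>)) x - log_potential (sq_radius_mset p (k - p) n) x\<bar> \<partial>M)
    \<le> (\<integral>\<^sup>+\<omega>. ennreal \<bar>log_potential (eigenvalue_mset (P \<omega>)) x - ln K\<bar> + ennreal (ln (real n + 1)) \<partial>M)"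
  proof (rule nn_integral_mono)
    fix \<omega>
    have "\<bar>log_potential (eigenvalue_mset (P \<omega>)) x - log_potential (sq_radius_mset p (k - p) n) x\<bar>
      \<le> \<bar>log_potential (eigenvalue_mset (P \<omega>)) x - ln K\<bar> + ln (real n + 1)" using lnK by linarith
    then show "ennreal \<bar>log_potential (eigenvalue_mset (P \<omega>)) x - log_potential (sq_radius_mset p (k - p) n) x\<bar>
      \<le> ennreal \<bar>log_potential (eigenvalue_mset (P \<omega>)) x - ln K\<bar> + ennreal (ln (real n + 1))"
      using ln0 by (simp flip: ennreal_plus add: ennreal_leI)
  qed
  also have "\<dots> = (\<integral>\<^sup>+\<omega>. ennreal \<bar>log_potential (eigenvalue_mset (P \<omega>)) x - ln K\<bar> \<partial>M) + ennreal (ln (real n + 1))"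
    using mpot by (subst nn_integral_add) (simp_all add: M.emeasure_space_1)
  also have "\<dots> \<le> ennreal ?B + ennreal (ln (real n + 1))" by (intro add_mono bound order_refl)
  also have "\<dots> = ennreal (real (2 * k) * fluct_bound n + ln (real n + 1))"
    using ln0 fluct_bound_nonneg[of n] by (simp add: ennreal_plus)
  finally show ?thesis .
qed

lemma integral_of_nn_bound:
  assumes f: "f \<in> borel_measurable M" and b: "(\<integral>\<^sup>+\<omega>. ennreal \<bar>f \<omega>\<bar> \<partial>M) \<le> ennreal c" and c: "0 \<le> c"
  shows "integrable M f" "\<bar>integral\<^sup>L M f\<bar> \<le> c"
proof -
  show i: "integrable M f"
    using f b by (intro integrableI_bounded) (auto intro: le_less_trans)
  have "ennreal (\<integral>\<omega>. \<bar>f \<omega>\<bar> \<partial>M) \<le> ennreal c"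
    using b i by (subst nn_integral_eq_integral[symmetric]) auto
  then have "(\<integral>\<omega>. \<bar>f \<omega>\<bar> \<partial>M) \<le> c" using c by simp
  then show "\<bar>integral\<^sup>L M f\<bar> \<le> c" using integral_abs_bound[of M f] by linarith
qed

lemma radial_count_bounds: "0 \<le> radial_count S x" "radial_count S x \<le> size S"
  by (simp_all add: radial_count_def size_filter_mset_lesseq)

text \<open>The mean increment of the potential from \<open>a\<close> to \<open>b\<close> differs
  from that of \<open>R\<close> by at most 2 c. Each increment lies between the counts at
  \<open>a\<close> and at \<open>b\<close>, multiplied by ln (b / a); crossing the two sides gives
  both inequalities.\<close>

lemma count_squeeze:
  assumes M: "prob_space M"
    and mc: "\<And>x. (\<lambda>\<omega>. radial_count (S \<omega>) x) \<in> borel_measurable M" and mp: "\<And>x. 0 < x \<Longrightarrow> (\<lambda>\<omega>. log_potential (S \<omega>) x) \<in> borel_measurable M"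
    and size: "\<And>\<omega>. size (S \<omega>) = n" and c: "0 \<le> c"
    and conc: "\<And>x. 0 < x \<Longrightarrow> (\<integral>\<^sup>+\<omega>. ennreal \<bar>log_potential (S \<omega>) x - log_potential R x\<bar> \<partial>M) \<le> ennreal c"
    and ab: "0 < a" "a < b"
  shows "(\<integral>\<omega>. radial_count (S \<omega>) a \<partial>M) * ln (b / a) \<le> radial_count R b * ln (b / a) + 2 * c"
    and "radial_count R a * ln (b / a) - 2 * c \<le> (\<integral>\<omega>. radial_count (S \<omega>) b \<partial>M) * ln (b / a)"
proof -
  interpret prob_space M by fact
  define D where "D x \<omega> = log_potential (S \<omega>) x - log_potential R x" for x \<omega>
  have b: "0 < b" using ab by linarith
  have mD: "D x \<in> borel_measurable M" if "0 < x" for x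
    using mp[OF that] by (simp add: D_def[abs_def])
  have D: "integrable M (D x)" "\<bar>integral\<^sup>L M (D x)\<bar> \<le> c" if "0 < x" for x
    using integral_of_nn_bound[OF mD[OF that] _ c] conc[OF that] by (simp_all add: D_def)
  have ic: "integrable M (\<lambda>\<omega>. radial_count (S \<omega>) x)" for x
  proof (rule integrable_const_bound[OF _ mc])
    show "AE \<omega> in M. norm (radial_count (S \<omega>) x) \<le> real n"
      using radial_count_bounds[of "S _" x] by (simp add: size)
  qed
  have icl: "integrable M (\<lambda>\<omega>. radial_count (S \<omega>) x * ln (b / a))" for x
    by (rule integrable_mult_left) (rule ic)
  have iD: "integrable M (\<lambda>\<omega>. D b \<omega> - D a \<omega>)"
    by (rule Bochner_Integration.integrable_diff[OF D(1)[OF b] D(1)[OF ab(1)]])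
  have iDR: "integrable M (\<lambda>\<omega>. D b \<omega> - D a \<omega> + (log_potential R b - log_potential R a))"
    by (rule Bochner_Integration.integrable_add[OF iD]) simp
  have ID: "(\<integral>\<omega>. D b \<omega> - D a \<omega> + (log_potential R b - log_potential R a) \<partial>M)
      = integral\<^sup>L M (D b) - integral\<^sup>L M (D a) + (log_potential R b - log_potential R a)"
    using Bochner_Integration.integral_diff[OF D(1)[OF b] D(1)[OF ab(1)]] Bochner_Integration.integral_add[OF iD, of "\<lambda>_. log_potential R b - log_potential R a"]
    by (simp add: prob_space)
  have "(\<integral>\<omega>. radial_count (S \<omega>) a * ln (b / a) \<partial>M) \<le> (\<integral>\<omega>. D b \<omega> - D a \<omega> + (log_potential R b - log_potential R a) \<partial>M)"
  proof (rule integral_mono[OF icl iDR])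
    show "radial_count (S \<omega>) a * ln (b / a) \<le> D b \<omega> - D a \<omega> + (log_potential R b - log_potential R a)" for \<omega>
      using log_potential_diff_bounds(1)[OF ab, of "S \<omega>"] unfolding D_def by linarith
  qed
  also have "\<dots> \<le> 2 * c + radial_count R b * ln (b / a)"
    unfolding ID using D(2)[OF ab(1)] D(2)[OF b] log_potential_diff_bounds(2)[OF ab, of R] by linarith
  finally show "(\<integral>\<omega>. radial_count (S \<omega>) a \<partial>M) * ln (b / a) \<le> radial_count R b * ln (b / a) + 2 * c" by simp
  have "radial_count R a * ln (b / a) - 2 * c \<le> (\<integral>\<omega>. D b \<omega> - D a \<omega> + (log_potential R b - log_potential R a) \<partial>M)"
    unfolding ID using D(2)[OF ab(1)] D(2)[OF b] log_potential_diff_bounds(1)[OF ab, of R] by linarith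
  also have "\<dots> \<le> (\<integral>\<omega>. radial_count (S \<omega>) b * ln (b / a) \<partial>M)"
  proof (rule integral_mono[OF iDR icl])
    show "D b \<omega> - D a \<omega> + (log_potential R b - log_potential R a) \<le> radial_count (S \<omega>) b * ln (b / a)" for \<omega>
      using log_potential_diff_bounds(2)[OF ab, of "S \<omega>"] unfolding D_def by linarith
  qed
  finally show "radial_count R a * ln (b / a) - 2 * c \<le> (\<integral>\<omega>. radial_count (S \<omega>) b \<partial>M) * ln (b / a)" by simp
qed

lemma emeasure_pmf_of_multiset:
  assumes "S \<noteq> {#}"
  shows "emeasure (measure_pmf (pmf_of_multiset S)) A = ennreal (real (size {#u \<in># S. u \<in> A#}) / real (size S))"
proof -
  have "emeasure (measure_pmf (pmf_of_multiset S)) A = emeasure (measure_pmf (pmf_of_multiset S)) (A \<inter> set_pmf (pmf_of_multiset S))"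
    by (rule emeasure_Int_set_pmf[symmetric])
  also have "\<dots> = (\<Sum>u\<in>A \<inter> set_mset S. ennreal (pmf (pmf_of_multiset S) u))"
    using assms by (subst emeasure_measure_pmf_finite) auto
  also have "\<dots> = ennreal (\<Sum>u\<in>A \<inter> set_mset S. real (count S u) / real (size S))"
    using assms by (simp add: sum_ennreal)
  also have "(\<Sum>u\<in>A \<inter> set_mset S. real (count S u) / real (size S)) = real (size {#u \<in># S. u \<in> A#}) / real (size S)"
  proof -
    have "size {#u \<in># S. u \<in> A#} = (\<Sum>u\<in>A \<inter> set_mset S. count S u)"
      unfolding size_multiset_overloaded_eq by (intro sum.cong) auto
    then show ?thesis by (simp add: sum_divide_distrib)
  qed
  finally show ?thesis .
qed

text \<open>\<open>measure_of\<close> reproduces the given set function only if that is a measure.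
  To see this, the function is identified with a mixture of probability kernels. Measurability of
  the kernel needs checking on half-lines only, which generate the Borel sets and are stable under
  intersection.\<close>

lemma expected_distribution_cdf:
  fixes P :: "'w \<Rightarrow> complex mat"
  assumes M: "prob_space M" and n: "1 \<le> n"
    and P: "\<And>\<omega>. P \<omega> \<in> carrier_mat n n"
    and mc: "\<And>x. (\<lambda>\<omega>. radial_count (eigenvalue_mset (P \<omega>)) x) \<in> borel_measurable M"
    and X: "\<And>\<omega>. \<omega> \<in> space M \<Longrightarrow> X \<omega> = P \<omega>"
  shows "cdf (expected_sq_radial_distribution M n X) x = (\<integral>\<omega>. radial_count (eigenvalue_mset (P \<omega>)) x \<partial>M) / n"
proof -
  interpret prob_space M by fact
  let ?S = "\<lambda>\<omega>. eigenvalue_mset (P \<omega>)"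
  let ?N = "\<lambda>\<omega> B. real (size {#u \<in># ?S \<omega>. (cmod u)\<^sup>2 \<in> B#}) / real n"
  \<comment> \<open>The empirical law for one outcome: the image of the uniform distribution on the
    multiset of eigenvalues.\<close>
  define Q where "Q \<omega> = distr (measure_pmf (pmf_of_multiset (?S \<omega>))) (borel :: real measure) (\<lambda>u. (cmod u)\<^sup>2)" for \<omega>
  have size: "size (?S \<omega>) = n" for \<omega> by (rule size_eigenvalue_mset[OF P])
  have ne: "?S \<omega> \<noteq> {#}" for \<omega> using size[of \<omega>] n by auto
  have Q: "emeasure (Q \<omega>) B = ennreal (?N \<omega> B)" if "B \<in> sets borel" for \<omega> B
    unfolding Q_def using that ne size by (simp add: emeasure_distr emeasure_pmf_of_multiset)
  have pQ: "prob_space (Q \<omega>)" for \<omega>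
    unfolding Q_def by (intro measure_pmf.prob_space_distr) simp
  have sQ: "sets (Q \<omega>) = sets borel" for \<omega> by (simp add: Q_def)
  have Qm: "Q \<in> measurable M (prob_algebra borel)"
  proof (rule measurable_prob_algebra_generated[where \<Omega> = UNIV and G = "range (\<lambda>x::real. {..x})"])
    show "sets (borel :: real measure) = sigma_sets UNIV (range (\<lambda>x::real. {..x}))"
      by (subst borel_eq_atMost) simp
    show "Int_stable (range (\<lambda>x::real. {..x}))" by (auto simp: Int_stable_def)
    show "(\<lambda>\<omega>. emeasure (Q \<omega>) A) \<in> borel_measurable M" if "A \<in> range (\<lambda>x::real. {..x})" for A
    proof -
      from that obtain x where A: "A = {..x}" by (rule rangeE)
      have "emeasure (Q \<omega>) A = ennreal (radial_count (?S \<omega>) x / real n)" for \<omega>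
        unfolding A by (subst Q) (simp_all add: radial_count_def)
      then show ?thesis using mc by simp
    qed
  qed (use pQ sQ in auto)
  \<comment> \<open>The mixture of the empirical laws over all outcomes; its values are the
    expectations in question.\<close>
  define B where "B = M \<bind> Q"
  have Qs: "Q \<in> measurable M (subprob_algebra borel)" using Qm by (rule measurable_prob_algebraD)
  have sB: "sets B = sets borel" unfolding B_def by (rule sets_bind[OF _ not_empty]) (use sQ in auto)
  have spB: "space B = UNIV" using sets_eq_imp_space_eq[OF sB] by simp
  have eB: "emeasure B A = (\<integral>\<^sup>+\<omega>. ennreal (?N \<omega> A) \<partial>M)" if "A \<in> sets borel" for A
    unfolding B_def by (subst emeasure_bind[OF not_empty Qs that]) (simp add: Q[OF that])
  have "expected_sq_radial_distribution M n X = measure_of UNIV (sets borel) (emeasure B)"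
    unfolding expected_sq_radial_distribution_def
  proof (rule measure_of_eq)
    fix A :: "real set" assume "A \<in> sigma_sets UNIV (sets borel)"
    then have A: "A \<in> sets borel" using sets.sigma_sets_eq[of "borel :: real measure"] by simp
    have "(\<integral>\<^sup>+\<omega>. ennreal (real (size {#z \<in># eigenvalue_mset (X \<omega>). (cmod z)\<^sup>2 \<in> A#}) / real n) \<partial>M) = (\<integral>\<^sup>+\<omega>. ennreal (?N \<omega> A) \<partial>M)"
      by (intro nn_integral_cong) (simp add: X)
    then show "(\<integral>\<^sup>+\<omega>. ennreal (real (size {#z \<in># eigenvalue_mset (X \<omega>). (cmod z)\<^sup>2 \<in> A#}) / real n) \<partial>M) = emeasure B A"
      by (simp only: eB[OF A])
  qed simp
  also have "\<dots> = B" using measure_of_of_measure[of B] by (simp only: sB spB)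
  finally have "cdf (expected_sq_radial_distribution M n X) x = measure B {..x}" by (simp add: cdf_def)
  also have "\<dots> = enn2real (\<integral>\<^sup>+\<omega>. ennreal (radial_count (?S \<omega>) x / real n) \<partial>M)"
    by (simp add: measure_def eB radial_count_def)
  also have "\<dots> = (\<integral>\<omega>. radial_count (?S \<omega>) x / real n \<partial>M)"
    using mc by (intro integral_eq_nn_integral[symmetric]) (auto simp: radial_count_bounds)
  finally show ?thesis by simp
qed

text \<open>The constant \<open>m\<close> is arbitrary because the type of the interval in the normalising constant
  \<open>measure lborel {0..1}\<close> is not tied to the reals; total mass \<open>1\<close> forces \<open>m = 1\<close>.\<close>

lemma cdf_radial_map:
  assumes N: "prob_space N" and U: "distributed N lborel U (\<lambda>x. ennreal (indicator {0..1} x / m))"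
  shows "cdf (distr N borel (\<lambda>\<omega>. U \<omega> ^ p * (1 / (1 - U \<omega>)) ^ q)) x = radial_cdf p q x"
proof -
  have Um: "U \<in> borel_measurable N" using distributed_measurable[OF U] by simp
  have "distr N lborel U = density lborel (\<lambda>x. ennreal (indicator {0..1} x / m))"
    using U by (simp add: distributed_def)
  also have "(\<lambda>x::real. ennreal (indicator {0..1} x / m)) = (\<lambda>x. ennreal (1 / m) * indicator {0..1} x)"
    by (auto simp: indicator_def)
  finally have dm: "distr N lborel U = density lborel (\<lambda>x. ennreal (1 / m) * indicator {0..1} x)" .
  have "emeasure (distr N lborel U) (space (distr N lborel U)) = 1"
    using Um by (intro prob_space.emeasure_space_1 prob_space.prob_space_distr[OF N]) simp
  then have "ennreal (1 / m) = 1"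
    unfolding dm by (simp add: emeasure_density nn_integral_cmult)
  then have d: "distr N lborel U = unit_unif"
    unfolding dm unit_unif_def by simp
  have "distr N borel (\<lambda>\<omega>. U \<omega> ^ p * (1 / (1 - U \<omega>)) ^ q) = distr N borel (radial_map p q \<circ> U)"
    by (simp add: radial_map_def o_def)
  also have "\<dots> = distr (distr N lborel U) borel (radial_map p q)"
    using Um by (intro distr_distr[symmetric]) auto
  finally have "cdf (distr N borel (\<lambda>\<omega>. U \<omega> ^ p * (1 / (1 - U \<omega>)) ^ q)) x = measure (distr unit_unif borel (radial_map p q)) {..x}"
    by (simp only: d cdf_def)
  also have "\<dots> = measure unit_unif (radial_map p q -` {..x} \<inter> space unit_unif)"
    by (intro measure_distr) auto
  also have "\<dots> = radial_cdf p q x"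
  proof -
    have m: "radial_map p q -` {..x} \<in> sets borel"
      using measurable_sets[OF measurable_radial_map, of "{..x}" p q] by simp
    have "emeasure unit_unif (radial_map p q -` {..x}) = (\<integral>\<^sup>+u. indicator {0..1} u * indicator (radial_map p q -` {..x}) u \<partial>lborel)"
      unfolding unit_unif_def using m by (intro emeasure_density) auto
    also have "\<dots> = (\<integral>\<^sup>+u. indicator {u \<in> {0..1}. radial_map p q u \<le> x} u \<partial>lborel)"
      by (intro nn_integral_cong) (auto simp: indicator_def)
    also have "\<dots> = emeasure lborel {u \<in> {0..1}. radial_map p q u \<le> x}"
      using radial_set_measurable by (intro nn_integral_indicator) simp
    finally show ?thesis by (simp add: measure_def radial_cdf_def)
  qed
  finally show ?thesis .
qed

theorem theorem9:
  fixes k p :: nat and \<epsilon> :: "nat \<Rightarrow> int"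
    and M :: "nat \<Rightarrow> 'a measure" and A :: "nat \<Rightarrow> nat \<Rightarrow> 'a \<Rightarrow> complex mat"
    and N :: "'b measure" and U :: "'b \<Rightarrow> real"
  assumes "k \<ge> 1"
    and "\<And>i. i \<in> {1..k} \<Longrightarrow> \<epsilon> i \<in> {1, -1}"
    and "p = card {i \<in> {1..k}. \<epsilon> i = 1}"
    and "\<And>n. n \<ge> 1 \<Longrightarrow> prob_space (M n)"
    and "\<And>n i. n \<ge> 1 \<Longrightarrow> i \<in> {1..k} \<Longrightarrow> gaussian_matrix (M n) n (A n i)"
    and "\<And>n. n \<ge> 1 \<Longrightarrow> indep_matrices (M n) n (A n) {1..k}"
    and "prob_space N"
    and "distributed N lborel U (\<lambda>x. indicator {0..1} x / measure lborel {0..1})"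
  shows "weak_conv_m
    (\<lambda>n. expected_sq_radial_distribution (M n) n (\<lambda>\<omega>. signed_product n k \<epsilon> (\<lambda>i. A n i \<omega>)))
    (distr N borel (\<lambda>\<omega>. U \<omega> ^ p * (1 / (1 - U \<omega>)) ^ (k - p)))"
proof -
  note k = assms(1) and signs = assms(2) and p = assms(3) and M = assms(4) and X = assms(5) and ind = assms(6)
  \<comment> \<open>Built from the entry functions, this product is an n by n matrix for every
    \<omega>. It agrees with the signed product on the space of \<open>M n\<close>, where the given
    matrices are known to have the right size.\<close>
  define P where "P n \<omega> = prodmat n \<epsilon> [1..<Suc k] (\<lambda>i. mat_entries n (A n i \<omega>))" for n \<omega>
  let ?S = "\<lambda>n \<omega>. eigenvalue_mset (P n \<omega>)" and ?R = "sq_radius_mset p (k - p)"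
  let ?F = "\<lambda>n. cdf (expected_sq_radial_distribution (M n) n (\<lambda>\<omega>. signed_product n k \<epsilon> (\<lambda>i. A n i \<omega>)))"
  define c where "c n = real (2 * k) * fluct_bound n + ln (real n + 1)" for n
  \<comment> \<open>The term 1 / n is the grid error, and 2 \<open>c n\<close> / n the error of the
    potentials at the two ends of an interval.\<close>
  define \<delta> where "\<delta> n = 1 / real n + 2 * (c n / real n)" for n
  have c: "0 \<le> c n" for n
    unfolding c_def using fluct_bound_nonneg[of n] by (intro add_nonneg_nonneg mult_nonneg_nonneg) simp_all
  have sg: "\<epsilon> i \<in> {1, -1}" if "i \<in> set [1..<Suc k]" for i using signs[of i] that by auto
  have P: "P n \<omega> \<in> carrier_mat n n" for n \<omega>
    unfolding P_def by (rule prodmat_carrier) (rule sg)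
  have mP: "(\<lambda>\<omega>. P n \<omega> $$ (i, j)) \<in> borel_measurable (M n)" if "1 \<le> n" "i < n" "j < n" for n i j
    unfolding P_def
  proof (rule measurable_prodmat[OF sg _ that(2,3)])
    fix l i j assume "l \<in> set [1..<Suc k]" "i < n" "j < n"
    then show "(\<lambda>\<omega>. mat_entries n (A n l \<omega>) (i, j)) \<in> borel_measurable (M n)"
      by (intro measurable_mat_entry X[OF that(1)]) auto
  qed
  have mc: "(\<lambda>\<omega>. radial_count (?S n \<omega>) x) \<in> borel_measurable (M n)" if "1 \<le> n" for n x
    by (rule measurable_radial_count_eigenvalues[OF P mP[OF that]])
  have F: "?F n x = (\<integral>\<omega>. radial_count (?S n \<omega>) x \<partial>M n) / real n" if n: "1 \<le> n" for n x
  proof (rule expected_distribution_cdf[OF M[OF n] n P mc[OF n]])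
    fix \<omega> assume "\<omega> \<in> space (M n)"
    then show "signed_product n k \<epsilon> (\<lambda>i. A n i \<omega>) = P n \<omega>"
      unfolding P_def using X[OF n] by (intro signed_product_eq_prodmat) (auto simp: gaussian_matrix_def)
  qed
  have squeeze:
    "(\<integral>\<omega>. radial_count (?S n \<omega>) a \<partial>M n) * ln (b / a) \<le> radial_count (?R n) b * ln (b / a) + 2 * c n"
    "radial_count (?R n) a * ln (b / a) - 2 * c n \<le> (\<integral>\<omega>. radial_count (?S n \<omega>) b \<partial>M n) * ln (b / a)"
    if n: "1 \<le> n" and ab: "0 < a" "a < b" for n a b
  proof -
    have conc: "(\<integral>\<^sup>+\<omega>. ennreal \<bar>log_potential (?S n \<omega>) x - log_potential (?R n) x\<bar> \<partial>M n) \<le> ennreal (c n)" if "0 < x" for x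
      unfolding c_def
      by (rule potential_concentration[OF M[OF n] n k signs X[OF n] ind[OF n] _ p that]) (simp_all add: P_def[abs_def])
    note * = count_squeeze[OF M[OF n] mc[OF n] measurable_log_potential_eigenvalues[OF P mP[OF n]] size_eigenvalue_mset[OF P] c conc ab]
    show "(\<integral>\<omega>. radial_count (?S n \<omega>) a \<partial>M n) * ln (b / a) \<le> radial_count (?R n) b * ln (b / a) + 2 * c n" by (rule *(1))
    show "radial_count (?R n) a * ln (b / a) - 2 * c n \<le> (\<integral>\<omega>. radial_count (?S n \<omega>) b \<partial>M n) * ln (b / a)" by (rule *(2))
  qed
  have \<delta>0: "\<delta> \<longlonglongrightarrow> 0"
  proof -
    have "\<delta> \<longlonglongrightarrow> 0 + 2 * 0"
      unfolding \<delta>_def c_def by (intro tendsto_intros lim_1_over_n fluct_bound_sublinear)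
    then show ?thesis by simp
  qed
  have H: "cdf (distr N borel (\<lambda>\<omega>. U \<omega> ^ p * (1 / (1 - U \<omega>)) ^ (k - p))) = radial_cdf p (k - p)"
    by (intro ext) (rule cdf_radial_map[OF assms(7,8)])
  have "(\<lambda>n. ?F n x) \<longlonglongrightarrow> radial_cdf p (k - p) x" if "isCont (radial_cdf p (k - p)) x" for x
  proof (rule LIMSEQ_cdf_squeeze[OF that, where \<delta> = \<delta>])
    show "?F n x \<le> ?F n y" if "1 \<le> n" "x \<le> y" for n x y
    proof -
      interpret prob_space "M n" by (rule M[OF that(1)])
      have "integrable (M n) (\<lambda>\<omega>. radial_count (?S n \<omega>) x)" for x
        using radial_count_bounds[of "?S n _" x] size_eigenvalue_mset[OF P] mc[OF that(1)]
        by (intro integrable_const_bound[of _ "real n"]) (auto simp: abs_of_nonneg)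
      then have "(\<integral>\<omega>. radial_count (?S n \<omega>) x \<partial>M n) \<le> (\<integral>\<omega>. radial_count (?S n \<omega>) y \<partial>M n)"
        using radial_count_mono[OF that(2)] by (intro integral_mono) auto
      then show ?thesis unfolding F[OF that(1)] by (intro divide_right_mono) auto
    qed
    show "0 \<le> ?F n x" for n x by (simp add: cdf_def)
    show "?F n x = 0" if "1 \<le> n" "x < 0" for n x
    proof -
      have "radial_count S x = 0" for S
        by (induction S) (use that in \<open>auto simp: radial_count_add not_le intro: less_le_trans[OF _ zero_le_power2]\<close>, simp add: radial_count_def)
      then show ?thesis by (simp add: F[OF that(1)])
    qed
    show "radial_cdf p (k - p) x = 0" if "x \<le> 0" for x by (rule radial_cdf_nonpos[OF that])
    show "\<delta> \<longlonglongrightarrow> 0" by (rule \<delta>0)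
    fix n :: nat and a b :: real assume n: "1 \<le> n" and ab: "0 < a" "a < b"
    have l: "0 < ln (b / a)" using ab by (intro ln_gt_zero) simp
    have nn: "0 \<le> 2 * (c n / real n)" "0 \<le> 1 / real n * (1 / ln (b / a))" using c[of n] l by simp_all
    have distrib: "(u + v) * (1 + w) = u + v * w + (v + u * w)" for u v w :: real
      by (simp add: algebra_simps)
    \<comment> \<open>Expanding the product yields the two error terms that are wanted and two
      nonnegative surplus terms, which are dropped.\<close>
    have split: "\<delta> n * (1 + 1 / ln (b / a)) = 1 / real n + 2 * (c n / real n) * (1 / ln (b / a)) + (2 * (c n / real n) + 1 / real n * (1 / ln (b / a)))"
      unfolding \<delta>_def by (rule distrib)
    have "(\<integral>\<omega>. radial_count (?S n \<omega>) a \<partial>M n) \<le> radial_count (?R n) b + 2 * c n * (1 / ln (b / a))"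
      using squeeze(1)[OF n ab] l by (simp add: field_simps)
    then have "?F n a \<le> (radial_count (?R n) b + 2 * c n * (1 / ln (b / a))) / real n"
      unfolding F[OF n] by (rule divide_right_mono) simp
    also have "\<dots> = radial_count (?R n) b / real n + 2 * (c n / real n) * (1 / ln (b / a))" by (simp add: add_divide_distrib)
    finally show "?F n a \<le> radial_cdf p (k - p) b + \<delta> n * (1 + 1 / ln (b / a))"
      using card_sq_radius_le_upper[OF n, of p "k - p" b] nn unfolding split radial_count_sq_radius by linarith
    have "radial_count (?R n) a - 2 * c n * (1 / ln (b / a)) \<le> (\<integral>\<omega>. radial_count (?S n \<omega>) b \<partial>M n)"
      using squeeze(2)[OF n ab] l by (simp add: field_simps)
    then have "(radial_count (?R n) a - 2 * c n * (1 / ln (b / a))) / real n \<le> ?F n b"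
      unfolding F[OF n] by (rule divide_right_mono) simp
    moreover have "(radial_count (?R n) a - 2 * c n * (1 / ln (b / a))) / real n = radial_count (?R n) a / real n - 2 * (c n / real n) * (1 / ln (b / a))"
      by (simp add: diff_divide_distrib)
    ultimately show "radial_cdf p (k - p) a - \<delta> n * (1 + 1 / ln (b / a)) \<le> ?F n b"
      using card_sq_radius_le_lower[OF n, of p "k - p" a] nn unfolding split radial_count_sq_radius by linarith
  qed
  then show ?thesis
    unfolding weak_conv_m_def weak_conv_def H by blast
qed

end
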